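(* Let $\varphi$ be an $N$-function, let $I=(0,a)$ with $0<a\le\infty$, and let $w$ be a positive decreasing weight function on $I$ with $W(t)=\int_0^tw<\infty$ for $t\in I$. The space $\mathcal{M}_{\varphi,w}$ is the Köthe bidual of $M_{\varphi,w}$. Consequently, if $M_{\varphi,w}$ is a linear space and $\varphi$ satisfies condition $\Delta_2$, then $\mathcal{M}_{\varphi,w}$ is the Banach envelope of $M_{\varphi,w}$.
   Context: An Orlicz function is a convex, strictly increasing $\varphi:\mathbb{R}_+\to\mathbb{R}_+$ with $\varphi(0)=0$; it is an $N$-function if $\lim_{t\to\infty}\varphi(t)/t=\infty$ and $\lim_{t\to0}\varphi(t)/t=0$; it satisfies $\Delta_2$ if for some $K>0$, $\varphi(2u)\le K\varphi(u)$ for all $u\ge0$. "Decreasing" means non-increasing. $L^0$ is the set of Lebesgue measurable $f:I\to\mathbb{R}$. For $f\in L^0$, $d_f(s)=|\{t\in I:|f(t)|>s\}|$ and $f^*(t)=\inf\{s\ge0:d_f(s)\le t\}$. A weight function is a non-negative decreasing function in $L^0$. $M(f)=\int_I\varphi(f^*/w)w$ (integrand $\infty$ where $f^*=\infty$); $M_{\varphi,w}=\{f\in L^0:M(\lambda f)<\infty\text{ for some }\lambda>0\}$ (not linear in general); $\|f\|_M=\inf\{\epsilon>0:M(f/\epsilon)\le1\}$. When $M_{\varphi,w}$ is linear, $\|\cdot\|_M$ is a quasi-norm and $M_{\varphi,w}$ is a quasi-Banach space. $g\prec f$ means $\int_0^tg^*\le\int_0^tf^*$ for all $t\in I$. $P(f)=\inf\{\int_I\varphi(|f|/v)v: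 v\prec w,\ v\ge0\}$, where at points with $v(t)=0$ the integrand is $0$ if $f(t)=0$ and $\infty$ otherwise; $\|f\|_{\mathcal{M}}=\inf\{\epsilon>0:P(f/\epsilon)\le1\}$; $\mathcal{M}_{\varphi,w}=\{f\in L^0:\|f\|_{\mathcal{M}}<\infty\}$, normed by $\|\cdot\|_{\mathcal{M}}$. The Köthe dual of $A\subset L^0$ is $A'=\{f\in L^0:fg\in L_1(I)\ \forall g\in A\}$; for $A=M_{\varphi,w}$ it is normed by $\|f\|=\sup\{\int_I|fg|:g\in M_{\varphi,w},\|g\|_M\le1\}$; the Köthe bidual is $(A')'$ with the norm dual to that of $A'$, and the identification with $\mathcal{M}_{\varphi,w}$ is isometric. Banach envelope: for a quasi-Banach space $X$ whose dual $X^*$ (bounded linear functionals) separates points, put $|||x|||=\sup\{|f(x)|:f\in X^*,\|f\|\le1\}$; the Banach envelope of $X$ is the completion of $(X,|||\cdot|||)$. *)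

theory Defs
  imports "HOL-Analysis.Analysis"
begin

text \<open>
  Functions on an interval \<open>I\<close> are rendered as functions on \<open>real\<close>; every notion below only depends
  on their values on \<open>I\<close>. As usual, functions that agree almost everywhere are identified: a norm is
  definite up to null functions. Norms take values in \<^typ>\<open>ennreal\<close>, so that they are
  defined on all of \<open>L\<^sup>0\<close>.
\<close>

section \<open>Orlicz functions\<close>

definition orlicz_function :: "(real \<Rightarrow> real) \<Rightarrow> bool" where
  "orlicz_function \<phi> \<longleftrightarrow>
     (\<forall>u\<ge>0. 0 \<le> \<phi> u) \<and> \<phi> 0 = 0 \<and> convex_on {0..} \<phi> \<and> strict_mono_on {0..} \<phi>"

definition N_function :: "(real \<Rightarrow> real) \<Rightarrow> bool" where
  "N_function \<phi> \<longleftrightarrow> orlicz_function \<phi> \<and>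
     filterlim (\<lambda>t. \<phi> t / t) at_top at_top \<and> ((\<lambda>t. \<phi> t / t) \<longlongrightarrow> 0) (at_right 0)"

definition Delta2 :: "(real \<Rightarrow> real) \<Rightarrow> bool" where
  "Delta2 \<phi> \<longleftrightarrow> (\<exists>K>0. \<forall>u\<ge>0. \<phi> (2 * u) \<le> K * \<phi> u)"

section \<open>Rearrangements and weights\<close>

abbreviation L0 :: "real set \<Rightarrow> (real \<Rightarrow> real) set" where
  "L0 I \<equiv> borel_measurable (lebesgue_on I)"

definition distribution_fun :: "real set \<Rightarrow> (real \<Rightarrow> real) \<Rightarrow> real \<Rightarrow> ennreal" where
  "distribution_fun I f s = emeasure lebesgue {t \<in> I. s < \<bar>f t\<bar>}"

text \<open>The value is \<open>\<infinity>\<close> if no \<open>s\<close> qualifies (possible when \<open>I\<close> is unbounded).\<close>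

definition rearrangement :: "real set \<Rightarrow> (real \<Rightarrow> real) \<Rightarrow> real \<Rightarrow> ennreal" where
  "rearrangement I f t = Inf {ennreal s |s. 0 \<le> s \<and> distribution_fun I f s \<le> ennreal t}"

definition weight_function :: "real set \<Rightarrow> (real \<Rightarrow> real) \<Rightarrow> bool" where
  "weight_function I w \<longleftrightarrow>
     w \<in> L0 I \<and> (\<forall>t\<in>I. 0 \<le> w t) \<and> monotone_on I (\<le>) (\<ge>) w"

definition submajorized :: "real set \<Rightarrow> (real \<Rightarrow> real) \<Rightarrow> (real \<Rightarrow> real) \<Rightarrow> bool" where
  "submajorized I g f \<longleftrightarrow>
     (\<forall>t\<in>I. (\<integral>\<^sup>+ s\<in>{0<..<t}. rearrangement I g s \<partial>lebesgue)
           \<le> (\<integral>\<^sup>+ s\<in>{0<..<t}. rearrangement I f s \<partial>lebesgue))"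

section \<open>The class \<open>M\<^bsub>\<phi>,w\<^esub>\<close>\<close>

text \<open>The modular is meant for \<open>w\<close> positive on \<open>I\<close>.\<close>

definition M_modular ::
    "real set \<Rightarrow> (real \<Rightarrow> real) \<Rightarrow> (real \<Rightarrow> real) \<Rightarrow> (real \<Rightarrow> real) \<Rightarrow> ennreal" where
  "M_modular I \<phi> w f =
     (\<integral>\<^sup>+ t. (if rearrangement I f t = \<infinity> then \<infinity>
             else ennreal (\<phi> (enn2real (rearrangement I f t) / w t) * w t)) \<partial>lebesgue_on I)"

definition M_class ::
    "real set \<Rightarrow> (real \<Rightarrow> real) \<Rightarrow> (real \<Rightarrow> real) \<Rightarrow> (real \<Rightarrow> real) set" where
  "M_class I \<phi> w = {f \<in> L0 I. \<exists>c>0. M_modular I \<phi> w (\<lambda>t. c * f t) < \<infinity>}"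

definition M_norm ::
    "real set \<Rightarrow> (real \<Rightarrow> real) \<Rightarrow> (real \<Rightarrow> real) \<Rightarrow> (real \<Rightarrow> real) \<Rightarrow> ennreal" where
  "M_norm I \<phi> w f = Inf {ennreal \<epsilon> |\<epsilon>. 0 < \<epsilon> \<and> M_modular I \<phi> w (\<lambda>t. f t / \<epsilon>) \<le> 1}"

section \<open>The space \<open>\<M>\<^bsub>\<phi>,w\<^esub>\<close>\<close>

definition P_modular ::
    "real set \<Rightarrow> (real \<Rightarrow> real) \<Rightarrow> (real \<Rightarrow> real) \<Rightarrow> (real \<Rightarrow> real) \<Rightarrow> ennreal" where
  "P_modular I \<phi> w f =
     (INF v\<in>{v \<in> L0 I. submajorized I v w \<and> (\<forall>t\<in>I. 0 \<le> v t)}.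
        \<integral>\<^sup>+ t. (if v t = 0 then (if f t = 0 then 0 else \<infinity>)
              else ennreal (\<phi> (\<bar>f t\<bar> / v t) * v t)) \<partial>lebesgue_on I)"

definition calM_norm ::
    "real set \<Rightarrow> (real \<Rightarrow> real) \<Rightarrow> (real \<Rightarrow> real) \<Rightarrow> (real \<Rightarrow> real) \<Rightarrow> ennreal" where
  "calM_norm I \<phi> w f = Inf {ennreal \<epsilon> |\<epsilon>. 0 < \<epsilon> \<and> P_modular I \<phi> w (\<lambda>t. f t / \<epsilon>) \<le> 1}"

definition calM_space ::
    "real set \<Rightarrow> (real \<Rightarrow> real) \<Rightarrow> (real \<Rightarrow> real) \<Rightarrow> (real \<Rightarrow> real) set" where
  "calM_space I \<phi> w = {f \<in> L0 I. calM_norm I \<phi> w f < \<infinity>}"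

section \<open>Koethe duality\<close>

definition koethe_dual :: "real set \<Rightarrow> (real \<Rightarrow> real) set \<Rightarrow> (real \<Rightarrow> real) set" where
  "koethe_dual I A = {f \<in> L0 I. \<forall>g\<in>A. integrable (lebesgue_on I) (\<lambda>t. f t * g t)}"

definition koethe_norm ::
    "real set \<Rightarrow> (real \<Rightarrow> real) set \<Rightarrow> ((real \<Rightarrow> real) \<Rightarrow> ennreal) \<Rightarrow> (real \<Rightarrow> real) \<Rightarrow> ennreal" where
  "koethe_norm I A N f =
     (SUP g\<in>{g \<in> A. N g \<le> 1}. \<integral>\<^sup>+ t. ennreal \<bar>f t * g t\<bar> \<partial>lebesgue_on I)"

section \<open>Quasi-Banach function spaces and Banach envelopes\<close>

definition linear_space :: "('a \<Rightarrow> real) set \<Rightarrow> bool" where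
  "linear_space X \<longleftrightarrow> (\<lambda>t. 0) \<in> X \<and>
     (\<forall>f\<in>X. \<forall>g\<in>X. (\<lambda>t. f t + g t) \<in> X) \<and> (\<forall>c. \<forall>f\<in>X. (\<lambda>t. c * f t) \<in> X)"

text \<open>\<open>C\<close> is the constant in the triangle inequality; \<open>C = 1\<close> gives norms.\<close>

definition quasi_norm_with ::
    "real \<Rightarrow> 'a measure \<Rightarrow> ('a \<Rightarrow> real) set \<Rightarrow> (('a \<Rightarrow> real) \<Rightarrow> ennreal) \<Rightarrow> bool" where
  "quasi_norm_with C \<mu> X N \<longleftrightarrow> linear_space X \<and> X \<subseteq> borel_measurable \<mu> \<and>
     (\<forall>f\<in>X. N f < \<infinity>) \<and>
     (\<forall>f\<in>X. N f = 0 \<longleftrightarrow> (AE t in \<mu>. f t = 0)) \<and>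
     (\<forall>c. \<forall>f\<in>X. N (\<lambda>t. c * f t) = ennreal \<bar>c\<bar> * N f) \<and>
     (\<forall>f\<in>X. \<forall>g\<in>X. N (\<lambda>t. f t + g t) \<le> ennreal C * (N f + N g))"

definition complete_under :: "('a \<Rightarrow> real) set \<Rightarrow> (('a \<Rightarrow> real) \<Rightarrow> ennreal) \<Rightarrow> bool" where
  "complete_under X N \<longleftrightarrow>
     (\<forall>u. (\<forall>n. u n \<in> X) \<and>
          (\<forall>e>0. \<exists>k. \<forall>m\<ge>k. \<forall>n\<ge>k. N (\<lambda>t. u m t - u n t) < e) \<longrightarrow>
          (\<exists>f\<in>X. (\<lambda>n::nat. N (\<lambda>t. u n t - f t)) \<longlonglongrightarrow> 0))"

definition quasi_Banach ::
    "'a measure \<Rightarrow> ('a \<Rightarrow> real) set \<Rightarrow> (('a \<Rightarrow> real) \<Rightarrow> ennreal) \<Rightarrow> bool" where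
  "quasi_Banach \<mu> X N \<longleftrightarrow> (\<exists>C\<ge>1. quasi_norm_with C \<mu> X N) \<and> complete_under X N"

definition Banach ::
    "'a measure \<Rightarrow> ('a \<Rightarrow> real) set \<Rightarrow> (('a \<Rightarrow> real) \<Rightarrow> ennreal) \<Rightarrow> bool" where
  "Banach \<mu> X N \<longleftrightarrow> quasi_norm_with 1 \<mu> X N \<and> complete_under X N"

definition functional_norm ::
    "('a \<Rightarrow> real) set \<Rightarrow> (('a \<Rightarrow> real) \<Rightarrow> ennreal) \<Rightarrow> (('a \<Rightarrow> real) \<Rightarrow> real) \<Rightarrow> ennreal" where
  "functional_norm X N F = (SUP f\<in>{f \<in> X. N f \<le> 1}. ennreal \<bar>F f\<bar>)"

text \<open>Bounded functionals automatically agree on functions that differ by a null function.\<close>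

definition topological_dual ::
    "('a \<Rightarrow> real) set \<Rightarrow> (('a \<Rightarrow> real) \<Rightarrow> ennreal) \<Rightarrow> (('a \<Rightarrow> real) \<Rightarrow> real) set" where
  "topological_dual X N =
     {F. (\<forall>f\<in>X. \<forall>g\<in>X. F (\<lambda>t. f t + g t) = F f + F g) \<and>
         (\<forall>c. \<forall>f\<in>X. F (\<lambda>t. c * f t) = c * F f) \<and>
         functional_norm X N F < \<infinity>}"

definition separates_points ::
    "'a measure \<Rightarrow> ('a \<Rightarrow> real) set \<Rightarrow> (('a \<Rightarrow> real) \<Rightarrow> real) set \<Rightarrow> bool" where
  "separates_points \<mu> X D \<longleftrightarrow>
     (\<forall>f\<in>X. \<forall>g\<in>X. \<not> (AE t in \<mu>. f t = g t) \<longrightarrow> (\<exists>F\<in>D. F f \<noteq> F g))"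

definition envelope_norm ::
    "('a \<Rightarrow> real) set \<Rightarrow> (('a \<Rightarrow> real) \<Rightarrow> ennreal) \<Rightarrow> ('a \<Rightarrow> real) \<Rightarrow> ennreal" where
  "envelope_norm X N f =
     (SUP F\<in>{F \<in> topological_dual X N. functional_norm X N F \<le> 1}. ennreal \<bar>F f\<bar>)"

text \<open>The canonical map into the completion is the inclusion.\<close>

definition is_completion ::
    "'a measure \<Rightarrow> ('a \<Rightarrow> real) set \<Rightarrow> (('a \<Rightarrow> real) \<Rightarrow> ennreal) \<Rightarrow>
     ('a \<Rightarrow> real) set \<Rightarrow> (('a \<Rightarrow> real) \<Rightarrow> ennreal) \<Rightarrow> bool" where
  "is_completion \<mu> X N Y N' \<longleftrightarrow> Banach \<mu> Y N' \<and> X \<subseteq> Y \<and> (\<forall>f\<in>X. N' f = N f) \<and>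
     (\<forall>f\<in>Y. \<forall>e>0. \<exists>g\<in>X. N' (\<lambda>t. f t - g t) < e)"

definition is_Banach_envelope ::
    "'a measure \<Rightarrow> ('a \<Rightarrow> real) set \<Rightarrow> (('a \<Rightarrow> real) \<Rightarrow> ennreal) \<Rightarrow>
     ('a \<Rightarrow> real) set \<Rightarrow> (('a \<Rightarrow> real) \<Rightarrow> ennreal) \<Rightarrow> bool" where
  "is_Banach_envelope \<mu> X N Y N' \<longleftrightarrow>
     quasi_Banach \<mu> X N \<and> separates_points \<mu> X (topological_dual X N) \<and>
     is_completion \<mu> X (envelope_norm X N) Y N'"

end

theory Submission
  imports Defs
begin

text \<open>
  Measure preserving rank maps transplant decreasing functions, so the dual norm of \<open>M\<close> is a supremum over decreasing
  test functions. The Young inequality and the Amemiya formula for this norm yield \<open>\<integral>|f h| \<le> \<parallel>h\<parallel>\<close> whenever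
  \<open>P(f) \<le> 1\<close>. Conversely, for a simple \<open>f\<close> a greedy construction gives a level function \<open>u\<close> such that
  \<open>v = f / u\<close> is submajorized by \<open>w\<close>, with equality of the integrals on the superlevel sets of \<open>u\<close>. This
  \<open>v\<close> is optimal in \<open>P(f)\<close>, and testing \<open>f\<close> against a function of \<open>u\<close> shows that \<open>P(f) \<le> 1\<close>
  if \<open>f\<close> lies in the unit ball of the bidual. Level functions increase with \<open>f\<close>, so
  \<open>P(f) \<le> 1\<close> passes to limits of simple functions.

  If \<open>M\<close> is linear, dilations are bounded on it, and it is complete. Under the doubling condition its quasi-norm is
  order continuous, so by the Radon--Nikodym theorem every bounded functional is integration against an element of
  the Koethe dual. The envelope norm is then the bidual norm, and \<open>M\<close> is dense in the bidual by order continuity.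
\<close>

section \<open>Layer cake comparison\<close>

text \<open>Until linearity is assumed, M need not be closed under sums, so uniform boundedness
  arguments are out of reach. What M does tolerate is a supremum of decreasing majorants: its
  modular is at most the sum of the modulars, and a function whose rearrangement lies below a
  majorant of finite modular belongs to M. Hump arguments on M therefore run on rearrangements, and
  this is why transplanting is needed. It costs a factor \<beta> > 1, because a positive limit of
  the rearrangement at infinity need not be attained by |h|; the factor is removed at the end of
  each estimate. Submajorization is used in the form of set integrals, where concavity of the
  primitive of w becomes submodularity of a set function; this is the source of the level function
  u. Its optimality rests on two equalities meeting: \<eta> (u) gives equality in the Young
  inequality, and tightness on superlevel sets matches integrals against v with integrals against w.
  Linearity of M is exploited through two disjointly supported summands whose rearrangements are
  smaller than that of their sum by a definite dilation.\<close>

lemma emeasure_lborel_ennreal_Ico: "emeasure lborel {y::real. 0 \<le> y \<and> ennreal y < x} = x"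
proof (cases x)
  case (real r)
  have "{y::real. 0 \<le> y \<and> ennreal y < x} = {0..<r}"
    using real by (auto simp: ennreal_less_iff)
  then show ?thesis using real by simp
next
  case top
  have *: "{y::real. 0 \<le> y \<and> ennreal y < x} = {0..}" using top by auto
  have "ennreal n \<le> emeasure lborel {0::real..}" for n :: nat
  proof -
    have "emeasure lborel {0..real n} \<le> emeasure lborel {0::real..}" by (intro emeasure_mono) auto
    then show ?thesis by simp
  qed
  then have "emeasure lborel {0::real..} = \<infinity>"
    by (metis ennreal_Ex_less_of_nat ennreal_of_nat_eq_real_of_nat infinity_ennreal_def leD top.not_eq_extremum)
  then show ?thesis using * top by simp
qed

text \<open>Tonelli applied to the pointwise fact that \<open>k x\<close> is the length of the set
  of y >= 0 below it. The density \<open>r\<close> is carried along so that one formula covers plain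
  measure as well as integrals against |f|, v and w.\<close>

lemma nn_integral_layer_cake:
  assumes "sigma_finite_measure M"
    and [measurable]: "r \<in> borel_measurable M" "k \<in> borel_measurable M"
  shows "(\<integral>\<^sup>+x. r x * k x \<partial>M) =
    (\<integral>\<^sup>+y. (\<integral>\<^sup>+x. r x * indicator {x. ennreal y < k x} x \<partial>M) * indicator {0..} y \<partial>lborel)"
proof -
  interpret M: sigma_finite_measure M by fact
  interpret pair_sigma_finite M "lborel :: real measure" ..
  have k: "k x = (\<integral>\<^sup>+y. indicator {0..} y * indicator {x. ennreal y < k x} x \<partial>lborel)" for x
  proof -
    have "(\<integral>\<^sup>+y. indicator {0..} y * indicator {x. ennreal y < k x} x \<partial>lborel)
       = (\<integral>\<^sup>+y. indicator {y::real. 0 \<le> y \<and> ennreal y < k x} y \<partial>lborel)"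
      by (intro nn_integral_cong) (auto simp: indicator_def)
    also have "\<dots> = k x" by (simp add: emeasure_lborel_ennreal_Ico)
    finally show ?thesis by simp
  qed
  have "(\<integral>\<^sup>+x. r x * k x \<partial>M) =
     (\<integral>\<^sup>+x. r x * (\<integral>\<^sup>+y. indicator {0..} y * indicator {x. ennreal y < k x} x \<partial>lborel) \<partial>M)"
    by (rule nn_integral_cong) (simp only: k[symmetric])
  also have "\<dots> = (\<integral>\<^sup>+x. (\<integral>\<^sup>+y. r x * (indicator {0..} y * indicator {x. ennreal y < k x} x) \<partial>lborel) \<partial>M)"
    by (intro nn_integral_cong, subst nn_integral_cmult) auto
  also have "\<dots> = (\<integral>\<^sup>+y. (\<integral>\<^sup>+x. r x * (indicator {0..} y * indicator {x. ennreal y < k x} x) \<partial>M) \<partial>lborel)"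
  proof (rule Fubini'[symmetric])
    have "(\<lambda>z. r (fst z) * (indicator {0..} (snd z) * (if ennreal (snd z) < k (fst z) then 1 else 0)))
       \<in> borel_measurable (M \<Otimes>\<^sub>M lborel)" by measurable
    then show "(\<lambda>(x, y). r x * (indicator {0..} y * indicator {x. ennreal y < k x} x))
       \<in> borel_measurable (M \<Otimes>\<^sub>M lborel)" by (simp add: case_prod_beta' indicator_def of_bool_def)
  qed
  also have "\<dots> = (\<integral>\<^sup>+y. (\<integral>\<^sup>+x. r x * indicator {x. ennreal y < k x} x \<partial>M) * indicator {0..} y \<partial>lborel)"
    by (intro nn_integral_cong) (simp add: indicator_def)
  finally show ?thesis .
qed

text \<open>The common mechanism of the comparisons below between a function and its rearrangement:
  superlevel sets are compared at each real level, and the levels are integrated out.\<close>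

lemma nn_integral_mono_superlevel:
  assumes "sigma_finite_measure M" "r \<in> borel_measurable M" "k \<in> borel_measurable M"
    and "sigma_finite_measure N" "r' \<in> borel_measurable N" "k' \<in> borel_measurable N"
    and "\<And>y. 0 \<le> y \<Longrightarrow> (\<integral>\<^sup>+x. r x * indicator {x. ennreal y < k x} x \<partial>M)
            \<le> (\<integral>\<^sup>+x. r' x * indicator {x. ennreal y < k' x} x \<partial>N)"
  shows "(\<integral>\<^sup>+x. r x * k x \<partial>M) \<le> (\<integral>\<^sup>+x. r' x * k' x \<partial>N)"
  unfolding nn_integral_layer_cake[OF assms(1-3)] nn_integral_layer_cake[OF assms(4-6)]
proof (rule nn_integral_mono)
  fix y :: real
  show "(\<integral>\<^sup>+x. r x * indicator {x. ennreal y < k x} x \<partial>M) * indicator {0..} y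
    \<le> (\<integral>\<^sup>+x. r' x * indicator {x. ennreal y < k' x} x \<partial>N) * indicator {0..} y"
    using assms(7)[of y] by (cases "0 \<le> y") simp_all
qed

section \<open>Rearrangements on an interval\<close>

locale interval_domain =
  fixes a :: ereal and I :: "real set"
  assumes a_pos: "0 < a" and I_def: "I = einterval 0 a"
begin

abbreviation "MI \<equiv> lebesgue_on I"
abbreviation "rear \<equiv> rearrangement I"
abbreviation "dist_f \<equiv> distribution_fun I"
abbreviation "len \<equiv> e2ennreal a"

lemma mem_I_iff: "t \<in> I \<longleftrightarrow> 0 < t \<and> ennreal t < len"
proof -
  have "0 < t \<Longrightarrow> ereal t < a \<longleftrightarrow> ennreal t < e2ennreal a"
    using a_pos by (cases a) (auto simp: ennreal_less_iff simp flip: ennreal.rep_eq)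
  then show ?thesis by (auto simp: I_def einterval_def)
qed

lemma I_down: "t \<in> I \<Longrightarrow> 0 < s \<Longrightarrow> s \<le> t \<Longrightarrow> s \<in> I"
  unfolding mem_I_iff by (metis ennreal_leI le_less_trans)

lemma I_pos: "t \<in> I \<Longrightarrow> 0 < t"
  by (simp add: mem_I_iff)

lemma open_I: "open I" unfolding I_def by (rule open_einterval)

lemma I_borel [measurable]: "I \<in> sets borel"
  using open_I by simp

lemma I_sets [measurable]: "I \<in> sets lebesgue"
  using I_borel by simp

lemma sets_MI_iff: "A \<in> sets MI \<longleftrightarrow> A \<subseteq> I \<and> A \<in> sets lebesgue"
  using sets_restrict_space_iff[of I lebesgue A] I_sets by auto

lemma emeasure_MI: "A \<subseteq> I \<Longrightarrow> emeasure MI A = emeasure lebesgue A"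
  using I_sets by (intro emeasure_restrict_space) auto

lemma sigma_finite_MI: "sigma_finite_measure MI"
proof (rule sigma_finite_measure_restrict_space[OF _ I_sets])
  show "sigma_finite_measure (lebesgue :: real measure)"
  proof
    have "(\<Union>n. {- real n..real n}) = UNIV"
    proof (intro equalityI subsetI UNIV_I)
      fix x :: real obtain n where "\<bar>x\<bar> \<le> real n" using real_arch_simple by blast
      then show "x \<in> (\<Union>n. {- real n..real n})" by (auto intro!: exI[of _ n])
    qed
    then show "\<exists>A. countable A \<and> A \<subseteq> sets lebesgue \<and> \<Union> A = space (lebesgue :: real measure)
        \<and> (\<forall>a\<in>A. emeasure lebesgue a \<noteq> \<infinity>)"
      by (intro exI[of _ "range (\<lambda>n. {- real n..real n})"]) auto
  qed
qed

lemma emeasure_initial: "emeasure MI {t\<in>I. ennreal t < x} = min x len"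
proof -
  define z where "z = min x len"
  have "emeasure lebesgue {t. 0 < t \<and> ennreal t < z} = z"
  proof -
    have "emeasure lebesgue {t. 0 < t \<and> ennreal t < z} = emeasure lborel {t. 0 < t \<and> ennreal t < z}"
    proof -
      have "{t. 0 < t \<and> ennreal t < z} \<in> sets lborel" by simp
      then show ?thesis by simp
    qed
    also have "\<dots> = emeasure lborel {t. 0 \<le> t \<and> ennreal t < z}"
    proof (cases "z = 0")
      case False
      have "{t. 0 \<le> t \<and> ennreal t < z} = insert 0 {t. 0 < t \<and> ennreal t < z}"
        using False by (auto simp: le_less zero_less_iff_neq_zero)
      then show ?thesis by (simp add: emeasure_insert)
    qed simp
    also have "\<dots> = z" by (rule emeasure_lborel_ennreal_Ico)
    finally show ?thesis .
  qed
  moreover have "{t\<in>I. ennreal t < x} = {t. 0 < t \<and> ennreal t < z}"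
    by (auto simp: mem_I_iff z_def)
  ultimately show ?thesis by (subst emeasure_MI) (auto simp: z_def)
qed

lemma emeasure_I: "emeasure MI I = len"
  using emeasure_initial[of top] by (simp add: mem_I_iff less_top[symmetric])
     (metis (no_types, lifting) emeasure_initial mem_Collect_eq min.idem mem_I_iff Collect_cong Collect_mem_eq)

lemma dist_f_eq: "dist_f f y = emeasure MI {t\<in>I. y < \<bar>f t\<bar>}"
  unfolding distribution_fun_def by (subst emeasure_MI) auto

lemma pred_abs_greater [measurable]: "f \<in> L0 I \<Longrightarrow> {t\<in>I. (y::real) < \<bar>f t\<bar>} \<in> sets MI"
proof -
  assume [measurable]: "f \<in> L0 I"
  have "{t\<in>space MI. y < \<bar>f t\<bar>} \<in> sets MI" by measurable
  then show ?thesis by simp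
qed

lemma dist_f_le_len: "f \<in> L0 I \<Longrightarrow> dist_f f y \<le> len"
  unfolding dist_f_eq emeasure_I[symmetric] by (intro emeasure_mono) (auto simp: sets_MI_iff)

lemma dist_f_antimono: "f \<in> L0 I \<Longrightarrow> x \<le> y \<Longrightarrow> dist_f f y \<le> dist_f f x"
  unfolding dist_f_eq by (intro emeasure_mono pred_abs_greater) auto

text \<open>Right continuity of the distribution function: the sets where |f| exceeds y + 1/(n+1)
  increase to the set where |f| exceeds y, so a measure above t is already reached at a slightly
  higher level. Most facts about rearrangements are read off from this equivalence.\<close>

lemma rear_gt_iff:
  assumes f: "f \<in> L0 I" and y: "0 \<le> y"
  shows "ennreal y < rear f t \<longleftrightarrow> ennreal t < dist_f f y"
proof
  assume "ennreal y < rear f t"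
  then have "\<not> dist_f f y \<le> ennreal t"
    unfolding rearrangement_def using y by (metis (mono_tags, lifting) Inf_lower leD mem_Collect_eq)
  then show "ennreal t < dist_f f y" by simp
next
  assume *: "ennreal t < dist_f f y"
  have "(\<lambda>n. emeasure MI {t\<in>I. y + 1 / real (Suc n) < \<bar>f t\<bar>})
      \<longlonglongrightarrow> emeasure MI (\<Union>n. {t\<in>I. y + 1 / real (Suc n) < \<bar>f t\<bar>})"
  proof (rule Lim_emeasure_incseq)
    show "range (\<lambda>n. {t\<in>I. y + 1 / real (Suc n) < \<bar>f t\<bar>}) \<subseteq> sets MI" using pred_abs_greater[OF f] by auto
    show "incseq (\<lambda>n. {t\<in>I. y + 1 / real (Suc n) < \<bar>f t\<bar>})"
    proof (rule incseq_SucI, rule subsetI)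
      fix n t assume "t \<in> {t\<in>I. y + 1 / real (Suc n) < \<bar>f t\<bar>}"
      moreover have "1 / real (Suc (Suc n)) \<le> 1 / real (Suc n)" by (intro divide_left_mono) auto
      ultimately show "t \<in> {t\<in>I. y + 1 / real (Suc (Suc n)) < \<bar>f t\<bar>}" by auto
    qed
  qed
  also have "(\<Union>n. {t\<in>I. y + 1 / real (Suc n) < \<bar>f t\<bar>}) = {t\<in>I. y < \<bar>f t\<bar>}"
  proof (intro equalityI subsetI)
    fix t assume "t \<in> {t\<in>I. y < \<bar>f t\<bar>}"
    then have "t \<in> I" "0 < \<bar>f t\<bar> - y" by auto
    then obtain n where "1 / real (Suc n) < \<bar>f t\<bar> - y" using nat_approx_posE by metis
    then show "t \<in> (\<Union>n. {t\<in>I. y + 1 / real (Suc n) < \<bar>f t\<bar>})" using \<open>t \<in> I\<close> by (auto intro!: exI[of _ n])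
  next
    fix t assume "t \<in> (\<Union>n. {t\<in>I. y + 1 / real (Suc n) < \<bar>f t\<bar>})"
    then obtain n where "t \<in> I" "y + 1 / real (Suc n) < \<bar>f t\<bar>" by auto
    moreover have "0 < 1 / real (Suc n)" by simp
    ultimately show "t \<in> {t\<in>I. y < \<bar>f t\<bar>}" by (auto intro: order.strict_trans[rotated])
  qed
  finally have "(\<lambda>n. dist_f f (y + 1 / real (Suc n))) \<longlonglongrightarrow> dist_f f y" unfolding dist_f_eq .
  then have "\<forall>\<^sub>F n in sequentially. ennreal t < dist_f f (y + 1 / real (Suc n))"
    using * by (rule order_tendstoD)
  then obtain n where n: "ennreal t < dist_f f (y + 1 / real (Suc n))"
    by (auto simp: eventually_sequentially)
  have "ennreal (y + 1 / real (Suc n)) \<le> rear f t"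
    unfolding rearrangement_def
  proof (rule Inf_greatest)
    fix x assume "x \<in> {ennreal s |s. 0 \<le> s \<and> dist_f f s \<le> ennreal t}"
    then obtain s where s: "x = ennreal s" "0 \<le> s" "dist_f f s \<le> ennreal t" by auto
    have "\<not> s < y + 1 / real (Suc n)"
      using dist_f_antimono[OF f, of s "y + 1 / real (Suc n)"] s n by auto
    then show "ennreal (y + 1 / real (Suc n)) \<le> x" using s by (auto intro: ennreal_leI)
  qed
  moreover have "ennreal y < ennreal (y + 1 / real (Suc n))"
    using y by (intro ennreal_lessI) (auto intro: add_nonneg_pos)
  ultimately show "ennreal y < rear f t" by simp
qed

text \<open>Real levels suffice: if \<open>X\<close> were below the rearrangement it would be
  finite, and could then itself serve as the level \<open>y\<close>.\<close>

lemma rear_leI: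
  assumes "f \<in> L0 I" "\<And>y. 0 \<le> y \<Longrightarrow> ennreal t < dist_f f y \<Longrightarrow> ennreal y < X"
  shows "rear f t \<le> X"
proof (rule ccontr)
  assume "\<not> rear f t \<le> X"
  then have *: "X < rear f t" by simp
  then have "X \<noteq> top" by auto
  then obtain y where y: "X = ennreal y" "0 \<le> y" by (cases X) auto
  then have "ennreal y < X" using assms(2)[of y] rear_gt_iff[OF assms(1), of y t] * by simp
  then show False using y by simp
qed

lemma rear_antimono: "f \<in> L0 I \<Longrightarrow> s \<le> t \<Longrightarrow> rear f t \<le> rear f s"
  unfolding rearrangement_def by (intro Inf_superset_mono) (blast intro: order_trans ennreal_leI)

lemma rear_measurable [measurable]: "f \<in> L0 I \<Longrightarrow> rear f \<in> borel_measurable borel"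
proof (rule borel_measurableI_greater)
  fix y :: ennreal assume f: "f \<in> L0 I"
  show "{x \<in> space borel. y < rear f x} \<in> sets borel"
  proof (cases y)
    case (real r)
    then have "{x \<in> space borel. y < rear f x} = {x. ennreal x < dist_f f r}"
      using rear_gt_iff[OF f, of r] by auto
    then show ?thesis by simp
  qed auto
qed

lemma borel_imp_MI: "f \<in> borel_measurable borel \<Longrightarrow> f \<in> borel_measurable MI"
  by (intro measurable_restrict_space1 measurable_completion) simp

lemma rear_measurable_MI [measurable]: "f \<in> L0 I \<Longrightarrow> rear f \<in> borel_measurable MI"
  by (rule borel_imp_MI[OF rear_measurable])

lemma rear_mono_dist:
  assumes "f \<in> L0 I" "g \<in> L0 I" "\<And>y. 0 \<le> y \<Longrightarrow> dist_f f y \<le> dist_f g y"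
  shows "rear f t \<le> rear g t"
  unfolding rearrangement_def using assms(3) by (intro Inf_superset_mono) (auto intro: order_trans)

lemma rear_mono:
  assumes [measurable]: "f \<in> L0 I" "g \<in> L0 I" and "AE t in MI. \<bar>f t\<bar> \<le> \<bar>g t\<bar>"
  shows "rear f t \<le> rear g t"
proof (rule rear_mono_dist[OF assms(1,2)])
  fix y :: real
  show "dist_f f y \<le> dist_f g y" unfolding dist_f_eq
  proof (rule emeasure_mono_AE)
    show "AE x in MI. x \<in> {t \<in> I. y < \<bar>f t\<bar>} \<longrightarrow> x \<in> {t \<in> I. y < \<bar>g t\<bar>}"
      using assms(3) by eventually_elim auto
  qed (intro pred_abs_greater assms)
qed

lemma rear_cmult:
  assumes f [measurable]: "f \<in> L0 I"
  shows "rear (\<lambda>t. c * f t) t = ennreal \<bar>c\<bar> * rear f t"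
proof (cases "c = 0")
  case True
  have "dist_f (\<lambda>t. c * f t) 0 = 0" using True by (simp add: dist_f_eq)
  then have "rear (\<lambda>t. c * f t) t \<le> ennreal 0" unfolding rearrangement_def
    by (intro Inf_lower) (auto intro!: exI[of _ 0])
  then show ?thesis using True by simp
next
  case False
  have m: "(\<lambda>t. c * f t) \<in> L0 I" by measurable
  have d: "dist_f (\<lambda>t. c * f t) y = dist_f f (y / \<bar>c\<bar>)" for y
    unfolding distribution_fun_def using False
    by (intro arg_cong[of _ _ "emeasure lebesgue"]) (auto simp: abs_mult field_simps)
  have key: "ennreal y < rear (\<lambda>t. c * f t) t \<longleftrightarrow> ennreal y < ennreal \<bar>c\<bar> * rear f t" if y: "0 \<le> y" for y
  proof -
    have "ennreal y < rear (\<lambda>t. c * f t) t \<longleftrightarrow> ennreal (y / \<bar>c\<bar>) < rear f t"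
      using y rear_gt_iff[OF m y, of t] rear_gt_iff[OF f, of "y / \<bar>c\<bar>" t] d by simp
    also have "\<dots> \<longleftrightarrow> ennreal y < ennreal \<bar>c\<bar> * rear f t"
    proof (cases "rear f t")
      case (real r)
      then show ?thesis using False y
        by (simp add: ennreal_less_iff field_simps flip: ennreal_mult)
    qed (use False in \<open>auto simp: ennreal_mult_top\<close>)
    finally show ?thesis .
  qed
  show ?thesis
  proof (rule ccontr)
    assume "rear (\<lambda>t. c * f t) t \<noteq> ennreal \<bar>c\<bar> * rear f t"
    then consider "rear (\<lambda>t. c * f t) t < ennreal \<bar>c\<bar> * rear f t" | "ennreal \<bar>c\<bar> * rear f t < rear (\<lambda>t. c * f t) t"
      by fastforce
    then show False
    proof cases
      case 1
      then obtain y where "rear (\<lambda>t. c * f t) t = ennreal y" "0 \<le> y" by (cases "rear (\<lambda>t. c * f t) t") auto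
      then show False using key[of y] 1 by auto
    next
      case 2
      then obtain y where "ennreal \<bar>c\<bar> * rear f t = ennreal y" "0 \<le> y" by (cases "ennreal \<bar>c\<bar> * rear f t") auto
      then show False using key[of y] 2 by auto
    qed
  qed
qed

lemma rear_divide:
  assumes f: "f \<in> L0 I" and "0 < c"
  shows "rear (\<lambda>t. f t / c) t = rear f t / ennreal c"
  using rear_cmult[OF f, of "1 / c" t] assms(2)
  by (simp add: divide_ennreal_def inverse_ennreal mult.commute inverse_eq_divide)

text \<open>Each summand exceeds its rearrangement at t/2 on a set of measure at most t/2, so the
  sum exceeds the sum of these levels on measure at most t. The halved argument is what
  \<open>linear_doubling\<close> later has to absorb.\<close>

lemma rear_add_le:
  assumes f [measurable]: "f \<in> L0 I" and g [measurable]: "g \<in> L0 I" and t: "0 \<le> t"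
  shows "rear (\<lambda>t. f t + g t) t \<le> rear f (t/2) + rear g (t/2)"
proof (cases "rear f (t/2) = top \<or> rear g (t/2) = top")
  case False
  then obtain x y where xy: "rear f (t/2) = ennreal x" "0 \<le> x" "rear g (t/2) = ennreal y" "0 \<le> y"
    by (metis ennreal_cases)
  have dx: "dist_f f x \<le> ennreal (t/2)" using rear_gt_iff[OF f xy(2), of "t/2"] xy(1) by auto
  have dy: "dist_f g y \<le> ennreal (t/2)" using rear_gt_iff[OF g xy(4), of "t/2"] xy(3) by auto
  have "dist_f (\<lambda>t. f t + g t) (x + y) \<le> emeasure MI ({t\<in>I. x < \<bar>f t\<bar>} \<union> {t\<in>I. y < \<bar>g t\<bar>})"
    unfolding dist_f_eq by (intro emeasure_mono sets.Un pred_abs_greater f g) auto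
  also have "\<dots> \<le> dist_f f x + dist_f g y" unfolding dist_f_eq
    by (intro emeasure_subadditive pred_abs_greater f g)
  also have "\<dots> \<le> ennreal (t/2) + ennreal (t/2)" by (intro add_mono dx dy)
  also have "\<dots> = ennreal t" using t by (simp flip: ennreal_plus)
  finally have "rear (\<lambda>t. f t + g t) t \<le> ennreal (x + y)"
    unfolding rearrangement_def using xy by (intro Inf_lower) (auto intro!: exI[of _ "x + y"])
  then show ?thesis using xy by simp
qed auto

text \<open>Fatou for the indicators of the superlevel sets gives lower semicontinuity of the
  distribution functions, and \<open>rear_gt_iff\<close> turns this into lower semicontinuity of the
  rearrangement at every single point.\<close>

lemma rear_le_liminf:
  assumes f [measurable]: "f \<in> L0 I" and u [measurable]: "\<And>n. u n \<in> L0 I"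
    and lim: "AE t in MI. (\<lambda>n. u n t) \<longlonglongrightarrow> f t"
  shows "rear f t \<le> liminf (\<lambda>n. rear (u n) t)"
proof -
  have "\<forall>\<^sub>F n in sequentially. y < rear (u n) t" if y: "y < rear f t" for y
  proof -
    obtain r where r: "y = ennreal r" "0 \<le> r" using y by (cases y) auto
    have "ennreal t < dist_f f r" using r y rear_gt_iff[OF f] by auto
    also have "dist_f f r = (\<integral>\<^sup>+x. indicator {t\<in>I. r < \<bar>f t\<bar>} x \<partial>MI)"
      unfolding dist_f_eq using pred_abs_greater[OF f] by simp
    also have "\<dots> \<le> (\<integral>\<^sup>+x. liminf (\<lambda>n. indicator {t\<in>I. r < \<bar>u n t\<bar>} x) \<partial>MI)"
    proof (rule nn_integral_mono_AE)
      show "AE x in MI. indicator {t\<in>I. r < \<bar>f t\<bar>} x \<le> liminf (\<lambda>n. indicator {t\<in>I. r < \<bar>u n t\<bar>} x :: ennreal)"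
        using lim
      proof eventually_elim
        case (elim x)
        show ?case
        proof (cases "x \<in> {t\<in>I. r < \<bar>f t\<bar>}")
          case True
          have "(\<lambda>n. \<bar>u n x\<bar>) \<longlonglongrightarrow> \<bar>f x\<bar>" using elim by (rule tendsto_rabs)
          then have "\<forall>\<^sub>F n in sequentially. r < \<bar>u n x\<bar>" using True by (auto dest: order_tendstoD)
          then have "\<forall>\<^sub>F n in sequentially. 1 \<le> (indicator {t\<in>I. r < \<bar>u n t\<bar>} x :: ennreal)"
            by eventually_elim (use True in auto)
          then have "1 \<le> liminf (\<lambda>n. indicator {t\<in>I. r < \<bar>u n t\<bar>} x :: ennreal)"
            by (rule Liminf_bounded)
          then show ?thesis using True by simp
        qed simp
      qed
    qed
    also have "\<dots> \<le> liminf (\<lambda>n. \<integral>\<^sup>+x. indicator {t\<in>I. r < \<bar>u n t\<bar>} x \<partial>MI)"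
      using pred_abs_greater[OF u] by (intro nn_integral_liminf) auto
    also have "\<dots> = liminf (\<lambda>n. dist_f (u n) r)"
      unfolding dist_f_eq using pred_abs_greater[OF u] by simp
    finally have "\<forall>\<^sub>F n in sequentially. ennreal t < dist_f (u n) r"
      using less_LiminfD by blast
    then show ?thesis by eventually_elim (use r rear_gt_iff[OF u] in auto)
  qed
  then show ?thesis by (auto simp: le_Liminf_iff)
qed

subsection \<open>The Hardy--Littlewood inequality\<close>

text \<open>The superlevel set of f restricted to E has at most the measure of the full superlevel
  set and at most that of E. The initial segment of the smaller length is precisely the superlevel
  set of the rearrangement cut off at the measure of E.\<close>

lemma set_nn_integral_le_rear:
  assumes f [measurable]: "f \<in> L0 I" and E: "E \<in> sets MI"
  shows "(\<integral>\<^sup>+t. ennreal \<bar>f t\<bar> * indicator E t \<partial>MI) \<le> (\<integral>\<^sup>+t. rear f t * indicator {t. ennreal t < emeasure MI E} t \<partial>MI)"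
proof -
  let ?e = "emeasure MI E"
  have EI: "E \<subseteq> I" using E by (simp add: sets_MI_iff)
  have "(\<integral>\<^sup>+t. 1 * (ennreal \<bar>f t\<bar> * indicator E t) \<partial>MI) \<le> (\<integral>\<^sup>+t. 1 * (rear f t * indicator {t. ennreal t < ?e} t) \<partial>MI)"
  proof (rule nn_integral_mono_superlevel)
    fix y :: real assume y: "0 \<le> y"
    have "(\<integral>\<^sup>+x. 1 * indicator {x. ennreal y < ennreal \<bar>f x\<bar> * indicator E x} x \<partial>MI) =
       (\<integral>\<^sup>+x. indicator ({x\<in>I. y < \<bar>f x\<bar>} \<inter> E) x \<partial>MI)"
      using EI y by (intro nn_integral_cong) (auto simp: indicator_def ennreal_less_iff)
    also have "\<dots> = emeasure MI ({x\<in>I. y < \<bar>f x\<bar>} \<inter> E)" using E pred_abs_greater[OF f] by simp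
    also have "\<dots> \<le> min (min (dist_f f y) ?e) len"
      unfolding dist_f_eq emeasure_I[symmetric] using E pred_abs_greater[OF f]
      by (auto intro!: emeasure_mono simp: sets_MI_iff)
    also have "\<dots> = emeasure MI {t\<in>I. ennreal t < min (dist_f f y) ?e}" by (rule emeasure_initial[symmetric])
    also have "\<dots> = (\<integral>\<^sup>+x. indicator {t\<in>I. ennreal t < min (dist_f f y) ?e} x \<partial>MI)"
    proof -
      have "{t\<in>space MI. ennreal t < min (dist_f f y) ?e} \<in> sets MI"
        by (rule measurable_sets_Collect[OF borel_imp_MI]) auto
      then show ?thesis by simp
    qed
    also have "\<dots> = (\<integral>\<^sup>+x. 1 * indicator {x. ennreal y < rear f x * indicator {t. ennreal t < ?e} x} x \<partial>MI)"
      using y rear_gt_iff[OF f y] by (intro nn_integral_cong) (auto simp: indicator_def)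
    finally show "(\<integral>\<^sup>+x. 1 * indicator {x. ennreal y < ennreal \<bar>f x\<bar> * indicator E x} x \<partial>MI)
      \<le> (\<integral>\<^sup>+x. 1 * indicator {x. ennreal y < rear f x * indicator {t. ennreal t < ?e} x} x \<partial>MI)" .
  next
    have [measurable]: "E \<in> sets MI" by fact
    show "(\<lambda>x. ennreal \<bar>f x\<bar> * indicator E x) \<in> borel_measurable MI" by measurable
    show "(\<lambda>x. rear f x * indicator {t. ennreal t < emeasure MI E} x) \<in> borel_measurable MI"
      by (rule borel_imp_MI) measurable
  qed (auto simp: sigma_finite_MI)
  then show ?thesis by simp
qed

lemma set_initial_MI [measurable]: "{t\<in>I. ennreal t < x} \<in> sets MI"
proof -
  have "{t\<in>space MI. ennreal t < x} \<in> sets MI"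
    by (rule measurable_sets_Collect[OF borel_imp_MI]) auto
  then show ?thesis by simp
qed

text \<open>Slicing g into its superlevel sets reduces the claim to
  \<open>set_nn_integral_le_rear\<close>, because the superlevel sets of \<open>rear g\<close> are
  initial segments of the same measure.\<close>

theorem Hardy_Littlewood:
  assumes f [measurable]: "f \<in> L0 I" and g [measurable]: "g \<in> L0 I"
  shows "(\<integral>\<^sup>+t. ennreal \<bar>f t * g t\<bar> \<partial>MI) \<le> (\<integral>\<^sup>+t. rear f t * rear g t \<partial>MI)"
proof -
  have "(\<integral>\<^sup>+t. ennreal \<bar>f t\<bar> * ennreal \<bar>g t\<bar> \<partial>MI) \<le> (\<integral>\<^sup>+t. rear f t * rear g t \<partial>MI)"
  proof (rule nn_integral_mono_superlevel)
    fix y :: real assume y: "0 \<le> y"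
    have "(\<integral>\<^sup>+x. ennreal \<bar>f x\<bar> * indicator {x. ennreal y < ennreal \<bar>g x\<bar>} x \<partial>MI)
      = (\<integral>\<^sup>+x. ennreal \<bar>f x\<bar> * indicator {x\<in>I. y < \<bar>g x\<bar>} x \<partial>MI)"
      using y by (intro nn_integral_cong) (auto simp: indicator_def ennreal_less_iff)
    also have "\<dots> \<le> (\<integral>\<^sup>+t. rear f t * indicator {t. ennreal t < dist_f g y} t \<partial>MI)"
      unfolding dist_f_eq by (rule set_nn_integral_le_rear[OF f pred_abs_greater[OF g]])
    also have "\<dots> = (\<integral>\<^sup>+t. rear f t * indicator {t. ennreal y < rear g t} t \<partial>MI)"
      using rear_gt_iff[OF g y] by simp
    finally show "(\<integral>\<^sup>+x. ennreal \<bar>f x\<bar> * indicator {x. ennreal y < ennreal \<bar>g x\<bar>} x \<partial>MI)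
      \<le> (\<integral>\<^sup>+t. rear f t * indicator {t. ennreal y < rear g t} t \<partial>MI)" .
  qed (auto simp: sigma_finite_MI)
  then show ?thesis by (simp add: abs_mult ennreal_mult)
qed

text \<open>A level y at or above \<open>G t\<close> confines the set where G exceeds y to (0,t), so
  its measure is at most t. At a jump of a G that is not right continuous the rearrangement can be
  strictly smaller, hence an inequality.\<close>

lemma rear_le_antimono:
  assumes f: "f \<in> L0 I" and t: "t \<in> I"
    and d: "\<And>y. 0 \<le> y \<Longrightarrow> dist_f f y \<le> emeasure MI {s\<in>I. ennreal y < G s}"
    and G: "\<And>s s'. s \<in> I \<Longrightarrow> s' \<in> I \<Longrightarrow> s \<le> s' \<Longrightarrow> G s' \<le> G s"
  shows "rear f t \<le> G t"
proof (rule rear_leI[OF f])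
  fix y :: real assume y: "0 \<le> y" and t': "ennreal t < dist_f f y"
  show "ennreal y < G t"
  proof (rule ccontr)
    assume "\<not> ennreal y < G t"
    then have Gt: "G t \<le> ennreal y" by simp
    have "s < t" if "s \<in> I" "ennreal y < G s" for s
      using G[OF t that(1)] that(2) Gt by (meson leD linorder_le_less_linear order_trans)
    then have "{s\<in>I. ennreal y < G s} \<subseteq> {s\<in>I. ennreal s < ennreal t}"
      using I_pos[OF t] by (auto intro!: ennreal_lessI)
    then have "emeasure MI {s\<in>I. ennreal y < G s} \<le> emeasure MI {s\<in>I. ennreal s < ennreal t}"
      by (intro emeasure_mono) auto
    also have "\<dots> \<le> ennreal t" unfolding emeasure_initial by simp
    finally show False using d[OF y] t' by auto
  qed
qed

end

section \<open>Transplanting decreasing functions\<close>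

context interval_domain
begin

lemma emeasure_below_le: "E \<subseteq> I \<Longrightarrow> emeasure MI (E \<inter> {..<t}) \<le> ennreal t"
proof -
  assume E: "E \<subseteq> I"
  have "0 < t" if "x \<in> E" "x < t" for x using E I_pos[of x] that by auto
  then have "emeasure MI (E \<inter> {..<t}) \<le> emeasure MI {s\<in>I. ennreal s < ennreal t}"
    using E by (intro emeasure_mono) (auto intro!: ennreal_lessI)
  also have "\<dots> \<le> ennreal t" by (simp add: emeasure_initial)
  finally show ?thesis .
qed

text \<open>The measure of E below t is a 1-Lipschitz function of t, so the intermediate value
  theorem finds the cut. \<open>T\<close> is downward closed, so cuts of one set for different
  values of c are automatically nested; \<open>rank_map\<close> exploits this.\<close>

lemma chop_initial:
  assumes E: "E \<in> sets MI" and c: "0 \<le> c" "ennreal c \<le> emeasure MI E"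
  obtains T where "T \<in> sets borel" "\<And>s s'. s \<in> T \<Longrightarrow> s' < s \<Longrightarrow> s' \<in> T" "emeasure MI (E \<inter> T) = ennreal c"
proof (cases "emeasure MI E = ennreal c")
  case True
  then show ?thesis using that[of UNIV] by simp
next
  case False
  then have less: "ennreal c < emeasure MI E" using c by simp
  have EI: "E \<subseteq> I" and El: "E \<in> sets lebesgue" using E by (auto simp: sets_MI_iff)
  have Et [measurable]: "E \<inter> {..<t} \<in> sets MI" for t :: real
    using EI El by (auto simp: sets_MI_iff)
  have "(\<lambda>n. emeasure MI (E \<inter> {..<real n})) \<longlonglongrightarrow> emeasure MI (\<Union>n. E \<inter> {..<real n})"
    by (rule Lim_emeasure_incseq) (auto simp: incseq_def Et)
  also have "(\<Union>n. E \<inter> {..<real n}) = E" using reals_Archimedean2 by fastforce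
  finally have "\<forall>\<^sub>F n in sequentially. ennreal c < emeasure MI (E \<inter> {..<real n})"
    using less by (rule order_tendstoD)
  \<comment> \<open>E may have infinite measure; a bounded part that already exceeds c provides the
    right endpoint for the intermediate value argument.\<close>
  then obtain n where n: "ennreal c < emeasure MI (E \<inter> {..<real n})"
    by (auto simp: eventually_sequentially)
  define g where "g t = measure MI (E \<inter> {..<t})" for t
  have fin: "emeasure MI (E \<inter> {..<t}) < top" for t :: real
    using emeasure_below_le[OF EI, of t] by (rule order.strict_trans1) simp
  have g: "emeasure MI (E \<inter> {..<t}) = ennreal (g t)" for t
    unfolding g_def using fin[of t] by (intro emeasure_eq_ennreal_measure) auto
  have g0: "g t \<ge> 0" for t unfolding g_def by simp
  have lip: "g s \<le> g t \<and> g t \<le> g s + (t - s)" if "s \<le> t" for s t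
  proof
    have "ennreal (g s) \<le> ennreal (g t)" unfolding g[symmetric]
      using that by (intro emeasure_mono) auto
    then show "g s \<le> g t" using g0 by simp
    have m: "I \<inter> {s..<t} \<in> sets MI" by (auto simp: sets_MI_iff)
    have "emeasure MI (E \<inter> {..<t}) \<le> emeasure MI ((E \<inter> {..<s}) \<union> (I \<inter> {s..<t}))"
      using EI m by (intro emeasure_mono) auto
    also have "\<dots> \<le> emeasure MI (E \<inter> {..<s}) + emeasure MI (I \<inter> {s..<t})"
      using m by (intro emeasure_subadditive) auto
    also have "emeasure MI (I \<inter> {s..<t}) \<le> emeasure lebesgue {s..<t}"
      by (subst emeasure_MI) (auto intro!: emeasure_mono)
    also have "emeasure lebesgue {s..<t} = ennreal (t - s)" using that by simp
    finally have "ennreal (g t) \<le> ennreal (g s + (t - s))"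
      unfolding g using that g0 by (simp flip: ennreal_plus add: add_left_mono)
    then show "g t \<le> g s + (t - s)" using that g0[of s] by (subst (asm) ennreal_le_iff) auto
  qed
  have "continuous_on UNIV g"
    unfolding continuous_on_iff
  proof safe
    fix x e :: real assume "e > 0"
    moreover have "\<bar>g x' - g x\<bar> \<le> \<bar>x' - x\<bar>" for x'
      using lip[of x x'] lip[of x' x] by (cases "x \<le> x'") auto
    ultimately show "\<exists>d>0. \<forall>x'\<in>UNIV. dist x' x < d \<longrightarrow> dist (g x') (g x) < e"
      by (intro exI[of _ e]) (auto simp: dist_real_def intro: order.strict_trans1)
  qed
  then have cont: "continuous_on {0..real n} g" by (rule continuous_on_subset) auto
  have "ennreal (g 0) \<le> ennreal 0" using emeasure_below_le[OF EI, of 0] g by simp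
  then have "g 0 \<le> c" using c g0[of 0] by simp
  moreover have "c \<le> g (real n)" using n c g[of "real n"] g0 by (simp add: ennreal_less_iff)
  ultimately obtain t where "g t = c" using IVT'[of g 0 c "real n"] cont by auto
  then show ?thesis using that[of "{..<t}"] g[of t] by auto
qed

lemma initial_exhaustion:
  assumes "0 < x"
  obtains z :: "nat \<Rightarrow> real" where "incseq z" "\<And>n. z n \<in> I" "\<And>n. ereal (z n) < x"
    "\<And>t. t \<in> I \<Longrightarrow> ereal t < x \<Longrightarrow> \<exists>n. t < z n"
proof -
  have "0 < min a x" using assms a_pos by simp
  then obtain u l where ul: "einterval 0 (min a x) = (\<Union>i. {l i .. u i})"
    "incseq u" "\<And>i. l i < u i" "\<And>i. 0 < ereal (l i)" "\<And>i. ereal (u i) < min a x" "u \<longlonglongrightarrow> min a x"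
    by (rule einterval_Icc_approximation) blast
  show ?thesis
  proof (rule that[of u])
    show "u n \<in> I" for n using ul(3,4,5)[of n] by (auto simp: I_def einterval_def intro: less_trans)
    fix t assume "t \<in> I" "ereal t < x"
    then have "ereal t < min a x" by (simp add: I_def einterval_def)
    then have "\<forall>\<^sub>F n in sequentially. ereal t < ereal (u n)" using ul(6) by (rule order_tendstoD(1)[rotated])
    then show "\<exists>n. t < u n" by (auto simp: eventually_sequentially)
  qed (use ul in auto)
qed

text \<open>\<open>A x\<close> below is a set of measure exactly x, lying between the sets where |h|
  exceeds, respectively reaches, its rearrangement at x; the hypothesis \<open>att\<close> leaves
  enough room for it. These sets are nested, and the rank \<open>\<sigma> s\<close>, the infimum of
  the x with s in \<open>A x\<close>, carries Lebesgue measure on \<open>D\<close> to Lebesgue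
  measure on \<open>I\<close>.\<close>

lemma rank_map:
  assumes h [measurable]: "h \<in> L0 I"
    and att: "\<And>x. x \<in> I \<Longrightarrow> \<exists>y\<ge>0. rear h x = ennreal y \<and> ennreal x \<le> emeasure MI {t\<in>I. y \<le> \<bar>h t\<bar>}"
  obtains D \<sigma> where "D \<in> sets MI" "\<sigma> \<in> borel_measurable MI"
    "\<And>t. t \<in> D \<Longrightarrow> rear h (\<sigma> t) \<le> ennreal \<bar>h t\<bar>"
    "\<And>F :: real \<Rightarrow> ennreal. F \<in> borel_measurable borel \<Longrightarrow>
       (\<integral>\<^sup>+t. F (\<sigma> t) * indicator D t \<partial>MI) = (\<integral>\<^sup>+t. F t \<partial>MI)"
proof -
  define Y where "Y x = enn2real (rear h x)" for x
  have Y: "rear h x = ennreal (Y x)" "0 \<le> Y x" "ennreal x \<le> emeasure MI {t\<in>I. Y x \<le> \<bar>h t\<bar>}"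
    if "x \<in> I" for x using att[OF that] by (auto simp: Y_def)
  define gr where "gr x = {t\<in>I. Y x < \<bar>h t\<bar>}" for x
  define eq where "eq x = {t\<in>I. \<bar>h t\<bar> = Y x}" for x
  have gr_m [measurable]: "gr x \<in> sets MI" for x unfolding gr_def by (rule pred_abs_greater[OF h])
  have eq_m [measurable]: "eq x \<in> sets MI" for x
  proof -
    have "{t\<in>space MI. \<bar>h t\<bar> = Y x} \<in> sets MI" by measurable
    then show ?thesis by (simp add: eq_def)
  qed
  have "\<exists>T. T \<in> sets borel \<and> (\<forall>s s'. s \<in> T \<longrightarrow> s' < s \<longrightarrow> s' \<in> T) \<and> emeasure MI (gr x \<union> (eq x \<inter> T)) = ennreal x"
    if x: "x \<in> I" for x
  proof -
    have le: "emeasure MI (gr x) \<le> ennreal x"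
      using rear_gt_iff[OF h Y(2)[OF x], of x] Y(1)[OF x] unfolding gr_def dist_f_eq by auto
    then obtain m where m: "emeasure MI (gr x) = ennreal m" "0 \<le> m" "m \<le> x"
      using I_pos[OF x] by (cases "emeasure MI (gr x)") (auto simp: top_unique)
    have "ennreal x \<le> emeasure MI (gr x \<union> eq x)"
    proof (rule order_trans[OF Y(3)[OF x] emeasure_mono])
      show "{t\<in>I. Y x \<le> \<bar>h t\<bar>} \<subseteq> gr x \<union> eq x" by (auto simp: gr_def eq_def)
    qed measurable
    also have "\<dots> = ennreal m + emeasure MI (eq x)"
      unfolding m(1)[symmetric] by (rule plus_emeasure[symmetric, OF gr_m eq_m]) (auto simp: gr_def eq_def)
    finally have le2: "ennreal (x - m) \<le> emeasure MI (eq x)"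
    proof (cases "emeasure MI (eq x)")
      case (real r)
      assume "ennreal x \<le> ennreal m + emeasure MI (eq x)"
      then show ?thesis using real m by (simp flip: ennreal_plus add: ennreal_le_iff)
    qed auto
    obtain T where T: "T \<in> sets borel" "\<And>s s'. s \<in> T \<Longrightarrow> s' < s \<Longrightarrow> s' \<in> T"
        "emeasure MI (eq x \<inter> T) = ennreal (x - m)"
      using chop_initial[OF eq_m _ le2] m by auto
    have "eq x \<inter> T \<in> sets MI" using eq_m[of x] T(1) by (auto simp: sets_MI_iff)
    then have "emeasure MI (gr x \<union> (eq x \<inter> T)) = emeasure MI (gr x) + emeasure MI (eq x \<inter> T)"
      by (rule plus_emeasure[symmetric, OF gr_m]) (auto simp: gr_def eq_def)
    also have "\<dots> = ennreal x" using m T(3) by (simp flip: ennreal_plus)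
    finally show ?thesis using T by blast
  qed
  then obtain T where T: "\<And>x. x \<in> I \<Longrightarrow> T x \<in> sets borel"
    "\<And>x s s'. x \<in> I \<Longrightarrow> s \<in> T x \<Longrightarrow> s' < s \<Longrightarrow> s' \<in> T x"
    "\<And>x. x \<in> I \<Longrightarrow> emeasure MI (gr x \<union> (eq x \<inter> T x)) = ennreal x"
    by metis
  define A where "A x = gr x \<union> (eq x \<inter> T x)" for x
  have Am: "A x \<in> sets MI" if "x \<in> I" for x
  proof -
    have "T x \<in> sets lebesgue" using T(1)[OF that] by simp
    then show ?thesis using gr_m[of x] eq_m[of x] by (auto simp: sets_MI_iff A_def intro!: sets.Un sets.Int)
  qed
  have AI: "A x \<subseteq> I" for x by (auto simp: A_def gr_def eq_def)
  have Ae: "emeasure MI (A x) = ennreal x" if "x \<in> I" for x using T(3)[OF that] by (simp add: A_def)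
  \<comment> \<open>Sets at different levels \<open>Y\<close> are nested through the superlevel
    sets; at equal levels they differ by the cuts \<open>T\<close>, which are both downward closed
    and hence comparable.\<close>
  have total: "A x \<subseteq> A x' \<or> A x' \<subseteq> A x" if "x \<in> I" "x' \<in> I" for x x'
  proof -
    have TT: "T x \<subseteq> T x' \<or> T x' \<subseteq> T x"
    proof (rule ccontr)
      assume "\<not> (T x \<subseteq> T x' \<or> T x' \<subseteq> T x)"
      then obtain s s' where "s \<in> T x" "s \<notin> T x'" "s' \<in> T x'" "s' \<notin> T x" by auto
      moreover consider "s < s'" | "s' < s" | "s = s'" by linarith
      ultimately show False using T(2)[OF that(1)] T(2)[OF that(2)] by cases blast+
    qed
    consider "Y x < Y x'" | "Y x' < Y x" | "Y x = Y x'" by linarith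
    then show ?thesis
      by cases (use TT in \<open>auto simp: A_def gr_def eq_def\<close>)
  qed
  \<comment> \<open>Comparability leaves the reverse inclusion to exclude, and it would contradict
    the measures x < x'.\<close>
  have mono: "A x \<subseteq> A x'" if "x \<in> I" "x' \<in> I" "x < x'" for x x'
  proof (rule ccontr)
    assume "\<not> A x \<subseteq> A x'"
    then have "A x' \<subseteq> A x" using total that by blast
    then have "emeasure MI (A x') \<le> emeasure MI (A x)" using Am that by (intro emeasure_mono) auto
    then show False using that Ae I_pos[OF that(2)] by (auto simp: ennreal_le_iff2)
  qed
  define D where "D = {s\<in>I. \<exists>x\<in>I. s \<in> A x}"
  \<comment> \<open>Off \<open>D\<close> the rank is set to -1, a value outside \<open>I\<close>;
    the transport formula carries the indicator of \<open>D\<close>.\<close>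
  define \<sigma> where "\<sigma> s = (if s \<in> D then Inf {x\<in>I. s \<in> A x} else -1)" for s
  have bdd: "bdd_below {x\<in>I. s \<in> A x}" for s by (rule bdd_belowI[of _ 0]) (auto dest: I_pos)
  have \<sigma>0: "0 \<le> \<sigma> s" if "s \<in> D" for s
    using that unfolding \<sigma>_def by (auto simp: D_def intro!: cInf_greatest dest: I_pos)
  have \<sigma>_less: "\<sigma> s < y \<longleftrightarrow> (\<exists>x\<in>I. s \<in> A x \<and> x < y)" if "s \<in> D" for s y
    using that cInf_less_iff[OF _ bdd, of s y] unfolding \<sigma>_def by (auto simp: D_def)
  have exh: "\<exists>z. incseq z \<and> (\<forall>n. z n \<in> I) \<and> D = (\<Union>n. A (z n))"
  proof -
    have "0 < (\<infinity>::ereal)" by simp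
    then obtain z :: "nat \<Rightarrow> real" where z: "incseq z" "\<And>n. z n \<in> I" "\<And>n. ereal (z n) < \<infinity>"
      "\<And>t. t \<in> I \<Longrightarrow> ereal t < \<infinity> \<Longrightarrow> \<exists>n. t < z n"
      by (rule initial_exhaustion) blast
    have "s \<in> (\<Union>n. A (z n))" if sD: "s \<in> D" for s
    proof -
      obtain x where x: "x \<in> I" "s \<in> A x" using sD by (auto simp: D_def)
      then obtain n where "x < z n" using z(4)[of x] by auto
      then show ?thesis using mono[OF x(1) z(2)[of n]] x by auto
    qed
    moreover have "A (z n) \<subseteq> D" for n using z(2)[of n] AI by (auto simp: D_def)
    ultimately show ?thesis using z by blast
  qed
  then have D_m: "D \<in> sets MI" using Am by auto
  have DI: "D \<subseteq> I" by (auto simp: D_def)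
  have lev: "{s\<in>D. \<sigma> s < x} \<in> sets MI \<and> emeasure MI {s\<in>D. \<sigma> s < x} = emeasure MI {t\<in>I. t < x}" for x
  proof (cases "0 < x")
    case False
    then have e: "{s\<in>D. \<sigma> s < x} = {}" "{t\<in>I. t < x} = {}" using \<sigma>0 I_pos by force+
    show ?thesis unfolding e by simp
  next
    case True
    then have "0 < ereal x" by simp
    then obtain z where z': "incseq z" "\<And>n. z n \<in> I" "\<And>n. ereal (z n) < ereal x"
      "\<And>t. t \<in> I \<Longrightarrow> ereal t < ereal x \<Longrightarrow> \<exists>n. t < z n"
      by (rule initial_exhaustion) blast
    then have z: "incseq z" "\<And>n. z n \<in> I" "\<And>n. z n < x" "\<And>t. t \<in> I \<Longrightarrow> t < x \<Longrightarrow> \<exists>n. t < z n"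
      by auto
    have zmono: "z m \<le> z n" if "m \<le> n" for m n using z(1) that by (rule incseqD)
    have u1: "{s\<in>D. \<sigma> s < x} = (\<Union>n. A (z n))"
    proof (intro equalityI subsetI)
      fix s assume "s \<in> {s\<in>D. \<sigma> s < x}"
      then obtain y where y: "y \<in> I" "s \<in> A y" "y < x" using \<sigma>_less by auto
      then obtain n where "y < z n" using z(4) by auto
      then show "s \<in> (\<Union>n. A (z n))" using mono[OF y(1) z(2)[of n]] y by auto
    next
      fix s assume "s \<in> (\<Union>n. A (z n))"
      then obtain n where n: "s \<in> A (z n)" by auto
      then have "s \<in> D" using z(2)[of n] AI by (auto simp: D_def)
      then show "s \<in> {s\<in>D. \<sigma> s < x}" using \<sigma>_less[of s x] n z(2,3)[of n] by auto
    qed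
    have u2: "{t\<in>I. t < x} = (\<Union>n. {t\<in>I. ennreal t < ennreal (z n)})"
    proof (intro equalityI subsetI)
      fix t assume "t \<in> {t\<in>I. t < x}"
      then obtain n where "t < z n" "t \<in> I" using z(4) by auto
      then have "t \<in> {t\<in>I. ennreal t < ennreal (z n)}" using I_pos by (auto intro!: ennreal_lessI dest: I_pos)
      then show "t \<in> (\<Union>n. {t\<in>I. ennreal t < ennreal (z n)})" by blast
    next
      fix t assume "t \<in> (\<Union>n. {t\<in>I. ennreal t < ennreal (z n)})"
      then obtain n where n: "t \<in> I" "ennreal t < ennreal (z n)" by auto
      then have "t < z n" using I_pos[OF n(1)] by (simp add: ennreal_less_iff)
      then show "t \<in> {t\<in>I. t < x}" using z(3)[of n] n by auto
    qed
    have s1: "emeasure MI (\<Union>n. A (z n)) = (SUP n. emeasure MI (A (z n)))"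
    proof (rule SUP_emeasure_incseq[symmetric])
      show "incseq (\<lambda>n. A (z n))"
        unfolding incseq_def using mono z(2) zmono by (metis order_le_less subset_refl)
    qed (use Am z in auto)
    have s2: "emeasure MI (\<Union>n. {t\<in>I. ennreal t < ennreal (z n)}) = (SUP n. emeasure MI {t\<in>I. ennreal t < ennreal (z n)})"
    proof (rule SUP_emeasure_incseq[symmetric])
      show "incseq (\<lambda>n. {t\<in>I. ennreal t < ennreal (z n)})"
        unfolding incseq_def using zmono by (auto intro: order.strict_trans2 ennreal_leI)
    qed auto
    have "emeasure MI {t\<in>I. ennreal t < ennreal (z n)} = emeasure MI (A (z n))" for n
      unfolding emeasure_initial using z(2)[of n] by (simp add: Ae mem_I_iff min_def less_imp_le)
    then show ?thesis unfolding u1 u2 s1 s2 using Am z(2) by auto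
  qed
  have \<sigma>_m [measurable]: "\<sigma> \<in> borel_measurable MI"
  proof (rule borel_measurableI_less)
    fix x
    have "{s\<in>space MI. \<sigma> s < x} = {s\<in>D. \<sigma> s < x} \<union> (if -1 < x then I - D else {})"
      using DI by (auto simp: \<sigma>_def)
    also have "\<dots> \<in> sets MI" using lev[of x] D_m sets.top[of MI] by auto
    finally show "{s\<in>space MI. \<sigma> s < x} \<in> sets MI" .
  qed
  let ?N1 = "distr (density MI (indicator D)) borel \<sigma>" and ?N2 = "distr MI borel (\<lambda>t. t)"
  have id_m [measurable]: "(\<lambda>t. t) \<in> borel_measurable MI" by (rule borel_imp_MI) simp
  have n1: "emeasure ?N1 {..<x} = emeasure MI {t\<in>I. t < x}" for x
  proof -
    have "emeasure ?N1 {..<x} = emeasure (density MI (indicator D)) (\<sigma> -` {..<x} \<inter> I)"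
      by (subst emeasure_distr) auto
    also have "\<dots> = (\<integral>\<^sup>+t. indicator D t * indicator (\<sigma> -` {..<x} \<inter> I) t \<partial>MI)"
      using D_m measurable_sets[OF \<sigma>_m, of "{..<x}"] by (subst emeasure_density) auto
    also have "\<dots> = (\<integral>\<^sup>+t. indicator {s\<in>D. \<sigma> s < x} t \<partial>MI)"
      using DI by (intro nn_integral_cong) (auto simp: indicator_def)
    also have "\<dots> = emeasure MI {t\<in>I. t < x}" using lev[of x] by simp
    finally show ?thesis .
  qed
  have n2: "emeasure ?N2 {..<x} = emeasure MI {t\<in>I. t < x}" for x
    by (subst emeasure_distr) (auto intro!: arg_cong[of _ _ "emeasure MI"])
  \<comment> \<open>The half-lines form a generating system closed under intersection. Both image
    measures agree on them and are finite on those with natural endpoints, which exhaust the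
    line.\<close>
  have N: "?N1 = ?N2"
  proof (rule measure_eqI_generator_eq[where E="range lessThan" and \<Omega>=UNIV and A="\<lambda>n. {..<real n}"])
    show "Int_stable (range lessThan :: real set set)"
    proof (rule Int_stableI)
      fix a b :: "real set" assume "a \<in> range lessThan" "b \<in> range lessThan"
      then obtain x y where "a = {..<x}" "b = {..<y}" by auto
      then have "a \<inter> b = {..<min x y}" by auto
      then show "a \<inter> b \<in> range lessThan" by simp
    qed
    have "sets (borel :: real measure) = sigma_sets UNIV (range lessThan)"
      by (subst borel_Iio) (rule sets_measure_of, simp)
    then show "sets ?N1 = sigma_sets UNIV (range lessThan)" "sets ?N2 = sigma_sets UNIV (range lessThan)"
      unfolding sets_distr by simp_all
    show "(\<Union>i. {..<real i}) = UNIV" using reals_Archimedean2 by auto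
    fix n
    have "emeasure MI {t\<in>I. t < real n} \<le> ennreal (real n)"
      using emeasure_below_le[of I "real n"] by (simp add: Int_def)
    then show "emeasure ?N1 {..<real n} \<noteq> \<infinity>" unfolding n1
      using neq_top_trans[OF ennreal_neq_top] by auto
  qed (auto simp: n1 n2)
  show ?thesis
  proof (rule that[OF D_m \<sigma>_m])
    fix t assume t: "t \<in> D"
    show "rear h (\<sigma> t) \<le> ennreal \<bar>h t\<bar>"
    proof (rule ccontr)
      assume "\<not> rear h (\<sigma> t) \<le> ennreal \<bar>h t\<bar>"
      then have "ennreal (\<sigma> t) < dist_f h \<bar>h t\<bar>"
        unfolding not_le rear_gt_iff[OF h abs_ge_zero] .
      \<comment> \<open>Some x slightly above the rank of t has t in \<open>A x\<close>, hence |h t|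
        >= \<open>Y x\<close>. But x is still below the measure of the set where |h| exceeds |h t|,
        which forces \<open>Y x\<close> > |h t|.\<close>
      then obtain e where e: "ennreal (\<sigma> t) < e" "e < dist_f h \<bar>h t\<bar>" using dense by blast
      then obtain r where r: "e = ennreal r" "0 \<le> r" by (cases e) auto
      then have "\<sigma> t < r" using e(1) \<sigma>0[OF t] by (simp add: ennreal_less_iff)
      then obtain x where x: "x \<in> I" "t \<in> A x" "x < r" using \<sigma>_less[OF t] by auto
      have "ennreal x < dist_f h \<bar>h t\<bar>" using x(3) e(2) r by (meson ennreal_leI less_imp_le order.strict_trans1)
      then have "ennreal \<bar>h t\<bar> < rear h x" unfolding rear_gt_iff[OF h abs_ge_zero] .
      then have "\<bar>h t\<bar> < Y x" using Y(1)[OF x(1)] by (simp add: ennreal_less_iff)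
      then show False using x(2) by (auto simp: A_def gr_def eq_def)
    qed
  next
    fix F :: "real \<Rightarrow> ennreal" assume F [measurable]: "F \<in> borel_measurable borel"
    have "(\<integral>\<^sup>+t. F (\<sigma> t) * indicator D t \<partial>MI) = (\<integral>\<^sup>+t. F (\<sigma> t) \<partial>density MI (indicator D))"
      using D_m by (subst nn_integral_density) (auto simp: mult.commute)
    also have "\<dots> = (\<integral>\<^sup>+t. F t \<partial>?N1)" by (subst nn_integral_distr) auto
    also have "\<dots> = (\<integral>\<^sup>+t. F t \<partial>MI)" unfolding N by (subst nn_integral_distr) auto
    finally show "(\<integral>\<^sup>+t. F (\<sigma> t) * indicator D t \<partial>MI) = (\<integral>\<^sup>+t. F t \<partial>MI)" .
  qed
qed

text \<open>Rounding down to powers of \<open>\<beta>\<close> makes every superlevel set at a positive value of the rearrangement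
  as large as the argument, even when \<open>rear h\<close> has a positive limit at infinity.\<close>

lemma discretize:
  assumes h [measurable]: "h \<in> L0 I" and fin: "\<And>x. x \<in> I \<Longrightarrow> rear h x < top" and \<beta>: "1 < \<beta>"
  obtains k where "k \<in> L0 I" "\<And>t. 0 \<le> k t" "\<And>t. k t \<le> \<bar>h t\<bar>" "\<And>t. \<bar>h t\<bar> \<le> \<beta> * k t"
    "\<And>x. x \<in> I \<Longrightarrow> \<exists>y\<ge>0. rear k x = ennreal y \<and> ennreal x \<le> emeasure MI {t\<in>I. y \<le> \<bar>k t\<bar>}"
proof -
  define k where "k t = (if h t = 0 then 0 else \<beta> powr real_of_int \<lfloor>log \<beta> \<bar>h t\<bar>\<rfloor>)" for t
  have k_m [measurable]: "k \<in> L0 I" unfolding k_def by measurable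
  have k0: "0 \<le> k t" for t by (simp add: k_def)
  have kh: "k t \<le> \<bar>h t\<bar>" for t
  proof (cases "h t = 0")
    case False
    have "\<beta> powr real_of_int \<lfloor>log \<beta> \<bar>h t\<bar>\<rfloor> \<le> \<beta> powr (log \<beta> \<bar>h t\<bar>)" using \<beta> by (intro powr_mono) auto
    then show ?thesis using False \<beta> by (simp add: k_def)
  qed (simp add: k_def)
  have hk: "\<bar>h t\<bar> \<le> \<beta> * k t" for t
  proof (cases "h t = 0")
    case False
    have "\<bar>h t\<bar> = \<beta> powr (log \<beta> \<bar>h t\<bar>)" using False \<beta> by simp
    also have "\<dots> \<le> \<beta> powr (1 + real_of_int \<lfloor>log \<beta> \<bar>h t\<bar>\<rfloor>)"
      using \<beta> by (intro powr_mono) linarith+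
    finally show ?thesis using False \<beta> by (simp add: k_def powr_add)
  qed (simp add: k_def)
  have "\<exists>y\<ge>0. rear k x = ennreal y \<and> ennreal x \<le> emeasure MI {t\<in>I. y \<le> \<bar>k t\<bar>}" if x: "x \<in> I" for x
  proof -
    have "rear k x \<le> rear h x" using kh k0 by (intro rear_mono) auto
    then have "rear k x < top" using fin[OF x] by simp
    then obtain y where y: "rear k x = ennreal y" "0 \<le> y" by (cases "rear k x") auto
    have "ennreal x \<le> emeasure MI {t\<in>I. y \<le> \<bar>k t\<bar>}"
    proof (cases "y = 0")
      case True
      then show ?thesis using x emeasure_I mem_I_iff[of x] by (simp add: less_imp_le)
    next
      case False
      \<comment> \<open>\<open>k\<close> takes only the value 0 and integer powers of \<beta>, so
        exceeding \<open>\<beta> powr (j - 1)\<close> means reaching \<open>\<beta> powr j\<close>,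
        which is at least y.\<close>
      define j where "j = \<lceil>log \<beta> y\<rceil>"
      have "log \<beta> y \<le> real_of_int j" unfolding j_def by linarith
      then have y_le: "y \<le> \<beta> powr j" using False y \<beta> by (simp add: log_le_iff)
      have "real_of_int j - 1 < log \<beta> y" unfolding j_def by linarith
      then have y_gt: "\<beta> powr (real_of_int j - 1) < y" using False y \<beta>
        by (simp add: less_log_iff)
      have "ennreal (\<beta> powr (real_of_int j - 1)) < rear k x" using y_gt y by (simp add: ennreal_less_iff)
      then have "ennreal x < dist_f k (\<beta> powr (real_of_int j - 1))" using rear_gt_iff[OF k_m] by simp
      also have "\<dots> \<le> emeasure MI {t\<in>I. y \<le> \<bar>k t\<bar>}"
        unfolding dist_f_eq
      proof (rule emeasure_mono)
        have "{t\<in>space MI. y \<le> \<bar>k t\<bar>} \<in> sets MI" by measurable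
        then show "{t\<in>I. y \<le> \<bar>k t\<bar>} \<in> sets MI" by simp
        show "{t \<in> I. \<beta> powr (real_of_int j - 1) < \<bar>k t\<bar>} \<subseteq> {t\<in>I. y \<le> \<bar>k t\<bar>}"
        proof safe
          fix t assume t: "t \<in> I" "\<beta> powr (real_of_int j - 1) < \<bar>k t\<bar>"
          then have "k t \<noteq> 0" by (smt (verit) powr_ge_zero)
          then obtain i :: int where i: "k t = \<beta> powr i" by (auto simp: k_def split: if_splits)
          then have "real_of_int j - 1 < real_of_int i" using t(2) \<beta> by simp
          then have "j \<le> i" by linarith
          then have "\<beta> powr j \<le> \<beta> powr i" using \<beta> by (intro powr_mono) auto
          then show "y \<le> \<bar>k t\<bar>" using y_le i by simp
        qed
      qed
      finally show ?thesis by simp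
    qed
    then show ?thesis using y by blast
  qed
  then show ?thesis using that k_m k0 kh hk by blast
qed

text \<open>With \<sigma> the rank map of the rounding \<open>k\<close> of |h|, take g to be G
  composed with \<sigma> on \<open>D\<close>. Since \<sigma> preserves measure, the superlevel sets
  of g have the measure of those of G. On \<open>D\<close> the function |h| dominates
  \<open>k\<close>, hence \<open>rear k\<close> at \<sigma>, and \<open>rear h\<close> is at most
  \<beta> times \<open>rear k\<close>: rounding is the origin of the factor.\<close>

lemma transplant:
  assumes h [measurable]: "h \<in> L0 I" and fin: "\<And>x. x \<in> I \<Longrightarrow> rear h x < top" and \<beta>: "1 < \<beta>"
    and G [measurable]: "G \<in> borel_measurable borel" and Gfin: "\<And>x. x \<in> I \<Longrightarrow> G x < top"
    and Gmono: "\<And>s s'. s \<in> I \<Longrightarrow> s' \<in> I \<Longrightarrow> s \<le> s' \<Longrightarrow> G s' \<le> G s"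
  obtains g where "g \<in> L0 I" "\<And>t. 0 \<le> g t" "\<And>t. t \<in> I \<Longrightarrow> rear g t \<le> G t"
    "(\<integral>\<^sup>+t. rear h t * G t \<partial>MI) \<le> ennreal \<beta> * (\<integral>\<^sup>+t. ennreal \<bar>h t * g t\<bar> \<partial>MI)"
proof -
  obtain k where k [measurable]: "k \<in> L0 I" and k2: "\<And>t. 0 \<le> k t" "\<And>t. k t \<le> \<bar>h t\<bar>" "\<And>t. \<bar>h t\<bar> \<le> \<beta> * k t"
    and att: "\<And>x. x \<in> I \<Longrightarrow> \<exists>y\<ge>0. rear k x = ennreal y \<and> ennreal x \<le> emeasure MI {t\<in>I. y \<le> \<bar>k t\<bar>}"
    using discretize[OF h fin \<beta>] by blast
  obtain D \<sigma> where D [measurable]: "D \<in> sets MI" and \<sigma> [measurable]: "\<sigma> \<in> borel_measurable MI"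
    and D\<sigma>: "\<And>t. t \<in> D \<Longrightarrow> rear k (\<sigma> t) \<le> ennreal \<bar>k t\<bar>"
    and push: "\<And>F :: real \<Rightarrow> ennreal. F \<in> borel_measurable borel \<Longrightarrow>
       (\<integral>\<^sup>+t. F (\<sigma> t) * indicator D t \<partial>MI) = (\<integral>\<^sup>+t. F t \<partial>MI)"
    using rank_map[OF k att] by blast
  \<comment> \<open>The rank may take values outside \<open>I\<close>, where \<open>G\<close> need
    not be finite; \<open>G0\<close> is finite everywhere.\<close>
  define G0 where "G0 t = G t * indicator I t" for t
  have G0_m [measurable]: "G0 \<in> borel_measurable borel" unfolding G0_def by measurable
  have G0fin: "G0 t < top" for t using Gfin by (auto simp: G0_def indicator_def)
  define g where "g t = indicator D t * enn2real (G0 (\<sigma> t))" for t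
  have g_m [measurable]: "g \<in> L0 I" unfolding g_def by measurable
  have DI: "D \<subseteq> I" using D by (simp add: sets_MI_iff)
  have "dist_f g y = emeasure MI {s\<in>I. ennreal y < G s}" if y: "0 \<le> y" for y
  proof -
    have "dist_f g y = (\<integral>\<^sup>+t. indicator {t\<in>I. y < \<bar>g t\<bar>} t \<partial>MI)"
      unfolding dist_f_eq using pred_abs_greater[OF g_m] by simp
    also have "\<dots> = (\<integral>\<^sup>+t. indicator {s. ennreal y < G0 s} (\<sigma> t) * indicator D t \<partial>MI)"
    proof (intro nn_integral_cong)
      fix t assume "t \<in> space MI"
      have "ennreal y < G0 (\<sigma> t) \<longleftrightarrow> y < enn2real (G0 (\<sigma> t))"
        using G0fin[of "\<sigma> t"] y by (cases "G0 (\<sigma> t)") (auto simp: ennreal_less_iff)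
      then show "indicator {t\<in>I. y < \<bar>g t\<bar>} t = (indicator {s. ennreal y < G0 s} (\<sigma> t) * indicator D t :: ennreal)"
        using DI y by (auto simp: g_def indicator_def)
    qed
    also have "\<dots> = (\<integral>\<^sup>+t. indicator {s. ennreal y < G0 s} t \<partial>MI)"
      by (rule push) measurable
    also have "\<dots> = (\<integral>\<^sup>+t. indicator {s\<in>I. ennreal y < G s} t \<partial>MI)"
      by (intro nn_integral_cong) (auto simp: G0_def indicator_def)
    also have "\<dots> = emeasure MI {s\<in>I. ennreal y < G s}"
    proof -
      have "{s\<in>space MI. ennreal y < G s} \<in> sets MI"
        by (rule measurable_sets_Collect[OF borel_imp_MI[OF G]]) auto
      then show ?thesis by simp
    qed
    finally show ?thesis .
  qed
  then have rear_g: "rear g t \<le> G t" if "t \<in> I" for t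
    using that Gmono by (intro rear_le_antimono[OF g_m]) auto
  have "(\<integral>\<^sup>+t. rear h t * G t \<partial>MI) = (\<integral>\<^sup>+t. rear h t * G0 t \<partial>MI)"
    by (intro nn_integral_cong) (simp add: G0_def)
  also have "\<dots> = (\<integral>\<^sup>+t. (rear h (\<sigma> t) * G0 (\<sigma> t)) * indicator D t \<partial>MI)"
    by (rule push[symmetric]) measurable
  also have "\<dots> \<le> (\<integral>\<^sup>+t. ennreal \<beta> * ennreal \<bar>h t * g t\<bar> \<partial>MI)"
  proof (intro nn_integral_mono)
    fix t
    show "rear h (\<sigma> t) * G0 (\<sigma> t) * indicator D t \<le> ennreal \<beta> * ennreal \<bar>h t * g t\<bar>"
    proof (cases "t \<in> D")
      case True
      have "rear h (\<sigma> t) \<le> rear (\<lambda>t. \<beta> * k t) (\<sigma> t)"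
        using k2 \<beta> by (intro rear_mono) (auto simp: abs_mult)
      also have "\<dots> = ennreal \<beta> * rear k (\<sigma> t)" using \<beta> by (simp add: rear_cmult)
      also have "\<dots> \<le> ennreal \<beta> * ennreal \<bar>h t\<bar>"
        using D\<sigma>[OF True] k2(1,2)[of t] by (intro mult_left_mono) (auto intro: order_trans ennreal_leI)
      finally have "rear h (\<sigma> t) * G0 (\<sigma> t) \<le> (ennreal \<beta> * ennreal \<bar>h t\<bar>) * G0 (\<sigma> t)"
        by (rule mult_right_mono) simp
      moreover have "G0 (\<sigma> t) = ennreal \<bar>g t\<bar>" using G0fin[of "\<sigma> t"] True by (simp add: g_def)
      ultimately show ?thesis using True by (simp add: abs_mult ennreal_mult mult.assoc)
    qed simp
  qed
  also have "\<dots> = ennreal \<beta> * (\<integral>\<^sup>+t. ennreal \<bar>h t * g t\<bar> \<partial>MI)"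
    by (rule nn_integral_cmult) measurable
  finally show ?thesis using that[of g] g_m rear_g by (auto simp: g_def)
qed

end

section \<open>Orlicz functions and their conjugates\<close>

locale orlicz =
  fixes \<phi> :: "real \<Rightarrow> real"
  assumes N_function: "N_function \<phi>"
begin

lemma phi_zero [simp]: "\<phi> 0 = 0" and phi_nonneg: "0 \<le> u \<Longrightarrow> 0 \<le> \<phi> u"
  and phi_convex: "convex_on {0..} \<phi>"
  and phi_less: "0 \<le> u \<Longrightarrow> u < v \<Longrightarrow> \<phi> u < \<phi> v"
  and phi_at_top: "filterlim (\<lambda>t. \<phi> t / t) at_top at_top"
  using N_function by (auto simp: N_function_def orlicz_function_def strict_mono_on_def)

lemma phi_mono: "0 \<le> u \<Longrightarrow> u \<le> v \<Longrightarrow> \<phi> u \<le> \<phi> v"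
  using phi_less[of u v] by (cases "u = v") auto

lemma phi_pos: "0 < u \<Longrightarrow> 0 < \<phi> u"
  using phi_less[of 0 u] by simp

lemma phi_scale:
  assumes "0 \<le> s" "s \<le> 1" "0 \<le> u"
  shows "\<phi> (s * u) \<le> s * \<phi> u"
  using convex_onD[OF phi_convex assms(1,2), of 0 u] assms(3) by simp

lemma phi_super_scale:
  assumes "1 \<le> c" "0 \<le> u"
  shows "c * \<phi> u \<le> \<phi> (c * u)"
  using phi_scale[of "1 / c" "c * u"] assms by (simp add: field_simps)

lemma phi_slope_mono: "0 < u \<Longrightarrow> u \<le> v \<Longrightarrow> \<phi> u / u \<le> \<phi> v / v"
  using phi_scale[of "u / v" v] by (simp add: field_simps)

lemma phi_continuous: "continuous_on {0..} \<phi>"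
proof -
  have "convex_on {0<..} \<phi>" using phi_convex by (rule convex_on_subset) auto
  then have c: "continuous_on {0<..} \<phi>" by (intro convex_on_continuous) auto
  show ?thesis unfolding continuous_on_eq_continuous_within
  proof
    fix x :: real assume x: "x \<in> {0..}"
    show "continuous (at x within {0..}) \<phi>"
    proof (cases "x = 0")
      case False
      then have "isCont \<phi> x" using c x by (auto simp: continuous_on_eq_continuous_at)
      then show ?thesis by (rule continuous_at_imp_continuous_at_within)
    next
      case True
      have ev: "\<forall>\<^sub>F t in at 0 within {0..}. t \<in> {0..} \<and> t < (1::real)"
        by (auto simp: eventually_at intro!: exI[of _ 1])
      have "((\<lambda>t. \<phi> t) \<longlongrightarrow> 0) (at 0 within {0..})"
      proof (rule tendsto_sandwich[where f="\<lambda>_. 0" and h="\<lambda>t. t * \<phi> 1"])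
        show "\<forall>\<^sub>F t in at 0 within {0..}. 0 \<le> \<phi> t" using ev by eventually_elim (auto intro: phi_nonneg)
        show "\<forall>\<^sub>F t in at 0 within {0..}. \<phi> t \<le> t * \<phi> 1" using ev
        proof eventually_elim
          case (elim t) then show ?case using phi_scale[of t 1] by simp
        qed
        have "((\<lambda>t. t * \<phi> 1) \<longlongrightarrow> 0 * \<phi> 1) (at 0 within {0..})" by (intro tendsto_intros)
        then show "((\<lambda>t. t * \<phi> 1) \<longlongrightarrow> 0) (at 0 within {0..})" by simp
      qed simp
      then show ?thesis using True by (simp add: continuous_within)
    qed
  qed
qed

lemma phi_tendsto:
  assumes "(X \<longlongrightarrow> x) F" "0 \<le> x" "\<forall>\<^sub>F n in F. 0 \<le> X n"
  shows "((\<lambda>n. \<phi> (X n)) \<longlongrightarrow> \<phi> x) F"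
  using phi_continuous assms by (intro continuous_on_tendsto_compose[of "{0..}" \<phi>]) auto

text \<open>Nothing is known about \<phi> at negative arguments, so monotonicity, and with it
  measurability, becomes available after truncation at 0.\<close>

lemma phi_measurable [measurable (raw)]:
  assumes [measurable]: "f \<in> borel_measurable M"
  shows "(\<lambda>x. \<phi> (max 0 (f x))) \<in> borel_measurable M"
proof -
  have "mono (\<lambda>u. \<phi> (max 0 u))" by (intro monoI phi_mono) auto
  then have [measurable]: "(\<lambda>u. \<phi> (max 0 u)) \<in> borel_measurable borel" by (rule borel_measurable_mono)
  show ?thesis by measurable
qed

lemma phi_superlinear: "\<exists>u0>0. \<forall>u\<ge>u0. R * u \<le> \<phi> u"
proof -
  have "\<forall>\<^sub>F t in at_top. R \<le> \<phi> t / t" using phi_at_top by (simp add: filterlim_at_top)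
  then obtain u1 where u1: "\<And>t. t \<ge> u1 \<Longrightarrow> R \<le> \<phi> t / t" by (auto simp: eventually_at_top_linorder)
  show ?thesis
  proof (intro exI[of _ "max 1 u1"] conjI allI impI)
    fix u assume "max 1 u1 \<le> u"
    then have "R \<le> \<phi> u / u" "0 < u" using u1[of u] by auto
    then show "R * u \<le> \<phi> u" by (simp add: field_simps)
  qed simp
qed

text \<open>Superlinear growth makes y x - \<phi> x nonpositive beyond some R, while its value at x
  = 0 is 0; the maximum over the compact interval up to R is therefore global.\<close>

lemma ex_argmax: "\<exists>u\<ge>0. \<forall>x\<ge>0. y * x - \<phi> x \<le> y * u - \<phi> u"
proof -
  obtain R where R: "R > 0" "\<And>u. u \<ge> R \<Longrightarrow> y * u \<le> \<phi> u" using phi_superlinear[of y] by auto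
  have "continuous_on {0..R} (\<lambda>u. y * u - \<phi> u)"
    using phi_continuous by (intro continuous_intros) (auto intro: continuous_on_subset)
  then obtain u where u: "u \<in> {0..R}" "\<And>x. x \<in> {0..R} \<Longrightarrow> y * x - \<phi> x \<le> y * u - \<phi> u"
    using continuous_attains_sup[of "{0..R}" "\<lambda>u. y * u - \<phi> u"] R by auto
  have "y * x - \<phi> x \<le> y * u - \<phi> u" if "x \<ge> 0" for x
  proof (cases "x \<le> R")
    case False
    then have "y * x - \<phi> x \<le> 0" using R(2)[of x] by simp
    also have "0 \<le> y * u - \<phi> u" using u(2)[of 0] R by simp
    finally show ?thesis .
  qed (use u that in auto)
  then show ?thesis using u by auto
qed

text \<open>A selection of maximizers in the Young inequality, that is, of subgradients of the
  conjugate function. No regularity of the choice is imposed: \<open>q_mono\<close> holds for every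
  selection, but \<open>q\<close> jumps where \<phi> has an affine piece.\<close>

definition q :: "real \<Rightarrow> real" where
  "q y = (SOME u. 0 \<le> u \<and> (\<forall>x\<ge>0. y * x - \<phi> x \<le> y * u - \<phi> u))"

text \<open>The complementary function, the supremum over x >= 0 of y x - \<phi> x, written through
  a point where it is attained.\<close>

definition \<psi> :: "real \<Rightarrow> real" where
  "\<psi> y = y * q y - \<phi> (q y)"

lemma q_nonneg: "0 \<le> q y" and q_max: "0 \<le> x \<Longrightarrow> y * x - \<phi> x \<le> y * q y - \<phi> (q y)"
  unfolding q_def using someI_ex[OF ex_argmax[of y]] by auto

lemma young: "0 \<le> x \<Longrightarrow> y * x \<le> \<phi> x + \<psi> y"
  using q_max[of x y] by (simp add: \<psi>_def)

lemma young_eq: "y * q y = \<phi> (q y) + \<psi> y"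
  by (simp add: \<psi>_def)

lemma psi_nonneg: "0 \<le> \<psi> y"
  using young[of 0 y] by simp

lemma psi_zero [simp]: "\<psi> 0 = 0" and q_zero [simp]: "q 0 = 0"
proof -
  have "\<phi> (q 0) \<le> 0" using q_max[of 0 0] by simp
  then show "q 0 = 0" using phi_pos[of "q 0"] q_nonneg[of 0] by (cases "q 0 = 0") auto
  then show "\<psi> 0 = 0" by (simp add: \<psi>_def)
qed

text \<open>Adding the two maximality inequalities, each with the other maximizer as competitor,
  leaves (z - y) (q z - q y) >= 0.\<close>

lemma q_mono: "y \<le> z \<Longrightarrow> q y \<le> q z"
proof (cases "y = z")
  case False
  assume "y \<le> z"
  have "y * q z - \<phi> (q z) \<le> y * q y - \<phi> (q y)" "z * q y - \<phi> (q y) \<le> z * q z - \<phi> (q z)"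
    using q_max q_nonneg by auto
  then have "0 \<le> (z - y) * (q z - q y)" by (simp add: algebra_simps)
  then show ?thesis using \<open>y \<le> z\<close> False by (simp add: zero_le_mult_iff)
qed simp

lemma psi_mono: "y \<le> z \<Longrightarrow> \<psi> y \<le> \<psi> z"
proof -
  assume "y \<le> z"
  then have "\<psi> y \<le> z * q y - \<phi> (q y)" unfolding \<psi>_def using q_nonneg[of y] by (simp add: mult_right_mono)
  also have "\<dots> \<le> \<psi> z" unfolding \<psi>_def using q_max[of "q y" z] q_nonneg by simp
  finally show ?thesis .
qed

text \<open>At a maximizer \<phi> (q y) <= y q y, so the slope \<phi> u / u at u = q y is at most y;
  slopes increase with u.\<close>

lemma q_small: "0 < e \<Longrightarrow> y < \<phi> e / e \<Longrightarrow> q y \<le> e"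
proof (rule ccontr)
  assume e: "0 < e" "y < \<phi> e / e" and "\<not> q y \<le> e"
  then have qe: "e < q y" by simp
  have "\<phi> (q y) \<le> y * q y" using q_max[of 0 y] by simp
  then have "\<phi> (q y) / q y \<le> y" using qe e by (simp add: field_simps)
  then show False using phi_slope_mono[of e "q y"] qe e by simp
qed

text \<open>The competitor is 2 R: if q y < R, maximality gives 2 R y - \<phi> (2 R) <= R y.\<close>

lemma q_large: "0 < R \<Longrightarrow> \<phi> (2 * R) / R < y \<Longrightarrow> R \<le> q y"
proof (rule ccontr)
  assume R: "0 < R" "\<phi> (2 * R) / R < y" and "\<not> R \<le> q y"
  then have qR: "q y < R" by simp
  have y0: "0 \<le> y" using R phi_nonneg[of "2 * R"] by (meson divide_nonneg_pos less_eq_real_def order_le_less_trans mult_nonneg_nonneg zero_le_numeral)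
  have "y * (2 * R) - \<phi> (2 * R) \<le> y * q y - \<phi> (q y)" using q_max[of "2 * R" y] R by simp
  also have "\<dots> \<le> y * q y" using phi_nonneg[OF q_nonneg] by simp
  also have "\<dots> \<le> y * R" using qR y0 by (intro mult_left_mono) auto
  finally have "y * R \<le> \<phi> (2 * R)" by (simp add: algebra_simps)
  then show False using R by (simp add: field_simps)
qed

text \<open>As a supremum of affine functions \<psi> is lower semicontinuous, so its sublevel sets
  on the half-line are closed intervals. Superlevel sets of \<psi> composed with h are thereby
  strict superlevel sets of h, the form in which distribution functions enter.\<close>

lemma psi_superlevel:
  assumes "0 \<le> c"
  shows "\<exists>s\<ge>0. \<forall>z\<ge>0. c < \<psi> z \<longleftrightarrow> s < z"
proof -
  define S where "S = {z. 0 \<le> z \<and> \<psi> z \<le> c}"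
  have "z \<le> c + \<phi> 1" if "z \<in> S" for z using young[of 1 z] that by (simp add: S_def)
  then have bdd: "bdd_above S" by (rule bdd_aboveI)
  have 0: "0 \<in> S" using assms by (simp add: S_def)
  define s where "s = Sup S"
  have s0: "0 \<le> s" unfolding s_def using 0 bdd by (rule cSup_upper)
  have "\<psi> s \<le> c"
  proof (rule ccontr)
    assume "\<not> \<psi> s \<le> c"
    then have *: "c < s * q s - \<phi> (q s)" by (simp add: \<psi>_def)
    then have qs: "0 < q s" using assms q_nonneg[of s] by (cases "q s = 0") auto
    \<comment> \<open>The point where the affine minorant of slope \<open>q s\<close> that touches
      \<psi> at s takes the value c; it lies below s because \<psi> s > c.\<close>
    define z where "z = (c + \<phi> (q s)) / q s"
    have "z < s" using * qs by (simp add: z_def field_simps)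
    then obtain z' where z': "z' \<in> S" "z < z'" unfolding s_def using less_cSup_iff[of S z] bdd 0 by auto
    have "c < z' * q s - \<phi> (q s)" using z'(2) qs by (simp add: z_def field_simps)
    also have "\<dots> \<le> \<psi> z'" using young[OF q_nonneg, of z' s] by simp
    finally show False using z'(1) by (simp add: S_def)
  qed
  then have "c < \<psi> z \<longleftrightarrow> s < z" if "0 \<le> z" for z
    using that psi_mono[of z s] cSup_upper[of z S] bdd by (auto simp: s_def S_def not_le not_less) (meson leD leI)+
  then show ?thesis using s0 by blast
qed

text \<open>The right derivative of \<phi>, as the infimum of the difference quotients to the right.
  The value 0 at 0 makes \<eta> composed with u vanish where u does.\<close>

definition \<eta> :: "real \<Rightarrow> real" where
  "\<eta> u = (if u \<le> 0 then 0 else Inf ((\<lambda>t. (\<phi> u - \<phi> t) / (u - t)) ` ({u<..} \<inter> {0..})))"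

lemma eta_subgradient: "0 \<le> u \<Longrightarrow> 0 \<le> x \<Longrightarrow> \<phi> u + \<eta> u * (x - u) \<le> \<phi> x"
proof (cases "u = 0")
  case False
  assume "0 \<le> u" "0 \<le> x"
  then show ?thesis
    using convex_le_Inf_differential[OF phi_convex, of u x] False by (simp add: \<eta>_def)
qed (simp add: \<eta>_def phi_nonneg)

lemma eta_nonneg: "0 \<le> \<eta> u"
proof (cases "u \<le> 0")
  case False
  have "\<phi> u \<le> \<eta> u * u" using eta_subgradient[of u 0] False by simp
  then have "0 < \<eta> u * u" using phi_pos[of u] False by linarith
  then show ?thesis using False by (simp add: zero_less_mult_iff)
qed (simp add: \<eta>_def)

lemma eta_mono: "mono \<eta>"
proof (rule monoI)
  fix u v :: real assume "u \<le> v"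
  show "\<eta> u \<le> \<eta> v"
  proof (cases "u \<le> 0 \<or> u = v")
    case False
    have "\<phi> u + \<eta> u * (v - u) \<le> \<phi> v" "\<phi> v + \<eta> v * (u - v) \<le> \<phi> u"
      using eta_subgradient[of u v] eta_subgradient[of v u] False \<open>u \<le> v\<close> by auto
    then have "0 \<le> (\<eta> v - \<eta> u) * (v - u)" by (simp add: algebra_simps)
    then show ?thesis using False \<open>u \<le> v\<close> by (simp add: zero_le_mult_iff)
  next
    case True then show ?thesis using eta_nonneg[of v] by (auto simp: \<eta>_def)
  qed
qed

lemma eta_zero [simp]: "\<eta> 0 = 0" by (simp add: \<eta>_def)

text \<open>The subgradient inequality says that u maximizes \<eta> u x - \<phi> x over x >= 0, so
  the Young inequality is an equality at this pair.\<close>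

lemma eta_young_eq: "0 \<le> u \<Longrightarrow> u * \<eta> u = \<phi> u + \<psi> (\<eta> u)"
proof (rule antisym)
  assume u: "0 \<le> u"
  show "u * \<eta> u \<le> \<phi> u + \<psi> (\<eta> u)" using young[OF u, of "\<eta> u"] by (simp add: mult.commute)
  have "\<phi> u + \<eta> u * (q (\<eta> u) - u) \<le> \<phi> (q (\<eta> u))" by (rule eta_subgradient[OF u q_nonneg])
  then show "\<phi> u + \<psi> (\<eta> u) \<le> u * \<eta> u" by (simp add: \<psi>_def algebra_simps)
qed

section \<open>The integrand of the modular\<close>

text \<open>The perspective of \<phi>, extended to the value infinity of a rearrangement so that it
  stays increasing and left continuous in the first argument when the second is positive.\<close>

definition Ph :: "ennreal \<Rightarrow> real \<Rightarrow> ennreal" where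
  "Ph x c = (if x = \<infinity> then \<infinity> else ennreal (\<phi> (enn2real x / c) * c))"

lemma Ph_ennreal: "0 \<le> x \<Longrightarrow> Ph (ennreal x) c = ennreal (\<phi> (x / c) * c)"
  by (simp add: Ph_def)

lemma Ph_top [simp]: "Ph top c = top" and Ph_zero [simp]: "Ph 0 c = 0"
  by (simp_all add: Ph_def)

lemma Ph_mono:
  assumes "x \<le> y" "0 < c"
  shows "Ph x c \<le> Ph y c"
proof (cases "y = top")
  case False
  then obtain r s where "y = ennreal r" "0 \<le> r" "x = ennreal s" "0 \<le> s" "s \<le> r"
    using assms by (cases x; cases y) (auto simp: top_unique)
  then show ?thesis using assms
    by (auto simp: Ph_ennreal intro!: ennreal_leI mult_right_mono phi_mono divide_right_mono)
qed simp

text \<open>Left continuity in the first argument. At finite x it comes from continuity of \<phi>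
  along x (1 - 1/(n+1)); at infinity from \<phi> (u / c) >= u \<phi> (1 / c) for u >= 1.\<close>

lemma Ph_less:
  assumes c: "0 < c" and r: "r < Ph x c"
  shows "\<exists>y<x. r < Ph y c"
proof (cases x)
  case (real x0)
  have x0: "0 < x0" using real r by (cases "x0 = 0") auto
  have "(\<lambda>n. x0 * (1 - 1 / real (Suc n))) \<longlonglongrightarrow> x0 * (1 - 0)"
    by (intro tendsto_intros LIMSEQ_inverse_real_of_nat[unfolded inverse_eq_divide])
  then have lim: "(\<lambda>n. (x0 * (1 - 1 / real (Suc n))) / c) \<longlonglongrightarrow> x0 / c"
    using c by (intro tendsto_divide tendsto_const) auto
  have nn: "0 \<le> x0 * (1 - 1 / real (Suc n))" for n using x0 by simp
  have "(\<lambda>n. \<phi> ((x0 * (1 - 1 / real (Suc n))) / c) * c) \<longlonglongrightarrow> \<phi> (x0 / c) * c"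
    by (rule tendsto_mult[OF phi_tendsto[OF lim] tendsto_const]) (use c x0 nn in auto)
  then have "(\<lambda>n. ennreal (\<phi> ((x0 * (1 - 1 / real (Suc n))) / c) * c)) \<longlonglongrightarrow> ennreal (\<phi> (x0 / c) * c)"
    by (rule tendsto_ennrealI)
  then have "(\<lambda>n. Ph (ennreal (x0 * (1 - 1 / real (Suc n)))) c) \<longlonglongrightarrow> Ph x c"
    using real nn by (simp add: Ph_ennreal del: of_nat_Suc)
  then have "\<forall>\<^sub>F n in sequentially. r < Ph (ennreal (x0 * (1 - 1 / real (Suc n)))) c"
    using r by (rule order_tendstoD)
  then obtain n where n: "r < Ph (ennreal (x0 * (1 - 1 / real (Suc n)))) c"
    by (auto simp: eventually_sequentially)
  have "x0 * (1 - 1 / real (Suc n)) < x0 * 1" using x0 by (intro mult_strict_left_mono) auto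
  then have "ennreal (x0 * (1 - 1 / real (Suc n))) < x" using x0 real by (simp add: ennreal_lessI)
  then show ?thesis using n by blast
next
  case top
  then obtain r0 where r0: "r = ennreal r0" "0 \<le> r0" using r by (cases r) auto
  define p where "p = \<phi> (1 / c) * c"
  have p: "0 < p" using phi_pos[of "1 / c"] c by (simp add: p_def)
  define u where "u = max 1 ((r0 + 1) / p)"
  have u: "1 \<le> u" "r0 < u * p"
  proof -
    have "(r0 + 1) / p * p \<le> u * p" using p by (intro mult_right_mono) (auto simp: u_def)
    then show "r0 < u * p" using p by simp
  qed (simp add: u_def)
  have "u * \<phi> (1 / c) \<le> \<phi> (u * (1 / c))" using phi_super_scale[of u "1 / c"] u c by simp
  then have "u * p \<le> \<phi> (u / c) * c" using c by (simp add: p_def mult.assoc[symmetric])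
  then have "r < Ph (ennreal u) c" using u r0 by (simp add: Ph_ennreal ennreal_less_iff)
  then show ?thesis using top by (intro exI[of _ "ennreal u"]) auto
qed

lemma Ph_liminf:
  assumes c: "0 < c" and x: "x \<le> liminf xs"
  shows "Ph x c \<le> liminf (\<lambda>n. Ph (xs n) c)"
  unfolding le_Liminf_iff
proof safe
  fix r assume "r < Ph x c"
  then obtain y where y: "y < x" "r < Ph y c" using Ph_less[OF c] by blast
  have "\<forall>\<^sub>F n in sequentially. y < xs n" using x y(1) by (auto simp: le_Liminf_iff)
  then show "\<forall>\<^sub>F n in sequentially. r < Ph (xs n) c"
    by eventually_elim (meson Ph_mono c less_imp_le order.strict_trans2 y(2))
qed

text \<open>By left continuity, anything below the value at the supremum is already exceeded at a
  single \<open>x n\<close>. The bound replaces the convexity estimate for series, as suprema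
  replace sums in the hump arguments.\<close>

lemma Ph_SUP_le_suminf:
  assumes c: "0 < c"
  shows "Ph (SUP n. x n) c \<le> (\<Sum>n::nat. Ph (x n) c)"
proof (rule ccontr)
  assume "\<not> Ph (SUP n. x n) c \<le> (\<Sum>n. Ph (x n) c)"
  then obtain y where y: "y < (SUP n. x n)" "(\<Sum>n. Ph (x n) c) < Ph y c"
    using Ph_less[OF c] by (meson not_le)
  then obtain n where "y < x n" by (auto simp: less_SUP_iff)
  then have "Ph y c \<le> Ph (x n) c" using c by (intro Ph_mono) auto
  also have "\<dots> \<le> (\<Sum>n. Ph (x n) c)"
    using sum_le_suminf[of "\<lambda>n. Ph (x n) c" "{n}"] by simp
  finally show False using y(2) by simp
qed

lemma Ph_scale:
  assumes "0 \<le> s" "s \<le> 1" "0 < c"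
  shows "Ph (ennreal s * x) c \<le> ennreal s * Ph x c"
proof (cases x)
  case (real r)
  have "\<phi> (s * r / c) * c \<le> s * \<phi> (r / c) * c"
    using phi_scale[of s "r / c"] assms real by (intro mult_right_mono) auto
  then show ?thesis using real assms
    by (auto simp: Ph_ennreal mult.assoc phi_nonneg simp flip: ennreal_mult intro!: ennreal_leI)
next
  case top then show ?thesis using assms by (cases "s = 0") (auto simp: ennreal_mult_top)
qed

lemma Ph_measurable:
  assumes [measurable]: "X \<in> borel_measurable M" "v \<in> borel_measurable M" and "\<And>t. t \<in> space M \<Longrightarrow> 0 \<le> v t"
  shows "(\<lambda>t. Ph (X t) (v t)) \<in> borel_measurable M"
proof -
  have "(\<lambda>t. if X t = \<infinity> then \<infinity> else ennreal (\<phi> (max 0 (enn2real (X t) / v t)) * v t)) \<in> borel_measurable M"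
    by measurable
  then show ?thesis
    by (rule measurable_cong[THEN iffD1, rotated]) (use assms(3) in \<open>auto simp: Ph_def max_absorb2\<close>)
qed

end

section \<open>The modular and the quasi-norm of the class M\<close>

locale orlicz_lorentz = interval_domain a I + orlicz \<phi> for a I \<phi> +
  fixes w :: "real \<Rightarrow> real"
  assumes weight: "weight_function I w" and w_pos: "t \<in> I \<Longrightarrow> 0 < w t"
    and W_finite: "t \<in> I \<Longrightarrow> (\<integral>\<^sup>+ s\<in>{0<..<t}. ennreal (w s) \<partial>lebesgue) < \<infinity>"
begin

abbreviation "Mod \<equiv> M_modular I \<phi> w"
abbreviation "Nm \<equiv> M_norm I \<phi> w"
abbreviation "Mcl \<equiv> M_class I \<phi> w"

lemma w_measurable [measurable]: "w \<in> L0 I" and w_antimono: "s \<in> I \<Longrightarrow> t \<in> I \<Longrightarrow> s \<le> t \<Longrightarrow> w t \<le> w s"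
  using weight by (auto simp: weight_function_def monotone_on_def)

lemma w_nonneg: "t \<in> I \<Longrightarrow> 0 \<le> w t" using w_pos by (simp add: less_imp_le)

lemma Ph_w_measurable [measurable (raw)]: "X \<in> borel_measurable MI \<Longrightarrow> (\<lambda>t. Ph (X t) (w t)) \<in> borel_measurable MI"
  by (rule Ph_measurable) (auto intro: w_nonneg)

lemma Mod_eq: "Mod f = (\<integral>\<^sup>+t. Ph (rear f t) (w t) \<partial>MI)"
  unfolding M_modular_def Ph_def by simp

lemma Mod_le: "(\<And>t. t \<in> I \<Longrightarrow> rear f t \<le> X t) \<Longrightarrow> Mod f \<le> (\<integral>\<^sup>+t. Ph (X t) (w t) \<partial>MI)"
  unfolding Mod_eq by (intro nn_integral_mono) (auto intro: Ph_mono w_pos)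

lemma Mod_mono: "(\<And>t. t \<in> I \<Longrightarrow> rear f t \<le> rear g t) \<Longrightarrow> Mod f \<le> Mod g"
  using Mod_le[of f "rear g"] by (simp add: Mod_eq)

lemma Mod_scale:
  assumes f [measurable]: "f \<in> L0 I" and "0 \<le> s" "s \<le> 1"
  shows "Mod (\<lambda>t. s * f t) \<le> ennreal s * Mod f"
proof -
  have "Mod (\<lambda>t. s * f t) \<le> (\<integral>\<^sup>+t. ennreal s * Ph (rear f t) (w t) \<partial>MI)"
    unfolding Mod_eq rear_cmult[OF f]
    using assms by (intro nn_integral_mono) (auto intro: Ph_scale w_pos)
  also have "\<dots> = ennreal s * Mod f" unfolding Mod_eq by (rule nn_integral_cmult) measurable
  finally show ?thesis .
qed

lemma Mod_liminf:
  assumes f [measurable]: "f \<in> L0 I" and u [measurable]: "\<And>n. u n \<in> L0 I"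
    and lim: "AE t in MI. (\<lambda>n. u n t) \<longlonglongrightarrow> f t"
  shows "Mod f \<le> liminf (\<lambda>n. Mod (u n))"
proof -
  have "Mod f \<le> (\<integral>\<^sup>+t. liminf (\<lambda>n. Ph (rear (u n) t) (w t)) \<partial>MI)"
    unfolding Mod_eq using rear_le_liminf[OF f u lim]
    by (intro nn_integral_mono) (auto intro: Ph_liminf w_pos)
  also have "\<dots> \<le> liminf (\<lambda>n. Mod (u n))"
    unfolding Mod_eq by (rule nn_integral_liminf) measurable
  finally show ?thesis .
qed

lemma Mod_zero [simp]: "Mod (\<lambda>t. 0) = 0"
proof -
  have "(\<lambda>t. 0) \<in> L0 I" by simp
  from rear_cmult[OF this, of 0] have "rear (\<lambda>t. 0) t = 0" for t by simp
  then show ?thesis by (simp add: Mod_eq)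
qed

text \<open>The infimum in the quasi-norm is attained: the scales e (1 + 1/(n+1)) decrease to e, all
  have modular at most 1, and the modular has the Fatou property.\<close>

lemma Nm_le_iff:
  assumes f [measurable]: "f \<in> L0 I" and e: "0 < e"
  shows "Nm f \<le> ennreal e \<longleftrightarrow> Mod (\<lambda>t. f t / e) \<le> 1"
proof
  assume "Mod (\<lambda>t. f t / e) \<le> 1"
  then show "Nm f \<le> ennreal e" unfolding M_norm_def using e by (intro Inf_lower) auto
next
  assume le: "Nm f \<le> ennreal e"
  have *: "Mod (\<lambda>t. f t / d) \<le> 1" if d: "e < d" for d
  proof -
    have "ennreal e < ennreal d" using d e by (intro ennreal_lessI) auto
    with le have "Nm f < ennreal d" by (rule le_less_trans)
    then obtain e' where e': "0 < e'" "Mod (\<lambda>t. f t / e') \<le> 1" "ennreal e' < ennreal d"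
      unfolding M_norm_def Inf_less_iff by auto
    have "e' < d" using e' by (simp add: ennreal_less_iff)
    then have "Mod (\<lambda>t. f t / d) \<le> Mod (\<lambda>t. f t / e')"
      using e' by (intro Mod_mono rear_mono) (auto intro!: divide_left_mono mult_pos_pos)
    then show ?thesis using e' by simp
  qed
  have "(\<lambda>n. e * (1 + 1 / real (Suc n))) \<longlonglongrightarrow> e * (1 + 0)"
    by (intro tendsto_intros LIMSEQ_inverse_real_of_nat[unfolded inverse_eq_divide])
  then have "(\<lambda>n. f t / (e * (1 + 1 / real (Suc n)))) \<longlonglongrightarrow> f t / e" for t
    using e by (intro tendsto_intros) auto
  then have "Mod (\<lambda>t. f t / e) \<le> liminf (\<lambda>n. Mod (\<lambda>t. f t / (e * (1 + 1 / real (Suc n)))))"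
    by (intro Mod_liminf) (auto simp del: of_nat_Suc)
  also have "\<dots> \<le> liminf (\<lambda>n. 1)"
  proof (intro Liminf_mono always_eventually allI *)
    fix n show "e < e * (1 + 1 / real (Suc n))" using e by (simp add: algebra_simps)
  qed
  finally show "Mod (\<lambda>t. f t / e) \<le> 1" by (simp add: Liminf_const)
qed

lemma Nm_le_1_iff: "f \<in> L0 I \<Longrightarrow> Nm f \<le> 1 \<longleftrightarrow> Mod f \<le> 1"
  using Nm_le_iff[of f 1] by simp

end

section \<open>Criteria for inequalities between extended nonnegative reals\<close>

lemma ennreal_le_by_reals:
  assumes "\<And>e. 0 < e \<Longrightarrow> y \<le> ennreal e \<Longrightarrow> x \<le> ennreal e"
  shows "x \<le> y"
proof (cases y)
  case (real r)
  show ?thesis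
  proof (rule ennreal_le_epsilon)
    fix e :: real assume "0 < e"
    then show "x \<le> y + ennreal e" using assms[of "r + e"] real by (simp add: ennreal_plus)
  qed
qed simp

lemma ennreal_eqI_le:
  assumes "\<And>e. 0 < e \<Longrightarrow> x \<le> ennreal e \<longleftrightarrow> y \<le> ennreal e"
  shows "x = y"
  by (rule antisym; rule ennreal_le_by_reals) (simp_all add: assms)

section \<open>Homogeneity and monotonicity of the quasi-norm\<close>

context orlicz_lorentz begin

lemma Nm_cmult:
  assumes f [measurable]: "f \<in> L0 I"
  shows "Nm (\<lambda>t. c * f t) = ennreal \<bar>c\<bar> * Nm f"
proof (rule ennreal_eqI_le)
  fix e :: real assume e: "0 < e"
  show "Nm (\<lambda>t. c * f t) \<le> ennreal e \<longleftrightarrow> ennreal \<bar>c\<bar> * Nm f \<le> ennreal e"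
  proof (cases "c = 0")
    case True
    then show ?thesis using Nm_le_iff[of "\<lambda>t. c * f t" e] e by simp
  next
    case False
    have "Mod (\<lambda>t. c * f t / e) = Mod (\<lambda>t. f t / (e / \<bar>c\<bar>))"
      by (intro antisym Mod_mono rear_mono) (auto simp: abs_mult mult.commute)
    then have "Nm (\<lambda>t. c * f t) \<le> ennreal e \<longleftrightarrow> Nm f \<le> ennreal (e / \<bar>c\<bar>)"
      using Nm_le_iff[of "\<lambda>t. c * f t" e] Nm_le_iff[of f "e / \<bar>c\<bar>"] e False by simp
    also have "\<dots> \<longleftrightarrow> ennreal \<bar>c\<bar> * Nm f \<le> ennreal e"
    proof (cases "Nm f")
      case (real r)
      then show ?thesis using False e by (simp add: field_simps flip: ennreal_mult)
    qed (use False in \<open>auto simp: ennreal_mult_top top_unique\<close>)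
    finally show ?thesis .
  qed
qed

lemma Mcl_iff: "f \<in> Mcl \<longleftrightarrow> f \<in> L0 I \<and> Nm f < \<infinity>"
proof safe
  assume "f \<in> Mcl"
  then obtain c where f: "f \<in> L0 I" and c: "0 < c" "Mod (\<lambda>t. c * f t) < \<infinity>"
    unfolding M_class_def by auto
  then show "f \<in> L0 I" by simp
  obtain m where m: "Mod (\<lambda>t. c * f t) = ennreal m" "0 \<le> m" using c by (cases "Mod (\<lambda>t. c * f t)") auto
  \<comment> \<open>By convexity the modular shrinks at least proportionally under scaling by s <=
    1, and s m <= 1.\<close>
  define s where "s = 1 / (1 + m)"
  have s: "0 < s" "s \<le> 1" "s * m \<le> 1" using m by (auto simp: s_def field_simps)
  have cf: "(\<lambda>t. c * f t) \<in> L0 I" using f by measurable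
  have "Mod (\<lambda>t. s * (c * f t)) \<le> ennreal s * Mod (\<lambda>t. c * f t)"
    using s by (intro Mod_scale cf) auto
  also have "\<dots> \<le> 1" using m s by (simp flip: ennreal_mult)
  finally have "Mod (\<lambda>t. f t / (1 / (s * c))) \<le> 1" by (simp add: mult.commute mult.left_commute)
  then have "Nm f \<le> ennreal (1 / (s * c))" using s c f by (subst Nm_le_iff) auto
  then show "Nm f < \<infinity>" by (auto intro: le_less_trans)
next
  assume f: "f \<in> L0 I" and "Nm f < \<infinity>"
  then obtain r where r: "Nm f = ennreal r" "0 \<le> r" by (cases "Nm f") auto
  then have "Mod (\<lambda>t. f t / (r + 1)) \<le> 1" using f by (subst Nm_le_iff[symmetric]) auto
  then have "Mod (\<lambda>t. (1 / (r + 1)) * f t) < \<infinity>" by (auto intro: le_less_trans)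
  then show "f \<in> Mcl" unfolding M_class_def using f r by (auto intro!: exI[of _ "1 / (r + 1)"])
qed

lemma Mod_le_1_imp_Mcl: "f \<in> L0 I \<Longrightarrow> Mod f \<le> 1 \<Longrightarrow> f \<in> Mcl"
  using Nm_le_1_iff[of f] by (auto simp: Mcl_iff intro: le_less_trans)

lemma Nm_mono: "f \<in> L0 I \<Longrightarrow> g \<in> L0 I \<Longrightarrow> (\<And>t. t \<in> I \<Longrightarrow> rear f t \<le> rear g t) \<Longrightarrow> Nm f \<le> Nm g"
proof (rule ccontr)
  assume f: "f \<in> L0 I" and g: "g \<in> L0 I" and le: "\<And>t. t \<in> I \<Longrightarrow> rear f t \<le> rear g t" and "\<not> Nm f \<le> Nm g"
  then have "Nm g < Nm f" by simp
  then obtain x where x: "Nm g < x" "x < Nm f" using dense by blast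
  then obtain e where e: "x = ennreal e" "0 \<le> e" by (cases x) auto
  then have e0: "0 < e" using x(1) by (cases "e = 0") auto
  have "Mod (\<lambda>t. f t / e) \<le> Mod (\<lambda>t. g t / e)"
    using le e0 by (intro Mod_mono) (simp add: rear_divide f g divide_right_mono_ennreal)
  also have "\<dots> \<le> 1" using x(1) e e0 Nm_le_iff[OF g e0] by (simp add: less_imp_le)
  finally show False using Nm_le_iff[OF f e0] x(2) e by auto
qed

end

text \<open>Disposes of the factors \<beta> > 1 and \<kappa> > 1 that transplanting and the Amemiya
  estimate leave behind.\<close>

lemma ennreal_le_mult_all:
  assumes "\<And>\<beta>. 1 < \<beta> \<Longrightarrow> x \<le> ennreal \<beta> * y"
  shows "x \<le> y"
proof (cases y)
  case (real r)
  show ?thesis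
  proof (rule ennreal_le_epsilon)
    fix e :: real assume e: "0 < e"
    have "x \<le> ennreal (1 + e / (r + 1)) * y" using e real by (intro assms) (simp add: field_simps)
    also have "\<dots> = ennreal (r + e * (r / (r + 1)))" using real e
      by (simp flip: ennreal_mult add: algebra_simps)
    also have "\<dots> \<le> ennreal (r + e)"
    proof (intro ennreal_leI add_left_mono)
      have "e * (r / (r + 1)) \<le> e * 1" using real e by (intro mult_left_mono) auto
      then show "e * (r / (r + 1)) \<le> e" by simp
    qed
    finally show "x \<le> y + ennreal e" using real e by (simp add: ennreal_plus)
  qed
qed simp

lemma ennreal_eq_topI:
  assumes "\<And>n :: nat. ennreal (c * 2 ^ n) \<le> x" "0 < c"
  shows "x = top"
proof (rule ccontr)
  assume "x \<noteq> top"
  then obtain r where r: "x = ennreal r" "0 \<le> r" by (cases x) auto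
  obtain n where "r / c < 2 ^ n" using real_arch_pow[of 2 "r / c"] by auto
  then have "r < c * 2 ^ n" using assms(2) by (simp add: field_simps)
  then show False using assms(1)[of n] r assms(2) by (simp add: ennreal_le_iff2)
qed

lemma suminf_half_pow: "(\<Sum>n. ennreal ((1/2) ^ Suc n)) = 1"
proof -
  have "(\<Sum>n. ennreal ((1/2) ^ Suc n)) = ennreal 1"
    by (rule suminf_ennreal_eq[OF _ power_half_series]) simp
  then show ?thesis by (simp only: ennreal_1)
qed

lemma divide_one_plus_le:
  fixes p x :: real
  assumes "0 \<le> p" "0 \<le> x"
  shows "p / (1 + x) * x \<le> p" "p / (1 + x) \<le> p"
proof -
  have "p * (x / (1 + x)) \<le> p * 1" using assms by (intro mult_left_mono) auto
  then show "p / (1 + x) * x \<le> p" by simp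
  have "p * (1 / (1 + x)) \<le> p * 1" using assms by (intro mult_left_mono) auto
  then show "p / (1 + x) \<le> p" by simp
qed

section \<open>Exhaustion of I and measurability of decreasing functions\<close>

context interval_domain begin

lemma ennreal_less_I_iff: "s \<in> I \<Longrightarrow> ennreal s < ennreal t \<longleftrightarrow> s < t"
  using I_pos[of s] by (simp add: ennreal_less_iff)

lemma I_nonempty: "\<exists>t. t \<in> I"
proof -
  obtain c where "0 < c" "c < a" using dense[OF a_pos] by blast
  then show ?thesis by (cases c) (auto simp: I_def einterval_def)
qed

lemma I_exhaustion:
  obtains b :: "nat \<Rightarrow> real" where "incseq b" "\<And>n. b n \<in> I" "\<And>t. t \<in> I \<Longrightarrow> \<exists>n. t < b n"
proof -
  have "0 < (\<infinity>::ereal)" by simp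
  then obtain z :: "nat \<Rightarrow> real" where "incseq z" "\<And>n. z n \<in> I" "\<And>n. ereal (z n) < \<infinity>"
      "\<And>t. t \<in> I \<Longrightarrow> ereal t < \<infinity> \<Longrightarrow> \<exists>n. t < z n"
    by (rule initial_exhaustion) blast
  then show ?thesis using that[of z] by auto
qed

text \<open>A superlevel set of a decreasing function on \<open>I\<close> is an initial segment: a
  union of open intervals (0,t) together with at most one point, its right end.\<close>

lemma antimono_borel:
  fixes G :: "real \<Rightarrow> ennreal"
  assumes G: "\<And>s t. s \<in> I \<Longrightarrow> t \<in> I \<Longrightarrow> s \<le> t \<Longrightarrow> G t \<le> G s"
  shows "(\<lambda>t. G t * indicator I t) \<in> borel_measurable borel"
proof (rule borel_measurableI_greater)
  fix y :: ennreal
  define J where "J = {t\<in>I. y < G t}"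
  have down: "s \<in> J" if "t \<in> J" "0 < s" "s < t" for s t
    using that I_down[of t s] G[of s t] by (auto simp: J_def intro: less_le_trans)
  define U where "U = (\<Union>t\<in>J. {0<..<t})"
  have "\<exists>m. J - U \<subseteq> {m}"
  proof (cases "J - U = {}")
    case False
    then obtain m where "m \<in> J - U" by auto
    moreover have "s = t" if "s \<in> J - U" "t \<in> J - U" for s t
      using that I_pos[of s] I_pos[of t] by (auto simp: U_def J_def dest!: bspec[of J] ) 
         (meson linorder_neqE_linordered_idom)
    ultimately show ?thesis by blast
  qed auto
  then have "finite (J - U)" by (meson finite.simps finite_subset)
  then have "J - U \<in> sets borel" by (intro borel_closed finite_imp_closed)
  moreover have "U \<in> sets borel" unfolding U_def by (intro borel_open open_UN) auto
  moreover have "J = U \<union> (J - U)" using down by (auto simp: U_def)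
  ultimately have "J \<in> sets borel" by (metis sets.Un)
  moreover have "{t \<in> space borel. y < G t * indicator I t} = J"
    by (auto simp: J_def indicator_def split: if_splits)
  ultimately show "{t \<in> space borel. y < G t * indicator I t} \<in> sets borel" by simp
qed

lemma antimono_MI:
  fixes G :: "real \<Rightarrow> ennreal"
  assumes G: "\<And>s t. s \<in> I \<Longrightarrow> t \<in> I \<Longrightarrow> s \<le> t \<Longrightarrow> G t \<le> G s"
  shows "G \<in> borel_measurable MI"
  by (rule measurable_cong[THEN iffD1, OF _ borel_imp_MI[OF antimono_borel[OF G]]]) auto

lemma rear_enn2real:
  assumes G: "\<And>s t. s \<in> I \<Longrightarrow> t \<in> I \<Longrightarrow> s \<le> t \<Longrightarrow> G t \<le> G s" and fin: "\<And>t. t \<in> I \<Longrightarrow> G t < top"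
    and t: "t \<in> I"
  shows "(\<lambda>t. enn2real (G t)) \<in> L0 I" "rear (\<lambda>t. enn2real (G t)) t \<le> G t"
proof -
  show m: "(\<lambda>t. enn2real (G t)) \<in> L0 I" using antimono_MI[OF G] by measurable
  have "{s\<in>I. y < \<bar>enn2real (G s)\<bar>} = {s\<in>I. ennreal y < G s}" if "0 \<le> y" for y
  proof -
    have "y < enn2real (G s) \<longleftrightarrow> ennreal y < G s" if "s \<in> I" for s
      using fin[OF that] \<open>0 \<le> y\<close> by (cases "G s") (auto simp: ennreal_less_iff)
    then show ?thesis by auto
  qed
  then show "rear (\<lambda>t. enn2real (G t)) t \<le> G t"
    by (intro rear_le_antimono[OF m t _ G]) (auto simp: dist_f_eq)
qed

lemma initial_integral:
  assumes t: "t \<in> I"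
  shows "(\<integral>\<^sup>+s\<in>{0<..<t}. X s \<partial>lebesgue) = (\<integral>\<^sup>+s. X s * indicator {s. ennreal s < ennreal t} s \<partial>MI)"
proof -
  have "(\<integral>\<^sup>+s. X s * indicator {s. ennreal s < ennreal t} s \<partial>MI)
     = (\<integral>\<^sup>+s. X s * indicator {s. ennreal s < ennreal t} s * indicator I s \<partial>lebesgue)"
    by (rule nn_integral_restrict_space) simp
  also have "\<dots> = (\<integral>\<^sup>+s\<in>{0<..<t}. X s \<partial>lebesgue)"
  proof (intro nn_integral_cong)
    fix s
    have "s \<in> {0<..<t} \<longleftrightarrow> ennreal s < ennreal t \<and> s \<in> I"
      using I_down[OF t, of s] I_pos by (auto simp: ennreal_less_I_iff)
    then show "X s * indicator {s. ennreal s < ennreal t} s * indicator I s = X s * indicator {0<..<t} s"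
      by (auto simp: indicator_def)
  qed
  finally show ?thesis by simp
qed

end

section \<open>The primitive of the weight\<close>

context orlicz_lorentz begin

text \<open>The argument is an extended real because the primitive will be evaluated at measures of
  sets, which may be infinite.\<close>

definition Wf :: "ennreal \<Rightarrow> ennreal" where
  "Wf x = (\<integral>\<^sup>+t. ennreal (w t) * indicator {t. ennreal t < x} t \<partial>MI)"

lemma indicator_initial_measurable [measurable]:
  "(\<lambda>t. indicator {t. ennreal t < x} t :: ennreal) \<in> borel_measurable MI"
  by (rule borel_imp_MI) measurable

lemma Wf_mono: "x \<le> y \<Longrightarrow> Wf x \<le> Wf y"
  unfolding Wf_def by (intro nn_integral_mono mult_left_mono) (auto simp: indicator_def)

lemma Wf_zero [simp]: "Wf 0 = 0" by (simp add: Wf_def)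

text \<open>Integrability of the weight is given up to points t of \<open>I\<close>; past a fixed t
  the weight is at most \<open>w t\<close>, which settles every finite length, the right end of a
  bounded \<open>I\<close> included.\<close>

lemma Wf_finite: "x < top \<Longrightarrow> Wf x < top"
proof -
  assume x: "x < top"
  obtain t where t: "t \<in> I" using I_nonempty by blast
  have "Wf x \<le> (\<integral>\<^sup>+s. ennreal (w s) * indicator {s. ennreal s < ennreal t} s + ennreal (w t) * indicator {s. ennreal s < x} s \<partial>MI)"
    unfolding Wf_def
  proof (intro nn_integral_mono)
    fix s assume "s \<in> space MI"
    then have s: "s \<in> I" by simp
    show "ennreal (w s) * indicator {t. ennreal t < x} s
       \<le> ennreal (w s) * indicator {s. ennreal s < ennreal t} s + ennreal (w t) * indicator {s. ennreal s < x} s"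
    proof (cases "s < t")
      case True then show ?thesis using s by (auto simp: indicator_def ennreal_less_I_iff)
    next
      case False then show ?thesis using w_antimono[OF t s]
        by (auto simp: indicator_def intro: add_increasing ennreal_leI)
    qed
  qed
  also have "\<dots> = (\<integral>\<^sup>+s. ennreal (w s) * indicator {s. ennreal s < ennreal t} s \<partial>MI) + ennreal (w t) * emeasure MI {s\<in>I. ennreal s < x}"
  proof -
    have "(\<integral>\<^sup>+s. ennreal (w t) * indicator {s. ennreal s < x} s \<partial>MI) = (\<integral>\<^sup>+s. ennreal (w t) * indicator {s\<in>I. ennreal s < x} s \<partial>MI)"
      by (intro nn_integral_cong) (auto simp: indicator_def)
    then show ?thesis by (subst nn_integral_add) (auto simp: nn_integral_cmult_indicator)
  qed
  also have "(\<integral>\<^sup>+s. ennreal (w s) * indicator {s. ennreal s < ennreal t} s \<partial>MI) = (\<integral>\<^sup>+ s\<in>{0<..<t}. ennreal (w s) \<partial>lebesgue)"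
    by (rule initial_integral[OF t, symmetric])
  also have "\<dots> + ennreal (w t) * emeasure MI {s\<in>I. ennreal s < x} < top"
    using W_finite[OF t] x unfolding emeasure_initial by (auto simp: ennreal_mult_less_top min_def)
  finally show ?thesis .
qed

lemma Wf_pos: "0 < x \<Longrightarrow> 0 < Wf x"
proof (rule ccontr)
  assume x: "0 < x" and "\<not> 0 < Wf x"
  then have "Wf x = 0" by simp
  then have "AE t in MI. ennreal (w t) * indicator {t. ennreal t < x} t = 0"
    unfolding Wf_def by (subst (asm) nn_integral_0_iff_AE) auto
  then have "AE t in MI. t \<notin> {t\<in>I. ennreal t < x}"
  proof (rule AE_mp, intro AE_I2 impI)
    fix t assume "t \<in> space MI" "ennreal (w t) * indicator {t. ennreal t < x} t = 0"
    then show "t \<notin> {t\<in>I. ennreal t < x}" using w_pos[of t] by (auto simp: indicator_def)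
  qed
  then have "emeasure MI {t\<in>I. ennreal t < x} = 0"
    by (subst (asm) AE_iff_measurable[of "{t\<in>I. ennreal t < x}"]) auto
  moreover have "0 < len" using I_nonempty mem_I_iff by (meson le_less_trans zero_le)
  ultimately show False using x unfolding emeasure_initial by (auto simp: min_def split: if_splits)
qed

section \<open>The Koethe dual of the class M\<close>

abbreviation "Nd \<equiv> koethe_norm I Mcl Nm"

lemma Nd_upper: "g \<in> L0 I \<Longrightarrow> Mod g \<le> 1 \<Longrightarrow> (\<integral>\<^sup>+t. ennreal \<bar>h t * g t\<bar> \<partial>MI) \<le> Nd h"
  unfolding koethe_norm_def by (intro SUP_upper) (auto simp: Mod_le_1_imp_Mcl Nm_le_1_iff)

lemma Nd_least:
  assumes "\<And>g. g \<in> L0 I \<Longrightarrow> Mod g \<le> 1 \<Longrightarrow> (\<integral>\<^sup>+t. ennreal \<bar>h t * g t\<bar> \<partial>MI) \<le> X"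
  shows "Nd h \<le> X"
  unfolding koethe_norm_def by (intro SUP_least) (auto simp: Mcl_iff Nm_le_1_iff intro: assms)

lemma Nd_le_Nm:
  assumes h [measurable]: "h \<in> L0 I" and g [measurable]: "g \<in> L0 I"
  shows "Nd h \<le> 1 \<Longrightarrow> (\<integral>\<^sup>+t. ennreal \<bar>h t * g t\<bar> \<partial>MI) \<le> Nm g"
proof (rule ennreal_le_by_reals)
  fix e :: real assume 1: "Nd h \<le> 1" and e: "0 < e" "Nm g \<le> ennreal e"
  then have "Mod (\<lambda>t. g t / e) \<le> 1" using Nm_le_iff[OF g] by simp
  then have "(\<integral>\<^sup>+t. ennreal \<bar>h t * (g t / e)\<bar> \<partial>MI) \<le> 1"
    using Nd_upper[of "\<lambda>t. g t / e" h] 1 by (auto intro: order_trans)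
  then have "ennreal e * (\<integral>\<^sup>+t. ennreal \<bar>h t * (g t / e)\<bar> \<partial>MI) \<le> ennreal e * 1"
    by (rule mult_left_mono) simp
  also have "ennreal e * (\<integral>\<^sup>+t. ennreal \<bar>h t * (g t / e)\<bar> \<partial>MI) = (\<integral>\<^sup>+t. ennreal e * ennreal \<bar>h t * (g t / e)\<bar> \<partial>MI)"
    by (rule nn_integral_cmult[symmetric]) measurable
  also have "\<dots> = (\<integral>\<^sup>+t. ennreal \<bar>h t * g t\<bar> \<partial>MI)"
    using e by (intro nn_integral_cong) (simp add: abs_mult flip: ennreal_mult)
  finally show "(\<integral>\<^sup>+t. ennreal \<bar>h t * g t\<bar> \<partial>MI) \<le> ennreal e" by simp
qed

lemma Nd_mono: "(\<And>t. t \<in> I \<Longrightarrow> \<bar>h t\<bar> \<le> \<bar>k t\<bar>) \<Longrightarrow> Nd h \<le> Nd k"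
  unfolding koethe_norm_def
  by (intro SUP_mono bexI nn_integral_mono) (auto simp: abs_mult intro!: mult_right_mono)

lemma koethe_norm_cmult:
  assumes A: "A \<subseteq> L0 I" and h [measurable]: "h \<in> L0 I"
  shows "koethe_norm I A N (\<lambda>t. c * h t) = ennreal \<bar>c\<bar> * koethe_norm I A N h"
proof -
  have "(\<integral>\<^sup>+t. ennreal \<bar>c * h t * g t\<bar> \<partial>MI) = ennreal \<bar>c\<bar> * (\<integral>\<^sup>+t. ennreal \<bar>h t * g t\<bar> \<partial>MI)"
    if "g \<in> A" for g
  proof -
    have [measurable]: "g \<in> L0 I" using that A by auto
    have "(\<integral>\<^sup>+t. ennreal \<bar>c * h t * g t\<bar> \<partial>MI) = (\<integral>\<^sup>+t. ennreal \<bar>c\<bar> * ennreal \<bar>h t * g t\<bar> \<partial>MI)"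
      by (intro nn_integral_cong) (simp add: abs_mult mult.assoc flip: ennreal_mult)
    also have "\<dots> = ennreal \<bar>c\<bar> * (\<integral>\<^sup>+t. ennreal \<bar>h t * g t\<bar> \<partial>MI)" by (rule nn_integral_cmult) measurable
    finally show ?thesis .
  qed
  then have "koethe_norm I A N (\<lambda>t. c * h t) = (SUP g\<in>{g \<in> A. N g \<le> 1}. ennreal \<bar>c\<bar> * (\<integral>\<^sup>+t. ennreal \<bar>h t * g t\<bar> \<partial>MI))"
    unfolding koethe_norm_def by (intro SUP_cong) auto
  then show ?thesis unfolding koethe_norm_def by (simp add: SUP_mult_left_ennreal)
qed

lemma Nd_cmult: "h \<in> L0 I \<Longrightarrow> Nd (\<lambda>t. c * h t) = ennreal \<bar>c\<bar> * Nd h"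
  by (intro koethe_norm_cmult) (auto simp: Mcl_iff)

text \<open>Superlinear growth gives u <= \<phi> u + u0 for all u >= 0. With u =
  \<open>rear g t / w t\<close> this bounds the rearrangement by the modular integrand plus u0
  \<open>w t\<close>, and the latter has a finite integral over an initial segment of finite
  length.\<close>

lemma Nd_indicator:
  assumes E [measurable]: "E \<in> sets MI" and fin: "emeasure MI E < top"
  obtains C where "0 \<le> C" "Nd (indicator E) \<le> ennreal C"
proof -
  obtain u0 where u0: "u0 > 0" "\<And>u. u \<ge> u0 \<Longrightarrow> u \<le> \<phi> u" using phi_superlinear[of 1] by auto
  let ?e = "emeasure MI E"
  have "Nd (indicator E) \<le> 1 + ennreal u0 * Wf ?e"
  proof (rule Nd_least)
    fix g assume g [measurable]: "g \<in> L0 I" and 1: "Mod g \<le> 1"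
    have "(\<integral>\<^sup>+t. ennreal \<bar>indicator E t * g t\<bar> \<partial>MI) = (\<integral>\<^sup>+t. ennreal \<bar>g t\<bar> * indicator E t \<partial>MI)"
      by (intro nn_integral_cong) (auto simp: indicator_def)
    also have "\<dots> \<le> (\<integral>\<^sup>+t. rear g t * indicator {t. ennreal t < ?e} t \<partial>MI)"
      by (rule set_nn_integral_le_rear) measurable
    also have "\<dots> \<le> (\<integral>\<^sup>+t. Ph (rear g t) (w t) + ennreal u0 * (ennreal (w t) * indicator {t. ennreal t < ?e} t) \<partial>MI)"
    proof (intro nn_integral_mono)
      fix t assume "t \<in> space MI"
      then have t: "0 < w t" using w_pos by simp
      have "rear g t \<le> Ph (rear g t) (w t) + ennreal u0 * ennreal (w t)"
      proof (cases "rear g t")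
        case (real r)
        have "r / w t \<le> \<phi> (r / w t) + u0"
          using u0(2)[of "r / w t"] phi_nonneg[of "r / w t"] u0(1) real t by (cases "u0 \<le> r / w t") auto
        then have "r \<le> (\<phi> (r / w t) + u0) * w t" using t by (simp add: field_simps)
        then have "r \<le> \<phi> (r / w t) * w t + u0 * w t" by (simp add: algebra_simps)
        then show ?thesis using real t u0 phi_nonneg[of "r / w t"]
          by (simp add: Ph_ennreal flip: ennreal_mult ennreal_plus)
      qed simp
      then show "rear g t * indicator {t. ennreal t < ?e} t \<le> Ph (rear g t) (w t) + ennreal u0 * (ennreal (w t) * indicator {t. ennreal t < ?e} t)"
        by (auto simp: indicator_def)
    qed
    also have "\<dots> = Mod g + ennreal u0 * Wf ?e"
      unfolding Mod_eq Wf_def by (subst nn_integral_add, measurable) (simp add: nn_integral_cmult)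
    also have "\<dots> \<le> 1 + ennreal u0 * Wf ?e" using 1 by (rule add_right_mono)
    finally show "(\<integral>\<^sup>+t. ennreal \<bar>indicator E t * g t\<bar> \<partial>MI) \<le> 1 + ennreal u0 * Wf ?e" .
  qed
  also have "\<dots> < top" using Wf_finite[OF fin] by (simp add: ennreal_mult_less_top)
  finally obtain C where "Nd (indicator E) = ennreal C" "0 \<le> C" by (cases "Nd (indicator E)") auto
  then show ?thesis using that[of C] by simp
qed

lemma rear_bounded_support:
  assumes f [measurable]: "f \<in> L0 I" and E: "E \<in> sets MI" "emeasure MI E \<le> ennreal b"
    and C: "0 \<le> C" "\<And>t. t \<in> I \<Longrightarrow> \<bar>f t\<bar> \<le> C * indicator E t"
  shows "rear f t \<le> ennreal C" "b \<le> t \<Longrightarrow> rear f t = 0"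
proof -
  have nC: "\<not> C < \<bar>f t\<bar>" if "t \<in> I" for t
    using C(2)[OF that] C(1) by (cases "t \<in> E") auto
  have "dist_f f C = emeasure MI {}" unfolding dist_f_eq
    by (rule arg_cong[of _ _ "emeasure MI"]) (use nC in blast)
  then have "\<not> ennreal t < dist_f f C" by simp
  then have "\<not> ennreal C < rear f t" using rear_gt_iff[OF f C(1)] by simp
  then show "rear f t \<le> ennreal C" by simp
  assume "b \<le> t"
  have sub: "t \<in> E" if "t \<in> I" "0 < \<bar>f t\<bar>" for t
    using C(2)[OF that(1)] that(2) by (cases "t \<in> E") auto
  have "dist_f f 0 \<le> emeasure MI E" unfolding dist_f_eq
    by (rule emeasure_mono[OF _ E(1)]) (use sub in auto)
  also have "\<dots> \<le> ennreal t" using E(2) \<open>b \<le> t\<close> by (meson ennreal_leI order_trans)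
  finally have "\<not> ennreal 0 < rear f t" using rear_gt_iff[OF f, of 0 t] by auto
  then show "rear f t = 0" by simp
qed

text \<open>On (0,b) the weight is at least \<open>w b\<close>, so the integrand is at most \<phi>
  (C / w b) times w; from b on the rearrangement vanishes.\<close>

lemma Mod_bounded_support:
  assumes f [measurable]: "f \<in> L0 I" and E: "E \<in> sets MI" "emeasure MI E \<le> ennreal b" and b: "b \<in> I"
    and C: "0 \<le> C" "\<And>t. t \<in> I \<Longrightarrow> \<bar>f t\<bar> \<le> C * indicator E t"
  shows "Mod f < \<infinity>"
proof -
  have "Mod f \<le> (\<integral>\<^sup>+t. ennreal (\<phi> (C / w b)) * (ennreal (w t) * indicator {t. ennreal t < ennreal b} t) \<partial>MI)"
    unfolding Mod_eq
  proof (intro nn_integral_mono)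
    fix t assume "t \<in> space MI"
    then have t: "t \<in> I" by simp
    show "Ph (rear f t) (w t) \<le> ennreal (\<phi> (C / w b)) * (ennreal (w t) * indicator {t. ennreal t < ennreal b} t)"
    proof (cases "t < b")
      case True
      have "Ph (rear f t) (w t) \<le> Ph (ennreal C) (w t)"
        using rear_bounded_support(1)[OF f E C] w_pos[OF t] by (intro Ph_mono)
      also have "\<dots> = ennreal (\<phi> (C / w t) * w t)" using C by (simp add: Ph_ennreal)
      also have "\<dots> \<le> ennreal (\<phi> (C / w b) * w t)"
        using C w_pos[OF t] w_pos[OF b] w_antimono[OF t b] True
        by (intro ennreal_leI mult_right_mono phi_mono divide_left_mono) auto
      finally show ?thesis using True t b C I_pos[OF t] w_nonneg[OF t] w_pos[OF b]
        by (simp add: ennreal_less_iff ennreal_mult phi_nonneg)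
    qed (simp add: rear_bounded_support(2)[OF f E C])
  qed
  also have "\<dots> = ennreal (\<phi> (C / w b)) * Wf (ennreal b)"
    unfolding Wf_def by (rule nn_integral_cmult) measurable
  also have "\<dots> < \<infinity>" using Wf_finite[of "ennreal b"] by (simp add: ennreal_mult_less_top)
  finally show ?thesis .
qed

lemma Mod_finite_imp_Mcl: "f \<in> L0 I \<Longrightarrow> Mod f < \<infinity> \<Longrightarrow> f \<in> Mcl"
  unfolding M_class_def by (auto intro!: exI[of _ 1])

lemma modular_finite_imp_finite:
  assumes G: "\<And>s t. s \<in> I \<Longrightarrow> t \<in> I \<Longrightarrow> s \<le> t \<Longrightarrow> G t \<le> G s"
    and fin: "(\<integral>\<^sup>+t. Ph (G t) (w t) \<partial>MI) < top" and t: "t \<in> I"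
  shows "G t < top"
proof (rule ccontr)
  assume "\<not> G t < top"
  then have top: "G s = top" if "s \<in> I" "s < t" for s using G[of s t] that t by (auto simp: top_unique less_top[symmetric])
  have "top = top * emeasure MI {s\<in>I. ennreal s < ennreal t}"
    using t mem_I_iff[of t] by (simp add: emeasure_initial ennreal_top_mult min_def less_imp_le)
  also have "\<dots> = (\<integral>\<^sup>+s. top * indicator {s\<in>I. ennreal s < ennreal t} s \<partial>MI)"
    by (rule nn_integral_cmult_indicator[symmetric]) measurable
  also have "\<dots> \<le> (\<integral>\<^sup>+t. Ph (G t) (w t) \<partial>MI)"
  proof (intro nn_integral_mono)
    fix s show "top * indicator {s\<in>I. ennreal s < ennreal t} s \<le> Ph (G s) (w s)"
      using top[of s] by (cases "s \<in> {s\<in>I. ennreal s < ennreal t}") (auto simp: ennreal_less_I_iff)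
  qed
  finally show False using fin by simp
qed

text \<open>A strictly positive h0 makes the quasi-norm and the bidual norm upper bounds for the
  norm of L1(h0 dt). Definiteness, almost everywhere convergence of Cauchy subsequences and
  separation of points are all obtained from this.\<close>

lemma ex_positive_dual:
  obtains h0 where "h0 \<in> L0 I" "\<And>t. t \<in> I \<Longrightarrow> 0 < h0 t" "Nd h0 \<le> 1"
proof -
  obtain b :: "nat \<Rightarrow> real" where b: "incseq b" "\<And>n. b n \<in> I" "\<And>t. t \<in> I \<Longrightarrow> \<exists>n. t < b n"
    by (rule I_exhaustion) blast
  define E where "E n = {t\<in>I. ennreal t < ennreal (b n)}" for n
  have Em [measurable]: "E n \<in> sets MI" for n unfolding E_def by (rule set_initial_MI)
  have "\<exists>C\<ge>0. Nd (indicator (E n)) \<le> ennreal C" for n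
  proof -
    have "emeasure MI (E n) < top" unfolding E_def emeasure_initial
      by (rule le_less_trans[of _ "ennreal (b n)"]) auto
    then show ?thesis using Nd_indicator[OF Em] by blast
  qed
  then obtain C where C: "\<And>n. 0 \<le> C n" "\<And>n. Nd (indicator (E n)) \<le> ennreal (C n)" by metis
  \<comment> \<open>The numerator makes the series of indicators summable at every point; the
    denominator compensates the dual norm of the n-th indicator.\<close>
  define \<delta> where "\<delta> n = (1/2) ^ Suc n / (1 + C n)" for n
  have \<delta>: "0 < \<delta> n" "\<delta> n * C n \<le> (1/2) ^ Suc n" "\<delta> n \<le> (1/2) ^ Suc n" for n
    unfolding \<delta>_def using C(1)[of n] divide_one_plus_le[of "(1/2) ^ Suc n" "C n"]
    by (auto intro!: divide_pos_pos simp del: power_Suc)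
  define h0 where "h0 t = (\<Sum>n. \<delta> n * indicator (E n) t)" for t
  have summ: "summable (\<lambda>n. \<delta> n * indicator (E n) t)" for t
  proof (rule summable_comparison_test'[where N=0])
    show "summable (\<lambda>n. (1/2::real) ^ Suc n)" using power_half_series by (simp add: sums_iff)
    show "norm (\<delta> n * indicator (E n) t) \<le> (1/2) ^ Suc n" for n
      using \<delta>[of n] by (auto simp: indicator_def)
  qed
  have h0m [measurable]: "h0 \<in> L0 I" unfolding h0_def by measurable
  have pos: "0 < h0 t" if tI: "t \<in> I" for t
  proof -
    obtain n where "t < b n" using b(3)[OF tI] by auto
    then have "t \<in> E n" using tI I_pos[OF tI] by (auto simp: E_def ennreal_lessI)
    then have "0 < \<delta> n * indicator (E n) t" using \<delta> by simp
    also have "\<delta> n * indicator (E n) t = (\<Sum>i\<in>{n}. \<delta> i * indicator (E i) t)"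
      by (subst sum.insert) simp_all
    also have "\<dots> \<le> h0 t" unfolding h0_def
      using \<delta> by (intro sum_le_suminf[OF summ]) (auto simp: less_imp_le)
    finally show ?thesis .
  qed
  have "Nd h0 \<le> 1"
  proof (rule Nd_least)
    fix g assume g [measurable]: "g \<in> L0 I" and 1: "Mod g \<le> 1"
    have "(\<integral>\<^sup>+t. ennreal \<bar>h0 t * g t\<bar> \<partial>MI) = (\<integral>\<^sup>+t. (\<Sum>n. ennreal (\<delta> n) * ennreal \<bar>indicator (E n) t * g t\<bar>) \<partial>MI)"
    proof (intro nn_integral_cong)
      fix t assume "t \<in> space MI"
      then have "ennreal \<bar>h0 t * g t\<bar> = ennreal (h0 t) * ennreal \<bar>g t\<bar>"
        using pos[of t] by (simp add: abs_mult ennreal_mult)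
      also have "ennreal (h0 t) = (\<Sum>n. ennreal (\<delta> n * indicator (E n) t))"
        unfolding h0_def using \<delta> summ by (intro suminf_ennreal2[symmetric]) (auto simp: less_imp_le)
      also have "\<dots> * ennreal \<bar>g t\<bar> = (\<Sum>n. ennreal (\<delta> n * indicator (E n) t) * ennreal \<bar>g t\<bar>)"
        by (rule ennreal_suminf_multc[symmetric])
      also have "\<dots> = (\<Sum>n. ennreal (\<delta> n) * ennreal \<bar>indicator (E n) t * g t\<bar>)"
        using \<delta> by (intro suminf_cong) (auto simp: indicator_def)
      finally show "ennreal \<bar>h0 t * g t\<bar> = (\<Sum>n. ennreal (\<delta> n) * ennreal \<bar>indicator (E n) t * g t\<bar>)" .
    qed
    also have "\<dots> = (\<Sum>n. ennreal (\<delta> n) * (\<integral>\<^sup>+t. ennreal \<bar>indicator (E n) t * g t\<bar> \<partial>MI))"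
      by (subst nn_integral_suminf, measurable) (simp add: nn_integral_cmult)
    also have "\<dots> \<le> (\<Sum>n. ennreal ((1/2) ^ Suc n))"
    proof (intro suminf_le)
      fix n
      have "(\<integral>\<^sup>+t. ennreal \<bar>indicator (E n) t * g t\<bar> \<partial>MI) \<le> ennreal (C n)"
        using Nd_upper[OF g 1] C(2) by (rule order_trans)
      then have "ennreal (\<delta> n) * (\<integral>\<^sup>+t. ennreal \<bar>indicator (E n) t * g t\<bar> \<partial>MI) \<le> ennreal (\<delta> n) * ennreal (C n)"
        by (rule mult_left_mono) simp
      also have "\<dots> = ennreal (\<delta> n * C n)" using \<delta>[of n] C by (simp add: ennreal_mult less_imp_le)
      also have "\<dots> \<le> ennreal ((1/2) ^ Suc n)" using \<delta> by (intro ennreal_leI)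
      finally show "ennreal (\<delta> n) * (\<integral>\<^sup>+t. ennreal \<bar>indicator (E n) t * g t\<bar> \<partial>MI) \<le> ennreal ((1/2) ^ Suc n)" .
    qed auto
    finally show "(\<integral>\<^sup>+t. ennreal \<bar>h0 t * g t\<bar> \<partial>MI) \<le> 1" by (simp only: suminf_half_pow)
  qed
  then show ?thesis using that h0m pos by blast
qed

text \<open>A series of multiples of w restricted to (0,b n) is replaced by a supremum, since the
  class need not be closed under sums. The supremum is decreasing, so its rearrangement does not
  exceed it, and its modular is at most the sum of the modulars.\<close>

lemma ex_positive_class:
  obtains g0 where "g0 \<in> L0 I" "\<And>t. t \<in> I \<Longrightarrow> 0 < g0 t" "Mod g0 \<le> 1"
proof -
  obtain b :: "nat \<Rightarrow> real" where b: "incseq b" "\<And>n. b n \<in> I" "\<And>t. t \<in> I \<Longrightarrow> \<exists>n. t < b n"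
    by (rule I_exhaustion) blast
  define W where "W n = enn2real (Wf (ennreal (b n)))" for n
  have W: "Wf (ennreal (b n)) = ennreal (W n)" "0 \<le> W n" for n
    using Wf_finite[of "ennreal (b n)"] by (auto simp: W_def)
  \<comment> \<open>Convexity gives \<phi> \<epsilon> <= \<epsilon> \<phi> 1 for \<epsilon> <= 1, so
    the n-th piece has modular at most 1 / 2^(n+1).\<close>
  define \<epsilon> where "\<epsilon> n = (1/2) ^ Suc n / (1 + \<phi> 1 * W n)" for n
  have p: "0 \<le> \<phi> 1 * W n" for n using W phi_nonneg[of 1] by simp
  have \<epsilon>0: "0 < \<epsilon> n" for n using p[of n] by (auto simp: \<epsilon>_def intro!: divide_pos_pos)
  have \<epsilon>1: "\<epsilon> n \<le> 1" for n
  proof -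
    have "(1/2::real) ^ Suc n \<le> 1" by (rule power_le_one) auto
    also have "1 \<le> 1 + \<phi> 1 * W n" using p by simp
    finally show ?thesis using p[of n] by (simp add: \<epsilon>_def)
  qed
  have \<epsilon>2: "\<phi> (\<epsilon> n) * W n \<le> (1/2) ^ Suc n" for n
  proof -
    have "\<phi> (\<epsilon> n) \<le> \<epsilon> n * \<phi> 1" using phi_scale[of "\<epsilon> n" 1] \<epsilon>0[of n] \<epsilon>1[of n] by simp
    then have "\<phi> (\<epsilon> n) * W n \<le> \<epsilon> n * (\<phi> 1 * W n)" using W(2)[of n] by (simp add: mult_right_mono mult.assoc[symmetric])
    also have "\<dots> \<le> (1/2) ^ Suc n" unfolding \<epsilon>_def using p[of n] by (intro divide_one_plus_le) auto
    finally show ?thesis .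
  qed
  define X where "X t = (SUP n. ennreal (\<epsilon> n * w t) * indicator {t. ennreal t < ennreal (b n)} t)" for t
  have Xle: "X t \<le> ennreal (w t)" if "t \<in> I" for t
    unfolding X_def
  proof (rule SUP_least)
    fix n
    have "\<epsilon> n * w t \<le> 1 * w t" using \<epsilon>1 w_nonneg[OF that] by (intro mult_right_mono) auto
    then show "ennreal (\<epsilon> n * w t) * indicator {t. ennreal t < ennreal (b n)} t \<le> ennreal (w t)"
      by (auto simp: indicator_def intro: ennreal_leI)
  qed
  have Xfin: "X t < top" if "t \<in> I" for t using Xle[OF that] by (rule le_less_trans) simp
  have Xanti: "X t \<le> X s" if "s \<in> I" "t \<in> I" "s \<le> t" for s t
    unfolding X_def
  proof (rule SUP_mono)
    fix n
    have "\<epsilon> n * w t \<le> \<epsilon> n * w s" using w_antimono[OF that] \<epsilon>0[of n] by (intro mult_left_mono) auto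
    moreover have "ennreal t < ennreal (b n) \<Longrightarrow> ennreal s < ennreal (b n)"
      using that(3) by (meson ennreal_leI le_less_trans)
    ultimately show "\<exists>m\<in>UNIV. ennreal (\<epsilon> n * w t) * indicator {t. ennreal t < ennreal (b n)} t
        \<le> ennreal (\<epsilon> m * w s) * indicator {t. ennreal t < ennreal (b m)} s"
      by (intro bexI[of _ n]) (auto simp: indicator_def intro: ennreal_leI)
  qed
  define g0 where "g0 t = enn2real (X t)" for t
  obtain t0 where t0: "t0 \<in> I" using I_nonempty by blast
  have g0m: "g0 \<in> L0 I" unfolding g0_def by (rule rear_enn2real(1)[OF Xanti Xfin t0])
  have rg: "rear g0 t \<le> X t" if "t \<in> I" for t unfolding g0_def by (rule rear_enn2real(2)[OF Xanti Xfin that])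
  have pos: "0 < g0 t" if t: "t \<in> I" for t
  proof -
    obtain n where "t < b n" using b(3)[OF t] by auto
    then have "0 < ennreal (\<epsilon> n * w t) * indicator {t. ennreal t < ennreal (b n)} t"
      using I_pos[OF t] w_pos[OF t] \<epsilon>0[of n] by (simp add: ennreal_lessI ennreal_less_iff)
    also have "\<dots> \<le> X t" unfolding X_def by (intro SUP_upper) simp
    finally show ?thesis using Xfin[OF t] unfolding g0_def by (simp add: enn2real_positive_iff)
  qed
  have "Mod g0 \<le> (\<integral>\<^sup>+t. Ph (X t) (w t) \<partial>MI)" using rg by (rule Mod_le)
  also have "\<dots> \<le> (\<integral>\<^sup>+t. (\<Sum>n. ennreal (\<phi> (\<epsilon> n)) * (ennreal (w t) * indicator {t. ennreal t < ennreal (b n)} t)) \<partial>MI)"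
  proof (intro nn_integral_mono)
    fix t assume "t \<in> space MI"
    then have t: "0 < w t" using w_pos by simp
    have "Ph (X t) (w t) \<le> (\<Sum>n. Ph (ennreal (\<epsilon> n * w t) * indicator {t. ennreal t < ennreal (b n)} t) (w t))"
      unfolding X_def using t by (rule Ph_SUP_le_suminf)
    also have "\<dots> = (\<Sum>n. ennreal (\<phi> (\<epsilon> n)) * (ennreal (w t) * indicator {t. ennreal t < ennreal (b n)} t))"
    proof (intro suminf_cong)
      fix n
      have "Ph (ennreal (\<epsilon> n * w t)) (w t) = ennreal (\<phi> (\<epsilon> n)) * ennreal (w t)"
        using t \<epsilon>0[of n] by (subst Ph_ennreal) (auto simp: ennreal_mult phi_nonneg less_imp_le)
      then show "Ph (ennreal (\<epsilon> n * w t) * indicator {t. ennreal t < ennreal (b n)} t) (w t)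
          = ennreal (\<phi> (\<epsilon> n)) * (ennreal (w t) * indicator {t. ennreal t < ennreal (b n)} t)"
        by (cases "ennreal t < ennreal (b n)") simp_all
    qed
    finally show "Ph (X t) (w t) \<le> (\<Sum>n. ennreal (\<phi> (\<epsilon> n)) * (ennreal (w t) * indicator {t. ennreal t < ennreal (b n)} t))" .
  qed
  also have "\<dots> = (\<Sum>n. ennreal (\<phi> (\<epsilon> n)) * Wf (ennreal (b n)))"
    unfolding Wf_def by (subst nn_integral_suminf, measurable) (simp add: nn_integral_cmult)
  also have "\<dots> \<le> (\<Sum>n. ennreal ((1/2) ^ Suc n))"
  proof (intro suminf_le)
    fix n
    have "ennreal (\<phi> (\<epsilon> n)) * Wf (ennreal (b n)) = ennreal (\<phi> (\<epsilon> n) * W n)"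
      using W \<epsilon>0[of n] by (simp add: ennreal_mult phi_nonneg less_imp_le)
    then show "ennreal (\<phi> (\<epsilon> n)) * Wf (ennreal (b n)) \<le> ennreal ((1/2) ^ Suc n)"
      using \<epsilon>2[of n] by (auto intro: ennreal_leI)
  qed auto
  finally have "Mod g0 \<le> 1" by (simp only: suminf_half_pow)
  then show ?thesis using that g0m pos by blast
qed

text \<open>A gliding hump: M need not be linear, so the humps are rearranged decreasingly, where suprema are
  controlled, and the result is transplanted back along the level sets of \<open>h\<close>.\<close>

lemma sup_rear_modular:
  assumes g [measurable]: "\<And>n. g n \<in> L0 I" and 1: "\<And>n. Mod (g n) \<le> 1"
    and X: "X = (\<lambda>t. SUP n. ennreal ((1/2) ^ Suc n) * rear (g n) t)"
  shows "(\<integral>\<^sup>+t. Ph (X t) (w t) \<partial>MI) \<le> 1" "\<And>s t. s \<in> I \<Longrightarrow> t \<in> I \<Longrightarrow> s \<le> t \<Longrightarrow> X t \<le> X s"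
    "\<And>t. t \<in> I \<Longrightarrow> X t < top" "X \<in> borel_measurable borel"
proof -
  have "(\<integral>\<^sup>+t. Ph (X t) (w t) \<partial>MI) \<le> (\<integral>\<^sup>+t. (\<Sum>n. ennreal ((1/2) ^ Suc n) * Ph (rear (g n) t) (w t)) \<partial>MI)"
  proof (intro nn_integral_mono)
    fix t assume "t \<in> space MI"
    then have t: "0 < w t" using w_pos by simp
    have "Ph (X t) (w t) \<le> (\<Sum>n. Ph (ennreal ((1/2) ^ Suc n) * rear (g n) t) (w t))"
      unfolding X using t by (rule Ph_SUP_le_suminf)
    also have "\<dots> \<le> (\<Sum>n. ennreal ((1/2) ^ Suc n) * Ph (rear (g n) t) (w t))"
      using t by (intro suminf_le Ph_scale power_le_one) auto
    finally show "Ph (X t) (w t) \<le> (\<Sum>n. ennreal ((1/2) ^ Suc n) * Ph (rear (g n) t) (w t))" .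
  qed
  also have "\<dots> = (\<Sum>n. ennreal ((1/2) ^ Suc n) * Mod (g n))"
    unfolding Mod_eq by (subst nn_integral_suminf, measurable) (simp add: nn_integral_cmult)
  also have "\<dots> \<le> (\<Sum>n. ennreal ((1/2) ^ Suc n) * 1)"
    using 1 by (intro suminf_le mult_left_mono) auto
  finally show le: "(\<integral>\<^sup>+t. Ph (X t) (w t) \<partial>MI) \<le> 1" by (simp only: suminf_half_pow mult_1_right)
  show anti: "X t \<le> X s" if "s \<in> I" "t \<in> I" "s \<le> t" for s t
    unfolding X
  proof (rule SUP_mono)
    fix n show "\<exists>m\<in>UNIV. ennreal ((1/2) ^ Suc n) * rear (g n) t \<le> ennreal ((1/2) ^ Suc m) * rear (g m) s"
      by (intro bexI[of _ n] mult_left_mono rear_antimono g that) auto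
  qed
  show "X t < top" if "t \<in> I" for t
    by (rule modular_finite_imp_finite[OF anti _ that]) (use le in \<open>auto intro: le_less_trans\<close>)
  show "X \<in> borel_measurable borel" unfolding X by measurable
qed

text \<open>Transplanting along h requires a finite rearrangement, so this is secured beforehand: if
  it were infinite at x, then |h| > 4^n on sets of measure x / 2^(n+1), and the indicator of their
  union, an element of the class, would have an infinite integral against h. After that, functions
  of modular at most 1 with integrals above 4^n, damped by 1 / 2^(n+1), are merged into one element
  of the class with an infinite integral.\<close>

lemma koethe_dual_finite:
  assumes h: "h \<in> koethe_dual I Mcl"
  shows "Nd h < top"
proof (rule ccontr)
  assume "\<not> Nd h < top"
  then have inf: "Nd h = top" by (simp add: less_top[symmetric])
  have hm [measurable]: "h \<in> L0 I" using h by (simp add: koethe_dual_def)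
  have int: "(\<integral>\<^sup>+t. ennreal \<bar>h t * g t\<bar> \<partial>MI) \<noteq> top" if "g \<in> Mcl" for g
    using h that by (auto simp: koethe_dual_def integrable_iff_bounded)
  have fin: "rear h x < top" if x: "x \<in> I" for x
  proof (rule ccontr)
    assume "\<not> rear h x < top"
    then have top: "rear h x = top" by (simp add: less_top[symmetric])
    have x0: "0 < x" using I_pos[OF x] .
    have "\<exists>E. E \<in> sets MI \<and> E \<subseteq> {t\<in>I. 4 ^ n < \<bar>h t\<bar>} \<and> emeasure MI E = ennreal (x * (1/2) ^ Suc n)" for n :: nat
    proof -
      have "ennreal x < dist_f h (4 ^ n)" using rear_gt_iff[OF hm, of "4^n" x] top by simp
      moreover have "x * (1/2) ^ Suc n \<le> x * 1" using x0 by (intro mult_left_mono power_le_one) auto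
      then have "ennreal (x * (1/2) ^ Suc n) \<le> ennreal x" by (intro ennreal_leI) simp
      ultimately have le: "ennreal (x * (1/2) ^ Suc n) \<le> emeasure MI {t\<in>I. 4 ^ n < \<bar>h t\<bar>}"
        unfolding dist_f_eq by (meson less_imp_le order_trans)
      have "0 \<le> x * (1/2) ^ Suc n" using x0 by simp
      then have "\<exists>T. T \<in> sets borel \<and> emeasure MI ({t\<in>I. 4 ^ n < \<bar>h t\<bar>} \<inter> T) = ennreal (x * (1/2) ^ Suc n)"
        using le
      proof (rule chop_initial[OF pred_abs_greater[OF hm]])
        fix T assume "T \<in> sets borel" "emeasure MI ({t\<in>I. 4 ^ n < \<bar>h t\<bar>} \<inter> T) = ennreal (x * (1/2) ^ Suc n)"
        then show ?thesis by blast
      qed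
      then obtain T where T: "T \<in> sets borel" "emeasure MI ({t\<in>I. 4 ^ n < \<bar>h t\<bar>} \<inter> T) = ennreal (x * (1/2) ^ Suc n)"
        by blast
      have "T \<in> sets lebesgue" using T by simp
      then have "{t\<in>I. 4 ^ n < \<bar>h t\<bar>} \<inter> T \<in> sets MI"
        using pred_abs_greater[OF hm, of "4^n"] by (auto simp: sets_MI_iff intro: sets.Int)
      then show ?thesis using T(2) by blast
    qed
    then have "\<exists>E. \<forall>n. E n \<in> sets MI \<and> E n \<subseteq> {t\<in>I. 4 ^ n < \<bar>h t\<bar>} \<and> emeasure MI (E n) = ennreal (x * (1/2) ^ Suc n)"
      by (intro choice allI)
    then obtain E where E: "\<And>n. E n \<in> sets MI" "\<And>n. E n \<subseteq> {t\<in>I. 4 ^ n < \<bar>h t\<bar>}"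
      "\<And>n. emeasure MI (E n) = ennreal (x * (1/2) ^ Suc n)" by blast
    have "emeasure MI (\<Union>n. E n) \<le> (\<Sum>n. emeasure MI (E n))"
      using E(1) by (intro emeasure_subadditive_countably) auto
    also have "\<dots> = (\<Sum>n. ennreal x * ennreal ((1/2) ^ Suc n))"
      using x0 by (intro suminf_cong, unfold E(3), intro ennreal_mult') simp
    also have "\<dots> = ennreal x" by (simp only: ennreal_suminf_cmult suminf_half_pow mult_1_right)
    finally have Ule: "emeasure MI (\<Union>n. E n) \<le> ennreal x" .
    have Um [measurable]: "(\<Union>n. E n) \<in> sets MI" using E(1) by auto
    have im: "(indicator (\<Union>n. E n) :: real \<Rightarrow> real) \<in> L0 I" by (rule borel_measurable_indicator[OF Um])
    have "Mod (indicator (\<Union>n. E n)) < \<infinity>"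
      by (rule Mod_bounded_support[OF im Um Ule x, of 1]) auto
    then have mem: "indicator (\<Union>n. E n) \<in> Mcl" using im by (intro Mod_finite_imp_Mcl)
    have "ennreal (x / 2 * 2 ^ n) \<le> (\<integral>\<^sup>+t. ennreal \<bar>h t * indicator (\<Union>n. E n) t\<bar> \<partial>MI)" for n
    proof -
      have "ennreal (x / 2 * 2 ^ n) = ennreal (4 ^ n) * emeasure MI (E n)"
        using E(3) x0 by (simp add: power_divide power_mult_distrib[symmetric] flip: ennreal_mult)
          (simp add: field_simps flip: power_mult_distrib)
      also have "\<dots> = (\<integral>\<^sup>+t. ennreal (4 ^ n) * indicator (E n) t \<partial>MI)"
        using E(1) by (simp add: nn_integral_cmult_indicator)
      also have "\<dots> \<le> (\<integral>\<^sup>+t. ennreal \<bar>h t * indicator (\<Union>n. E n) t\<bar> \<partial>MI)"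
      proof (intro nn_integral_mono)
        fix t
        show "ennreal (4 ^ n) * indicator (E n) t \<le> ennreal \<bar>h t * indicator (\<Union>n. E n) t\<bar>"
          using E(2)[of n] by (cases "t \<in> E n") (auto simp: indicator_def intro!: ennreal_leI)
      qed
      finally show ?thesis .
    qed
    then have "(\<integral>\<^sup>+t. ennreal \<bar>h t * indicator (\<Union>n. E n) t\<bar> \<partial>MI) = top"
      using x0 by (intro ennreal_eq_topI[of "x / 2"]) auto
    then show False using int[OF mem] by simp
  qed
  have "\<exists>g. g \<in> L0 I \<and> Mod g \<le> 1 \<and> ennreal (4 ^ n) < (\<integral>\<^sup>+t. ennreal \<bar>h t * g t\<bar> \<partial>MI)" for n :: nat
  proof (rule ccontr)
    assume "\<not> ?thesis"
    then have "Nd h \<le> ennreal (4 ^ n)" by (intro Nd_least) (auto simp: not_less)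
    then show False using inf by (simp add: top_unique)
  qed
  then obtain g where g: "\<And>n. g n \<in> L0 I" "\<And>n. Mod (g n) \<le> 1"
    "\<And>n::nat. ennreal (4 ^ n) < (\<integral>\<^sup>+t. ennreal \<bar>h t * g n t\<bar> \<partial>MI)" by metis
  define X where "X = (\<lambda>t. SUP n. ennreal ((1/2) ^ Suc n) * rear (g n) t)"
  note X = sup_rear_modular[OF g(1,2) X_def]
  obtain k where k: "k \<in> L0 I" "\<And>t. 0 \<le> k t" "\<And>t. t \<in> I \<Longrightarrow> rear k t \<le> X t"
    "(\<integral>\<^sup>+t. rear h t * X t \<partial>MI) \<le> ennreal 2 * (\<integral>\<^sup>+t. ennreal \<bar>h t * k t\<bar> \<partial>MI)"
    using transplant[OF hm fin _ X(4) X(3) X(2), of 2] by auto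
  have "Mod k \<le> 1" using Mod_le[OF k(3)] X(1) by (rule order_trans)
  then have kM: "k \<in> Mcl" using k(1) by (intro Mod_le_1_imp_Mcl)
  have "ennreal (1 / 2 * 2 ^ n) \<le> (\<integral>\<^sup>+t. rear h t * X t \<partial>MI)" for n
  proof -
    have "ennreal (1 / 2 * 2 ^ n) = ennreal ((1/2) ^ Suc n) * ennreal (4 ^ n)"
      by (simp add: power_mult_distrib[symmetric] flip: ennreal_mult)
    also have "\<dots> \<le> ennreal ((1/2) ^ Suc n) * (\<integral>\<^sup>+t. rear h t * rear (g n) t \<partial>MI)"
      using g(3)[of n] Hardy_Littlewood[OF hm g(1), of n] by (intro mult_left_mono) auto
    also have "\<dots> = (\<integral>\<^sup>+t. ennreal ((1/2) ^ Suc n) * (rear h t * rear (g n) t) \<partial>MI)"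
      using g(1)[of n] by (intro nn_integral_cmult[symmetric]) measurable
    also have "\<dots> \<le> (\<integral>\<^sup>+t. rear h t * X t \<partial>MI)"
    proof (intro nn_integral_mono)
      fix t
      have "ennreal ((1/2) ^ Suc n) * rear (g n) t \<le> X t" unfolding X_def by (intro SUP_upper) simp
      then have "rear h t * (ennreal ((1/2) ^ Suc n) * rear (g n) t) \<le> rear h t * X t" by (rule mult_left_mono) simp
      then show "ennreal ((1/2) ^ Suc n) * (rear h t * rear (g n) t) \<le> rear h t * X t"
        by (simp only: mult.left_commute)
    qed
    finally show ?thesis .
  qed
  then have "(\<integral>\<^sup>+t. rear h t * X t \<partial>MI) = top" by (intro ennreal_eq_topI[of "1/2"]) auto
  then show False using k(4) int[OF kM] by (auto simp: top_unique ennreal_mult_eq_top_iff)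
qed

lemma koethe_dual_iff: "h \<in> koethe_dual I Mcl \<longleftrightarrow> h \<in> L0 I \<and> Nd h < top"
proof
  assume h: "h \<in> koethe_dual I Mcl"
  then show "h \<in> L0 I \<and> Nd h < top" using koethe_dual_finite[OF h] by (simp add: koethe_dual_def)
next
  assume "h \<in> L0 I \<and> Nd h < top"
  then have hm [measurable]: "h \<in> L0 I" and fin: "Nd h < top" by auto
  obtain r where r: "Nd h = ennreal r" "0 \<le> r" using fin by (cases "Nd h") auto
  have "integrable MI (\<lambda>t. h t * g t)" if g: "g \<in> Mcl" for g
  proof -
    have gm [measurable]: "g \<in> L0 I" and gf: "Nm g < top" using g by (auto simp: Mcl_iff)
    have "Nd (\<lambda>t. (1 / (r + 1)) * h t) = ennreal \<bar>1 / (r + 1)\<bar> * Nd h" by (rule Nd_cmult[OF hm])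
    also have "\<dots> \<le> 1" using r by (simp flip: ennreal_mult)
    finally have "(\<integral>\<^sup>+t. ennreal \<bar>(1 / (r + 1)) * h t * g t\<bar> \<partial>MI) \<le> Nm g"
      by (intro Nd_le_Nm) auto
    then have "(\<integral>\<^sup>+t. ennreal \<bar>(1 / (r + 1)) * h t * g t\<bar> \<partial>MI) < top" using gf by (rule le_less_trans)
    then have "integrable MI (\<lambda>t. (1 / (r + 1)) * h t * g t)" by (simp add: integrable_iff_bounded)
    then have "integrable MI (\<lambda>t. (r + 1) * ((1 / (r + 1)) * h t * g t))" by (rule integrable_mult_right)
    then show ?thesis using r by simp
  qed
  then show "h \<in> koethe_dual I Mcl" using hm by (simp add: koethe_dual_def)
qed

end

section \<open>Measurability of the conjugate function and of the subgradients\<close>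

context orlicz begin

lemma psi_measurable [measurable (raw)]: "f \<in> borel_measurable M \<Longrightarrow> (\<lambda>x. \<psi> (f x)) \<in> borel_measurable M"
proof -
  have [measurable]: "\<psi> \<in> borel_measurable borel" by (intro borel_measurable_mono monoI psi_mono)
  show "f \<in> borel_measurable M \<Longrightarrow> ?thesis" by measurable
qed

lemma q_measurable [measurable (raw)]: "f \<in> borel_measurable M \<Longrightarrow> (\<lambda>x. q (f x)) \<in> borel_measurable M"
proof -
  have [measurable]: "q \<in> borel_measurable borel" by (intro borel_measurable_mono monoI q_mono)
  show "f \<in> borel_measurable M \<Longrightarrow> ?thesis" by measurable
qed

lemma eta_measurable [measurable (raw)]: "f \<in> borel_measurable M \<Longrightarrow> (\<lambda>x. \<eta> (f x)) \<in> borel_measurable M"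
proof -
  have [measurable]: "\<eta> \<in> borel_measurable borel" by (intro borel_measurable_mono eta_mono)
  show "f \<in> borel_measurable M \<Longrightarrow> ?thesis" by measurable
qed

end

context orlicz_lorentz begin

subsection \<open>Submajorization in terms of set integrals\<close>

text \<open>Submajorization by w in a form that does not rearrange v. It passes to almost everywhere
  limits by Fatou and makes v a set function bounded by a concave function of the measure.\<close>

definition "below_W v \<longleftrightarrow> (\<forall>E\<in>sets MI. (\<integral>\<^sup>+t. ennreal (v t) * indicator E t \<partial>MI) \<le> Wf (emeasure MI E))"

lemma rear_w_le: "t \<in> I \<Longrightarrow> rear w t \<le> ennreal (w t)"
proof (rule rear_le_antimono[OF w_measurable])
  fix y :: real assume "0 \<le> y"
  then have "{s\<in>I. y < \<bar>w s\<bar>} = {s\<in>I. ennreal y < ennreal (w s)}"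
    by (auto simp: ennreal_less_iff w_nonneg)
  then show "dist_f w y \<le> emeasure MI {s \<in> I. ennreal y < ennreal (w s)}" by (simp add: dist_f_eq)
qed (auto intro: ennreal_leI w_antimono)

text \<open>Submajorization speaks of t in \<open>I\<close>, whereas the measure of E can be
  infinite or the full length. E is therefore exhausted by its parts below \<open>b n\<close>, whose
  measure is 0 or a point of \<open>I\<close>.\<close>

lemma submajorized_below_W:
  assumes v [measurable]: "v \<in> L0 I" and v0: "\<And>t. t \<in> I \<Longrightarrow> 0 \<le> v t" and sub: "submajorized I v w"
  shows "below_W v"
  unfolding below_W_def
proof
  fix E assume E [measurable]: "E \<in> sets MI"
  obtain b :: "nat \<Rightarrow> real" where b: "incseq b" "\<And>n. b n \<in> I" "\<And>t. t \<in> I \<Longrightarrow> \<exists>n. t < b n"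
    by (rule I_exhaustion) blast
  define En where "En n = E \<inter> {..<b n}" for n
  have EI: "E \<subseteq> I" "E \<in> sets lebesgue" using E by (auto simp: sets_MI_iff)
  have Em [measurable]: "En n \<in> sets MI" for n using EI by (auto simp: sets_MI_iff En_def)
  let ?\<nu> = "density MI (\<lambda>t. ennreal (v t))"
  have \<nu>: "emeasure ?\<nu> A = (\<integral>\<^sup>+t. ennreal (v t) * indicator A t \<partial>MI)" if "A \<in> sets MI" for A
    using that by (subst emeasure_density) auto
  have "(\<lambda>n. emeasure ?\<nu> (En n)) \<longlonglongrightarrow> emeasure ?\<nu> (\<Union>n. En n)"
  proof (rule Lim_emeasure_incseq)
    show "range En \<subseteq> sets ?\<nu>" using Em by auto
    show "incseq En" using b(1) unfolding incseq_def En_def by (auto intro: less_le_trans)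
  qed
  also have "(\<Union>n. En n) = E" using b(3) EI by (auto simp: En_def)
  finally have lim: "(\<lambda>n. emeasure ?\<nu> (En n)) \<longlonglongrightarrow> emeasure ?\<nu> E" .
  have "emeasure ?\<nu> (En n) \<le> Wf (emeasure MI E)" for n
  proof -
    have le: "emeasure MI (En n) \<le> ennreal (b n)" unfolding En_def by (rule emeasure_below_le[OF EI(1)])
    obtain r where r: "emeasure MI (En n) = ennreal r" "0 \<le> r" using le by (cases "emeasure MI (En n)") (auto simp: top_unique)
    show ?thesis
    proof (cases "r = 0")
      case True
      then have "En n \<in> null_sets MI" using r Em by (intro null_setsI) auto
      then have "emeasure ?\<nu> (En n) = 0" unfolding \<nu>[OF Em]
        by (intro nn_integral_0_iff_AE[THEN iffD2]) (auto dest!: AE_not_in elim!: eventually_mono)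
      then show ?thesis by simp
    next
      case False
      have "r \<le> b n" using le r I_pos[OF b(2)[of n]] by simp
      then have rI: "r \<in> I" using I_down[OF b(2)[of n]] False r by simp
      have "emeasure ?\<nu> (En n) = (\<integral>\<^sup>+t. ennreal \<bar>v t\<bar> * indicator (En n) t \<partial>MI)"
        unfolding \<nu>[OF Em] by (intro nn_integral_cong) (simp add: v0)
      also have "\<dots> \<le> (\<integral>\<^sup>+t. rear v t * indicator {t. ennreal t < ennreal r} t \<partial>MI)"
        using set_nn_integral_le_rear[OF v Em, of n] r by simp
      also have "\<dots> = (\<integral>\<^sup>+ s\<in>{0<..<r}. rear v s \<partial>lebesgue)" by (rule initial_integral[OF rI, symmetric])
      also have "\<dots> \<le> (\<integral>\<^sup>+ s\<in>{0<..<r}. rear w s \<partial>lebesgue)" using sub rI by (simp add: submajorized_def)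
      also have "\<dots> = (\<integral>\<^sup>+t. rear w t * indicator {t. ennreal t < ennreal r} t \<partial>MI)" by (rule initial_integral[OF rI])
      also have "\<dots> \<le> Wf (ennreal r)" unfolding Wf_def
        by (intro nn_integral_mono mult_right_mono) (auto intro: rear_w_le)
      also have "\<dots> \<le> Wf (emeasure MI E)" unfolding r(1)[symmetric]
        by (intro Wf_mono emeasure_mono E) (auto simp: En_def)
      finally show ?thesis .
    qed
  qed
  then have "emeasure ?\<nu> E \<le> Wf (emeasure MI E)" by (intro LIMSEQ_le_const2[OF lim]) auto
  then show "(\<integral>\<^sup>+t. ennreal (v t) * indicator E t \<partial>MI) \<le> Wf (emeasure MI E)" by (simp add: \<nu>)
qed

text \<open>Transplanting the indicator of (0,t) along the truncated v produces a g between 0 and 1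
  almost everywhere, carried by a set of measure at most t, so the bound on set integrals applies.
  Truncation at n makes the rearrangement finite, as transplanting requires.\<close>

lemma below_W_submajorized:
  assumes v [measurable]: "v \<in> L0 I" and v0: "\<And>t. t \<in> I \<Longrightarrow> 0 \<le> v t" and sub: "below_W v"
  shows "submajorized I v w"
  unfolding submajorized_def
proof
  fix t assume t: "t \<in> I"
  let ?J = "{s. ennreal s < ennreal t}"
  define u where "u n s = min (v s) (real n)" for n s
  have um [measurable]: "u n \<in> L0 I" for n unfolding u_def by measurable
  have ulim: "(\<lambda>n. u n s) \<longlonglongrightarrow> v s" for s
  proof (rule tendsto_eventually)
    obtain n where "v s \<le> real n" using real_arch_simple by blast
    then show "\<forall>\<^sub>F n in sequentially. u n s = v s"
      by (auto simp: eventually_sequentially u_def intro!: exI[of _ n])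
  qed
  have "(\<integral>\<^sup>+s. rear (u n) s * indicator ?J s \<partial>MI) \<le> Wf (ennreal t)" for n
  proof (rule ennreal_le_mult_all)
    fix \<beta> :: real assume \<beta>: "1 < \<beta>"
    have fin: "rear (u n) x < top" if "x \<in> I" for x
    proof -
      have "dist_f (u n) (real n) = emeasure MI {}" unfolding dist_f_eq
        by (rule arg_cong[of _ _ "emeasure MI"]) (use v0 in \<open>auto simp: u_def\<close>)
      then have "\<not> ennreal (real n) < rear (u n) x" using rear_gt_iff[OF um, of "real n" n x] by simp
      then show ?thesis by (auto intro: le_less_trans simp: not_less)
    qed
    define G where "G s = (indicator ?J s :: ennreal)" for s
    obtain g where g [measurable]: "g \<in> L0 I" and g0: "\<And>t. 0 \<le> g t" and rg: "\<And>t. t \<in> I \<Longrightarrow> rear g t \<le> G t"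
      and le: "(\<integral>\<^sup>+s. rear (u n) s * G s \<partial>MI) \<le> ennreal \<beta> * (\<integral>\<^sup>+s. ennreal \<bar>u n s * g s\<bar> \<partial>MI)"
    proof (rule transplant[OF um[of n] fin \<beta>, where G=G])
      show "G \<in> borel_measurable borel" unfolding G_def by measurable
      show "G x < top" for x by (cases "ennreal x < ennreal t") (simp_all add: G_def)
      show "G s' \<le> G s" if "s \<in> I" "s' \<in> I" "s \<le> s'" for s s'
        using that by (auto simp: G_def indicator_def ennreal_less_I_iff)
    qed (auto simp: G_def)
    define F where "F = {s\<in>I. 0 < \<bar>g s\<bar>}"
    have Fm [measurable]: "F \<in> sets MI" unfolding F_def by (rule pred_abs_greater[OF g])
    have "\<not> ennreal 0 < rear g t" using rg[OF t] by (auto simp: G_def)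
    then have "emeasure MI F \<le> ennreal t" using rear_gt_iff[OF g, of 0 t] by (simp add: F_def dist_f_eq)
    have "\<not> ennreal 1 < rear g s" if "s \<in> I" for s
      using rg[OF that] by (auto simp: G_def indicator_def not_less intro: order_trans)
    then have "\<not> ennreal s < dist_f g 1" if "s \<in> I" for s using rear_gt_iff[OF g, of 1 s] that by simp
    then have "dist_f g 1 = 0"
    proof -
      assume *: "\<And>s. s \<in> I \<Longrightarrow> \<not> ennreal s < dist_f g 1"
      show ?thesis
      proof (rule ccontr)
        assume "dist_f g 1 \<noteq> 0"
        then have "0 < dist_f g 1" by (simp add: zero_less_iff_neq_zero)
        then obtain e where e: "0 < e" "e < dist_f g 1" using dense by blast
        then obtain s where s: "e = ennreal s" "0 \<le> s" by (cases e) auto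
        have "s \<in> I" unfolding mem_I_iff using e s dist_f_le_len[OF g, of 1] by (auto intro: less_le_trans)
        then show False using * e s by auto
      qed
    qed
    then have "AE s in MI. s \<notin> {s\<in>I. 1 < \<bar>g s\<bar>}"
      unfolding dist_f_eq using pred_abs_greater[OF g, of 1] by (intro AE_not_in null_setsI)
    then have g1: "AE s in MI. g s \<le> 1" by (rule AE_mp) (rule AE_I2, auto simp: not_less)
    have "(\<integral>\<^sup>+s. ennreal \<bar>u n s * g s\<bar> \<partial>MI) \<le> (\<integral>\<^sup>+s. ennreal (v s) * indicator F s \<partial>MI)"
    proof (rule nn_integral_mono_AE)
      show "AE s in MI. ennreal \<bar>u n s * g s\<bar> \<le> ennreal (v s) * indicator F s"
        using g1
      proof (rule AE_mp, intro AE_I2 impI)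
        fix s assume s: "s \<in> space MI" and 1: "g s \<le> 1"
        then have "v s \<ge> 0" using v0 by simp
        then have "\<bar>u n s * g s\<bar> \<le> v s * 1"
          unfolding abs_mult using 1 g0[of s] by (intro mult_mono) (auto simp: u_def)
        then show "ennreal \<bar>u n s * g s\<bar> \<le> ennreal (v s) * indicator F s"
          using s g0[of s] by (cases "g s = 0") (auto simp: F_def intro: ennreal_leI)
      qed
    qed
    also have "\<dots> \<le> Wf (emeasure MI F)" using sub Fm by (simp add: below_W_def)
    also have "\<dots> \<le> Wf (ennreal t)" by (intro Wf_mono) fact
    finally have "ennreal \<beta> * (\<integral>\<^sup>+s. ennreal \<bar>u n s * g s\<bar> \<partial>MI) \<le> ennreal \<beta> * Wf (ennreal t)"
      by (rule mult_left_mono) simp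
    then show "(\<integral>\<^sup>+s. rear (u n) s * indicator ?J s \<partial>MI) \<le> ennreal \<beta> * Wf (ennreal t)"
      using le unfolding G_def by (rule order_trans[rotated])
  qed
  then have bd: "liminf (\<lambda>n. \<integral>\<^sup>+s. rear (u n) s * indicator ?J s \<partial>MI) \<le> Wf (ennreal t)"
    by (intro Liminf_le) auto
  have "(\<integral>\<^sup>+ s\<in>{0<..<t}. rear v s \<partial>lebesgue) = (\<integral>\<^sup>+s. rear v s * indicator ?J s \<partial>MI)" by (rule initial_integral[OF t])
  also have "\<dots> \<le> (\<integral>\<^sup>+s. liminf (\<lambda>n. rear (u n) s * indicator ?J s) \<partial>MI)"
  proof (intro nn_integral_mono)
    fix s
    have "rear v s \<le> liminf (\<lambda>n. rear (u n) s)" using ulim by (intro rear_le_liminf) auto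
    then show "rear v s * indicator ?J s \<le> liminf (\<lambda>n. rear (u n) s * indicator ?J s)"
      by (cases "s \<in> ?J") simp_all
  qed
  also have "\<dots> \<le> liminf (\<lambda>n. \<integral>\<^sup>+s. rear (u n) s * indicator ?J s \<partial>MI)"
    by (rule nn_integral_liminf) measurable
  also have "\<dots> \<le> Wf (ennreal t)" by (rule bd)
  also have "\<dots> = (\<integral>\<^sup>+s. ennreal \<bar>w s\<bar> * indicator {s\<in>I. ennreal s < ennreal t} s \<partial>MI)"
    unfolding Wf_def by (intro nn_integral_cong) (auto simp: indicator_def w_nonneg)
  also have "\<dots> \<le> (\<integral>\<^sup>+s. rear w s * indicator {s. ennreal s < emeasure MI {s\<in>I. ennreal s < ennreal t}} s \<partial>MI)"
    by (rule set_nn_integral_le_rear) measurable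
  also have "emeasure MI {s\<in>I. ennreal s < ennreal t} = ennreal t"
    unfolding emeasure_initial using t mem_I_iff[of t] by (simp add: min_def less_imp_le)
  also have "(\<integral>\<^sup>+s. rear w s * indicator ?J s \<partial>MI) = (\<integral>\<^sup>+ s\<in>{0<..<t}. rear w s \<partial>lebesgue)"
    by (rule initial_integral[OF t, symmetric])
  finally show "(\<integral>\<^sup>+ s\<in>{0<..<t}. rear v s \<partial>lebesgue) \<le> (\<integral>\<^sup>+ s\<in>{0<..<t}. rear w s \<partial>lebesgue)" .
qed

subsection \<open>Integrals of increasing functions against v and w\<close>

lemma psi_superlevel_real:
  assumes "0 \<le> y"
  obtains s where "0 \<le> s" "\<And>z. 0 \<le> z \<Longrightarrow> ennreal y < ennreal (\<psi> z) \<longleftrightarrow> s < z"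
  using psi_superlevel[OF assms] assms psi_nonneg by (auto simp: ennreal_less_iff)

lemma w_superlevel:
  assumes h [measurable]: "h \<in> L0 I" and fin: "\<And>t. t \<in> I \<Longrightarrow> rear h t < top" and s: "0 \<le> s"
  shows "(\<integral>\<^sup>+t. ennreal (w t) * indicator {t. s < enn2real (rear h t)} t \<partial>MI) = Wf (dist_f h s)"
  unfolding Wf_def
proof (intro nn_integral_cong)
  fix t assume "t \<in> space MI"
  then have "s < enn2real (rear h t) \<longleftrightarrow> ennreal s < rear h t" using fin[of t] s
    by (cases "rear h t") (auto simp: ennreal_less_iff)
  also have "\<dots> \<longleftrightarrow> ennreal t < dist_f h s" by (rule rear_gt_iff[OF h s])
  finally show "ennreal (w t) * indicator {t. s < enn2real (rear h t)} t = ennreal (w t) * indicator {t. ennreal t < dist_f h s} t"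
    by (simp add: indicator_def)
qed

text \<open>By \<open>psi_superlevel\<close> the superlevel sets of both integrands are described by
  one number s: the set where h > s, and the initial segment of the same length. The integrals
  compare as soon as these do. The upper estimate serves the Hoelder inequality, the lower one
  serves level functions.\<close>

lemma psi_integral_cases:
  assumes h [measurable]: "h \<in> L0 I" and h0: "\<And>t. t \<in> I \<Longrightarrow> 0 \<le> h t"
    and fin: "\<And>t. t \<in> I \<Longrightarrow> rear h t < top" and v [measurable]: "v \<in> L0 I"
  shows psi_integral_le: "(\<And>s. 0 \<le> s \<Longrightarrow> (\<integral>\<^sup>+t. ennreal (v t) * indicator {t\<in>I. s < h t} t \<partial>MI) \<le> Wf (dist_f h s)) \<Longrightarrow>
      (\<integral>\<^sup>+t. ennreal (v t) * ennreal (\<psi> (h t)) \<partial>MI) \<le> (\<integral>\<^sup>+t. ennreal (w t) * ennreal (\<psi> (enn2real (rear h t))) \<partial>MI)"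
    and psi_integral_ge: "(\<And>s. 0 \<le> s \<Longrightarrow> Wf (dist_f h s) \<le> (\<integral>\<^sup>+t. ennreal (v t) * indicator {t\<in>I. s < h t} t \<partial>MI)) \<Longrightarrow>
      (\<integral>\<^sup>+t. ennreal (w t) * ennreal (\<psi> (enn2real (rear h t))) \<partial>MI) \<le> (\<integral>\<^sup>+t. ennreal (v t) * ennreal (\<psi> (h t)) \<partial>MI)"
proof -
  have *: "\<exists>s\<ge>0. (\<integral>\<^sup>+t. ennreal (v t) * indicator {t. ennreal y < ennreal (\<psi> (h t))} t \<partial>MI) = (\<integral>\<^sup>+t. ennreal (v t) * indicator {t\<in>I. s < h t} t \<partial>MI)
     \<and> (\<integral>\<^sup>+t. ennreal (w t) * indicator {t. ennreal y < ennreal (\<psi> (enn2real (rear h t)))} t \<partial>MI) = Wf (dist_f h s)"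
    if y: "0 \<le> y" for y
  proof -
    obtain s where s: "0 \<le> s" "\<And>z. 0 \<le> z \<Longrightarrow> ennreal y < ennreal (\<psi> z) \<longleftrightarrow> s < z"
      by (rule psi_superlevel_real[OF y]) blast
    have "(\<integral>\<^sup>+t. ennreal (v t) * indicator {t. ennreal y < ennreal (\<psi> (h t))} t \<partial>MI) = (\<integral>\<^sup>+t. ennreal (v t) * indicator {t\<in>I. s < h t} t \<partial>MI)"
      using s(2) h0 by (intro nn_integral_cong) (auto simp: indicator_def)
    moreover have "(\<integral>\<^sup>+t. ennreal (w t) * indicator {t. ennreal y < ennreal (\<psi> (enn2real (rear h t)))} t \<partial>MI) = Wf (dist_f h s)"
      unfolding s(2)[OF enn2real_nonneg] by (rule w_superlevel[OF h fin s(1)])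
    ultimately show ?thesis using s(1) by blast
  qed
  {
    assume le: "\<And>s. 0 \<le> s \<Longrightarrow> (\<integral>\<^sup>+t. ennreal (v t) * indicator {t\<in>I. s < h t} t \<partial>MI) \<le> Wf (dist_f h s)"
    show "(\<integral>\<^sup>+t. ennreal (v t) * ennreal (\<psi> (h t)) \<partial>MI) \<le> (\<integral>\<^sup>+t. ennreal (w t) * ennreal (\<psi> (enn2real (rear h t))) \<partial>MI)"
    proof (rule nn_integral_mono_superlevel[OF sigma_finite_MI _ _ sigma_finite_MI])
      fix y :: real assume "0 \<le> y"
      then show "(\<integral>\<^sup>+x. ennreal (v x) * indicator {x. ennreal y < ennreal (\<psi> (h x))} x \<partial>MI)
         \<le> (\<integral>\<^sup>+x. ennreal (w x) * indicator {x. ennreal y < ennreal (\<psi> (enn2real (rear h x)))} x \<partial>MI)"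
        using *[of y] le by auto
    qed measurable
  next
    assume le: "\<And>s. 0 \<le> s \<Longrightarrow> Wf (dist_f h s) \<le> (\<integral>\<^sup>+t. ennreal (v t) * indicator {t\<in>I. s < h t} t \<partial>MI)"
    show "(\<integral>\<^sup>+t. ennreal (w t) * ennreal (\<psi> (enn2real (rear h t))) \<partial>MI) \<le> (\<integral>\<^sup>+t. ennreal (v t) * ennreal (\<psi> (h t)) \<partial>MI)"
    proof (rule nn_integral_mono_superlevel[OF sigma_finite_MI _ _ sigma_finite_MI])
      fix y :: real assume "0 \<le> y"
      then show "(\<integral>\<^sup>+x. ennreal (w x) * indicator {x. ennreal y < ennreal (\<psi> (enn2real (rear h x)))} x \<partial>MI)
         \<le> (\<integral>\<^sup>+x. ennreal (v x) * indicator {x. ennreal y < ennreal (\<psi> (h x))} x \<partial>MI)"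
        using *[of y] le by auto
    qed measurable
  }
qed

text \<open>Hardy-Littlewood, followed by the Young inequality at the pair
  \<open>rear g t / w t\<close> and \<open>rear h t\<close>, multiplied by
  \<open>w t\<close>.\<close>

lemma Nd_le_psi:
  assumes h [measurable]: "h \<in> L0 I" and fin: "\<And>t. t \<in> I \<Longrightarrow> rear h t < top"
  shows "Nd h \<le> 1 + (\<integral>\<^sup>+t. ennreal (w t) * ennreal (\<psi> (enn2real (rear h t))) \<partial>MI)"
proof (rule Nd_least)
  fix g assume g [measurable]: "g \<in> L0 I" and 1: "Mod g \<le> 1"
  have "(\<integral>\<^sup>+t. ennreal \<bar>h t * g t\<bar> \<partial>MI) \<le> (\<integral>\<^sup>+t. rear h t * rear g t \<partial>MI)"
    by (rule Hardy_Littlewood[OF h g])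
  also have "\<dots> \<le> (\<integral>\<^sup>+t. Ph (rear g t) (w t) + ennreal (w t) * ennreal (\<psi> (enn2real (rear h t))) \<partial>MI)"
  proof (intro nn_integral_mono)
    fix t assume "t \<in> space MI"
    then have t: "t \<in> I" "0 < w t" using w_pos by auto
    obtain H where H: "rear h t = ennreal H" "0 \<le> H" using fin[OF t(1)] by (cases "rear h t") auto
    show "rear h t * rear g t \<le> Ph (rear g t) (w t) + ennreal (w t) * ennreal (\<psi> (enn2real (rear h t)))"
    proof (cases "rear g t")
      case (real r)
      have "H * (r / w t) * w t \<le> (\<phi> (r / w t) + \<psi> H) * w t"
        using young[of "r / w t" H] real t by (intro mult_right_mono) auto
      then have "H * r \<le> \<phi> (r / w t) * w t + w t * \<psi> H" using t by (simp add: algebra_simps)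
      then show ?thesis using real H t phi_nonneg[of "r / w t"] psi_nonneg
        by (simp add: Ph_ennreal flip: ennreal_mult ennreal_plus)
    qed simp
  qed
  also have "\<dots> = Mod g + (\<integral>\<^sup>+t. ennreal (w t) * ennreal (\<psi> (enn2real (rear h t))) \<partial>MI)"
    unfolding Mod_eq by (subst nn_integral_add, measurable)
  also have "\<dots> \<le> 1 + (\<integral>\<^sup>+t. ennreal (w t) * ennreal (\<psi> (enn2real (rear h t))) \<partial>MI)"
    using 1 by (rule add_right_mono)
  finally show "(\<integral>\<^sup>+t. ennreal \<bar>h t * g t\<bar> \<partial>MI) \<le> 1 + (\<integral>\<^sup>+t. ennreal (w t) * ennreal (\<psi> (enn2real (rear h t))) \<partial>MI)" .
qed

text \<open>The product V w is decreasing and can be transplanted along h; dividing by w inside the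
  modular gives back V, so the transplanted function has modular at most 1.\<close>

lemma Nd_ge_antimono:
  assumes h [measurable]: "h \<in> L0 I" and fin: "\<And>t. t \<in> I \<Longrightarrow> rear h t < top"
    and V: "\<And>s t. s \<in> I \<Longrightarrow> t \<in> I \<Longrightarrow> s \<le> t \<Longrightarrow> V t \<le> V s" "\<And>t. t \<in> I \<Longrightarrow> 0 \<le> V t"
    and 1: "(\<integral>\<^sup>+t. ennreal (\<phi> (V t) * w t) \<partial>MI) \<le> 1"
  shows "(\<integral>\<^sup>+t. rear h t * ennreal (V t * w t) \<partial>MI) \<le> Nd h"
proof (rule ennreal_le_mult_all)
  fix \<beta> :: real assume \<beta>: "1 < \<beta>"
  define G where "G t = ennreal (V t * w t) * indicator I t" for t
  have anti: "ennreal (V t * w t) \<le> ennreal (V s * w s)" if "s \<in> I" "t \<in> I" "s \<le> t" for s t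
    using that V by (intro ennreal_leI mult_mono w_antimono) (auto simp: w_nonneg)
  obtain g where g [measurable]: "g \<in> L0 I" and rg: "\<And>t. t \<in> I \<Longrightarrow> rear g t \<le> G t"
    and le: "(\<integral>\<^sup>+s. rear h s * G s \<partial>MI) \<le> ennreal \<beta> * (\<integral>\<^sup>+s. ennreal \<bar>h s * g s\<bar> \<partial>MI)"
  proof (rule transplant[OF h fin \<beta>, where G=G])
    show "G \<in> borel_measurable borel" unfolding G_def by (rule antimono_borel[OF anti])
    show "G s' \<le> G s" if "s \<in> I" "s' \<in> I" "s \<le> s'" for s s'
      using anti[OF that] that by (simp add: G_def)
  qed (auto simp: G_def)
  have "Mod g \<le> (\<integral>\<^sup>+t. Ph (G t) (w t) \<partial>MI)" by (rule Mod_le[OF rg])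
  also have "\<dots> = (\<integral>\<^sup>+t. ennreal (\<phi> (V t) * w t) \<partial>MI)"
  proof (intro nn_integral_cong)
    fix t assume "t \<in> space MI"
    then have t: "t \<in> I" by simp
    then show "Ph (G t) (w t) = ennreal (\<phi> (V t) * w t)"
      using w_pos[OF t] V(2)[OF t] unfolding G_def by (simp del: ennreal_mult'' add: Ph_ennreal)
  qed
  finally have "Mod g \<le> 1" using 1 by simp
  then have "(\<integral>\<^sup>+s. ennreal \<bar>h s * g s\<bar> \<partial>MI) \<le> Nd h" by (rule Nd_upper[OF g])
  then have "ennreal \<beta> * (\<integral>\<^sup>+s. ennreal \<bar>h s * g s\<bar> \<partial>MI) \<le> ennreal \<beta> * Nd h" by (rule mult_left_mono) simp
  moreover have "(\<integral>\<^sup>+t. rear h t * ennreal (V t * w t) \<partial>MI) = (\<integral>\<^sup>+s. rear h s * G s \<partial>MI)"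
    by (intro nn_integral_cong) (simp add: G_def)
  ultimately show "(\<integral>\<^sup>+t. rear h t * ennreal (V t * w t) \<partial>MI) \<le> ennreal \<beta> * Nd h"
    using le by (auto intro: order_trans)
qed

text \<open>A nearly optimal decreasing test function \<open>V\<close> for \<open>h\<close> interpolates between the maximizers \<open>q (c * H)\<close> and
  \<open>q (\<kappa> * c * H)\<close> of the Young inequality; \<open>q\<close> may jump, so a single scale \<open>c\<close> need not give modular one.\<close>

lemma amemiya_le_Nd:
  assumes h [measurable]: "h \<in> L0 I" and h0: "\<And>t. t \<in> I \<Longrightarrow> 0 \<le> h t"
    and B: "0 \<le> B" "\<And>t. t \<in> I \<Longrightarrow> h t \<le> B * indicator E t"
    and E: "E \<in> sets MI" "emeasure MI E \<le> ennreal b" and b: "b \<in> I"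
    and \<kappa>: "1 < \<kappa>" and nn: "dist_f h 0 \<noteq> 0"
  shows "\<exists>c>0. 1 + (\<integral>\<^sup>+t. ennreal (w t) * ennreal (\<psi> (enn2real (rear (\<lambda>t. c * h t) t))) \<partial>MI) \<le> ennreal (\<kappa> * c) * Nd h"
proof -
  have B': "\<bar>h t\<bar> \<le> B * indicator E t" if "t \<in> I" for t using h0[OF that] B(2)[OF that] by simp
  define H where "H t = enn2real (rear h t)" for t
  have rB: "rear h t \<le> ennreal B" for t by (rule rear_bounded_support(1)[OF h E B(1) B'])
  have rfin: "rear h t < top" for t using rB[of t] by (rule le_less_trans) simp
  have rH: "rear h t = ennreal (H t)" for t using rfin[of t] by (simp add: H_def)
  have H0: "0 \<le> H t" for t by (simp add: H_def)
  have HB: "H t \<le> B" for t using rB[of t] B(1) rH[of t] by simp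
  have Hb: "H t = 0" if "b \<le> t" for t using rear_bounded_support(2)[OF h E B(1) B' that] by (simp add: H_def)
  have Hanti: "H t \<le> H s" if "s \<le> t" for s t using rear_antimono[OF h that] H0 by (simp add: rH)
  have Hm [measurable]: "H \<in> L0 I" unfolding H_def by measurable
  \<comment> \<open>The integral that becomes the modular of the test function
    \<open>q (c * H t) * w t\<close>; a scale c at which it equals 1 would make the Young inequality
    sharp.\<close>
  define S where "S c = (\<integral>\<^sup>+t. ennreal (\<phi> (q (c * H t)) * w t) \<partial>MI)" for c
  obtain Wb where Wb: "Wf (ennreal b) = ennreal Wb" "0 \<le> Wb"
    using Wf_finite[of "ennreal b"] by (cases "Wf (ennreal b)") auto
  define ind where "ind t = (indicator {t. ennreal t < ennreal b} t :: real)" for t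
  have indm [measurable]: "ind \<in> L0 I" unfolding ind_def by (rule borel_imp_MI) measurable
  have ind_eq: "ind t = (if t < b then 1 else 0)" if "t \<in> I" for t
    using ennreal_less_I_iff[OF that, of b] by (simp add: ind_def)
  have cW: "(\<integral>\<^sup>+t. ennreal (x * (w t * ind t)) \<partial>MI) = ennreal (x * Wb)" if "0 \<le> x" for x
  proof -
    have "(\<integral>\<^sup>+t. ennreal (x * (w t * ind t)) \<partial>MI) = (\<integral>\<^sup>+t. ennreal x * (ennreal (w t) * indicator {t. ennreal t < ennreal b} t) \<partial>MI)"
      using that by (intro nn_integral_cong) (auto simp: ind_def indicator_def ennreal_mult w_nonneg)
    also have "\<dots> = ennreal x * Wf (ennreal b)" unfolding Wf_def by (rule nn_integral_cmult) measurable
    finally show ?thesis using that Wb by (simp add: ennreal_mult)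
  qed
  have small: "\<exists>c>0. S c \<le> 1"
  proof -
    define \<epsilon> where "\<epsilon> = 1 / (1 + \<phi> 1 * Wb)"
    have p: "0 \<le> \<phi> 1 * Wb" using Wb phi_nonneg[of 1] by simp
    have \<epsilon>: "0 < \<epsilon>" "\<epsilon> \<le> 1" using p by (auto simp: \<epsilon>_def)
    have "\<phi> \<epsilon> \<le> \<epsilon> * \<phi> 1" using phi_scale[of \<epsilon> 1] \<epsilon> by simp
    then have "\<phi> \<epsilon> * Wb \<le> \<epsilon> * \<phi> 1 * Wb" using Wb by (intro mult_right_mono) auto
    also have "\<dots> = 1 / (1 + \<phi> 1 * Wb) * (\<phi> 1 * Wb)" by (simp add: \<epsilon>_def)
    also have "\<dots> \<le> 1" using p by (intro divide_one_plus_le) auto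
    finally have \<epsilon>W: "\<phi> \<epsilon> * Wb \<le> 1" .
    \<comment> \<open>Small enough that c B lies below \<phi> \<epsilon> / \<epsilon>;
      \<open>q_small\<close> then bounds the maximizers by \<epsilon>.\<close>
    define c where "c = \<phi> \<epsilon> / \<epsilon> / (2 * (B + 1))"
    have c: "0 < c" using phi_pos[of \<epsilon>] \<epsilon> B by (simp add: c_def)
    have "c * B < \<phi> \<epsilon> / \<epsilon>"
    proof -
      have "0 < \<phi> \<epsilon> / \<epsilon>" using phi_pos[of \<epsilon>] \<epsilon> by simp
      moreover have "c * B = \<phi> \<epsilon> / \<epsilon> * (B / (2 * (B + 1)))" by (simp add: c_def)
      moreover have "B / (2 * (B + 1)) < 1" using B by simp
      ultimately show ?thesis using mult_strict_left_mono[of "B / (2 * (B + 1))" 1 "\<phi> \<epsilon> / \<epsilon>"] by simp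
    qed
    then have q: "q (c * H t) \<le> \<epsilon>" for t
      using \<epsilon> HB[of t] c by (intro q_small) (auto intro: le_less_trans[OF mult_left_mono])
    have "S c \<le> (\<integral>\<^sup>+t. ennreal (\<phi> \<epsilon> * (w t * ind t)) \<partial>MI)"
      unfolding S_def
    proof (intro nn_integral_mono ennreal_leI)
      fix t assume "t \<in> space MI"
      then have t: "t \<in> I" by simp
      show "\<phi> (q (c * H t)) * w t \<le> \<phi> \<epsilon> * (w t * ind t)"
        using phi_mono[OF q_nonneg q[of t]] w_nonneg[OF t] Hb[of t] by (auto simp: ind_eq[OF t] mult_right_mono)
    qed
    also have "\<dots> \<le> 1" using cW[of "\<phi> \<epsilon>"] \<epsilon>W phi_nonneg[of \<epsilon>] \<epsilon> by simp
    finally show ?thesis using c by blast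
  qed
  obtain t1 where t1: "t1 \<in> I" "0 < H t1"
  proof -
    have "0 < dist_f h 0" using nn by (simp add: zero_less_iff_neq_zero)
    then obtain e where e: "0 < e" "e < dist_f h 0" using dense by blast
    then obtain t where t: "e = ennreal t" "0 \<le> t" by (cases e) auto
    have "t \<in> I" unfolding mem_I_iff using e t dist_f_le_len[OF h, of 0] by (auto intro: less_le_trans)
    moreover have "ennreal 0 < rear h t" using e t rear_gt_iff[OF h, of 0 t] by simp
    ultimately show ?thesis using that[of t] by (simp add: rH)
  qed
  have large: "\<exists>L. \<forall>c>L. 1 < S c"
  proof -
    obtain W1 where W1: "Wf (ennreal t1) = ennreal W1" "0 \<le> W1"
      using Wf_finite[of "ennreal t1"] by (cases "Wf (ennreal t1)") auto
    have W1p: "0 < W1" using Wf_pos[of "ennreal t1"] W1 I_pos[OF t1(1)] by simp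
    \<comment> \<open>Chosen so that \<phi> R W1 >= 2: maximizers of size R on (0,t1) alone push the
      integral above 1.\<close>
    define R where "R = max 1 (2 / (\<phi> 1 * W1))"
    have \<phi>1: "0 < \<phi> 1" by (rule phi_pos) simp
    have "R * \<phi> 1 \<le> \<phi> R" using phi_super_scale[of R 1] by (simp add: R_def)
    then have A: "R * \<phi> 1 * W1 \<le> \<phi> R * W1" using W1 by (intro mult_right_mono) auto
    have "2 / (\<phi> 1 * W1) * (\<phi> 1 * W1) \<le> R * (\<phi> 1 * W1)"
      using \<phi>1 W1p by (intro mult_right_mono) (auto simp: R_def)
    then have "2 \<le> R * \<phi> 1 * W1" using \<phi>1 W1p by (simp add: mult.assoc)
    with A have R: "2 \<le> \<phi> R * W1" "0 < R" by (linarith, simp add: R_def)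
    have "1 < S c" if c: "c > max 0 (\<phi> (2 * R) / R / H t1)" for c
    proof -
      have "\<phi> (2 * R) / R / H t1 < c" using c by simp
      then have "\<phi> (2 * R) / R < c * H t1" using t1(2) by (simp only: pos_divide_less_eq)
      then have q: "R \<le> q (c * H t)" if "t < t1" for t
        using that Hanti[of t t1] c R(2) by (intro q_large) (auto intro: less_le_trans[OF _ mult_left_mono])
      have "ennreal 1 < ennreal (\<phi> R * W1)" using R by (intro ennreal_lessI) auto
      also have "\<dots> = ennreal (\<phi> R) * Wf (ennreal t1)" using W1 R phi_nonneg[of R] by (simp add: ennreal_mult)
      also have "\<dots> = (\<integral>\<^sup>+t. ennreal (\<phi> R) * (ennreal (w t) * indicator {t. ennreal t < ennreal t1} t) \<partial>MI)"
        unfolding Wf_def by (rule nn_integral_cmult[symmetric]) measurable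
      also have "\<dots> \<le> S c" unfolding S_def
      proof (intro nn_integral_mono)
        fix t assume "t \<in> space MI"
        then have t: "t \<in> I" by simp
        show "ennreal (\<phi> R) * (ennreal (w t) * indicator {t. ennreal t < ennreal t1} t) \<le> ennreal (\<phi> (q (c * H t)) * w t)"
        proof (cases "t < t1")
          case True
          have "\<phi> R \<le> \<phi> (q (c * H t))" using q[OF True] R by (intro phi_mono) auto
          then show ?thesis using True t w_nonneg[OF t] R phi_nonneg[of R]
            by (simp add: ennreal_less_I_iff mult_right_mono flip: ennreal_mult)
        qed (simp add: ennreal_less_I_iff[OF t])
      qed
      finally show ?thesis by simp
    qed
    then show ?thesis by blast
  qed
  \<comment> \<open>S is at most 1 at some scale and above 1 at all large ones, so along the powers
    of \<kappa> there is a crossing within one factor \<kappa>.\<close>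
  have "\<exists>c>0. S c \<le> 1 \<and> 1 < S (\<kappa> * c)"
  proof (rule ccontr)
    assume *: "\<not> (\<exists>c>0. S c \<le> 1 \<and> 1 < S (\<kappa> * c))"
    have step: "S (\<kappa> * c) \<le> 1" if "0 < c" "S c \<le> 1" for c using * that by (meson not_le)
    obtain c1 where c1: "0 < c1" "S c1 \<le> 1" using small by blast
    obtain L where L: "\<And>c. c > L \<Longrightarrow> 1 < S c" using large by blast
    have it: "S (\<kappa> ^ n * c1) \<le> 1" for n
    proof (induction n)
      case (Suc n)
      then show ?case using step[of "\<kappa> ^ n * c1"] c1 \<kappa> by (simp add: mult.assoc)
    qed (use c1 in simp)
    obtain n where "L / c1 < \<kappa> ^ n" using real_arch_pow[OF \<kappa>] by blast
    then have "L < \<kappa> ^ n * c1" using c1 by (simp add: field_simps)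
    then show False using L it[of n] by fastforce
  qed
  then obtain c where c: "0 < c" "S c \<le> 1" "1 < S (\<kappa> * c)" by blast
  define Ul where "Ul t = q (c * H t)" for t
  define Uu where "Uu t = q (\<kappa> * c * H t)" for t
  \<comment> \<open>Convex combinations of the two maximizers stay decreasing, and their modular
    depends continuously on \<tau>; this restores the intermediate value argument that is lost at
    jumps of \<open>q\<close>.\<close>
  define V where "V \<tau> t = (1 - \<tau>) * Ul t + \<tau> * Uu t" for \<tau> t
  define Mx where "Mx = q (\<kappa> * c * B)"
  have Ul0: "0 \<le> Ul t" and Uu0: "0 \<le> Uu t" for t by (auto simp: Ul_def Uu_def q_nonneg)
  have le: "Ul t \<le> Uu t" for t unfolding Ul_def Uu_def using \<kappa> c H0[of t]
    by (intro q_mono mult_right_mono) auto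
  have UuM: "Uu t \<le> Mx" for t unfolding Uu_def Mx_def using \<kappa> c HB[of t] by (intro q_mono mult_left_mono) auto
  have [measurable]: "Ul \<in> L0 I" "Uu \<in> L0 I" unfolding Ul_def Uu_def by measurable
  have [measurable]: "V \<tau> \<in> L0 I" for \<tau> unfolding V_def by measurable
  have V0: "0 \<le> V \<tau> t" and VM: "V \<tau> t \<le> Mx" if "\<tau> \<in> {0..1}" for \<tau> t
  proof -
    show "0 \<le> V \<tau> t" unfolding V_def using that Ul0 Uu0 by (intro add_nonneg_nonneg mult_nonneg_nonneg) auto
    have "V \<tau> t \<le> (1 - \<tau>) * Mx + \<tau> * Mx" unfolding V_def
      using that UuM[of t] le[of t] by (intro add_mono mult_left_mono) auto
    then show "V \<tau> t \<le> Mx" by (simp add: algebra_simps)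
  qed
  have Vb: "V \<tau> t = 0" if "b \<le> t" for \<tau> t using Hb[OF that] by (simp add: V_def Ul_def Uu_def)
  have Vanti: "V \<tau> t \<le> V \<tau> s" if "\<tau> \<in> {0..1}" "s \<le> t" for \<tau> s t
    unfolding V_def Ul_def Uu_def using that Hanti[OF that(2)] \<kappa> c
    by (intro add_mono mult_left_mono q_mono) auto
  have \<phi>V [measurable]: "(\<lambda>t. \<phi> (V \<tau> t) * w t) \<in> L0 I" if "\<tau> \<in> {0..1}" for \<tau>
  proof -
    have "(\<lambda>t. \<phi> (max 0 (V \<tau> t)) * w t) \<in> L0 I" by measurable
    then show ?thesis using V0[OF that] by (simp add: max_absorb2)
  qed
  have Mx0: "0 \<le> Mx" by (simp add: Mx_def q_nonneg)
  have bound: "\<bar>\<phi> (V \<tau> t) * w t\<bar> \<le> \<phi> Mx * (w t * ind t)" if "\<tau> \<in> {0..1}" "t \<in> I" for \<tau> t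
    using phi_mono[OF V0 VM, OF that(1) that(1), of t] phi_nonneg[OF V0[OF that(1), of t]] w_nonneg[OF that(2)] Vb[of t \<tau>]
    by (auto simp: ind_eq[OF that(2)] abs_mult mult_right_mono)
  have Dint: "integrable MI (\<lambda>t. \<phi> Mx * (w t * ind t))"
  proof (rule integrableI_bounded)
    have "(\<integral>\<^sup>+t. ennreal (norm (\<phi> Mx * (w t * ind t))) \<partial>MI) = (\<integral>\<^sup>+t. ennreal (\<phi> Mx * (w t * ind t)) \<partial>MI)"
      using phi_nonneg[OF Mx0] by (intro nn_integral_cong) (auto simp: ind_def w_nonneg abs_mult)
    then show "(\<integral>\<^sup>+t. ennreal (norm (\<phi> Mx * (w t * ind t))) \<partial>MI) < \<infinity>"
      using cW[OF phi_nonneg[OF Mx0]] by simp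
  qed measurable
  have jint: "integrable MI (\<lambda>t. \<phi> (V \<tau> t) * w t)" if "\<tau> \<in> {0..1}" for \<tau>
    by (rule Bochner_Integration.integrable_bound[OF Dint \<phi>V[OF that]])
      (rule AE_I2, use bound[OF that] in \<open>auto intro: order_trans abs_ge_self\<close>)
  define j where "j \<tau> = (\<integral>t. \<phi> (V \<tau> t) * w t \<partial>MI)" for \<tau>
  have jS: "(\<integral>\<^sup>+t. ennreal (\<phi> (V \<tau> t) * w t) \<partial>MI) = ennreal (j \<tau>)" if "\<tau> \<in> {0..1}" for \<tau>
    unfolding j_def using phi_nonneg[OF V0[OF that]]
    by (intro nn_integral_eq_integral[OF jint[OF that]] AE_I2) (auto simp: w_nonneg)
  have cont: "continuous_on {0..1} j"
    unfolding continuous_on_sequentially comp_def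
  proof safe
    fix x :: "nat \<Rightarrow> real" and \<tau> assume \<tau>: "\<tau> \<in> {0..1}" and x: "\<forall>n. x n \<in> {0..1}" "x \<longlonglongrightarrow> \<tau>"
    show "(\<lambda>n. j (x n)) \<longlonglongrightarrow> j \<tau>"
      unfolding j_def
    proof (rule integral_dominated_convergence[OF _ _ Dint])
      show "AE t in MI. (\<lambda>n. \<phi> (V (x n) t) * w t) \<longlonglongrightarrow> \<phi> (V \<tau> t) * w t"
      proof (rule AE_I2)
        fix t
        have "(\<lambda>n. V (x n) t) \<longlonglongrightarrow> V \<tau> t" unfolding V_def by (intro tendsto_intros x)
        then show "(\<lambda>n. \<phi> (V (x n) t) * w t) \<longlonglongrightarrow> \<phi> (V \<tau> t) * w t"
          using V0 \<tau> x by (intro tendsto_mult phi_tendsto tendsto_const) auto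
      qed
      show "AE t in MI. norm (\<phi> (V (x n) t) * w t) \<le> \<phi> Mx * (w t * ind t)" for n
        using bound[of "x n"] x by (intro AE_I2) auto
    qed (use \<tau> x \<phi>V in auto)
  qed
  have "j 0 \<le> 1"
  proof -
    have "ennreal (j 0) \<le> ennreal 1" using jS[of 0] c(2) by (simp add: S_def V_def Ul_def)
    then show ?thesis by (subst (asm) ennreal_le_iff) auto
  qed
  moreover have "1 \<le> j 1"
  proof -
    have "ennreal 1 < ennreal (j 1)" using jS[of 1] c(3) by (simp add: S_def V_def Uu_def)
    then show ?thesis by (subst (asm) ennreal_less_iff) auto
  qed
  ultimately obtain \<tau> where \<tau>: "\<tau> \<in> {0..1}" "j \<tau> = 1" using IVT'[of j 0 1 1] cont by auto
  \<comment> \<open>Convexity of \<phi> splits the left side into the two Young equalities; raising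
    c to \<kappa> c in the first, and \<psi> (c H) to \<psi> (\<kappa> c H) in the second, is where
    \<kappa> is paid.\<close>
  have pt: "\<phi> (V \<tau> t) + \<psi> (c * H t) \<le> \<kappa> * c * (H t * V \<tau> t)" for t
  proof -
    have 1: "c * H t * Ul t = \<phi> (Ul t) + \<psi> (c * H t)" and 2: "\<kappa> * c * H t * Uu t = \<phi> (Uu t) + \<psi> (\<kappa> * c * H t)"
      unfolding Ul_def Uu_def by (rule young_eq)+
    have 3: "\<psi> (c * H t) \<le> \<psi> (\<kappa> * c * H t)" using \<kappa> c H0[of t] by (intro psi_mono mult_right_mono) auto
    have 4: "\<phi> (V \<tau> t) \<le> (1 - \<tau>) * \<phi> (Ul t) + \<tau> * \<phi> (Uu t)"
      using convex_onD[OF phi_convex, of \<tau> "Ul t" "Uu t"] \<tau> Ul0 Uu0 by (simp add: V_def)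
    have 5: "c * H t * Ul t \<le> \<kappa> * c * H t * Ul t" using \<kappa> c H0[of t] Ul0[of t]
      by (intro mult_right_mono) auto
    have "\<phi> (V \<tau> t) + \<psi> (c * H t) \<le> (1 - \<tau>) * (\<phi> (Ul t) + \<psi> (c * H t)) + \<tau> * (\<phi> (Uu t) + \<psi> (c * H t))"
      using 4 by (simp add: algebra_simps)
    also have "\<dots> \<le> (1 - \<tau>) * (\<kappa> * c * H t * Ul t) + \<tau> * (\<kappa> * c * H t * Uu t)"
      using 1 2 3 5 \<tau> by (intro add_mono mult_left_mono) auto
    also have "\<dots> = \<kappa> * c * (H t * V \<tau> t)" by (simp add: V_def algebra_simps)
    finally show ?thesis .
  qed
  have "1 + (\<integral>\<^sup>+t. ennreal (w t) * ennreal (\<psi> (c * H t)) \<partial>MI)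
     = (\<integral>\<^sup>+t. ennreal (\<phi> (V \<tau> t) * w t) \<partial>MI) + (\<integral>\<^sup>+t. ennreal (w t) * ennreal (\<psi> (c * H t)) \<partial>MI)"
    using jS[OF \<tau>(1)] \<tau>(2) by simp
  also have "\<dots> = (\<integral>\<^sup>+t. ennreal (\<phi> (V \<tau> t) * w t) + ennreal (w t) * ennreal (\<psi> (c * H t)) \<partial>MI)"
    by (rule nn_integral_add[symmetric, OF measurable_compose[OF \<phi>V[OF \<tau>(1)] measurable_ennreal]]) measurable
  also have "\<dots> \<le> (\<integral>\<^sup>+t. ennreal (\<kappa> * c) * (rear h t * ennreal (V \<tau> t * w t)) \<partial>MI)"
  proof (intro nn_integral_mono)
    fix t assume "t \<in> space MI"
    then have t: "0 \<le> w t" using w_nonneg by simp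
    have "(\<phi> (V \<tau> t) + \<psi> (c * H t)) * w t \<le> \<kappa> * c * (H t * V \<tau> t) * w t" using pt t by (rule mult_right_mono)
    then have "\<phi> (V \<tau> t) * w t + w t * \<psi> (c * H t) \<le> \<kappa> * c * (H t * (V \<tau> t * w t))"
      by (simp add: algebra_simps)
    then show "ennreal (\<phi> (V \<tau> t) * w t) + ennreal (w t) * ennreal (\<psi> (c * H t)) \<le> ennreal (\<kappa> * c) * (rear h t * ennreal (V \<tau> t * w t))"
      using t V0[OF \<tau>(1), of t] phi_nonneg[OF V0[OF \<tau>(1), of t]] psi_nonneg \<kappa> c H0[of t]
      by (simp add: rH flip: ennreal_mult ennreal_plus)
  qed
  also have "\<dots> = ennreal (\<kappa> * c) * (\<integral>\<^sup>+t. rear h t * ennreal (V \<tau> t * w t) \<partial>MI)"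
    by (rule nn_integral_cmult) measurable
  also have "\<dots> \<le> ennreal (\<kappa> * c) * Nd h"
  proof (intro mult_left_mono Nd_ge_antimono[OF h])
    show "(\<integral>\<^sup>+t. ennreal (\<phi> (V \<tau> t) * w t) \<partial>MI) \<le> 1" using jS[OF \<tau>(1)] \<tau>(2) by simp
  qed (use rfin Vanti[OF \<tau>(1)] V0[OF \<tau>(1)] in auto)
  finally have "1 + (\<integral>\<^sup>+t. ennreal (w t) * ennreal (\<psi> (c * H t)) \<partial>MI) \<le> ennreal (\<kappa> * c) * Nd h" .
  moreover have "enn2real (rear (\<lambda>t. c * h t) t) = c * H t" for t
    using c(1) by (simp add: rear_cmult[OF h] H_def enn2real_mult)
  ultimately show ?thesis using c(1) by auto
qed

section \<open>The Hoelder inequality between P and the Koethe dual\<close>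

definition "Pint f v t = (if v t = 0 then (if f t = 0 then 0 else \<infinity>) else ennreal (\<phi> (\<bar>f t\<bar> / v t) * v t) :: ennreal)"
  for f v :: "real \<Rightarrow> real"

lemma P_modular_eq: "P_modular I \<phi> w f =
    (INF v\<in>{v \<in> L0 I. submajorized I v w \<and> (\<forall>t\<in>I. 0 \<le> v t)}. \<integral>\<^sup>+t. Pint f v t \<partial>MI)"
  by (simp add: P_modular_def Pint_def)

lemma Pint_measurable:
  assumes [measurable]: "f \<in> L0 I" "v \<in> L0 I" and v0: "\<And>t. t \<in> I \<Longrightarrow> 0 \<le> v t"
  shows "Pint f v \<in> borel_measurable MI"
proof -
  have "(\<lambda>t. if v t = 0 then (if f t = 0 then 0 else \<infinity>) else ennreal (\<phi> (max 0 (\<bar>f t\<bar> / v t)) * v t)) \<in> borel_measurable MI"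
    by measurable
  then show ?thesis
    by (rule measurable_cong[THEN iffD1, rotated]) (use v0 in \<open>auto simp: Pint_def max_absorb2\<close>)
qed

text \<open>For a nearly optimal v, Young's inequality bounds c |f h| by the integrand of P plus v
  \<psi> (c h). Since v is below w, the second integral is at most that of w times \<psi> of the
  rearrangement of c h, and \<open>amemiya_le_Nd\<close> provides the scale c at which 1 plus this
  is at most \<kappa> c \<open>Nd h\<close>.\<close>

lemma Hoelder_bounded:
  assumes f [measurable]: "f \<in> L0 I" and P: "P_modular I \<phi> w f \<le> 1"
    and h [measurable]: "h \<in> L0 I" and h0: "\<And>t. t \<in> I \<Longrightarrow> 0 \<le> h t"
    and B: "0 \<le> B" "\<And>t. t \<in> I \<Longrightarrow> h t \<le> B * indicator E t"
    and E: "E \<in> sets MI" "emeasure MI E \<le> ennreal b" and b: "b \<in> I"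
  shows "(\<integral>\<^sup>+t. ennreal \<bar>f t * h t\<bar> \<partial>MI) \<le> Nd h"
proof (cases "dist_f h 0 = 0")
  case True
  then have "AE t in MI. t \<notin> {t\<in>I. 0 < \<bar>h t\<bar>}"
    unfolding dist_f_eq using pred_abs_greater[OF h, of 0] by (intro AE_not_in null_setsI)
  then have "AE t in MI. ennreal \<bar>f t * h t\<bar> = 0" by (rule AE_mp) (rule AE_I2, auto)
  then have "(\<integral>\<^sup>+t. ennreal \<bar>f t * h t\<bar> \<partial>MI) = 0" by (subst nn_integral_0_iff_AE) auto
  then show ?thesis by simp
next
  case False
  let ?X = "\<integral>\<^sup>+t. ennreal \<bar>f t * h t\<bar> \<partial>MI"
  show ?thesis
  proof (rule ennreal_le_mult_all)
    fix \<kappa> :: real assume \<kappa>: "1 < \<kappa>"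
    obtain c where c: "0 < c" and le: "1 + (\<integral>\<^sup>+t. ennreal (w t) * ennreal (\<psi> (enn2real (rear (\<lambda>t. c * h t) t))) \<partial>MI) \<le> ennreal (\<kappa> * c) * Nd h"
      using amemiya_le_Nd[OF h h0 B E b \<kappa> False] by blast
    have hb: "\<bar>h t\<bar> \<le> B * indicator E t" if "t \<in> I" for t using h0[OF that] B(2)[OF that] by simp
    have fin: "rear (\<lambda>t. c * h t) t < top" for t
      using rear_bounded_support(1)[OF h E B(1) hb, of t] unfolding rear_cmult[OF h]
      by (auto simp: ennreal_mult_less_top intro: le_less_trans)
    have "ennreal c * ?X \<le> ennreal c * (ennreal \<kappa> * Nd h)"
    proof (rule ennreal_le_epsilon)
      \<comment> \<open>The infimum in P is not known to be attained; \<delta> is the loss in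
        choosing v.\<close>
      fix \<delta> :: real assume \<delta>: "0 < \<delta>"
      have "ennreal 1 < ennreal (1 + \<delta>)" using \<delta> by (intro ennreal_lessI) auto
      then have "P_modular I \<phi> w f < 1 + ennreal \<delta>" using \<delta> by (intro le_less_trans[OF P]) (simp add: ennreal_plus)
      then obtain v where v [measurable]: "v \<in> L0 I" and vs: "submajorized I v w" and v0: "\<And>t. t \<in> I \<Longrightarrow> 0 \<le> v t"
        and vP: "(\<integral>\<^sup>+t. Pint f v t \<partial>MI) < 1 + ennreal \<delta>"
        unfolding P_modular_eq by (auto simp: INF_less_iff)
      have bW: "below_W v" by (rule submajorized_below_W[OF v v0 vs])
      have "ennreal c * ?X = (\<integral>\<^sup>+t. ennreal c * ennreal \<bar>f t * h t\<bar> \<partial>MI)" by (rule nn_integral_cmult[symmetric]) measurable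
      also have "\<dots> \<le> (\<integral>\<^sup>+t. Pint f v t + ennreal (v t) * ennreal (\<psi> (c * h t)) \<partial>MI)"
      proof (intro nn_integral_mono)
        fix t assume "t \<in> space MI"
        then have t: "t \<in> I" by simp
        show "ennreal c * ennreal \<bar>f t * h t\<bar> \<le> Pint f v t + ennreal (v t) * ennreal (\<psi> (c * h t))"
        proof (cases "v t = 0")
          case False
          then have vt: "0 < v t" using v0[OF t] by simp
          have "c * h t * (\<bar>f t\<bar> / v t) * v t \<le> (\<phi> (\<bar>f t\<bar> / v t) + \<psi> (c * h t)) * v t"
            using young[of "\<bar>f t\<bar> / v t" "c * h t"] vt by (intro mult_right_mono) auto
          then have "c * \<bar>f t * h t\<bar> \<le> \<phi> (\<bar>f t\<bar> / v t) * v t + v t * \<psi> (c * h t)"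
            using vt h0[OF t] by (simp add: algebra_simps abs_mult)
          then show ?thesis using vt phi_nonneg[of "\<bar>f t\<bar> / v t"] psi_nonneg c
            by (simp add: Pint_def flip: ennreal_mult ennreal_plus)
        qed (auto simp: Pint_def)
      qed
      also have "\<dots> = (\<integral>\<^sup>+t. Pint f v t \<partial>MI) + (\<integral>\<^sup>+t. ennreal (v t) * ennreal (\<psi> (c * h t)) \<partial>MI)"
        by (rule nn_integral_add[OF Pint_measurable[OF f v v0]]) auto
      also have "\<dots> \<le> (1 + ennreal \<delta>) + (\<integral>\<^sup>+t. ennreal (w t) * ennreal (\<psi> (enn2real (rear (\<lambda>t. c * h t) t))) \<partial>MI)"
      proof (intro add_mono psi_integral_le)
        fix s :: real assume s: "0 \<le> s"
        have "{t\<in>I. s < c * h t} = {t\<in>I. s < \<bar>c * h t\<bar>}" using h0 c by auto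
        then show "(\<integral>\<^sup>+t. ennreal (v t) * indicator {t\<in>I. s < c * h t} t \<partial>MI) \<le> Wf (dist_f (\<lambda>t. c * h t) s)"
          using bW pred_abs_greater[of "\<lambda>t. c * h t" s] by (simp add: below_W_def dist_f_eq)
      qed (use vP h0 c fin in \<open>auto simp: less_imp_le\<close>)
      also have "\<dots> = (1 + (\<integral>\<^sup>+t. ennreal (w t) * ennreal (\<psi> (enn2real (rear (\<lambda>t. c * h t) t))) \<partial>MI)) + ennreal \<delta>"
        by (simp add: add_ac)
      also have "\<dots> \<le> ennreal (\<kappa> * c) * Nd h + ennreal \<delta>" using le by (rule add_right_mono)
      also have "ennreal (\<kappa> * c) * Nd h = ennreal c * (ennreal \<kappa> * Nd h)"
        using \<kappa> c by (simp add: ennreal_mult ac_simps)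
      finally show "ennreal c * ?X \<le> ennreal c * (ennreal \<kappa> * Nd h) + ennreal \<delta>" .
    qed
    then show "?X \<le> ennreal \<kappa> * Nd h" using c by (subst (asm) ennreal_mult_le_mult_iff) auto
  qed
qed

text \<open>|h| is cut off at height n and to (0,b n); the truncations have smaller dual norm, and
  Fatou recovers h.\<close>

theorem Hoelder:
  assumes f [measurable]: "f \<in> L0 I" and P: "P_modular I \<phi> w f \<le> 1" and h [measurable]: "h \<in> L0 I"
  shows "(\<integral>\<^sup>+t. ennreal \<bar>f t * h t\<bar> \<partial>MI) \<le> Nd h"
proof -
  obtain b :: "nat \<Rightarrow> real" where b: "incseq b" "\<And>n. b n \<in> I" "\<And>t. t \<in> I \<Longrightarrow> \<exists>n. t < b n"
    by (rule I_exhaustion) blast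
  define E where "E n = {t\<in>I. ennreal t < ennreal (b n)}" for n
  have Em [measurable]: "E n \<in> sets MI" for n unfolding E_def by (rule set_initial_MI)
  have Ee: "emeasure MI (E n) \<le> ennreal (b n)" for n unfolding E_def emeasure_initial by simp
  define u where "u n t = min \<bar>h t\<bar> (real n) * indicator (E n) t" for n t
  have um [measurable]: "u n \<in> L0 I" for n unfolding u_def by measurable
  have bd: "(\<integral>\<^sup>+t. ennreal \<bar>f t * u n t\<bar> \<partial>MI) \<le> Nd h" for n
  proof -
    have "(\<integral>\<^sup>+t. ennreal \<bar>f t * u n t\<bar> \<partial>MI) \<le> Nd (u n)"
    proof (rule Hoelder_bounded[OF f P um _ _ _ Em Ee b(2)])
      show "u n t \<le> real n * indicator (E n) t" for t by (auto simp: u_def indicator_def)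
    qed (auto simp: u_def)
    also have "\<dots> \<le> Nd h" by (intro Nd_mono) (auto simp: u_def indicator_def)
    finally show ?thesis .
  qed
  have "(\<integral>\<^sup>+t. ennreal \<bar>f t * h t\<bar> \<partial>MI) \<le> (\<integral>\<^sup>+t. liminf (\<lambda>n. ennreal \<bar>f t * u n t\<bar>) \<partial>MI)"
  proof (intro nn_integral_mono)
    fix t assume "t \<in> space MI"
    then have t: "t \<in> I" by simp
    obtain n1 where n1: "t < b n1" using b(3)[OF t] by blast
    obtain n2 where n2: "\<bar>h t\<bar> \<le> real n2" using real_arch_simple by blast
    have "\<bar>f t * u n t\<bar> = \<bar>f t * h t\<bar>" if "max n1 n2 \<le> n" for n
    proof -
      have "b n1 \<le> b n" using b(1) that by (auto dest: incseqD)
      then have "t \<in> E n" using n1 t by (simp add: E_def ennreal_less_I_iff)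
      moreover have "\<bar>h t\<bar> \<le> real n" using n2 that by simp
      ultimately show ?thesis by (simp add: u_def abs_mult)
    qed
    then have "\<forall>\<^sub>F n in sequentially. ennreal \<bar>f t * h t\<bar> \<le> ennreal \<bar>f t * u n t\<bar>"
      by (auto simp: eventually_sequentially intro!: exI[of _ "max n1 n2"])
    then show "ennreal \<bar>f t * h t\<bar> \<le> liminf (\<lambda>n. ennreal \<bar>f t * u n t\<bar>)" by (rule Liminf_bounded)
  qed
  also have "\<dots> \<le> liminf (\<lambda>n. \<integral>\<^sup>+t. ennreal \<bar>f t * u n t\<bar> \<partial>MI)" by (rule nn_integral_liminf) measurable
  also have "\<dots> \<le> Nd h" using bd by (intro Liminf_le) auto
  finally show ?thesis .
qed

end

section \<open>Level functions\<close>

text \<open>Greedy construction: on a set \<open>S\<close> maximizing \<open>c S / \<omega> S\<close> the function \<open>u\<close> takes that maximal value, and the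
  remainder is treated with the contraction of \<open>\<omega>\<close> by \<open>S\<close>.\<close>

lemma polymatroid_levels:
  fixes c :: "'i \<Rightarrow> real" and \<omega> :: "'i set \<Rightarrow> real"
  assumes "finite K" "\<And>i. i \<in> K \<Longrightarrow> 0 < c i" "\<omega> {} = 0"
    and "\<And>A B. A \<subseteq> K \<Longrightarrow> B \<subseteq> K \<Longrightarrow> \<omega> (A \<union> B) + \<omega> (A \<inter> B) \<le> \<omega> A + \<omega> B"
    and "\<And>A B. A \<subset> B \<Longrightarrow> B \<subseteq> K \<Longrightarrow> \<omega> A < \<omega> B"
  shows "\<exists>u. (\<forall>i\<in>K. 0 < u i) \<and> (\<forall>T\<subseteq>K. (\<Sum>i\<in>T. c i / u i) \<le> \<omega> T)
      \<and> (\<forall>x. (\<Sum>i\<in>{i\<in>K. x \<le> u i}. c i / u i) = \<omega> {i\<in>K. x \<le> u i})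
      \<and> (\<forall>r. (\<forall>T\<subseteq>K. sum c T \<le> r * \<omega> T) \<longrightarrow> (\<forall>i\<in>K. u i \<le> r))"
  using assms
proof (induction K arbitrary: \<omega> rule: finite_psubset_induct)
  case (psubset K)
  note c = psubset.prems(1) and \<omega>0 = psubset.prems(2) and submod = psubset.prems(3) and strict = psubset.prems(4)
  show ?case
  proof (cases "K = {}")
    case False
    have pos: "0 < \<omega> T" if "T \<subseteq> K" "T \<noteq> {}" for T
      using strict[of "{}" T] \<omega>0 that by auto
    define R where "R = (\<lambda>T. sum c T / \<omega> T) ` (Pow K - {{}})"
    have fin: "finite R" "R \<noteq> {}" using psubset.hyps False by (auto simp: R_def)
    define r where "r = Max R"
    have "r \<in> R" unfolding r_def using fin by (rule Max_in)
    then obtain S where S: "S \<subseteq> K" "S \<noteq> {}" "r = sum c S / \<omega> S" by (auto simp: R_def)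
    have cS: "0 < sum c S" using S c psubset.hyps by (intro sum_pos) (auto intro: finite_subset)
    have r: "0 < r" "sum c S = r * \<omega> S" using S cS pos[of S] by auto
    have le: "sum c T \<le> r * \<omega> T" if "T \<subseteq> K" for T
    proof (cases "T = {}")
      case False
      then have "sum c T / \<omega> T \<le> r" unfolding r_def using that fin by (intro Max_ge) (auto simp: R_def)
      then show ?thesis using pos[OF that False] by (simp add: field_simps)
    qed (simp add: \<omega>0)
    \<comment> \<open>The contraction by S inherits submodularity, strict monotonicity and the value
      0 at the empty set.\<close>
    define \<omega>' where "\<omega>' T = \<omega> (S \<union> T) - \<omega> S" for T
    let ?K' = "K - S"
    have "?K' \<subset> K" using S by auto
    then have "\<exists>u. (\<forall>i\<in>?K'. 0 < u i) \<and> (\<forall>T\<subseteq>?K'. (\<Sum>i\<in>T. c i / u i) \<le> \<omega>' T)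
      \<and> (\<forall>x. (\<Sum>i\<in>{i\<in>?K'. x \<le> u i}. c i / u i) = \<omega>' {i\<in>?K'. x \<le> u i})
      \<and> (\<forall>r. (\<forall>T\<subseteq>?K'. sum c T \<le> r * \<omega>' T) \<longrightarrow> (\<forall>i\<in>?K'. u i \<le> r))"
    proof (rule psubset.IH)
      show "\<omega>' {} = 0" by (simp add: \<omega>'_def)
      fix A B
      show "\<omega>' (A \<union> B) + \<omega>' (A \<inter> B) \<le> \<omega>' A + \<omega>' B" if "A \<subseteq> ?K'" "B \<subseteq> ?K'"
      proof -
        have "(S \<union> A) \<union> (S \<union> B) = S \<union> (A \<union> B)" "(S \<union> A) \<inter> (S \<union> B) = S \<union> (A \<inter> B)" by auto
        then show ?thesis using submod[of "S \<union> A" "S \<union> B"] that S by (auto simp: \<omega>'_def)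
      qed
      show "\<omega>' A < \<omega>' B" if "A \<subset> B" "B \<subseteq> ?K'"
        using strict[of "S \<union> A" "S \<union> B"] that S by (auto simp: \<omega>'_def)
    qed (use c in auto)
    then obtain u' where u'': "\<forall>i\<in>?K'. 0 < u' i"
      "\<forall>T\<subseteq>?K'. (\<Sum>i\<in>T. c i / u' i) \<le> \<omega>' T"
      "\<forall>x. (\<Sum>i\<in>{i\<in>?K'. x \<le> u' i}. c i / u' i) = \<omega>' {i\<in>?K'. x \<le> u' i}"
      "\<forall>r. (\<forall>T\<subseteq>?K'. sum c T \<le> r * \<omega>' T) \<longrightarrow> (\<forall>i\<in>?K'. u' i \<le> r)"
      by (elim exE conjE) (rule that)
    note u' = u''(1)[rule_format] u''(2)[rule_format] u''(3)[rule_format] u''(4)[THEN spec, THEN mp]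
    have finS: "finite T" if "T \<subseteq> K" for T using that psubset.hyps by (rule finite_subset)
    \<comment> \<open>Maximality of r passes to the contraction, since sum c S = r \<omega> S can be
      subtracted. Levels on the remainder thus stay at or below r, and a superlevel set of the
      combined u is either empty or contains S.\<close>
    have u'r: "u' i \<le> r" if "i \<in> ?K'" for i
    proof -
      have "sum c T \<le> r * \<omega>' T" if T: "T \<subseteq> ?K'" for T
      proof -
        have "sum c S + sum c T = sum c (S \<union> T)"
          using T S by (intro sum.union_disjoint[symmetric] finS) auto
        also have "\<dots> \<le> r * \<omega> (S \<union> T)" using T S by (intro le) auto
        finally show ?thesis using r(2) by (simp add: \<omega>'_def algebra_simps)
      qed
      then show ?thesis using u'(4) that by blast
    qed
    define u where "u i = (if i \<in> S then r else u' i)" for i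
    have sum_u: "(\<Sum>i\<in>T. c i / u i) = sum c (T \<inter> S) / r + (\<Sum>i\<in>T - S. c i / u' i)" if "T \<subseteq> K" for T
    proof -
      have "(\<Sum>i\<in>T. c i / u i) = (\<Sum>i\<in>T \<inter> S. c i / u i) + (\<Sum>i\<in>T - S. c i / u i)"
        using that finS by (subst sum.union_disjoint[symmetric]) (auto intro!: sum.cong)
      also have "(\<Sum>i\<in>T \<inter> S. c i / u i) = sum c (T \<inter> S) / r"
        by (simp add: u_def sum_divide_distrib)
      also have "(\<Sum>i\<in>T - S. c i / u i) = (\<Sum>i\<in>T - S. c i / u' i)" by (intro sum.cong) (auto simp: u_def)
      finally show ?thesis .
    qed
    have "(\<Sum>i\<in>T. c i / u i) \<le> \<omega> T" if T: "T \<subseteq> K" for T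
    proof -
      have "sum c (T \<inter> S) / r \<le> \<omega> (T \<inter> S)" using le[of "T \<inter> S"] T r(1) by (simp add: field_simps le_infI1)
      moreover have "(\<Sum>i\<in>T - S. c i / u' i) \<le> \<omega>' (T - S)" using T by (intro u'(2)) auto
      moreover have "\<omega>' (T - S) = \<omega> (S \<union> T) - \<omega> S" by (simp add: \<omega>'_def)
      moreover have "\<omega> (S \<union> T) + \<omega> (S \<inter> T) \<le> \<omega> S + \<omega> T" using S T by (intro submod)
      ultimately show ?thesis using sum_u[OF T] by (simp add: Int_commute)
    qed
    moreover have "(\<Sum>i\<in>{i\<in>K. x \<le> u i}. c i / u i) = \<omega> {i\<in>K. x \<le> u i}" for x
    proof (cases "x \<le> r")
      case True
      then have eq: "{i\<in>K. x \<le> u i} = S \<union> {i\<in>?K'. x \<le> u' i}" using S by (auto simp: u_def)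
      have "(\<Sum>i\<in>{i\<in>K. x \<le> u i}. c i / u i) = sum c S / r + (\<Sum>i\<in>{i\<in>?K'. x \<le> u' i}. c i / u' i)"
      proof -
        have "{i\<in>K. x \<le> u i} \<inter> S = S" "{i\<in>K. x \<le> u i} - S = {i\<in>?K'. x \<le> u' i}" unfolding eq by auto
        then show ?thesis using sum_u[of "{i\<in>K. x \<le> u i}"] by simp
      qed
      also have "\<dots> = \<omega> S + \<omega>' {i\<in>?K'. x \<le> u' i}" using u'(3) r by simp
      also have "\<dots> = \<omega> {i\<in>K. x \<le> u i}" unfolding eq by (simp add: \<omega>'_def)
      finally show ?thesis .
    next
      case False
      then have "{i\<in>K. x \<le> u i} = {}" using u'r S by (force simp: u_def)
      then show ?thesis using \<omega>0 by (simp only: sum.empty)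
    qed
    moreover have "\<forall>i\<in>K. 0 < u i" using u'(1) r by (auto simp: u_def)
    moreover have "\<forall>i\<in>K. u i \<le> r'" if "\<forall>T\<subseteq>K. sum c T \<le> r' * \<omega> T" for r'
    proof -
      have "r * \<omega> S \<le> r' * \<omega> S" using that S r by auto
      then have "r \<le> r'" by (rule mult_right_le_imp_le[OF _ pos[OF S(1,2)]])
      then show ?thesis using u'r by (fastforce simp: u_def)
    qed
    ultimately show ?thesis by blast
  qed (auto simp: \<omega>0)
qed

section \<open>Concavity of the primitive, and level functions of simple functions\<close>

context orlicz_lorentz begin

definition Wr :: "real \<Rightarrow> real" where "Wr x = enn2real (Wf (ennreal x))"

lemma Wf_Wr: "Wf (ennreal x) = ennreal (Wr x)"
  using Wf_finite[of "ennreal x"] by (simp add: Wr_def)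

lemma Wr_zero [simp]: "Wr 0 = 0" and Wr_nonneg: "0 \<le> Wr x"
  by (simp_all add: Wr_def)

lemma Wr_mono: "x \<le> y \<Longrightarrow> Wr x \<le> Wr y"
  using Wf_mono[OF ennreal_leI[of x y]] Wr_nonneg by (simp add: Wf_Wr)

text \<open>Beyond \<open>I\<close> the weight is continued by 0, so that the primitive stays
  concave past the right end.\<close>

definition w0 :: "real \<Rightarrow> real" where "w0 t = (if t \<in> I then w t else 0)"

lemma w0_antimono: "0 < s \<Longrightarrow> s \<le> t \<Longrightarrow> w0 t \<le> w0 s"
  using I_down[of t s] w_antimono[of s t] by (auto simp: w0_def w_nonneg)

text \<open>The weight at the right end bounds the slope from below, that at the left end from
  above. The upper bound asks for p > 0 because \<open>w0 0\<close> is 0 while w may be unbounded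
  near 0.\<close>

lemma Wr_increment:
  assumes "0 \<le> p" "p \<le> r"
  shows "w0 r * (r - p) \<le> Wr r - Wr p" "0 < p \<Longrightarrow> Wr r - Wr p \<le> w0 p * (r - p)"
proof -
  define A where "A = {t\<in>I. p \<le> t \<and> t < r}"
  have Am [measurable]: "A \<in> sets MI"
  proof -
    have "A = I \<inter> {p..<r}" by (auto simp: A_def)
    then show ?thesis by (auto simp: sets_MI_iff)
  qed
  have split: "Wf (ennreal r) = Wf (ennreal p) + (\<integral>\<^sup>+t. ennreal (w t) * indicator A t \<partial>MI)"
  proof -
    have "Wf (ennreal r) = (\<integral>\<^sup>+t. ennreal (w t) * indicator {t. ennreal t < ennreal p} t + ennreal (w t) * indicator A t \<partial>MI)"
      unfolding Wf_def using assms
      by (intro nn_integral_cong) (auto simp: indicator_def A_def ennreal_less_I_iff)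
    also have "\<dots> = Wf (ennreal p) + (\<integral>\<^sup>+t. ennreal (w t) * indicator A t \<partial>MI)"
      unfolding Wf_def by (rule nn_integral_add) measurable
    finally show ?thesis .
  qed
  have Ale: "emeasure MI A \<le> ennreal (r - p)"
  proof -
    have "emeasure MI A \<le> emeasure lebesgue {p..<r}"
      by (subst emeasure_MI) (auto simp: A_def intro!: emeasure_mono)
    then show ?thesis using assms by simp
  qed
  have up: "(\<integral>\<^sup>+t. ennreal (w t) * indicator A t \<partial>MI) \<le> ennreal (w0 p * (r - p))" if "0 < p"
  proof -
    have "(\<integral>\<^sup>+t. ennreal (w t) * indicator A t \<partial>MI) \<le> (\<integral>\<^sup>+t. ennreal (w0 p) * indicator A t \<partial>MI)"
    proof (intro nn_integral_mono)
      fix t show "ennreal (w t) * indicator A t \<le> ennreal (w0 p) * indicator A t"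
      proof (cases "t \<in> A")
        case True
        then have "w t = w0 t" "w0 t \<le> w0 p" using w0_antimono[OF that, of t] by (auto simp: A_def w0_def)
        then show ?thesis using True by (simp add: ennreal_leI)
      qed simp
    qed
    also have "\<dots> = ennreal (w0 p) * emeasure MI A" by (rule nn_integral_cmult_indicator) measurable
    also have "\<dots> \<le> ennreal (w0 p) * ennreal (r - p)" using Ale by (rule mult_left_mono) simp
    also have "\<dots> = ennreal (w0 p * (r - p))" using assms by (intro ennreal_mult[symmetric]) (auto simp: w0_def w_nonneg)
    finally show ?thesis .
  qed
  have lo: "ennreal (w0 r * (r - p)) \<le> (\<integral>\<^sup>+t. ennreal (w t) * indicator A t \<partial>MI)"
  proof (cases "r \<in> I")
    case True
    have "emeasure MI A = ennreal (r - p)"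
    proof -
      have "A \<subseteq> I" "{p<..<r} \<subseteq> A" using assms I_down[OF True] by (auto simp: A_def)
      have "emeasure lebesgue {p<..<r} \<le> emeasure lebesgue A"
        using Am \<open>{p<..<r} \<subseteq> A\<close> by (intro emeasure_mono) (simp_all add: sets_MI_iff)
      also have "\<dots> = emeasure MI A" using \<open>A \<subseteq> I\<close> by (rule emeasure_MI[symmetric])
      finally show ?thesis using Ale assms by (intro antisym) auto
    qed
    then have "ennreal (w0 r * (r - p)) = ennreal (w0 r) * emeasure MI A"
      using assms by (simp add: ennreal_mult w0_def w_nonneg)
    also have "\<dots> = (\<integral>\<^sup>+t. ennreal (w0 r) * indicator A t \<partial>MI)"
      by (rule nn_integral_cmult_indicator[symmetric]) measurable
    also have "\<dots> \<le> (\<integral>\<^sup>+t. ennreal (w t) * indicator A t \<partial>MI)"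
    proof (intro nn_integral_mono)
      fix t show "ennreal (w0 r) * indicator A t \<le> ennreal (w t) * indicator A t"
        using True w_antimono[of t r] by (auto simp: indicator_def A_def w0_def intro!: ennreal_leI)
    qed
    finally show ?thesis .
  qed (simp add: w0_def)
  have le: "Wr p \<le> Wr r" using assms by (intro Wr_mono)
  have eq: "(\<integral>\<^sup>+t. ennreal (w t) * indicator A t \<partial>MI) = ennreal (Wr r - Wr p)"
  proof (cases "\<integral>\<^sup>+t. ennreal (w t) * indicator A t \<partial>MI")
    case (real d)
    then have "ennreal (Wr r) = ennreal (Wr p + d)" using split Wr_nonneg by (simp add: Wf_Wr)
    then have "Wr r = Wr p + d" using real Wr_nonneg by (subst (asm) ennreal_inj) auto
    then show ?thesis using real by simp
  qed (use split in \<open>simp add: Wf_Wr\<close>)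
  show "w0 r * (r - p) \<le> Wr r - Wr p" using lo le unfolding eq by (subst (asm) ennreal_le_iff) auto
  show "Wr r - Wr p \<le> w0 p * (r - p)" if "0 < p"
    using up[OF that] assms unfolding eq by (subst (asm) ennreal_le_iff) (auto simp: w0_def w_nonneg)
qed

lemma Wr_supergradient: "0 < x \<Longrightarrow> 0 \<le> y \<Longrightarrow> Wr y \<le> Wr x + w0 x * (y - x)"
  using Wr_increment(2)[of x y] Wr_increment(1)[of y x] by (cases "x \<le> y") (auto simp: algebra_simps)

text \<open>Concavity: the increment over an interval of length z shrinks as the interval moves
  right. Increments over intervals without overlap are separated by a value of \<open>w0\<close>;
  overlapping ones are first stripped of their common part, which leaves intervals of length y -
  x.\<close>

lemma Wr_submodular:
  assumes "0 \<le> x" "x \<le> y" "0 \<le> z"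
  shows "Wr (y + z) + Wr x \<le> Wr (x + z) + Wr y"
proof (cases "y = 0 \<or> z = 0")
  case True then show ?thesis using assms by auto
next
  case False
  show ?thesis
  proof (cases "x + z \<le> y")
    case True
    have "Wr (y + z) - Wr y \<le> w0 y * z" using Wr_increment(2)[of y "y + z"] assms False by simp
    also have "\<dots> \<le> w0 (x + z) * z" using True assms False by (intro mult_right_mono w0_antimono) auto
    also have "\<dots> \<le> Wr (x + z) - Wr x" using Wr_increment(1)[of x "x + z"] assms by simp
    finally show ?thesis by simp
  next
    case F2: False
    have "Wr (y + z) - Wr (x + z) \<le> w0 (x + z) * (y - x)" using Wr_increment(2)[of "x + z" "y + z"] assms False by (simp add: algebra_simps)
    also have "\<dots> \<le> w0 y * (y - x)" using F2 assms False by (intro mult_right_mono w0_antimono) auto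
    also have "\<dots> \<le> Wr y - Wr x" using Wr_increment(1)[of x y] assms by simp
    finally show ?thesis by simp
  qed
qed

lemma Wr_strict:
  assumes "0 \<le> x" "x < y" "ennreal y \<le> len"
  shows "Wr x < Wr y"
proof -
  \<comment> \<open>The midpoint lies in \<open>I\<close> even if y is the right end, and there the
    weight is positive.\<close>
  define m where "m = (x + y) / 2"
  have m: "x < m" "m < y" using assms by (auto simp: m_def)
  have "ennreal m < ennreal y" using m assms by (intro ennreal_lessI) auto
  then have mI: "m \<in> I" using assms m unfolding mem_I_iff by (auto intro: less_le_trans)
  have "0 < w0 m * (m - x)" using w_pos[OF mI] m mI by (simp add: w0_def)
  also have "\<dots> \<le> Wr m - Wr x" using m assms by (intro Wr_increment) auto
  finally show ?thesis using Wr_mono[of m y] m by simp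
qed

text \<open>Here f / u is the candidate v for P, and it exhausts the bound on each superlevel set of
  u. These sets are coded by upward closed predicates Q that fail at 0, so that strict and
  non-strict levels of u and of increasing functions of u are covered at once.\<close>

definition "level f u \<longleftrightarrow> u \<in> L0 I \<and> (\<forall>t. 0 \<le> u t) \<and> (AE t in MI. 0 < f t \<longleftrightarrow> 0 < u t) \<and>
   emeasure MI {t\<in>I. 0 < u t} < top \<and> below_W (\<lambda>t. f t / u t) \<and>
   (\<forall>Q. (\<forall>x y. Q x \<longrightarrow> x \<le> y \<longrightarrow> Q y) \<longrightarrow> \<not> Q (0::real) \<longrightarrow> {t\<in>I. Q (u t)} \<in> sets MI \<and>
      (\<integral>\<^sup>+t. ennreal (f t / u t) * indicator {t\<in>I. Q (u t)} t \<partial>MI) = Wf (emeasure MI {t\<in>I. Q (u t)}))"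

text \<open>The level sets of f form a finite ground set with weights c m(c), and \<omega> T is the
  primitive of w at the total measure of T, submodular because the primitive is concave. What
  remains is to pass from unions of level sets to arbitrary measurable sets.\<close>

lemma level_exists:
  assumes f [measurable]: "f \<in> L0 I" and f0: "\<And>t. 0 \<le> f t" and fin: "finite (f ` I)"
    and supp: "emeasure MI {t\<in>I. 0 < f t} < top"
  shows "\<exists>u C. level f u \<and> (\<forall>t. u t \<le> C)"
proof -
  define E where "E c = {t\<in>I. f t = c}" for c
  have Em [measurable]: "E c \<in> sets MI" for c
  proof -
    have "{t\<in>space MI. f t = c} \<in> sets MI" by measurable
    then show ?thesis by (simp add: E_def)
  qed
  have Efin: "emeasure MI (E c) < top" if "0 < c" for c
  proof -
    have "{t\<in>space MI. 0 < f t} \<in> sets MI" by measurable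
    then have "emeasure MI (E c) \<le> emeasure MI {t\<in>I. 0 < f t}" using that
      by (intro emeasure_mono) (auto simp: E_def)
    then show ?thesis using supp by (rule le_less_trans)
  qed
  define m where "m c = measure MI (E c)" for c
  have me: "emeasure MI (E c) = ennreal (m c)" if "0 < c" for c
    unfolding m_def using Efin[OF that] by (intro emeasure_eq_ennreal_measure) auto
  \<comment> \<open>Values attained on null sets are dropped, as they would violate strict
    monotonicity of \<omega>.\<close>
  define K where "K = {c \<in> f ` I. 0 < c \<and> 0 < m c}"
  have K: "finite K" "\<And>c. c \<in> K \<Longrightarrow> 0 < c" "\<And>c. c \<in> K \<Longrightarrow> 0 < m c" using fin by (auto simp: K_def)
  have disj: "disjoint_family_on E T" for T by (auto simp: disjoint_family_on_def E_def)
  have eU: "emeasure MI (\<Union>c\<in>T. E c) = ennreal (sum m T)" if "T \<subseteq> K" for T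
  proof -
    have "emeasure MI (\<Union>c\<in>T. E c) = (\<Sum>c\<in>T. emeasure MI (E c))"
      using that K(1) by (intro sum_emeasure[symmetric] disj) (auto intro: finite_subset)
    also have "\<dots> = (\<Sum>c\<in>T. ennreal (m c))" using that K(2) by (intro sum.cong) (auto simp: me)
    also have "\<dots> = ennreal (sum m T)" using that K(3) by (intro sum_ennreal) (auto simp: m_def)
    finally show ?thesis .
  qed
  have m0: "0 \<le> sum m T" for T by (auto simp: m_def intro: sum_nonneg)
  have "\<exists>u. (\<forall>i\<in>K. 0 < u i) \<and> (\<forall>T\<subseteq>K. (\<Sum>i\<in>T. (i * m i) / u i) \<le> Wr (sum m T))
      \<and> (\<forall>x. (\<Sum>i\<in>{i\<in>K. x \<le> u i}. (i * m i) / u i) = Wr (sum m {i\<in>K. x \<le> u i}))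
      \<and> (\<forall>r. (\<forall>T\<subseteq>K. (\<Sum>i\<in>T. i * m i) \<le> r * Wr (sum m T)) \<longrightarrow> (\<forall>i\<in>K. u i \<le> r))"
  proof (rule polymatroid_levels[of K "\<lambda>i. i * m i" "\<lambda>T. Wr (sum m T)"])
    fix A B :: "real set"
    show "Wr (sum m (A \<union> B)) + Wr (sum m (A \<inter> B)) \<le> Wr (sum m A) + Wr (sum m B)" if AB: "A \<subseteq> K" "B \<subseteq> K"
    proof -
      have f: "finite A" "finite B" using AB K(1) by (auto intro: finite_subset)
      have "sum m (A \<union> B) + sum m (A \<inter> B) = sum m A + sum m B" using f by (rule sum.union_inter)
      then have e: "sum m A + (sum m B - sum m (A \<inter> B)) = sum m (A \<union> B)" by simp
      have "sum m (A \<inter> B) \<le> sum m A" "sum m (A \<inter> B) \<le> sum m B"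
        using f by (auto intro!: sum_mono2 simp: m_def)
      then show ?thesis
        using Wr_submodular[of "sum m (A \<inter> B)" "sum m A" "sum m B - sum m (A \<inter> B)"] m0[of "A \<inter> B"]
        unfolding e by simp
    qed
    show "Wr (sum m A) < Wr (sum m B)" if AB: "A \<subset> B" "B \<subseteq> K"
    proof (rule Wr_strict[OF m0])
      obtain c where c: "c \<in> B - A" using AB(1) by blast
      show "sum m A < sum m B"
      proof (rule sum_strict_mono2[OF _ _ c])
        show "finite B" using that(2) K(1) by (rule finite_subset)
        show "0 < m c" using c that(2) K(3) by auto
      qed (use that(1) in \<open>auto simp: m_def\<close>)
      have "ennreal (sum m B) \<le> emeasure MI I" unfolding eU[OF that(2), symmetric]
        by (intro emeasure_mono) (auto simp: E_def sets_MI_iff)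
      then show "ennreal (sum m B) \<le> len" by (simp only: emeasure_I)
    qed
  qed (use K in auto)
  then obtain u where u': "\<forall>i\<in>K. 0 < u i" "\<forall>T\<subseteq>K. (\<Sum>i\<in>T. (i * m i) / u i) \<le> Wr (sum m T)"
      "\<forall>x. (\<Sum>i\<in>{i\<in>K. x \<le> u i}. (i * m i) / u i) = Wr (sum m {i\<in>K. x \<le> u i})"
    by (elim exE conjE) (rule that)
  note u = u'(1)[rule_format] u'(2)[rule_format] u'(3)[rule_format]
  define U where "U t = (\<Sum>c\<in>K. u c * indicator (E c) t)" for t
  have U: "U t = (if f t \<in> K \<and> t \<in> I then u (f t) else 0)" for t
  proof -
    have "U t = (\<Sum>c\<in>K. if c = f t then (if t \<in> I then u (f t) else 0) else 0)"
      unfolding U_def by (intro sum.cong) (auto simp: E_def indicator_def)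
    then show ?thesis using K(1) by (simp add: sum.delta)
  qed
  have Um [measurable]: "U \<in> L0 I" unfolding U_def by measurable
  define b where "b c = c / u c" for c
  have b0: "0 \<le> b c" if "c \<in> K" for c using K(2)[OF that] u(1)[OF that] by (simp add: b_def)
  have v: "f t / U t = (\<Sum>c\<in>K. b c * indicator (E c) t)" if "t \<in> I" for t
  proof -
    have "(\<Sum>c\<in>K. b c * indicator (E c) t) = (\<Sum>c\<in>K. if c = f t then b (f t) else 0)"
      using that by (intro sum.cong) (auto simp: E_def indicator_def)
    also have "\<dots> = f t / U t" using K(1) that by (simp add: sum.delta U b_def)
    finally show ?thesis by simp
  qed
  have int: "(\<integral>\<^sup>+t. ennreal (f t / U t) * indicator F t \<partial>MI) = ennreal (\<Sum>c\<in>K. b c * measure MI (E c \<inter> F))"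
    if F [measurable]: "F \<in> sets MI" for F
  proof -
    have "(\<integral>\<^sup>+t. ennreal (f t / U t) * indicator F t \<partial>MI) = (\<integral>\<^sup>+t. (\<Sum>c\<in>K. ennreal (b c) * indicator (E c \<inter> F) t) \<partial>MI)"
    proof (intro nn_integral_cong)
      fix t assume "t \<in> space MI"
      then have "ennreal (f t / U t) = (\<Sum>c\<in>K. ennreal (b c * indicator (E c) t))"
        using v b0 by (subst sum_ennreal) auto
      then show "ennreal (f t / U t) * indicator F t = (\<Sum>c\<in>K. ennreal (b c) * indicator (E c \<inter> F) t)"
        by (auto simp: sum_distrib_right indicator_def intro!: sum.cong)
    qed
    also have "\<dots> = (\<Sum>c\<in>K. ennreal (b c) * emeasure MI (E c \<inter> F))"
      by (subst nn_integral_sum) (auto simp: nn_integral_cmult_indicator)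
    also have "\<dots> = (\<Sum>c\<in>K. ennreal (b c * measure MI (E c \<inter> F)))"
    proof (intro sum.cong refl)
      fix c assume c: "c \<in> K"
      have "emeasure MI (E c \<inter> F) \<le> emeasure MI (E c)" by (intro emeasure_mono) auto
      then have "emeasure MI (E c \<inter> F) < top" using Efin[OF K(2)[OF c]] by (rule le_less_trans)
      then have "emeasure MI (E c \<inter> F) = ennreal (measure MI (E c \<inter> F))"
        by (intro emeasure_eq_ennreal_measure) auto
      then show "ennreal (b c) * emeasure MI (E c \<inter> F) = ennreal (b c * measure MI (E c \<inter> F))"
        using b0[OF c] by (simp add: ennreal_mult)
    qed
    also have "\<dots> = ennreal (\<Sum>c\<in>K. b c * measure MI (E c \<inter> F))"
      using b0 by (intro sum_ennreal) auto
    finally show ?thesis .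
  qed
  have "below_W (\<lambda>t. f t / U t)"
    unfolding below_W_def
  proof
    fix F assume F [measurable]: "F \<in> sets MI"
    define e where "e c = measure MI (E c \<inter> F)" for c
    have e0: "0 \<le> e c" for c by (simp add: e_def)
    have eF: "emeasure MI (E c \<inter> F) = ennreal (e c)" if "c \<in> K" for c
    proof -
      have "emeasure MI (E c \<inter> F) \<le> emeasure MI (E c)" by (intro emeasure_mono) auto
      then have "emeasure MI (E c \<inter> F) < top" using Efin[OF K(2)[OF that]] by (rule le_less_trans)
      then show ?thesis unfolding e_def by (intro emeasure_eq_ennreal_measure) auto
    qed
    have em: "e c \<le> m c" if "c \<in> K" for c
    proof -
      have "ennreal (e c) \<le> ennreal (m c)" unfolding eF[OF that, symmetric] me[OF K(2)[OF that], symmetric]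
        by (intro emeasure_mono) auto
      then show ?thesis by (subst (asm) ennreal_le_iff) (auto simp: m_def)
    qed
    let ?x = "sum e K"
    have xF: "ennreal ?x \<le> emeasure MI F"
    proof -
      have "ennreal ?x = (\<Sum>c\<in>K. emeasure MI (E c \<inter> F))"
        using e0 eF by (subst sum_ennreal[symmetric]) auto
      also have "\<dots> = emeasure MI (\<Union>c\<in>K. E c \<inter> F)"
      proof (rule sum_emeasure[OF _ _ K(1)])
        show "disjoint_family_on (\<lambda>c. E c \<inter> F) K" by (auto simp: disjoint_family_on_def E_def)
      qed auto
      also have "\<dots> \<le> emeasure MI F" by (intro emeasure_mono) auto
      finally show ?thesis .
    qed
    have "(\<Sum>c\<in>K. b c * e c) \<le> Wr ?x"
    proof (cases "?x = 0")
      case True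
      then have "\<forall>c\<in>K. e c = 0" using K(1) e0 by (simp add: sum_nonneg_eq_0_iff)
      then show ?thesis using True by simp
    next
      case False
      then have x0: "0 < ?x" using e0 by (simp add: sum_nonneg order.not_eq_order_implies_strict)
      \<comment> \<open>The slope of a line supporting the primitive at \<open>?x\<close>. Relative
        to it, filling up the level sets with density above \<beta> and emptying the others can only
        increase the left side, and for unions of full level sets the bound is known.\<close>
      define \<beta> where "\<beta> = w0 ?x"
      define T where "T = {c\<in>K. \<beta> < b c}"
      have T: "T \<subseteq> K" "finite T" using K(1) by (auto simp: T_def)
      have "(\<Sum>c\<in>K. (b c - \<beta>) * e c) = (\<Sum>c\<in>T. (b c - \<beta>) * e c) + (\<Sum>c\<in>K - T. (b c - \<beta>) * e c)"
        using T K(1) by (simp add: sum.subset_diff)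
      also have "\<dots> \<le> (\<Sum>c\<in>T. (b c - \<beta>) * m c) + 0"
        using T em e0 by (intro add_mono sum_mono mult_left_mono sum_nonpos)
          (auto simp: T_def mult_nonpos_nonneg)
      also have "\<dots> = (\<Sum>c\<in>T. (c * m c) / u c) - \<beta> * sum m T"
        by (simp add: b_def algebra_simps sum_subtractf sum_distrib_left)
      also have "\<dots> \<le> Wr (sum m T) - \<beta> * sum m T" using u(2)[OF T(1)] by simp
      also have "\<dots> \<le> Wr ?x - \<beta> * ?x" using Wr_supergradient[OF x0 m0, of T] by (simp add: \<beta>_def algebra_simps)
      finally have "(\<Sum>c\<in>K. b c * e c) - \<beta> * ?x \<le> Wr ?x - \<beta> * ?x"
        by (simp add: algebra_simps sum_subtractf sum_distrib_left)
      then show ?thesis by simp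
    qed
    then have "(\<integral>\<^sup>+t. ennreal (f t / U t) * indicator F t \<partial>MI) \<le> ennreal (Wr ?x)"
      unfolding int[OF F] e_def by (rule ennreal_leI)
    also have "\<dots> = Wf (ennreal ?x)" by (rule Wf_Wr[symmetric])
    also have "\<dots> \<le> Wf (emeasure MI F)" using xF by (rule Wf_mono)
    finally show "(\<integral>\<^sup>+t. ennreal (f t / U t) * indicator F t \<partial>MI) \<le> Wf (emeasure MI F)" .
  qed
  moreover have "{t\<in>I. Q (U t)} \<in> sets MI \<and>
      (\<integral>\<^sup>+t. ennreal (f t / U t) * indicator {t\<in>I. Q (U t)} t \<partial>MI) = Wf (emeasure MI {t\<in>I. Q (U t)})"
    if Q: "\<forall>x y. Q x \<longrightarrow> x \<le> y \<longrightarrow> Q y" "\<not> Q 0" for Q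
  proof -
    define T where "T = {c\<in>K. Q (u c)}"
    have TK: "T \<subseteq> K" and Tf: "finite T" using K(1) by (auto simp: T_def)
    have eq: "{t\<in>I. Q (U t)} = (\<Union>c\<in>T. E c)" using Q(2) by (auto simp: U T_def E_def)
    have mm: "(\<Union>c\<in>T. E c) \<in> sets MI" using Tf by auto
    have tight: "(\<Sum>i\<in>T. (i * m i) / u i) = Wr (sum m T)"
    proof (cases "T = {}")
      case False
      \<comment> \<open>On finitely many values an upward closed predicate is a threshold, at the
        least value of u on T.\<close>
      define x where "x = Min (u ` T)"
      have "x \<in> u ` T" unfolding x_def using Tf False by (intro Min_in) auto
      then have Qx: "Q x" by (auto simp: T_def)
      have "T = {i\<in>K. x \<le> u i}"
      proof (intro equalityI subsetI)
        fix i assume "i \<in> T" then show "i \<in> {i\<in>K. x \<le> u i}" using Tf TK by (auto simp: x_def)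
      next
        fix i assume "i \<in> {i\<in>K. x \<le> u i}" then show "i \<in> T" using Q(1) Qx by (auto simp: T_def)
      qed
      then show ?thesis using u(3)[of x] by simp
    qed simp
    have "(\<Sum>c\<in>K. b c * measure MI (E c \<inter> (\<Union>c\<in>T. E c))) = (\<Sum>c\<in>T. b c * measure MI (E c \<inter> (\<Union>c\<in>T. E c)))"
    proof (rule sum.mono_neutral_right[OF K(1) TK])
      show "\<forall>i\<in>K - T. b i * measure MI (E i \<inter> (\<Union>c\<in>T. E c)) = 0"
      proof
        fix i assume "i \<in> K - T"
        then have "E i \<inter> (\<Union>c\<in>T. E c) = {}" by (auto simp: E_def)
        then show "b i * measure MI (E i \<inter> (\<Union>c\<in>T. E c)) = 0" by (simp only: measure_empty mult_zero_right)
      qed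
    qed
    also have "\<dots> = (\<Sum>i\<in>T. (i * m i) / u i)"
    proof (intro sum.cong refl)
      fix c assume "c \<in> T"
      then have "E c \<inter> (\<Union>c\<in>T. E c) = E c" by auto
      then show "b c * measure MI (E c \<inter> (\<Union>c\<in>T. E c)) = c * m c / u c" by (simp only: b_def m_def times_divide_eq_left)
    qed
    finally have "(\<integral>\<^sup>+t. ennreal (f t / U t) * indicator (\<Union>c\<in>T. E c) t \<partial>MI) = ennreal (Wr (sum m T))"
      using int[OF mm] tight by simp
    also have "\<dots> = Wf (emeasure MI (\<Union>c\<in>T. E c))" using eU[OF TK] by (simp add: Wf_Wr)
    finally show ?thesis using mm unfolding eq by blast
  qed
  moreover have "AE t in MI. 0 < f t \<longleftrightarrow> 0 < U t"
  proof -
    define N where "N = (\<Union>c\<in>{c\<in>f ` I. 0 < c \<and> m c = 0}. E c)"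
    have "E c \<in> null_sets MI" if "0 < c" "m c = 0" for c
      using me[OF that(1)] that(2) by (intro null_setsI) auto
    then have "N \<in> null_sets MI" unfolding N_def using fin by (intro null_sets.finite_UN) auto
    then have "AE t in MI. t \<notin> N" by (rule AE_not_in)
    then show ?thesis
    proof (rule AE_mp, intro AE_I2 impI)
      fix t assume t: "t \<in> space MI" "t \<notin> N"
      show "0 < f t \<longleftrightarrow> 0 < U t"
      proof
        assume ft: "0 < f t"
        then have "m (f t) \<noteq> 0" using t by (auto simp: N_def E_def)
        then have "f t \<in> K" using ft t by (auto simp: K_def m_def order.not_eq_order_implies_strict)
        then show "0 < U t" using u(1) t by (simp add: U)
      next
        assume "0 < U t" then show "0 < f t" using K(2) by (auto simp: U split: if_splits)
      qed
    qed
  qed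
  moreover have "emeasure MI {t\<in>I. 0 < U t} < top"
  proof -
    have "{t\<in>space MI. 0 < f t} \<in> sets MI" by measurable
    then have "emeasure MI {t\<in>I. 0 < U t} \<le> emeasure MI {t\<in>I. 0 < f t}"
      using K(2) by (intro emeasure_mono) (auto simp: U split: if_splits)
    then show ?thesis using supp by (rule le_less_trans)
  qed
  moreover have "0 \<le> U t" for t using u(1) by (auto simp: U less_imp_le)
  ultimately have "level f U" unfolding level_def using Um by blast
  moreover have "U t \<le> (\<Sum>c\<in>K. u c)" for t unfolding U_def
    using u(1) by (intro sum_mono) (auto simp: indicator_def less_imp_le)
  ultimately show ?thesis by blast
qed

text \<open>On sets of finite measure the integrals of v are finite, so they form a real additive
  set function whose values may be subtracted.\<close>

lemma below_W_real:
  assumes v [measurable]: "v \<in> L0 I" and bW: "below_W v"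
  defines "\<nu> \<equiv> \<lambda>E. enn2real (\<integral>\<^sup>+t. ennreal (v t) * indicator E t \<partial>MI)"
  shows "E \<in> sets MI \<Longrightarrow> emeasure MI E < top \<Longrightarrow> (\<integral>\<^sup>+t. ennreal (v t) * indicator E t \<partial>MI) = ennreal (\<nu> E)"
    and "E \<in> sets MI \<Longrightarrow> emeasure MI E < top \<Longrightarrow> \<nu> E \<le> Wr (measure MI E)"
    and "E \<in> sets MI \<Longrightarrow> F \<in> sets MI \<Longrightarrow> E \<inter> F = {} \<Longrightarrow> emeasure MI E < top \<Longrightarrow> emeasure MI F < top \<Longrightarrow>
      \<nu> (E \<union> F) = \<nu> E + \<nu> F"
proof -
  have eqWr: "Wf (emeasure MI E) = ennreal (Wr (measure MI E))" if "emeasure MI E < top" for E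
  proof -
    have "emeasure MI E = ennreal (measure MI E)" using that by (intro emeasure_eq_ennreal_measure) auto
    then show ?thesis by (simp add: Wf_Wr)
  qed
  have le: "(\<integral>\<^sup>+t. ennreal (v t) * indicator E t \<partial>MI) \<le> ennreal (Wr (measure MI E))"
    if "E \<in> sets MI" "emeasure MI E < top" for E
    using bW that eqWr[of E] by (auto simp: below_W_def)
  show eq: "(\<integral>\<^sup>+t. ennreal (v t) * indicator E t \<partial>MI) = ennreal (\<nu> E)"
    if "E \<in> sets MI" "emeasure MI E < top" for E
    using le[OF that] unfolding \<nu>_def by (cases "\<integral>\<^sup>+t. ennreal (v t) * indicator E t \<partial>MI") (auto simp: top_unique)
  show "\<nu> E \<le> Wr (measure MI E)" if "E \<in> sets MI" "emeasure MI E < top" for E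
    using le[OF that] Wr_nonneg unfolding eq[OF that] by (subst (asm) ennreal_le_iff) auto
  show "\<nu> (E \<union> F) = \<nu> E + \<nu> F"
    if EF: "E \<in> sets MI" "F \<in> sets MI" "E \<inter> F = {}" and fin: "emeasure MI E < top" "emeasure MI F < top"
  proof -
    have [measurable]: "E \<in> sets MI" "F \<in> sets MI" by fact+
    have "(\<integral>\<^sup>+t. ennreal (v t) * indicator (E \<union> F) t \<partial>MI)
       = (\<integral>\<^sup>+t. ennreal (v t) * indicator E t + ennreal (v t) * indicator F t \<partial>MI)"
      using EF(3) by (intro nn_integral_cong) (auto simp: indicator_def)
    also have "\<dots> = ennreal (\<nu> E) + ennreal (\<nu> F)"
      using eq[OF EF(1) fin(1)] eq[OF EF(2) fin(2)] by (subst nn_integral_add) auto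
    also have "\<dots> = ennreal (\<nu> E + \<nu> F)" by (rule ennreal_plus[symmetric]) (simp_all add: \<nu>_def)
    finally have X: "(\<integral>\<^sup>+t. ennreal (v t) * indicator (E \<union> F) t \<partial>MI) = ennreal (\<nu> E + \<nu> F)" .
    have "\<nu> (E \<union> F) = enn2real (\<integral>\<^sup>+t. ennreal (v t) * indicator (E \<union> F) t \<partial>MI)" by (simp only: \<nu>_def)
    also have "\<dots> = enn2real (ennreal (\<nu> E + \<nu> F))" by (simp only: X)
    also have "\<dots> = \<nu> E + \<nu> F" by (rule enn2real_ennreal) (simp add: \<nu>_def)
    finally show ?thesis .
  qed
qed

text \<open>Let T and A be the sets where u > x and u' > x, and B = T - A. Tightness on T and A
  together with concavity of the primitive forces the integral of g / u' over B to be at most that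
  of f / u. But on B one has u' <= x < u and f <= g, so g / u' > f / u almost everywhere there, and
  B is null.\<close>

lemma level_mono:
  assumes f [measurable]: "f \<in> L0 I" and g [measurable]: "g \<in> L0 I" and f0: "\<And>t. t \<in> I \<Longrightarrow> 0 \<le> f t"
    and fg: "\<And>t. t \<in> I \<Longrightarrow> f t \<le> g t" and u: "level f u" and u': "level g u'"
  shows "AE t in MI. u t \<le> u' t"
proof -
  have [measurable]: "u \<in> L0 I" "u' \<in> L0 I" using u u' by (auto simp: level_def)
  have bW: "below_W (\<lambda>t. f t / u t)" "below_W (\<lambda>t. g t / u' t)" using u u' by (auto simp: level_def)
  have m: "(\<lambda>t. f t / u t) \<in> L0 I" "(\<lambda>t. g t / u' t) \<in> L0 I" by measurable
  define \<nu> where "\<nu> E = enn2real (\<integral>\<^sup>+t. ennreal (f t / u t) * indicator E t \<partial>MI)" for E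
  define \<nu>' where "\<nu>' E = enn2real (\<integral>\<^sup>+t. ennreal (g t / u' t) * indicator E t \<partial>MI)" for E
  note \<nu> = below_W_real[OF m(1) bW(1), folded \<nu>_def]
  note \<nu>' = below_W_real[OF m(2) bW(2), folded \<nu>'_def]
  have main: "AE t in MI. \<not> (u' t \<le> x \<and> x < u t)" if x: "0 \<le> x" for x
  proof -
    define A where "A = {t\<in>I. x < u' t}"
    define T where "T = {t\<in>I. x < u t}"
    define B where "B = T - A"
    have sup: "emeasure MI {t\<in>I. 0 < u t} < top" "emeasure MI {t\<in>I. 0 < u' t} < top" using u u' by (auto simp: level_def)
    have pm: "{t\<in>space MI. 0 < u t} \<in> sets MI" "{t\<in>space MI. 0 < u' t} \<in> sets MI"
      "{t\<in>space MI. x < u t} \<in> sets MI" "{t\<in>space MI. x < u' t} \<in> sets MI" by measurable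
    then have [measurable]: "A \<in> sets MI" "T \<in> sets MI" "B \<in> sets MI" by (auto simp: A_def T_def B_def)
    have Afin: "emeasure MI A < top"
      using sup(2) pm x by (intro le_less_trans[OF emeasure_mono[of A "{t\<in>I. 0 < u' t}"]]) (auto simp: A_def)
    have Tfin: "emeasure MI T < top"
      using sup(1) pm x by (intro le_less_trans[OF emeasure_mono[of T "{t\<in>I. 0 < u t}"]]) (auto simp: T_def)
    have Bfin: "emeasure MI B < top"
      using Tfin by (intro le_less_trans[OF emeasure_mono[of B T]]) (auto simp: B_def)
    have TAfin: "emeasure MI (T \<inter> A) < top"
      using Tfin by (intro le_less_trans[OF emeasure_mono[of "T \<inter> A" T]]) auto
    have ABfin: "emeasure MI (A \<union> B) < top"
      using emeasure_subadditive[of A MI B] Afin Bfin by (auto intro: le_less_trans)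
    have tight: "(\<integral>\<^sup>+t. ennreal (f t / u t) * indicator T t \<partial>MI) = Wf (emeasure MI T)"
      "(\<integral>\<^sup>+t. ennreal (g t / u' t) * indicator A t \<partial>MI) = Wf (emeasure MI A)"
      using u[unfolded level_def, THEN conjunct2, THEN conjunct2, THEN conjunct2, THEN conjunct2, THEN conjunct2, THEN spec, of "\<lambda>y. x < y"]
        u'[unfolded level_def, THEN conjunct2, THEN conjunct2, THEN conjunct2, THEN conjunct2, THEN conjunct2, THEN spec, of "\<lambda>y. x < y"] x
      by (auto simp: T_def A_def)
    have e: "emeasure MI E = ennreal (measure MI E)" if "emeasure MI E < top" for E
      using that by (intro emeasure_eq_ennreal_measure) auto
    have tT: "\<nu> T = Wr (measure MI T)"
      unfolding \<nu>_def tight e[OF Tfin] Wf_Wr using Wr_nonneg by simp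
    have tA: "\<nu>' A = Wr (measure MI A)"
      unfolding \<nu>'_def tight e[OF Afin] Wf_Wr using Wr_nonneg by simp
    have mAB: "measure MI (A \<union> B) = measure MI A + measure MI B"
      using Afin Bfin by (intro measure_Union) (auto simp: B_def)
    have Tsplit: "T = (T \<inter> A) \<union> B" by (auto simp: B_def)
    have mT: "measure MI T = measure MI (T \<inter> A) + measure MI B"
      using TAfin Bfin by (subst Tsplit, intro measure_Union) (auto simp: B_def)
    have "\<nu>' A + \<nu>' B \<le> Wr (measure MI A + measure MI B)"
      using \<nu>'(3)[of A B] \<nu>'(2)[of "A \<union> B"] Afin Bfin ABfin mAB by (auto simp: B_def)
    moreover have "\<nu> T = \<nu> (T \<inter> A) + \<nu> B"
      using \<nu>(3)[of "T \<inter> A" B] TAfin Bfin Tsplit by (auto simp: B_def)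
    moreover have "\<nu> (T \<inter> A) \<le> Wr (measure MI (T \<inter> A))" using \<nu>(2)[of "T \<inter> A"] TAfin by auto
    moreover have "Wr (measure MI A + measure MI B) + Wr (measure MI (T \<inter> A)) \<le> Wr (measure MI (T \<inter> A) + measure MI B) + Wr (measure MI A)"
    proof (rule Wr_submodular)
      have "ennreal (measure MI (T \<inter> A)) \<le> ennreal (measure MI A)"
        unfolding e[OF TAfin, symmetric] e[OF Afin, symmetric] by (intro emeasure_mono) auto
      then show "measure MI (T \<inter> A) \<le> measure MI A" by (subst (asm) ennreal_le_iff) auto
    qed auto
    ultimately have "\<nu>' B \<le> \<nu> B" using tT tA mT by simp
    then have le: "(\<integral>\<^sup>+t. ennreal (g t / u' t) * indicator B t \<partial>MI) \<le> (\<integral>\<^sup>+t. ennreal (f t / u t) * indicator B t \<partial>MI)"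
      using \<nu>(1)[of B] \<nu>'(1)[of B] Bfin by (auto intro: ennreal_leI)
    have strict: "AE t in MI. t \<in> B \<longrightarrow> 0 \<le> f t / u t \<and> f t / u t < g t / u' t"
    proof -
      have "AE t in MI. 0 < f t \<longleftrightarrow> 0 < u t" "AE t in MI. 0 < g t \<longleftrightarrow> 0 < u' t" using u u' by (auto simp: level_def)
      then have "AE t in MI. (0 < f t \<longleftrightarrow> 0 < u t) \<and> (0 < g t \<longleftrightarrow> 0 < u' t)" by eventually_elim auto
      then show ?thesis
      proof (rule AE_mp, intro AE_I2 impI)
        fix t assume t: "t \<in> space MI" "(0 < f t \<longleftrightarrow> 0 < u t) \<and> (0 < g t \<longleftrightarrow> 0 < u' t)" "t \<in> B"
        then have b: "x < u t" "u' t \<le> x" by (auto simp: B_def T_def A_def)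
        then have ft: "0 < f t" "f t \<le> g t" "0 < u t" using t x fg[of t] by auto
        then have ut: "0 < u' t" using t by auto
        have "f t / u t \<le> g t / u t" using ft by (intro divide_right_mono) auto
        also have "\<dots> < g t / u' t" using ft ut b by (intro divide_strict_left_mono) auto
        finally show "0 \<le> f t / u t \<and> f t / u t < g t / u' t" using ft by auto
      qed
    qed
    let ?X = "\<integral>\<^sup>+t. ennreal (f t / u t) * indicator B t \<partial>MI"
    let ?Y = "\<integral>\<^sup>+t. ennreal (g t / u' t - f t / u t) * indicator B t \<partial>MI"
    have "?X + ?Y = (\<integral>\<^sup>+t. ennreal (f t / u t) * indicator B t + ennreal (g t / u' t - f t / u t) * indicator B t \<partial>MI)"
      by (rule nn_integral_add[symmetric]) measurable
    also have "\<dots> = (\<integral>\<^sup>+t. ennreal (g t / u' t) * indicator B t \<partial>MI)"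
    proof (rule nn_integral_cong_AE)
      show "AE t in MI. ennreal (f t / u t) * indicator B t + ennreal (g t / u' t - f t / u t) * indicator B t
          = ennreal (g t / u' t) * indicator B t"
        using strict
      proof eventually_elim
        case (elim t)
        show ?case
        proof (cases "t \<in> B")
          case True
          then show ?thesis using elim ennreal_plus[of "f t / u t" "g t / u' t - f t / u t"] by simp
        qed simp
      qed
    qed
    also have "\<dots> \<le> ?X" by (rule le)
    finally have XY: "?X + ?Y \<le> ?X" .
    have "?Y = 0"
    proof -
      have "?X = ennreal (\<nu> B)" using \<nu>(1)[of B] Bfin by auto
      then have Xf: "?X \<noteq> top" by simp
      have "?X + ?Y \<le> ?X + 0" using XY by simp
      then show ?thesis using Xf by (subst (asm) ennreal_add_left_cancel_le) auto
    qed
    then have "AE t in MI. ennreal (g t / u' t - f t / u t) * indicator B t = 0"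
      by (subst (asm) nn_integral_0_iff_AE) auto
    then have "AE t in MI. ennreal (g t / u' t - f t / u t) * indicator B t = 0 \<and> t \<in> I" using AE_space[of MI] by eventually_elim simp
    then show ?thesis using strict
    proof eventually_elim
      case (elim t)
      then have "t \<notin> B" by (auto simp: indicator_def ennreal_eq_0_iff split: if_splits)
      then show ?case using elim by (auto simp: B_def T_def A_def)
    qed
  qed
  \<comment> \<open>Countably many levels suffice, because a rational lies strictly between u' t and
    u t whenever u' t < u t.\<close>
  have "AE t in MI. \<forall>x\<in>{x\<in>\<rat>. 0 \<le> x}. \<not> (u' t \<le> x \<and> x < u t)"
  proof (rule AE_ball_countable[THEN iffD2])
    show "countable {x\<in>\<rat>. 0 \<le> (x::real)}" using countable_rat by (rule countable_subset[rotated]) auto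
  qed (use main in auto)
  then show ?thesis
  proof eventually_elim
    case (elim t)
    show ?case
    proof (rule ccontr)
      assume "\<not> u t \<le> u' t"
      then obtain x where x: "x \<in> \<rat>" "u' t < x" "x < u t" using Rats_dense_in_real[of "u' t" "u t"] by auto
      moreover have "0 \<le> u' t" using u' by (simp add: level_def)
      ultimately show False using elim by auto
    qed
  qed
qed

text \<open>The test function is h = \<eta> (u). Equality in the Young inequality gives f h = \<phi>
  (u) v + v \<psi> (h), and tightness on the superlevel sets bounds \<open>Nd h\<close> by 1 plus
  the integral of v \<psi> (h). This integral is finite because u is bounded with support of finite
  measure, so it cancels and 1 remains.\<close>

lemma level_modular_le_1:
  assumes F [measurable]: "F \<in> L0 I" and bd: "\<And>h. h \<in> L0 I \<Longrightarrow> Nd h < top \<Longrightarrow> (\<integral>\<^sup>+t. ennreal \<bar>F t * h t\<bar> \<partial>MI) \<le> Nd h"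
    and f [measurable]: "f \<in> L0 I" and f0: "\<And>t. t \<in> I \<Longrightarrow> 0 \<le> f t" and fF: "\<And>t. t \<in> I \<Longrightarrow> f t \<le> \<bar>F t\<bar>"
    and u: "level f u" and C: "\<And>t. u t \<le> C"
  shows "(\<integral>\<^sup>+t. ennreal (\<phi> (u t) * (f t / u t)) \<partial>MI) \<le> 1"
proof -
  have um [measurable]: "u \<in> L0 I" and u0: "\<And>t. 0 \<le> u t" and sup: "emeasure MI {t\<in>I. 0 < u t} < top"
    and bW: "below_W (\<lambda>t. f t / u t)" and AEu: "AE t in MI. 0 < f t \<longleftrightarrow> 0 < u t"
    using u by (auto simp: level_def)
  have tight: "{t\<in>I. Q (u t)} \<in> sets MI \<and> (\<integral>\<^sup>+t. ennreal (f t / u t) * indicator {t\<in>I. Q (u t)} t \<partial>MI) = Wf (emeasure MI {t\<in>I. Q (u t)})"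
    if "\<forall>x y. Q x \<longrightarrow> x \<le> y \<longrightarrow> Q y" "\<not> Q 0" for Q using u that unfolding level_def by blast
  let ?v = "\<lambda>t. f t / u t"
  define E where "E = {t\<in>I. 0 < u t}"
  have Em [measurable]: "E \<in> sets MI"
  proof -
    have "{t\<in>space MI. 0 < u t} \<in> sets MI" by measurable
    then show ?thesis by (simp add: E_def)
  qed
  have vm [measurable]: "?v \<in> L0 I" by measurable
  have v0: "0 \<le> ?v t" if "t \<in> I" for t using f0[OF that] u0[of t] by simp
  define h where "h t = \<eta> (u t)" for t
  have hm [measurable]: "h \<in> L0 I" unfolding h_def by measurable
  have h0: "0 \<le> h t" for t by (simp add: h_def eta_nonneg)
  have hE: "\<bar>h t\<bar> \<le> \<eta> C * indicator E t" if "t \<in> I" for t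
  proof (cases "t \<in> E")
    case False
    then have "u t = 0" using u0[of t] that by (auto simp: E_def not_less)
    then show ?thesis using False by (simp add: h_def)
  qed (use h0[of t] monoD[OF eta_mono C] in \<open>simp add: h_def\<close>)
  obtain e where e: "emeasure MI E \<le> ennreal e" using sup by (cases "emeasure MI E") (auto simp: E_def)
  have fin: "rear h t < top" for t
    using rear_bounded_support(1)[OF hm Em e eta_nonneg hE, of t] by (auto intro: le_less_trans)
  let ?Psi = "\<integral>\<^sup>+t. ennreal (?v t) * ennreal (\<psi> (h t)) \<partial>MI"
  have Psi_fin: "?Psi < top"
  proof -
    have "?Psi \<le> (\<integral>\<^sup>+t. ennreal (\<psi> (\<eta> C)) * (ennreal (?v t) * indicator E t) \<partial>MI)"
    proof (intro nn_integral_mono)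
      fix t assume "t \<in> space MI"
      then have t: "t \<in> I" by simp
      show "ennreal (?v t) * ennreal (\<psi> (h t)) \<le> ennreal (\<psi> (\<eta> C)) * (ennreal (?v t) * indicator E t)"
      proof (cases "t \<in> E")
        case True
        have "\<psi> (h t) \<le> \<psi> (\<eta> C)" unfolding h_def by (intro psi_mono monoD[OF eta_mono] C)
        then have "ennreal (?v t) * ennreal (\<psi> (h t)) \<le> ennreal (?v t) * ennreal (\<psi> (\<eta> C))"
          by (intro mult_left_mono ennreal_leI) auto
        then show ?thesis using True by (simp add: mult.commute)
      next
        case False
        then have "u t = 0" using u0[of t] t by (auto simp: E_def not_less)
        then show ?thesis by simp
      qed
    qed
    also have "\<dots> = ennreal (\<psi> (\<eta> C)) * (\<integral>\<^sup>+t. ennreal (?v t) * indicator E t \<partial>MI)" by (rule nn_integral_cmult) measurable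
    also have "\<dots> \<le> ennreal (\<psi> (\<eta> C)) * Wf (emeasure MI E)" using bW by (intro mult_left_mono) (auto simp: below_W_def)
    also have "\<dots> < top" using Wf_finite[of "emeasure MI E"] sup by (auto simp: ennreal_mult_less_top E_def)
    finally show ?thesis .
  qed
  have "(\<integral>\<^sup>+t. ennreal (w t) * ennreal (\<psi> (enn2real (rear h t))) \<partial>MI) \<le> ?Psi"
  proof (rule psi_integral_ge[OF hm h0 fin vm])
    fix s :: real assume s: "0 \<le> s"
    have Q: "\<forall>x y. s < \<eta> x \<longrightarrow> x \<le> y \<longrightarrow> s < \<eta> y" "\<not> s < \<eta> 0"
      using s monoD[OF eta_mono] by (auto intro: less_le_trans)
    have eq: "{t\<in>I. s < h t} = {t\<in>I. s < \<eta> (u t)}" "dist_f h s = emeasure MI {t\<in>I. s < \<eta> (u t)}"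
      by (simp_all add: h_def dist_f_eq abs_of_nonneg eta_nonneg)
    show "Wf (dist_f h s) \<le> (\<integral>\<^sup>+t. ennreal (?v t) * indicator {t\<in>I. s < h t} t \<partial>MI)"
      unfolding eq using tight[OF Q] by simp
  qed
  then have Ndh: "Nd h \<le> 1 + ?Psi" using Nd_le_psi[OF hm fin] by (auto intro: order_trans add_left_mono)
  then have Ndf: "Nd h < top" using Psi_fin by (auto intro: le_less_trans)
  have \<phi>m [measurable]: "(\<lambda>t. ennreal (\<phi> (u t) * ?v t)) \<in> borel_measurable MI"
  proof -
    have "(\<lambda>t. ennreal (\<phi> (max 0 (u t)) * ?v t)) \<in> borel_measurable MI" by measurable
    then show ?thesis using u0 by (simp add: max_absorb2)
  qed
  have "(\<integral>\<^sup>+t. ennreal (\<phi> (u t) * ?v t) \<partial>MI) + ?Psi = (\<integral>\<^sup>+t. ennreal (\<phi> (u t) * ?v t) + ennreal (?v t) * ennreal (\<psi> (h t)) \<partial>MI)"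
    by (rule nn_integral_add[symmetric]) measurable
  also have "\<dots> = (\<integral>\<^sup>+t. ennreal (f t * h t) \<partial>MI)"
  proof (rule nn_integral_cong_AE)
    show "AE t in MI. ennreal (\<phi> (u t) * ?v t) + ennreal (?v t) * ennreal (\<psi> (h t)) = ennreal (f t * h t)"
      using AEu
    proof (rule AE_mp, intro AE_I2 impI)
      fix t assume t: "t \<in> space MI" "0 < f t \<longleftrightarrow> 0 < u t"
      show "ennreal (\<phi> (u t) * ?v t) + ennreal (?v t) * ennreal (\<psi> (h t)) = ennreal (f t * h t)"
      proof (cases "0 < u t")
        case True
        have "\<phi> (u t) * ?v t + ?v t * \<psi> (h t) = (u t * \<eta> (u t)) * ?v t"
          using eta_young_eq[OF u0[of t]] by (simp add: h_def algebra_simps)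
        also have "\<dots> = f t * h t" using True by (simp add: h_def)
        finally show ?thesis using t True v0[of t] phi_nonneg[OF u0[of t]] psi_nonneg
          by (simp flip: ennreal_plus ennreal_mult)
      next
        case False
        then have "u t = 0" using u0[of t] by simp
        then show ?thesis by (simp add: h_def)
      qed
    qed
  qed
  also have "\<dots> \<le> (\<integral>\<^sup>+t. ennreal \<bar>F t * h t\<bar> \<partial>MI)"
    using fF h0 by (intro nn_integral_mono ennreal_leI) (auto simp: abs_mult intro: mult_right_mono)
  also have "\<dots> \<le> Nd h" using bd[OF hm Ndf] .
  also have "\<dots> \<le> 1 + ?Psi" by (rule Ndh)
  finally have "?Psi + (\<integral>\<^sup>+t. ennreal (\<phi> (u t) * ?v t) \<partial>MI) \<le> ?Psi + 1" by (simp add: add.commute)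
  then show ?thesis using Psi_fin by (subst (asm) ennreal_add_left_cancel_le) auto
qed

text \<open>Simple functions f n increase to |F| and, by \<open>level_mono\<close>, their levels u n
  increase almost everywhere; f n / u n converges to v = |F| / U with U the limit of the levels.
  Fatou gives both that v is below w and that the integral defining P at this v is at most
  1.\<close>

theorem P_modular_le_1:
  assumes F [measurable]: "F \<in> L0 I" and bd: "\<And>h. h \<in> L0 I \<Longrightarrow> Nd h < top \<Longrightarrow> (\<integral>\<^sup>+t. ennreal \<bar>F t * h t\<bar> \<partial>MI) \<le> Nd h"
  shows "P_modular I \<phi> w F \<le> 1"
proof -
  obtain b :: "nat \<Rightarrow> real" where b: "incseq b" "\<And>n. b n \<in> I" "\<And>t. t \<in> I \<Longrightarrow> \<exists>n. t < b n"
    by (rule I_exhaustion) blast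
  define E where "E n = {t\<in>I. ennreal t < ennreal (b n)}" for n
  have Em [measurable]: "E n \<in> sets MI" for n unfolding E_def by (rule set_initial_MI)
  have Ee: "emeasure MI (E n) < top" for n
    unfolding E_def emeasure_initial by (rule le_less_trans[of _ "ennreal (b n)"]) auto
  obtain s :: "nat \<Rightarrow> real \<Rightarrow> real" where s: "incseq s" "\<And>i. simple_function MI (s i)" "\<And>x. bdd_above (range (\<lambda>i. s i x))"
    "\<And>i x. 0 \<le> s i x" "(\<lambda>t. \<bar>F t\<bar>) = (SUP i. s i)"
    using borel_measurable_implies_simple_function_sequence_real[of "\<lambda>t. \<bar>F t\<bar>" MI] by auto
  have s_inc: "incseq (\<lambda>i. s i t)" for t using s(1) by (auto simp: incseq_def le_fun_def)
  have s_lim: "(\<lambda>i. s i t) \<longlonglongrightarrow> \<bar>F t\<bar>" for t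
    using LIMSEQ_incseq_SUP[OF s(3) s_inc, of t] fun_cong[OF s(5), of t] by (simp add: image_comp)
  define f where "f n t = s n t * indicator (E n) t" for n t
  have sm [measurable]: "s n \<in> L0 I" for n using s(2) by (rule borel_measurable_simple_function)
  have fm [measurable]: "f n \<in> L0 I" for n unfolding f_def by measurable
  have f0: "0 \<le> f n t" for n t using s(4) by (simp add: f_def)
  have fF: "f n t \<le> \<bar>F t\<bar>" for n t
    using incseq_le[OF s_inc s_lim, of n t] s(4)[of n t] by (auto simp: f_def indicator_def)
  have f_inc: "f m t \<le> f n t" if "m \<le> n" "t \<in> I" for m n t
  proof -
    have "s m t \<le> s n t" using s_inc that by (auto dest: incseqD)
    moreover have "t \<in> E m \<Longrightarrow> t \<in> E n" using incseqD[OF b(1) that(1)] by (auto simp: E_def ennreal_less_I_iff)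
    ultimately show ?thesis using s(4)[of n t] by (auto simp: f_def indicator_def)
  qed
  have f_lim: "(\<lambda>n. f n t) \<longlonglongrightarrow> \<bar>F t\<bar>" if t: "t \<in> I" for t
  proof -
    obtain n0 where "t < b n0" using b(3)[OF t] by blast
    then have "s n t = f n t" if "n0 \<le> n" for n
      using incseqD[OF b(1) that] t by (simp add: f_def E_def ennreal_less_I_iff)
    then have "\<forall>\<^sub>F n in sequentially. s n t = f n t" by (auto simp: eventually_sequentially)
    then show ?thesis using s_lim[of t] by (rule Lim_transform_eventually[rotated])
  qed
  have "\<exists>u C. level (f n) u \<and> (\<forall>t. u t \<le> C)" for n
  proof (rule level_exists[OF fm f0])
    have "finite (s n ` I)" using s(2)[of n] by (simp add: simple_function_def)
    moreover have "f n ` I \<subseteq> insert 0 (s n ` I)" by (auto simp: f_def indicator_def)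
    ultimately show "finite (f n ` I)" by (meson finite.insertI finite_subset)
    have "emeasure MI {t\<in>I. 0 < f n t} \<le> emeasure MI (E n)"
      by (intro emeasure_mono) (auto simp: f_def indicator_def split: if_splits)
    then show "emeasure MI {t\<in>I. 0 < f n t} < top" using Ee by (rule le_less_trans)
  qed
  then obtain u where u: "\<And>n. \<exists>C. level (f n) (u n) \<and> (\<forall>t. u n t \<le> C)" by metis
  then have lev: "level (f n) (u n)" for n by blast
  have um [measurable]: "u n \<in> L0 I" and u0: "0 \<le> u n t" for n t using lev[of n] by (auto simp: level_def)
  have uinc: "AE t in MI. \<forall>n. u n t \<le> u (Suc n) t"
    using f0 f_inc by (intro AE_all_countable[THEN iffD2] allI level_mono[OF fm fm _ _ lev lev]) auto
  have upos: "AE t in MI. \<forall>n. 0 < f n t \<longleftrightarrow> 0 < u n t"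
    using lev by (intro AE_all_countable[THEN iffD2]) (auto simp: level_def)
  define Y where "Y n t = ennreal (\<phi> (u n t) * (f n t / u n t))" for n t
  have Ym [measurable]: "Y n \<in> borel_measurable MI" for n
  proof -
    have "(\<lambda>t. ennreal (\<phi> (max 0 (u n t)) * (f n t / u n t))) \<in> borel_measurable MI" by measurable
    then show ?thesis using u0 by (simp add: max_absorb2 Y_def[abs_def])
  qed
  have Y1: "(\<integral>\<^sup>+t. Y n t \<partial>MI) \<le> 1" for n
  proof -
    obtain C where "\<And>t. u n t \<le> C" using u[of n] by blast
    then show ?thesis unfolding Y_def using bd f0 fF
      by (intro level_modular_le_1[OF F _ fm _ _ lev]) auto
  qed
  have liminf1: "(\<integral>\<^sup>+t. liminf (\<lambda>n. Y n t) \<partial>MI) \<le> 1"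
  proof -
    have "(\<integral>\<^sup>+t. liminf (\<lambda>n. Y n t) \<partial>MI) \<le> liminf (\<lambda>n. \<integral>\<^sup>+t. Y n t \<partial>MI)" by (rule nn_integral_liminf) measurable
    also have "\<dots> \<le> 1" using Y1 by (intro Liminf_le) auto
    finally show ?thesis .
  qed
  then have Yfin: "AE t in MI. liminf (\<lambda>n. Y n t) \<noteq> \<infinity>"
    by (intro nn_integral_PInf_AE) (auto simp: top_unique)
  define U where "U t = enn2real (SUP n. ennreal (u n t))" for t
  define v where "v t = \<bar>F t\<bar> / U t" for t
  have Um [measurable]: "U \<in> L0 I" unfolding U_def by measurable
  have vm [measurable]: "v \<in> L0 I" unfolding v_def by measurable
  have U0: "0 \<le> U t" for t by (simp add: U_def)
  have v0: "0 \<le> v t" for t using U0[of t] by (simp add: v_def)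
  have conv: "AE t in MI. (\<lambda>n. f n t / u n t) \<longlonglongrightarrow> v t \<and> Pint F v t \<le> liminf (\<lambda>n. Y n t)"
    using AE_space uinc upos Yfin
  proof eventually_elim
    case (elim t)
    then have t: "t \<in> I" by simp
    show ?case
    proof (cases "F t = 0")
      case True
      then have "f n t = 0" for n using fF[of n t] f0[of n t] by simp
      then show ?thesis using True by (simp add: v_def Pint_def)
    next
      case False
      then have Fp: "0 < \<bar>F t\<bar>" by simp
      have inc: "incseq (\<lambda>n. u n t)" using elim by (auto intro: incseq_SucI)
      have "\<forall>\<^sub>F n in sequentially. 0 < f n t" using f_lim[OF t] Fp by (rule order_tendstoD)
      then have ev: "\<forall>\<^sub>F n in sequentially. 0 < f n t \<and> 0 < u n t" by eventually_elim (use elim in auto)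
      \<comment> \<open>Where F is nonzero the levels cannot tend to infinity: the integrands \<phi>
        (u n) f n / u n would diverge by superlinear growth, against the finiteness of their
        liminf.\<close>
      have bdd: "bdd_above (range (\<lambda>n. u n t))"
      proof (rule ccontr)
        assume nb: "\<not> bdd_above (range (\<lambda>n. u n t))"
        have top: "filterlim (\<lambda>n. u n t) at_top sequentially"
          unfolding filterlim_at_top
        proof
          fix Z
          obtain n where "Z < u n t" using nb by (auto simp: bdd_above_def not_le)
          then show "\<forall>\<^sub>F n in sequentially. Z \<le> u n t"
            using inc by (auto simp: eventually_sequentially incseq_def intro!: exI[of _ n] intro: less_imp_le order_trans)
        qed
        have "filterlim (\<lambda>n. f n t * (\<phi> (u n t) / u n t)) at_top sequentially"
          using f_lim[OF t] Fp filterlim_compose[OF phi_at_top top] by (rule filterlim_tendsto_pos_mult_at_top)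
        then have top2: "filterlim (\<lambda>n. \<phi> (u n t) * (f n t / u n t)) at_top sequentially"
          by (simp add: mult.commute)
        have "ennreal (real k) \<le> liminf (\<lambda>n. Y n t)" for k
        proof (rule Liminf_bounded)
          have "\<forall>\<^sub>F n in sequentially. real k \<le> \<phi> (u n t) * (f n t / u n t)"
            using top2 by (simp add: filterlim_at_top)
          then show "\<forall>\<^sub>F n in sequentially. ennreal (real k) \<le> Y n t"
            by eventually_elim (auto simp: Y_def intro: ennreal_leI)
        qed
        then have "liminf (\<lambda>n. Y n t) = \<infinity>"
          by (metis ennreal_Ex_less_of_nat ennreal_of_nat_eq_real_of_nat infinity_ennreal_def leD top.not_eq_extremum)
        then show False using elim by simp
      qed
      define L where "L = (SUP n. u n t)"
      have L: "(\<lambda>n. u n t) \<longlonglongrightarrow> L" unfolding L_def by (rule LIMSEQ_incseq_SUP[OF bdd inc])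
      have leL: "u n t \<le> L" for n by (rule incseq_le[OF inc L])
      have UL: "U t = L"
      proof -
        have "(\<lambda>n. ennreal (u n t)) \<longlonglongrightarrow> (SUP n. ennreal (u n t))"
          using inc by (intro LIMSEQ_SUP) (auto simp: incseq_def intro: ennreal_leI)
        moreover have "(\<lambda>n. ennreal (u n t)) \<longlonglongrightarrow> ennreal L" using L by (rule tendsto_ennrealI)
        ultimately have "(SUP n. ennreal (u n t)) = ennreal L" by (rule LIMSEQ_unique)
        moreover have "0 \<le> L" using leL[of 0] u0[of 0 t] by linarith
        ultimately show ?thesis by (simp add: U_def)
      qed
      have Lp: "0 < L"
      proof -
        obtain n where "0 < u n t" using ev by (auto simp: eventually_sequentially)
        then show ?thesis using leL[of n] by linarith
      qed
      have lim1: "(\<lambda>n. f n t / u n t) \<longlonglongrightarrow> v t"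
        unfolding v_def UL using f_lim[OF t] L Lp by (intro tendsto_divide) auto
      have "(\<lambda>n. \<phi> (u n t) * (f n t / u n t)) \<longlonglongrightarrow> \<phi> L * v t"
        using Lp u0 by (intro tendsto_mult phi_tendsto L lim1) (auto intro: less_imp_le)
      then have "(\<lambda>n. Y n t) \<longlonglongrightarrow> ennreal (\<phi> L * v t)" unfolding Y_def by (rule tendsto_ennrealI)
      then have "liminf (\<lambda>n. Y n t) = ennreal (\<phi> L * v t)" by (rule lim_imp_Liminf[OF sequentially_bot])
      moreover have "\<bar>F t\<bar> / v t = L" "v t \<noteq> 0" using Lp Fp by (auto simp: v_def UL)
      ultimately show ?thesis using lim1 by (simp add: Pint_def)
    qed
  qed
  have bWv: "below_W v"
    unfolding below_W_def
  proof
    fix A assume A [measurable]: "A \<in> sets MI"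
    have "(\<integral>\<^sup>+t. ennreal (v t) * indicator A t \<partial>MI) \<le> (\<integral>\<^sup>+t. liminf (\<lambda>n. ennreal (f n t / u n t) * indicator A t) \<partial>MI)"
    proof (rule nn_integral_mono_AE)
      show "AE t in MI. ennreal (v t) * indicator A t \<le> liminf (\<lambda>n. ennreal (f n t / u n t) * indicator A t)"
        using conv
      proof eventually_elim
        case (elim t)
        then have "(\<lambda>n. ennreal (f n t / u n t)) \<longlonglongrightarrow> ennreal (v t)" by (intro tendsto_ennrealI) auto
        then have "liminf (\<lambda>n. ennreal (f n t / u n t)) = ennreal (v t)" by (rule lim_imp_Liminf[OF sequentially_bot])
        then show ?case by (cases "t \<in> A") auto
      qed
    qed
    also have "\<dots> \<le> liminf (\<lambda>n. \<integral>\<^sup>+t. ennreal (f n t / u n t) * indicator A t \<partial>MI)"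
      by (rule nn_integral_liminf) measurable
    also have "\<dots> \<le> Wf (emeasure MI A)"
      using lev A by (intro Liminf_le) (auto simp: level_def below_W_def)
    finally show "(\<integral>\<^sup>+t. ennreal (v t) * indicator A t \<partial>MI) \<le> Wf (emeasure MI A)" .
  qed
  have "P_modular I \<phi> w F \<le> (\<integral>\<^sup>+t. Pint F v t \<partial>MI)"
    unfolding P_modular_eq using below_W_submajorized[OF vm v0 bWv] vm v0 by (intro INF_lower) auto
  also have "\<dots> \<le> (\<integral>\<^sup>+t. liminf (\<lambda>n. Y n t) \<partial>MI)"
  proof (rule nn_integral_mono_AE)
    show "AE t in MI. Pint F v t \<le> liminf (\<lambda>n. Y n t)" using conv by eventually_elim auto
  qed
  also have "\<dots> \<le> 1" by (rule liminf1)
  finally show ?thesis .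
qed

end

section \<open>A completeness criterion\<close>

lemma linear_space_diff:
  assumes "linear_space X" "f \<in> X" "g \<in> X"
  shows "(\<lambda>t. f t - g t) \<in> X"
proof -
  have "(\<lambda>t. (-1) * g t) \<in> X" using assms unfolding linear_space_def by blast
  moreover have "\<forall>f\<in>X. \<forall>g\<in>X. (\<lambda>t. f t + g t) \<in> X" using assms(1) by (simp add: linear_space_def)
  ultimately have "(\<lambda>t. f t + (\<lambda>t. (-1) * g t) t) \<in> X" using assms(2) by (elim ballE) auto
  then show ?thesis by simp
qed

context interval_domain begin

text \<open>A fast Cauchy subsequence converges almost everywhere by the bound in L1(h0 dt), and the
  Fatou property turns this into convergence for N. Fatou takes the place of the triangle
  inequality, so that the norm and the quasi-norm are covered alike.\<close>

lemma complete_underI: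
  assumes h0 [measurable]: "h0 \<in> L0 I" and h0_pos: "\<And>t. t \<in> I \<Longrightarrow> 0 < h0 t"
    and L1: "\<And>f. f \<in> L0 I \<Longrightarrow> (\<integral>\<^sup>+t. ennreal \<bar>f t * h0 t\<bar> \<partial>MI) \<le> N f"
    and fatou: "\<And>f u. f \<in> L0 I \<Longrightarrow> (\<And>n. u n \<in> L0 I) \<Longrightarrow> (AE t in MI. (\<lambda>n. u n t) \<longlonglongrightarrow> f t) \<Longrightarrow> N f \<le> liminf (\<lambda>n. N (u n))"
    and X: "X \<subseteq> L0 I" "\<And>f g. f \<in> X \<Longrightarrow> g \<in> L0 I \<Longrightarrow> N (\<lambda>t. f t - g t) < \<infinity> \<Longrightarrow> g \<in> X"
  shows "complete_under X N"
  unfolding complete_under_def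
proof (intro allI impI)
  fix u :: "nat \<Rightarrow> real \<Rightarrow> real"
  assume *: "(\<forall>n. u n \<in> X) \<and> (\<forall>e>0. \<exists>k. \<forall>m\<ge>k. \<forall>n\<ge>k. N (\<lambda>t. u m t - u n t) < e)"
  then have um [measurable]: "u n \<in> L0 I" for n using X by auto
  have "\<exists>k. \<forall>m\<ge>k. \<forall>n\<ge>k. N (\<lambda>t. u m t - u n t) < ennreal ((1/2) ^ Suc j)" for j :: nat
  proof -
    have "0 < ennreal ((1/2) ^ Suc j)" by (simp add: ennreal_less_zero_iff del: power_Suc)
    then show ?thesis using * by blast
  qed
  then obtain K where K: "\<And>j m n. K j \<le> m \<Longrightarrow> K j \<le> n \<Longrightarrow> N (\<lambda>t. u m t - u n t) < ennreal ((1/2) ^ Suc j)" by metis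
  \<comment> \<open>Partial sums of the thresholds dominate every \<open>K i\<close> with i <= j, so
    one index serves all of them.\<close>
  define r where "r j = (\<Sum>i\<le>j. K i)" for j
  have rK: "K j \<le> r i" if "j \<le> i" for i j
    unfolding r_def using that by (intro member_le_sum) auto
  define d where "d j t = u (r (Suc j)) t - u (r j) t" for j t
  have dm [measurable]: "d j \<in> L0 I" for j unfolding d_def by measurable
  have "(\<integral>\<^sup>+t. (\<Sum>j. ennreal \<bar>d j t * h0 t\<bar>) \<partial>MI) = (\<Sum>j. \<integral>\<^sup>+t. ennreal \<bar>d j t * h0 t\<bar> \<partial>MI)"
    by (rule nn_integral_suminf) measurable
  also have "\<dots> \<le> (\<Sum>j. ennreal ((1/2) ^ Suc j))"
  proof (intro suminf_le)
    fix j
    have "d j = (\<lambda>t. u (r (Suc j)) t - u (r j) t)" by (simp add: d_def fun_eq_iff)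
    then have "N (d j) \<le> ennreal ((1/2) ^ Suc j)" using less_imp_le[OF K[OF rK rK], of j "Suc j" j] by simp
    then show "(\<integral>\<^sup>+t. ennreal \<bar>d j t * h0 t\<bar> \<partial>MI) \<le> ennreal ((1/2) ^ Suc j)" using L1[OF dm] by (rule order_trans[rotated])
  qed auto
  finally have "(\<integral>\<^sup>+t. (\<Sum>j. ennreal \<bar>d j t * h0 t\<bar>) \<partial>MI) \<le> 1" by (simp only: suminf_half_pow)
  then have "AE t in MI. (\<Sum>j. ennreal \<bar>d j t * h0 t\<bar>) \<noteq> \<infinity>"
    by (intro nn_integral_PInf_AE) (auto simp: top_unique)
  then have conv: "AE t in MI. convergent (\<lambda>j. u (r j) t)"
    using AE_space
  proof eventually_elim
    case (elim t)
    then have t: "t \<in> I" by simp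
    have "summable (\<lambda>j. \<bar>d j t * h0 t\<bar>)" using elim(1) by (intro summable_suminf_not_top) auto
    then have "summable (\<lambda>j. \<bar>d j t * h0 t\<bar> * (1 / h0 t))" by (rule summable_mult2)
    then have "summable (\<lambda>j. \<bar>d j t\<bar>)" using h0_pos[OF t] by (simp add: abs_mult)
    then have "summable (\<lambda>j. u (r (Suc j)) t - u (r j) t)" unfolding d_def by (rule summable_rabs_cancel)
    then have "convergent (\<lambda>n. \<Sum>j<n. u (r (Suc j)) t - u (r j) t)" by (simp add: summable_iff_convergent)
    then have "convergent (\<lambda>n. u (r n) t - u (r 0) t)" by (simp only: sum_lessThan_telescope[where f="\<lambda>j. u (r j) t"])
    then have "convergent (\<lambda>n. (u (r n) t - u (r 0) t) + u (r 0) t)" by (intro convergent_add convergent_const)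
    then show ?case by simp
  qed
  define f where "f t = lim (\<lambda>j. u (r j) t)" for t
  have fm [measurable]: "f \<in> L0 I" unfolding f_def by (rule borel_measurable_lim_metric) measurable
  have lim: "AE t in MI. (\<lambda>j. u (r j) t) \<longlonglongrightarrow> f t"
    using conv by eventually_elim (simp add: f_def convergent_LIMSEQ_iff)
  have close: "N (\<lambda>t. u n t - f t) \<le> ennreal ((1/2) ^ Suc i)" if n: "K i \<le> n" for n i
  proof -
    have "N (\<lambda>t. u n t - f t) \<le> liminf (\<lambda>j. N (\<lambda>t. u n t - u (r j) t))"
    proof (rule fatou)
      show "AE t in MI. (\<lambda>j. u n t - u (r j) t) \<longlonglongrightarrow> u n t - f t"
        using lim by eventually_elim (intro tendsto_intros)
    qed measurable
    also have "\<dots> \<le> ennreal ((1/2) ^ Suc i)"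
    proof (rule Liminf_le)
      have "\<forall>\<^sub>F j in sequentially. i \<le> j" by (rule eventually_ge_at_top)
      then show "\<forall>\<^sub>F j in sequentially. N (\<lambda>t. u n t - u (r j) t) \<le> ennreal ((1/2) ^ Suc i)"
        by eventually_elim (rule less_imp_le[OF K[OF n rK]])
    qed simp
    finally show ?thesis .
  qed
  show "\<exists>f\<in>X. (\<lambda>n. N (\<lambda>t. u n t - f t)) \<longlonglongrightarrow> 0"
  proof (intro bexI)
    have "N (\<lambda>t. u (K 0) t - f t) < \<infinity>" by (rule le_less_trans[OF close[OF order_refl]]) (simp only: infinity_ennreal_def ennreal_less_top)
    moreover have "u (K 0) \<in> X" using * by blast
    ultimately show "f \<in> X" by (intro X(2)[OF _ fm])
    show "(\<lambda>n. N (\<lambda>t. u n t - f t)) \<longlonglongrightarrow> 0"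
    proof (rule order_tendstoI)
      fix e :: ennreal assume e: "0 < e"
      then obtain e' where e': "0 < e'" "e' < e" using dense by blast
      then obtain x where x: "e' = ennreal x" "0 < x" by (cases e') auto
      obtain i where "(1/2) ^ i < x" using real_arch_pow_inv[of x "1/2"] x by auto
      moreover have "(1/2::real) ^ Suc i \<le> (1/2) ^ i" by (rule power_decreasing) auto
      ultimately have i: "(1/2) ^ Suc i < x" by linarith
      show "\<forall>\<^sub>F n in sequentially. N (\<lambda>t. u n t - f t) < e"
        unfolding eventually_sequentially
      proof (intro exI[of _ "K i"] allI impI)
        fix n assume "K i \<le> n"
        then have "N (\<lambda>t. u n t - f t) \<le> ennreal ((1/2) ^ Suc i)" by (rule close)
        also have "\<dots> \<le> ennreal x" using i by (intro ennreal_leI) simp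
        finally show "N (\<lambda>t. u n t - f t) < e" using e' x by auto
      qed
    qed simp
  qed
qed

end

section \<open>The Koethe bidual\<close>

context orlicz_lorentz begin

abbreviation "Nb \<equiv> koethe_norm I (koethe_dual I Mcl) Nd"
abbreviation "cMn \<equiv> calM_norm I \<phi> w"
abbreviation "cM \<equiv> calM_space I \<phi> w"

lemma Nb_upper: "h \<in> L0 I \<Longrightarrow> Nd h \<le> 1 \<Longrightarrow> (\<integral>\<^sup>+t. ennreal \<bar>f t * h t\<bar> \<partial>MI) \<le> Nb f"
  unfolding koethe_norm_def[of I "koethe_dual I Mcl"]
  by (intro SUP_upper) (auto simp: koethe_dual_iff intro: le_less_trans)

lemma Nb_least:
  assumes "\<And>h. h \<in> L0 I \<Longrightarrow> Nd h \<le> 1 \<Longrightarrow> (\<integral>\<^sup>+t. ennreal \<bar>f t * h t\<bar> \<partial>MI) \<le> X"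
  shows "Nb f \<le> X"
  unfolding koethe_norm_def[of I "koethe_dual I Mcl"]
  by (intro SUP_least) (auto simp: koethe_dual_iff intro: assms)

lemma integral_scale:
  assumes [measurable]: "f \<in> L0 I" "h \<in> L0 I" and e: "0 < e"
  shows "(\<integral>\<^sup>+t. ennreal \<bar>f t * h t\<bar> \<partial>MI) = ennreal e * (\<integral>\<^sup>+t. ennreal \<bar>f t / e * h t\<bar> \<partial>MI)"
    "(\<integral>\<^sup>+t. ennreal \<bar>f t * h t\<bar> \<partial>MI) = ennreal e * (\<integral>\<^sup>+t. ennreal \<bar>f t * (h t / e)\<bar> \<partial>MI)"
proof -
  show "(\<integral>\<^sup>+t. ennreal \<bar>f t * h t\<bar> \<partial>MI) = ennreal e * (\<integral>\<^sup>+t. ennreal \<bar>f t / e * h t\<bar> \<partial>MI)"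
    by (subst nn_integral_cmult[symmetric], measurable, intro nn_integral_cong)
      (use e in \<open>simp add: abs_mult flip: ennreal_mult\<close>)
  then show "(\<integral>\<^sup>+t. ennreal \<bar>f t * h t\<bar> \<partial>MI) = ennreal e * (\<integral>\<^sup>+t. ennreal \<bar>f t * (h t / e)\<bar> \<partial>MI)" by simp
qed

lemma Nb_le_imp:
  assumes f [measurable]: "f \<in> L0 I" and h [measurable]: "h \<in> L0 I" and e: "0 < e" "Nb f \<le> ennreal e"
  shows "(\<integral>\<^sup>+t. ennreal \<bar>f t / e * h t\<bar> \<partial>MI) \<le> Nd h"
proof (rule ennreal_le_by_reals)
  fix d :: real assume d: "0 < d" "Nd h \<le> ennreal d"
  have "Nd (\<lambda>t. (1 / d) * h t) = ennreal \<bar>1 / d\<bar> * Nd h" by (rule Nd_cmult[OF h])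
  also have "\<dots> \<le> ennreal \<bar>1 / d\<bar> * ennreal d" using d by (intro mult_left_mono) auto
  also have "\<dots> = 1" using d by (simp flip: ennreal_mult)
  finally have "(\<integral>\<^sup>+t. ennreal \<bar>f t * ((1 / d) * h t)\<bar> \<partial>MI) \<le> Nb f" by (intro Nb_upper) auto
  also have "\<dots> \<le> ennreal e" by (rule e)
  finally have "(\<integral>\<^sup>+t. ennreal \<bar>f t * (h t / d)\<bar> \<partial>MI) \<le> ennreal e" by simp
  then have "ennreal e * (\<integral>\<^sup>+t. ennreal \<bar>f t / e * (h t / d)\<bar> \<partial>MI) \<le> ennreal e * 1"
    using integral_scale(1)[of f "\<lambda>t. h t / d" e] e by simp
  then have "(\<integral>\<^sup>+t. ennreal \<bar>f t / e * (h t / d)\<bar> \<partial>MI) \<le> 1" using e by (subst (asm) ennreal_mult_le_mult_iff) auto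
  then have "ennreal d * (\<integral>\<^sup>+t. ennreal \<bar>f t / e * (h t / d)\<bar> \<partial>MI) \<le> ennreal d * 1" by (rule mult_left_mono) simp
  then show "(\<integral>\<^sup>+t. ennreal \<bar>f t / e * h t\<bar> \<partial>MI) \<le> ennreal d"
    using integral_scale(2)[of "\<lambda>t. f t / e" h d] d by simp
qed

text \<open>Both sides are gauges: at each scale e, \<open>P_modular_le_1\<close> and
  \<open>Hoelder\<close> applied to f / e give the two inclusions between the balls of radius
  e.\<close>

theorem calM_norm_eq:
  assumes f [measurable]: "f \<in> L0 I"
  shows "cMn f = Nb f"
proof (rule antisym)
  show "cMn f \<le> Nb f"
  proof (rule ennreal_le_by_reals)
    fix e :: real assume e: "0 < e" "Nb f \<le> ennreal e"
    have "P_modular I \<phi> w (\<lambda>t. f t / e) \<le> 1"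
      using Nb_le_imp[OF f _ e] by (intro P_modular_le_1) auto
    then show "cMn f \<le> ennreal e" unfolding calM_norm_def using e by (intro Inf_lower) auto
  qed
  show "Nb f \<le> cMn f"
    unfolding calM_norm_def
  proof (rule Inf_greatest, safe)
    fix e :: real assume e: "0 < e" and P: "P_modular I \<phi> w (\<lambda>t. f t / e) \<le> 1"
    show "Nb f \<le> ennreal e"
    proof (rule Nb_least)
      fix h assume h [measurable]: "h \<in> L0 I" and 1: "Nd h \<le> 1"
      have "(\<integral>\<^sup>+t. ennreal \<bar>f t / e * h t\<bar> \<partial>MI) \<le> Nd h" using P by (intro Hoelder) auto
      then have "ennreal e * (\<integral>\<^sup>+t. ennreal \<bar>f t / e * h t\<bar> \<partial>MI) \<le> ennreal e * 1"
        using 1 by (intro mult_left_mono) auto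
      then show "(\<integral>\<^sup>+t. ennreal \<bar>f t * h t\<bar> \<partial>MI) \<le> ennreal e" using integral_scale(1)[OF f h e] by simp
    qed
  qed
qed

lemma cM_iff: "f \<in> cM \<longleftrightarrow> f \<in> L0 I \<and> Nb f < \<infinity>"
  unfolding calM_space_def using calM_norm_eq by auto

text \<open>The hump series may be summed directly here because the dual norm is subadditive. The
  strictly positive g0 of the class shows that the sum is finite almost everywhere, as its integral
  against g0 is at most 1.\<close>

lemma bidual_finite:
  assumes f: "f \<in> koethe_dual I (koethe_dual I Mcl)"
  shows "Nb f < top"
proof (rule ccontr)
  assume "\<not> Nb f < top"
  then have inf: "Nb f = top" by (simp add: less_top[symmetric])
  have fm [measurable]: "f \<in> L0 I" using f by (simp add: koethe_dual_def)
  obtain g0 where g0 [measurable]: "g0 \<in> L0 I" and g0p: "\<And>t. t \<in> I \<Longrightarrow> 0 < g0 t" and g01: "Mod g0 \<le> 1"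
    by (rule ex_positive_class) blast
  have "\<exists>h. h \<in> L0 I \<and> Nd h \<le> 1 \<and> ennreal (4 ^ n) < (\<integral>\<^sup>+t. ennreal \<bar>f t * h t\<bar> \<partial>MI)" for n :: nat
  proof (rule ccontr)
    assume "\<not> ?thesis"
    then have "Nb f \<le> ennreal (4 ^ n)" by (intro Nb_least) (auto simp: not_less)
    then show False using inf by (simp add: top_unique)
  qed
  then obtain h where h [measurable]: "\<And>n. h n \<in> L0 I" and h1: "\<And>n. Nd (h n) \<le> 1"
    and h2: "\<And>n::nat. ennreal (4 ^ n) < (\<integral>\<^sup>+t. ennreal \<bar>f t * h n t\<bar> \<partial>MI)" by metis
  define S where "S t = (\<Sum>n. ennreal ((1/2) ^ Suc n) * ennreal \<bar>h n t\<bar>)" for t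
  have Sm [measurable]: "S \<in> borel_measurable MI" unfolding S_def by measurable
  have S_int: "(\<integral>\<^sup>+t. S t * ennreal \<bar>g t\<bar> \<partial>MI) \<le> 1" if g [measurable]: "g \<in> L0 I" and 1: "Mod g \<le> 1" for g
  proof -
    have "(\<integral>\<^sup>+t. S t * ennreal \<bar>g t\<bar> \<partial>MI) = (\<integral>\<^sup>+t. (\<Sum>n. ennreal ((1/2) ^ Suc n) * ennreal \<bar>h n t * g t\<bar>) \<partial>MI)"
      by (intro nn_integral_cong) (simp add: S_def abs_mult ennreal_mult mult.assoc flip: ennreal_suminf_multc del: power_Suc)
    also have "\<dots> = (\<Sum>n. ennreal ((1/2) ^ Suc n) * (\<integral>\<^sup>+t. ennreal \<bar>h n t * g t\<bar> \<partial>MI))"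
      by (subst nn_integral_suminf, measurable) (simp add: nn_integral_cmult)
    also have "\<dots> \<le> (\<Sum>n. ennreal ((1/2) ^ Suc n) * 1)"
      using Nd_upper[OF g 1] h1 by (intro suminf_le mult_left_mono) (auto intro: order_trans)
    finally show ?thesis by (simp only: suminf_half_pow mult_1_right)
  qed
  have "AE t in MI. S t * ennreal \<bar>g0 t\<bar> \<noteq> \<infinity>"
    using S_int[OF g0 g01] by (intro nn_integral_PInf_AE) (auto simp: top_unique)
  then have Sfin: "AE t in MI. S t < top"
    using AE_space by eventually_elim (use g0p in \<open>fastforce simp: ennreal_mult_eq_top_iff less_top\<close>)
  define k where "k t = enn2real (S t)" for t
  have km [measurable]: "k \<in> L0 I" unfolding k_def by measurable
  have kS: "AE t in MI. ennreal \<bar>k t\<bar> = S t" using Sfin by eventually_elim (simp add: k_def)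
  have "Nd k \<le> 1"
  proof (rule Nd_least)
    fix g assume g [measurable]: "g \<in> L0 I" and 1: "Mod g \<le> 1"
    have "(\<integral>\<^sup>+t. ennreal \<bar>k t * g t\<bar> \<partial>MI) = (\<integral>\<^sup>+t. S t * ennreal \<bar>g t\<bar> \<partial>MI)"
    proof (rule nn_integral_cong_AE)
      show "AE t in MI. ennreal \<bar>k t * g t\<bar> = S t * ennreal \<bar>g t\<bar>"
        using kS by eventually_elim (simp add: abs_mult ennreal_mult)
    qed
    then show "(\<integral>\<^sup>+t. ennreal \<bar>k t * g t\<bar> \<partial>MI) \<le> 1" using S_int[OF g 1] by simp
  qed
  then have "k \<in> koethe_dual I Mcl" by (auto simp: koethe_dual_iff intro: le_less_trans)
  then have "integrable MI (\<lambda>t. f t * k t)" using f by (auto simp: koethe_dual_def)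
  then have fk: "(\<integral>\<^sup>+t. ennreal \<bar>f t * k t\<bar> \<partial>MI) < top" by (simp add: integrable_iff_bounded)
  have "ennreal (1 / 2 * 2 ^ n) \<le> (\<integral>\<^sup>+t. ennreal \<bar>f t * k t\<bar> \<partial>MI)" for n
  proof -
    have "ennreal (1 / 2 * 2 ^ n) = ennreal ((1/2) ^ Suc n) * ennreal (4 ^ n)"
      by (simp add: power_mult_distrib[symmetric] flip: ennreal_mult)
    also have "\<dots> \<le> ennreal ((1/2) ^ Suc n) * (\<integral>\<^sup>+t. ennreal \<bar>f t * h n t\<bar> \<partial>MI)"
      using h2[of n] by (intro mult_left_mono) auto
    also have "\<dots> = (\<integral>\<^sup>+t. ennreal ((1/2) ^ Suc n) * ennreal \<bar>f t * h n t\<bar> \<partial>MI)"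
      by (rule nn_integral_cmult[symmetric]) measurable
    also have "\<dots> \<le> (\<integral>\<^sup>+t. ennreal \<bar>f t * k t\<bar> \<partial>MI)"
    proof (rule nn_integral_mono_AE)
      show "AE t in MI. ennreal ((1/2) ^ Suc n) * ennreal \<bar>f t * h n t\<bar> \<le> ennreal \<bar>f t * k t\<bar>"
        using kS
      proof eventually_elim
        case (elim t)
        have "ennreal ((1/2) ^ Suc n) * ennreal \<bar>h n t\<bar> \<le> S t"
          unfolding S_def using sum_le_suminf[of "\<lambda>n. ennreal ((1/2) ^ Suc n) * ennreal \<bar>h n t\<bar>" "{n}"] by simp
        then have "ennreal \<bar>f t\<bar> * (ennreal ((1/2) ^ Suc n) * ennreal \<bar>h n t\<bar>) \<le> ennreal \<bar>f t\<bar> * S t"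
          by (rule mult_left_mono) simp
        then show ?case unfolding elim[symmetric] by (simp add: abs_mult ennreal_mult mult.left_commute del: power_Suc)
      qed
    qed
    finally show ?thesis .
  qed
  then have "(\<integral>\<^sup>+t. ennreal \<bar>f t * k t\<bar> \<partial>MI) = top" by (intro ennreal_eq_topI[of "1/2"]) auto
  then show False using fk by simp
qed

theorem calM_space_eq: "cM = koethe_dual I (koethe_dual I Mcl)"
proof (intro set_eqI iffI)
  fix f assume "f \<in> koethe_dual I (koethe_dual I Mcl)"
  then show "f \<in> cM" using bidual_finite[of f] by (simp add: cM_iff koethe_dual_def[of I "koethe_dual I Mcl"])
next
  fix f assume "f \<in> cM"
  then have f [measurable]: "f \<in> L0 I" and fin: "Nb f < top" by (auto simp: cM_iff)
  obtain r where r: "Nb f = ennreal r" "0 \<le> r" using fin by (cases "Nb f") auto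
  have le: "Nb f \<le> ennreal (r + 1)" using r by (auto intro: ennreal_leI)
  have "integrable MI (\<lambda>t. f t * h t)" if h: "h \<in> koethe_dual I Mcl" for h
  proof -
    have hm [measurable]: "h \<in> L0 I" and hf: "Nd h < top" using h by (auto simp: koethe_dual_iff)
    have "(\<integral>\<^sup>+t. ennreal \<bar>f t / (r + 1) * h t\<bar> \<partial>MI) \<le> Nd h" using r le by (intro Nb_le_imp) auto
    then have "(\<integral>\<^sup>+t. ennreal \<bar>f t / (r + 1) * h t\<bar> \<partial>MI) < top" using hf by (rule le_less_trans)
    then have "(\<integral>\<^sup>+t. ennreal \<bar>f t * h t\<bar> \<partial>MI) < top"
      using integral_scale(1)[OF f hm, of "r + 1"] r by (simp add: ennreal_mult_less_top)
    then show ?thesis by (simp add: integrable_iff_bounded)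
  qed
  then show "f \<in> koethe_dual I (koethe_dual I Mcl)" unfolding koethe_dual_def[of I "koethe_dual I Mcl"] using f by simp
qed

section \<open>The bidual norm as a complete norm\<close>

lemma Nb_cmult: "f \<in> L0 I \<Longrightarrow> Nb (\<lambda>t. c * f t) = ennreal \<bar>c\<bar> * Nb f"
  by (intro koethe_norm_cmult) (auto simp: koethe_dual_iff)

lemma Nb_triangle:
  assumes f [measurable]: "f \<in> L0 I" and g [measurable]: "g \<in> L0 I"
  shows "Nb (\<lambda>t. f t + g t) \<le> Nb f + Nb g"
proof (rule Nb_least)
  fix h assume h [measurable]: "h \<in> L0 I" and 1: "Nd h \<le> 1"
  have "(\<integral>\<^sup>+t. ennreal \<bar>(f t + g t) * h t\<bar> \<partial>MI) \<le> (\<integral>\<^sup>+t. ennreal \<bar>f t * h t\<bar> + ennreal \<bar>g t * h t\<bar> \<partial>MI)"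
  proof (intro nn_integral_mono)
    fix t
    have "\<bar>(f t + g t) * h t\<bar> \<le> \<bar>f t * h t\<bar> + \<bar>g t * h t\<bar>" unfolding distrib_right by (rule abs_triangle_ineq)
    then show "ennreal \<bar>(f t + g t) * h t\<bar> \<le> ennreal \<bar>f t * h t\<bar> + ennreal \<bar>g t * h t\<bar>"
      by (simp flip: ennreal_plus add: ennreal_leI)
  qed
  also have "\<dots> = (\<integral>\<^sup>+t. ennreal \<bar>f t * h t\<bar> \<partial>MI) + (\<integral>\<^sup>+t. ennreal \<bar>g t * h t\<bar> \<partial>MI)" by (rule nn_integral_add) measurable
  also have "\<dots> \<le> Nb f + Nb g" using 1 by (intro add_mono Nb_upper h)
  finally show "(\<integral>\<^sup>+t. ennreal \<bar>(f t + g t) * h t\<bar> \<partial>MI) \<le> Nb f + Nb g" .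
qed

lemma Nb_fatou:
  assumes f [measurable]: "f \<in> L0 I" and u [measurable]: "\<And>n. u n \<in> L0 I"
    and lim: "AE t in MI. (\<lambda>n. u n t) \<longlonglongrightarrow> f t"
  shows "Nb f \<le> liminf (\<lambda>n. Nb (u n))"
proof (rule Nb_least)
  fix h assume h [measurable]: "h \<in> L0 I" and 1: "Nd h \<le> 1"
  have "(\<integral>\<^sup>+t. ennreal \<bar>f t * h t\<bar> \<partial>MI) \<le> (\<integral>\<^sup>+t. liminf (\<lambda>n. ennreal \<bar>u n t * h t\<bar>) \<partial>MI)"
  proof (rule nn_integral_mono_AE)
    show "AE t in MI. ennreal \<bar>f t * h t\<bar> \<le> liminf (\<lambda>n. ennreal \<bar>u n t * h t\<bar>)"
      using lim
    proof eventually_elim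
      case (elim t)
      then have "(\<lambda>n. ennreal \<bar>u n t * h t\<bar>) \<longlonglongrightarrow> ennreal \<bar>f t * h t\<bar>"
        by (intro tendsto_ennrealI tendsto_rabs tendsto_mult tendsto_const)
      then show ?case using lim_imp_Liminf[OF sequentially_bot] by fastforce
    qed
  qed
  also have "\<dots> \<le> liminf (\<lambda>n. \<integral>\<^sup>+t. ennreal \<bar>u n t * h t\<bar> \<partial>MI)" by (rule nn_integral_liminf) measurable
  also have "\<dots> \<le> liminf (\<lambda>n. Nb (u n))" using 1 by (intro Liminf_mono always_eventually allI Nb_upper h)
  finally show "(\<integral>\<^sup>+t. ennreal \<bar>f t * h t\<bar> \<partial>MI) \<le> liminf (\<lambda>n. Nb (u n))" .
qed

lemma AE_zero_of_integral:
  assumes [measurable]: "f \<in> L0 I" "h0 \<in> L0 I" and "\<And>t. t \<in> I \<Longrightarrow> 0 < h0 t"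
    and "(\<integral>\<^sup>+t. ennreal \<bar>f t * h0 t\<bar> \<partial>MI) = 0"
  shows "AE t in MI. f t = 0"
proof -
  have "AE t in MI. ennreal \<bar>f t * h0 t\<bar> = 0" using assms(4) by (subst (asm) nn_integral_0_iff_AE) auto
  then show ?thesis using AE_space by eventually_elim (use assms(3) in fastforce)
qed

lemma Nb_zero_iff:
  assumes f [measurable]: "f \<in> L0 I"
  shows "Nb f = 0 \<longleftrightarrow> (AE t in MI. f t = 0)"
proof
  obtain h0 where h0: "h0 \<in> L0 I" "\<And>t. t \<in> I \<Longrightarrow> 0 < h0 t" "Nd h0 \<le> 1" by (rule ex_positive_dual) blast
  assume "Nb f = 0"
  then have "(\<integral>\<^sup>+t. ennreal \<bar>f t * h0 t\<bar> \<partial>MI) = 0" using Nb_upper[OF h0(1,3), of f] by simp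
  then show "AE t in MI. f t = 0" using h0 by (intro AE_zero_of_integral[OF f h0(1)]) auto
next
  assume z: "AE t in MI. f t = 0"
  have "Nb f \<le> 0"
  proof (rule Nb_least)
    fix h assume [measurable]: "h \<in> L0 I"
    have "AE t in MI. ennreal \<bar>f t * h t\<bar> = 0" using z by eventually_elim simp
    then show "(\<integral>\<^sup>+t. ennreal \<bar>f t * h t\<bar> \<partial>MI) \<le> 0" by (subst nn_integral_0_iff_AE[THEN iffD2]) auto
  qed
  then show "Nb f = 0" by simp
qed

theorem calM_Banach: "Banach MI cM cMn"
  unfolding Banach_def
proof
  have lin: "linear_space cM"
    unfolding linear_space_def
  proof (intro conjI ballI allI)
    have "(\<lambda>t. 0) \<in> L0 I" by simp
    then show "(\<lambda>t. 0) \<in> cM" using Nb_zero_iff[of "\<lambda>t. 0"] by (simp add: cM_iff)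
    fix f g :: "real \<Rightarrow> real" and c :: real assume f: "f \<in> cM"
    then have fm [measurable]: "f \<in> L0 I" by (simp add: cM_iff)
    show "(\<lambda>t. c * f t) \<in> cM" using f by (auto simp: cM_iff Nb_cmult ennreal_mult_less_top)
    assume g: "g \<in> cM"
    then have gm [measurable]: "g \<in> L0 I" by (simp add: cM_iff)
    have "Nb (\<lambda>t. f t + g t) \<le> Nb f + Nb g" by (rule Nb_triangle) measurable
    also have "\<dots> < top" using f g by (simp add: cM_iff)
    finally show "(\<lambda>t. f t + g t) \<in> cM" by (simp add: cM_iff)
  qed
  show "quasi_norm_with 1 MI cM cMn"
    unfolding quasi_norm_with_def
  proof (intro conjI ballI allI lin)
    show "cM \<subseteq> L0 I" by (auto simp: cM_iff)
    fix f assume f: "f \<in> cM"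
    then have fm [measurable]: "f \<in> L0 I" by (simp add: cM_iff)
    show "cMn f < \<infinity>" using f by (simp add: cM_iff calM_norm_eq)
    show "cMn f = 0 \<longleftrightarrow> (AE t in MI. f t = 0)" by (simp only: calM_norm_eq[OF fm] Nb_zero_iff[OF fm])
    show "cMn (\<lambda>t. c * f t) = ennreal \<bar>c\<bar> * cMn f" for c
      using calM_norm_eq[of "\<lambda>t. c * f t"] by (simp add: calM_norm_eq Nb_cmult)
    fix g assume "g \<in> cM"
    then have gm [measurable]: "g \<in> L0 I" by (simp add: cM_iff)
    have m: "(\<lambda>t. f t + g t) \<in> L0 I" by measurable
    show "cMn (\<lambda>t. f t + g t) \<le> ennreal 1 * (cMn f + cMn g)"
      using Nb_triangle[OF fm gm] by (simp add: calM_norm_eq[OF m] calM_norm_eq[OF fm] calM_norm_eq[OF gm])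
  qed
  obtain h0 where h0: "h0 \<in> L0 I" "\<And>t. t \<in> I \<Longrightarrow> 0 < h0 t" "Nd h0 \<le> 1" by (rule ex_positive_dual) blast
  show "complete_under cM cMn"
  proof (rule complete_underI[OF h0(1,2)])
    show "cM \<subseteq> L0 I" by (auto simp: cM_iff)
    fix f assume f [measurable]: "f \<in> L0 I"
    show "(\<integral>\<^sup>+t. ennreal \<bar>f t * h0 t\<bar> \<partial>MI) \<le> cMn f" using Nb_upper[OF h0(1,3)] by (simp add: calM_norm_eq[OF f])
    fix u :: "nat \<Rightarrow> real \<Rightarrow> real" assume u: "\<And>n. u n \<in> L0 I" and lim: "AE t in MI. (\<lambda>n. u n t) \<longlonglongrightarrow> f t"
    show "cMn f \<le> liminf (\<lambda>n. cMn (u n))" using Nb_fatou[OF f u lim] by (simp add: calM_norm_eq[OF f] calM_norm_eq[OF u])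
  next
    fix f g assume f: "f \<in> cM" and g [measurable]: "g \<in> L0 I" and d: "cMn (\<lambda>t. f t - g t) < \<infinity>"
    have fm [measurable]: "f \<in> L0 I" using f by (simp add: cM_iff)
    have m: "(\<lambda>t. f t - g t) \<in> cM" using d by (auto simp: calM_space_def)
    show "g \<in> cM" using linear_space_diff[OF lin f m] by simp
  qed
qed

end

section \<open>The class M as a quasi-Banach space\<close>

text \<open>Doubling exchanges the two sets below. Hence the measure \<open>e\<close> of the initial segments of either of them satisfies
  \<open>e t \<le> e (2 t) = 2 (t - e t)\<close>, i.e. \<open>e t \<le> 2 t / 3\<close>.\<close>

definition dyadic_set :: "bool \<Rightarrow> real set" where
  "dyadic_set p = {t. 0 < t \<and> (even \<lfloor>log 2 t\<rfloor> \<longleftrightarrow> p)}"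

lemma dyadic_set_borel [measurable]: "dyadic_set p \<in> sets borel"
proof -
  have "Measurable.pred borel (\<lambda>t::real. 0 < t \<and> (even \<lfloor>log 2 t\<rfloor> \<longleftrightarrow> p))" by measurable
  then show ?thesis by (simp add: dyadic_set_def pred_def)
qed

lemma dyadic_set_measure:
  assumes t: "0 < t"
  shows "emeasure lebesgue (dyadic_set p \<inter> {..<t}) \<le> ennreal (2 * t / 3)"
proof -
  define e where "e p t = measure lebesgue (dyadic_set p \<inter> {..<t})" for p t
  have sub: "dyadic_set p \<inter> {..<t} \<subseteq> {0<..<t}" for p and t :: real by (auto simp: dyadic_set_def)
  have fin: "dyadic_set p \<inter> {..<t} \<in> lmeasurable" for p and t :: real
    by (rule fmeasurableI2[OF _ sub]) (auto intro: lmeasurable_interval)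
  have "e q t + e (\<not> q) t = t" if "0 < t" for q t
  proof -
    have "e q t + e (\<not> q) t = measure lebesgue ((dyadic_set q \<inter> {..<t}) \<union> (dyadic_set (\<not> q) \<inter> {..<t}))"
      unfolding e_def using fin[of q t] fin[of "\<not> q" t]
      by (intro measure_Union[symmetric]) (auto simp: dyadic_set_def dest: fmeasurableD fmeasurableD2)
    also have "(dyadic_set q \<inter> {..<t}) \<union> (dyadic_set (\<not> q) \<inter> {..<t}) = {0<..<t}" by (auto simp: dyadic_set_def)
    finally show ?thesis using that by simp
  qed note sum = this
  have scale: "e q (2 * t) = 2 * e (\<not> q) t" if "0 < t" for q t
  proof -
    have "dyadic_set q \<inter> {..<2 * t} = (\<lambda>x. 2 *\<^sub>R x + 0) ` (dyadic_set (\<not> q) \<inter> {..<t})"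
    proof (intro equalityI subsetI)
      fix x assume x: "x \<in> dyadic_set q \<inter> {..<2 * t}"
      have "log 2 x = 1 + log 2 (x / 2)" using x by (simp add: dyadic_set_def log_divide)
      then have "\<lfloor>log 2 x\<rfloor> = \<lfloor>log 2 (x / 2)\<rfloor> + 1" by linarith
      then have "x / 2 \<in> dyadic_set (\<not> q) \<inter> {..<t}" using x by (auto simp: dyadic_set_def)
      then show "x \<in> (\<lambda>x. 2 *\<^sub>R x + 0) ` (dyadic_set (\<not> q) \<inter> {..<t})" by (intro image_eqI[of _ _ "x / 2"]) auto
    next
      fix x assume "x \<in> (\<lambda>x. 2 *\<^sub>R x + 0) ` (dyadic_set (\<not> q) \<inter> {..<t})"
      then obtain y where y: "x = 2 * y" "y \<in> dyadic_set (\<not> q)" "y < t" by auto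
      have "log 2 x = 1 + log 2 y" using y by (simp add: dyadic_set_def log_mult)
      then have "\<lfloor>log 2 x\<rfloor> = \<lfloor>log 2 y\<rfloor> + 1" by linarith
      then show "x \<in> dyadic_set q \<inter> {..<2 * t}" using y by (auto simp: dyadic_set_def)
    qed
    then show ?thesis unfolding e_def using measure_lebesgue_affine[of 2 0 "dyadic_set (\<not> q) \<inter> {..<t}"]
      by (simp add: add.commute)
  qed
  have "e p t \<le> e p (2 * t)" unfolding e_def using t fin by (intro measure_mono_fmeasurable) (auto dest: fmeasurableD)
  also have "\<dots> = 2 * (t - e p t)" using scale[OF t, of p] sum[OF t, of p] by simp
  finally have "e p t \<le> 2 * t / 3" by simp
  moreover have "emeasure lebesgue (dyadic_set p \<inter> {..<t}) = ennreal (e p t)"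
    unfolding e_def using fin[of p t] by (intro emeasure_eq_measure2)
  ultimately show ?thesis by (simp add: ennreal_leI)
qed

context orlicz_lorentz begin

text \<open>The stretched function G t = X (2 t / 3) is split along the two dyadic sets. Since each
  fills at most 2/3 of (0, 3 t / 2), both parts have rearrangement at most X and lie in M; by
  linearity so does their sum. This is a dilation by 2/3, weakened to 7/10.\<close>

lemma linear_dilation:
  assumes lin: "linear_space Mcl"
    and X: "\<And>s t. s \<in> I \<Longrightarrow> t \<in> I \<Longrightarrow> s \<le> t \<Longrightarrow> X t \<le> X s"
    and fin: "(\<integral>\<^sup>+t. Ph (X t) (w t) \<partial>MI) < top"
  shows "\<exists>f\<in>Mcl. \<forall>t\<in>I. X (7 / 10 * t) \<le> rear f t"
proof -
  have Xfin: "X t < top" if "t \<in> I" for t using modular_finite_imp_finite[OF X fin that] .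
  define G where "G t = X (2 / 3 * t)" for t
  have sI: "2 / 3 * t \<in> I" "7 / 10 * t \<in> I" if "t \<in> I" for t using I_down[OF that] I_pos[OF that] by auto
  have Ganti: "G t \<le> G s" if "s \<in> I" "t \<in> I" "s \<le> t" for s t
    unfolding G_def using that sI by (intro X) auto
  have Gfin: "G t < top" if "t \<in> I" for t unfolding G_def using Xfin sI that by blast
  obtain t0 where "t0 \<in> I" using I_nonempty by blast
  have Gm [measurable]: "(\<lambda>t. enn2real (G t)) \<in> L0 I" by (rule rear_enn2real(1)[OF Ganti Gfin \<open>t0 \<in> I\<close>])
  define k where "k p t = enn2real (G t) * indicator (dyadic_set p) t" for p t
  have im: "(\<lambda>t. indicator (dyadic_set p) t :: real) \<in> L0 I" for p by (rule borel_imp_MI) measurable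
  have km [measurable]: "k p \<in> L0 I" for p unfolding k_def using im[of p] by measurable
  have rk: "rear (k p) t \<le> X t" if t: "t \<in> I" for p t
  proof (rule rear_leI[OF km])
    fix y :: real assume y: "0 \<le> y" "ennreal t < dist_f (k p) y"
    show "ennreal y < X t"
    proof (rule ccontr)
      assume "\<not> ennreal y < X t"
      then have Xt: "X t \<le> ennreal y" by simp
      have sub: "{s\<in>I. y < \<bar>k p s\<bar>} \<subseteq> dyadic_set p \<inter> {..<3 / 2 * t}"
      proof safe
        fix s assume s: "s \<in> I" "y < \<bar>k p s\<bar>"
        then show sE: "s \<in> dyadic_set p" using y by (cases "s \<in> dyadic_set p") (auto simp: k_def)
        have "y < enn2real (G s)" using s sE by (simp add: k_def)
        then have "ennreal y < G s" using y Gfin[OF s(1)] by (cases "G s") (auto simp: ennreal_less_iff)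
        then have "ennreal y < X (2 / 3 * s)" by (simp add: G_def)
        then have "\<not> t \<le> 2 / 3 * s" using X[OF t sI(1)[OF s(1)]] Xt by (meson leD order_trans)
        then show "s < 3 / 2 * t" by simp
      qed
      have "dist_f (k p) y \<le> emeasure lebesgue (dyadic_set p \<inter> {..<3 / 2 * t})"
        unfolding distribution_fun_def by (rule emeasure_mono[OF sub]) auto
      also have "\<dots> \<le> ennreal (2 * (3 / 2 * t) / 3)" using I_pos[OF t] by (intro dyadic_set_measure) auto
      finally show False using y(2) by simp
    qed
  qed
  have kM: "k p \<in> Mcl" for p
  proof (rule Mod_finite_imp_Mcl[OF km])
    show "Mod (k p) < \<infinity>" using Mod_le[OF rk] fin by (auto intro: le_less_trans)
  qed
  have "\<forall>f\<in>Mcl. \<forall>g\<in>Mcl. (\<lambda>t. f t + g t) \<in> Mcl" using lin by (simp add: linear_space_def)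
  then have mem: "(\<lambda>t. k True t + k False t) \<in> Mcl" using kM by auto
  then have fm: "(\<lambda>t. k True t + k False t) \<in> L0 I" by (simp add: Mcl_iff)
  have feq: "k True s + k False s = enn2real (G s)" if "s \<in> I" for s
    using I_pos[OF that] by (auto simp: k_def indicator_def dyadic_set_def)
  have "X (7 / 10 * t) \<le> rear (\<lambda>t. k True t + k False t) t" if t: "t \<in> I" for t
  proof (rule ccontr)
    assume "\<not> X (7 / 10 * t) \<le> rear (\<lambda>t. k True t + k False t) t"
    then have lt: "rear (\<lambda>t. k True t + k False t) t < X (7 / 10 * t)" by simp
    then obtain y where y: "rear (\<lambda>t. k True t + k False t) t = ennreal y" "0 \<le> y"
      by (cases "rear (\<lambda>t. k True t + k False t) t") auto
    \<comment> \<open>7/10 is 2/3 times 21/20: the slack 21/20 > 1 yields a superlevel set of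
      measure strictly larger than t, as the strict inequality in \<open>rear_gt_iff\<close> demands
      when X is not right continuous.\<close>
    have "min (ennreal (21 / 20 * t)) len = emeasure MI {s\<in>I. ennreal s < ennreal (21 / 20 * t)}"
      by (rule emeasure_initial[symmetric])
    also have "\<dots> \<le> dist_f (\<lambda>t. k True t + k False t) y"
      unfolding dist_f_eq
    proof (rule emeasure_mono[OF _ pred_abs_greater[OF fm]], safe)
      fix s assume s: "s \<in> I" "ennreal s < ennreal (21 / 20 * t)"
      then have "2 / 3 * s \<le> 7 / 10 * t" by (simp add: ennreal_less_I_iff)
      then have "X (7 / 10 * t) \<le> G s" unfolding G_def by (intro X sI t s)
      then have "ennreal y < G s" using lt y by simp
      then have "y < enn2real (G s)" using Gfin[OF s(1)] y by (cases "G s") (auto simp: ennreal_less_iff)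
      then show "y < \<bar>k True s + k False s\<bar>" unfolding feq[OF s(1)] by simp
    qed
    finally have le: "min (ennreal (21 / 20 * t)) len \<le> dist_f (\<lambda>t. k True t + k False t) y" .
    have "ennreal t < ennreal (21 / 20 * t)" using I_pos[OF t] by (intro ennreal_lessI) auto
    then have "ennreal t < min (ennreal (21 / 20 * t)) len" using t by (simp add: mem_I_iff)
    then have "ennreal t < dist_f (\<lambda>t. k True t + k False t) y" using le by (rule less_le_trans)
    then show False using rear_gt_iff[OF fm y(2), of t] y(1) by simp
  qed
  then show ?thesis using mem by blast
qed

text \<open>The square of 7/10 is 49/100, below 1/2, so two applications of
  \<open>linear_dilation\<close> suffice. In between, f1 is scaled by some c that makes its modular
  finite, and the scaling is undone at the end.\<close>

lemma linear_doubling: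
  assumes lin: "linear_space Mcl"
    and X: "\<And>s t. s \<in> I \<Longrightarrow> t \<in> I \<Longrightarrow> s \<le> t \<Longrightarrow> X t \<le> X s"
    and fin: "(\<integral>\<^sup>+t. Ph (X t) (w t) \<partial>MI) < top"
  shows "\<exists>f\<in>Mcl. \<forall>t\<in>I. X (t / 2) \<le> rear f t"
proof -
  obtain f1 where f1: "f1 \<in> Mcl" "\<And>t. t \<in> I \<Longrightarrow> X (7 / 10 * t) \<le> rear f1 t"
    using linear_dilation[OF lin X fin] by blast
  have f1m [measurable]: "f1 \<in> L0 I" using f1 by (simp add: Mcl_iff)
  obtain c where c: "0 < c" "Mod (\<lambda>t. c * f1 t) < \<infinity>" using f1(1) by (auto simp: M_class_def)
  have cm: "(\<lambda>t. c * f1 t) \<in> L0 I" by measurable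
  have "\<exists>f\<in>Mcl. \<forall>t\<in>I. rear (\<lambda>t. c * f1 t) (7 / 10 * t) \<le> rear f t"
    using c(2) unfolding Mod_eq by (intro linear_dilation[OF lin rear_antimono[OF cm]]) auto
  then obtain f2 where f2: "f2 \<in> Mcl" "\<And>t. t \<in> I \<Longrightarrow> rear (\<lambda>t. c * f1 t) (7 / 10 * t) \<le> rear f2 t" by blast
  have f2m [measurable]: "f2 \<in> L0 I" using f2 by (simp add: Mcl_iff)
  have "(\<lambda>t. (1 / c) * f2 t) \<in> Mcl" using lin f2(1) unfolding linear_space_def by blast
  moreover have "X (t / 2) \<le> rear (\<lambda>t. (1 / c) * f2 t) t" if t: "t \<in> I" for t
  proof -
    have i: "7 / 10 * t \<in> I" "7 / 10 * (7 / 10 * t) \<in> I" "t / 2 \<in> I" using I_down[OF t] I_pos[OF t] by auto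
    have "X (t / 2) \<le> X (7 / 10 * (7 / 10 * t))" using i I_pos[OF t] by (intro X) auto
    also have "\<dots> \<le> rear f1 (7 / 10 * t)" by (rule f1(2)[OF i(1)])
    also have "\<dots> = ennreal (1 / c) * (ennreal c * rear f1 (7 / 10 * t))"
      using c(1) by (simp add: mult.assoc[symmetric] flip: ennreal_mult)
    also have "ennreal c * rear f1 (7 / 10 * t) = rear (\<lambda>t. c * f1 t) (7 / 10 * t)"
      using c(1) by (simp add: rear_cmult[OF f1m])
    also have "ennreal (1 / c) * \<dots> \<le> ennreal (1 / c) * rear f2 t" using f2(2)[OF t] by (rule mult_left_mono) simp
    also have "\<dots> = rear (\<lambda>t. (1 / c) * f2 t) t" using c(1) by (simp only: rear_cmult[OF f2m]) simp
    finally show ?thesis .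
  qed
  ultimately show ?thesis by blast
qed

text \<open>Failure would provide pairs f n, g n in the unit ball whose sums have quasi-norm above
  4^n. The damped rearrangements have a common majorant Z of finite modular, and linearity enters
  through one F in M with \<open>rear F t\<close> >= Z (t / 2). Then 4^n < 2^(n+2)
  \<open>Nm F\<close> for all n, where 2^(n+1) undoes the damping and the last 2 counts the
  summands.\<close>

lemma M_uniform_bound:
  assumes lin: "linear_space Mcl"
  shows "\<exists>K. \<forall>f\<in>L0 I. \<forall>g\<in>L0 I. Mod f \<le> 1 \<longrightarrow> Mod g \<le> 1 \<longrightarrow> Nm (\<lambda>t. f t + g t) \<le> ennreal K"
proof (rule ccontr)
  assume "\<not> ?thesis"
  then have "\<exists>p. fst p \<in> L0 I \<and> snd p \<in> L0 I \<and> Mod (fst p) \<le> 1 \<and> Mod (snd p) \<le> 1 \<and>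
      ennreal (4 ^ n) < Nm (\<lambda>t. fst p t + snd p t)" for n :: nat
    unfolding split_paired_Ex fst_conv snd_conv by (meson not_le)
  then have "\<exists>p. \<forall>n::nat. fst (p n) \<in> L0 I \<and> snd (p n) \<in> L0 I \<and> Mod (fst (p n)) \<le> 1 \<and> Mod (snd (p n)) \<le> 1 \<and>
      ennreal (4 ^ n) < Nm (\<lambda>t. fst (p n) t + snd (p n) t)"
    by (intro choice allI)
  then obtain p where p: "\<forall>n::nat. fst (p n) \<in> L0 I \<and> snd (p n) \<in> L0 I \<and> Mod (fst (p n)) \<le> 1 \<and> Mod (snd (p n)) \<le> 1 \<and>
      ennreal (4 ^ n) < Nm (\<lambda>t. fst (p n) t + snd (p n) t)" ..
  define f where "f n = fst (p n)" for n
  define g where "g n = snd (p n)" for n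
  have f [measurable]: "f n \<in> L0 I" and g [measurable]: "g n \<in> L0 I" and f1: "Mod (f n) \<le> 1" and g1: "Mod (g n) \<le> 1"
    and big: "ennreal (4 ^ n) < Nm (\<lambda>t. f n t + g n t)" for n
    using p by (simp_all add: f_def g_def)
  define X where "X = (\<lambda>t. SUP n. ennreal ((1/2) ^ Suc n) * rear (f n) t)"
  define Y where "Y = (\<lambda>t. SUP n. ennreal ((1/2) ^ Suc n) * rear (g n) t)"
  note X = sup_rear_modular[OF f f1 X_def] and Y = sup_rear_modular[OF g g1 Y_def]
  have [measurable]: "X \<in> borel_measurable MI" "Y \<in> borel_measurable MI"
    using X(4) Y(4) by (auto intro: borel_imp_MI)
  define Z where "Z t = max (X t) (Y t)" for t
  have Zanti: "Z t \<le> Z s" if "s \<in> I" "t \<in> I" "s \<le> t" for s t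
    unfolding Z_def by (intro max.mono X(2) Y(2) that)
  have "(\<integral>\<^sup>+t. Ph (Z t) (w t) \<partial>MI) \<le> (\<integral>\<^sup>+t. Ph (X t) (w t) + Ph (Y t) (w t) \<partial>MI)"
    by (intro nn_integral_mono) (auto simp: Z_def max_def intro: add_increasing add_increasing2)
  also have "\<dots> = (\<integral>\<^sup>+t. Ph (X t) (w t) \<partial>MI) + (\<integral>\<^sup>+t. Ph (Y t) (w t) \<partial>MI)" by (rule nn_integral_add) measurable
  also have "\<dots> \<le> 1 + 1" by (intro add_mono X(1) Y(1))
  also have "\<dots> < top" by simp
  finally have Zfin: "(\<integral>\<^sup>+t. Ph (Z t) (w t) \<partial>MI) < top" .
  obtain F where F: "F \<in> Mcl" "\<And>t. t \<in> I \<Longrightarrow> Z (t / 2) \<le> rear F t"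
    using linear_doubling[OF lin Zanti Zfin] by blast
  have Fm [measurable]: "F \<in> L0 I" using F by (simp add: Mcl_iff)
  obtain r where r: "Nm F = ennreal r" "0 \<le> r" using F(1) by (cases "Nm F") (auto simp: Mcl_iff)
  have bound: "4 ^ n < 2 ^ (n + 2) * r" for n :: nat
  proof -
    have up: "rear (k n) s \<le> ennreal (2 ^ Suc n) * V s"
      if V: "V = (\<lambda>t. SUP n. ennreal ((1/2) ^ Suc n) * rear (k n) t)" for V s and k :: "nat \<Rightarrow> real \<Rightarrow> real"
    proof -
      have "rear (k n) s = ennreal (2 ^ Suc n) * (ennreal ((1/2) ^ Suc n) * rear (k n) s)"
        by (simp add: mult.assoc[symmetric] power_mult_distrib[symmetric] flip: ennreal_mult del: power_Suc)
      also have "\<dots> \<le> ennreal (2 ^ Suc n) * V s" unfolding V by (intro mult_left_mono SUP_upper) auto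
      finally show ?thesis .
    qed
    have "Nm (\<lambda>t. f n t + g n t) \<le> Nm (\<lambda>t. 2 ^ (n + 2) * F t)"
    proof (rule Nm_mono)
      fix t assume t: "t \<in> I"
      have "rear (\<lambda>t. f n t + g n t) t \<le> rear (f n) (t / 2) + rear (g n) (t / 2)"
        using I_pos[OF t] by (intro rear_add_le) auto
      also have "\<dots> \<le> ennreal (2 ^ Suc n) * X (t / 2) + ennreal (2 ^ Suc n) * Y (t / 2)"
        by (intro add_mono up X_def Y_def)
      also have "\<dots> \<le> ennreal (2 ^ Suc n) * Z (t / 2) + ennreal (2 ^ Suc n) * Z (t / 2)"
        by (intro add_mono mult_left_mono) (auto simp: Z_def)
      also have "\<dots> = ennreal (2 ^ (n + 2)) * Z (t / 2)"
        by (simp add: distrib_right[symmetric] flip: ennreal_plus)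
      also have "\<dots> \<le> ennreal (2 ^ (n + 2)) * rear F t" using F(2)[OF t] by (rule mult_left_mono) simp
      also have "\<dots> = rear (\<lambda>t. 2 ^ (n + 2) * F t) t" by (simp only: rear_cmult[OF Fm]) simp
      finally show "rear (\<lambda>t. f n t + g n t) t \<le> rear (\<lambda>t. 2 ^ (n + 2) * F t) t" .
    qed measurable
    also have "\<dots> = ennreal \<bar>2 ^ (n + 2)\<bar> * Nm F" by (rule Nm_cmult[OF Fm])
    also have "\<dots> = ennreal (2 ^ (n + 2) * r)" using r by (simp add: ennreal_mult del: power_add power_Suc)
    finally have "ennreal (4 ^ n) < ennreal (2 ^ (n + 2) * r)" using big[of n] by (rule less_le_trans[rotated])
    then show ?thesis by (subst (asm) ennreal_less_iff) auto
  qed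
  obtain n where "4 * r < 2 ^ n" using real_arch_pow[of 2 "4 * r"] by auto
  then have "2 ^ n * (4 * r) < 2 ^ n * 2 ^ n" by simp
  then show False using bound[of n] by (simp add: power_add power_mult_distrib[symmetric] algebra_simps)
qed

lemma Nm_fatou:
  assumes f [measurable]: "f \<in> L0 I" and u [measurable]: "\<And>n. u n \<in> L0 I"
    and lim: "AE t in MI. (\<lambda>n. u n t) \<longlonglongrightarrow> f t"
  shows "Nm f \<le> liminf (\<lambda>n. Nm (u n))"
proof (rule ccontr)
  assume "\<not> ?thesis"
  then obtain x where x: "liminf (\<lambda>n. Nm (u n)) < x" "x < Nm f" using dense by (meson not_le)
  then obtain e where e: "x = ennreal e" "0 \<le> e" by (cases x) auto
  have e0: "0 < e" using x(1) e by (cases "e = 0") auto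
  have "Mod (\<lambda>t. f t / e) \<le> liminf (\<lambda>n. Mod (\<lambda>t. u n t / e))"
  proof (rule Mod_liminf)
    show "AE t in MI. (\<lambda>n. u n t / e) \<longlonglongrightarrow> f t / e"
      using lim by eventually_elim (use e0 in \<open>intro tendsto_divide tendsto_const, auto\<close>)
  qed measurable
  also have "\<dots> \<le> 1"
  proof (rule ccontr)
    assume "\<not> liminf (\<lambda>n. Mod (\<lambda>t. u n t / e)) \<le> 1"
    then have "1 < liminf (\<lambda>n. Mod (\<lambda>t. u n t / e))" by simp
    then have "\<forall>\<^sub>F n in sequentially. 1 < Mod (\<lambda>t. u n t / e)" by (rule less_LiminfD)
    then have "\<forall>\<^sub>F n in sequentially. ennreal e \<le> Nm (u n)"
    proof eventually_elim
      case (elim n)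
      then have "\<not> Nm (u n) \<le> ennreal e" using Nm_le_iff[OF u e0, of n] by simp
      then show ?case by simp
    qed
    then have "ennreal e \<le> liminf (\<lambda>n. Nm (u n))" by (rule Liminf_bounded)
    then show False using x(1) e by simp
  qed
  finally show False using Nm_le_iff[OF f e0] x(2) e by simp
qed

text \<open>If e is at least the sum of the quasi-norms, both f / e and g / e lie in the unit ball,
  so the uniform bound on sums becomes the constant of the quasi-triangle inequality.\<close>

theorem M_quasi_Banach:
  assumes lin: "linear_space Mcl"
  shows "quasi_Banach MI Mcl Nm"
  unfolding quasi_Banach_def
proof
  obtain h0 where h0: "h0 \<in> L0 I" "\<And>t. t \<in> I \<Longrightarrow> 0 < h0 t" "Nd h0 \<le> 1" by (rule ex_positive_dual) blast
  have L1: "(\<integral>\<^sup>+t. ennreal \<bar>f t * h0 t\<bar> \<partial>MI) \<le> Nm f" if "f \<in> L0 I" for f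
    using Nd_le_Nm[OF h0(1) that h0(3)] by (simp add: mult.commute)
  obtain K where K: "\<And>f g. f \<in> L0 I \<Longrightarrow> g \<in> L0 I \<Longrightarrow> Mod f \<le> 1 \<Longrightarrow> Mod g \<le> 1 \<Longrightarrow> Nm (\<lambda>t. f t + g t) \<le> ennreal K"
    using M_uniform_bound[OF lin] by blast
  define C where "C = max 1 K"
  have C: "1 \<le> C" "ennreal K \<le> ennreal C" by (auto simp: C_def intro: ennreal_leI)
  have tri: "Nm (\<lambda>t. f t + g t) \<le> ennreal C * (Nm f + Nm g)"
    if f [measurable]: "f \<in> L0 I" and g [measurable]: "g \<in> L0 I" for f g
  proof (rule ennreal_le_by_reals)
    fix d :: real assume d: "0 < d" "ennreal C * (Nm f + Nm g) \<le> ennreal d"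
    define e where "e = d / C"
    have e: "0 < e" "C * e = d" using d C by (auto simp: e_def)
    have "ennreal C * (Nm f + Nm g) \<le> ennreal C * ennreal e" using d e C by (simp flip: ennreal_mult)
    then have "Nm f + Nm g \<le> ennreal e" using C by (subst (asm) ennreal_mult_le_mult_iff) auto
    then have "Nm f \<le> ennreal e" "Nm g \<le> ennreal e"
      by (auto intro: order_trans[rotated] add_increasing add_increasing2)
    then have "Mod (\<lambda>t. f t / e) \<le> 1" "Mod (\<lambda>t. g t / e) \<le> 1" using Nm_le_iff e by auto
    then have "Nm (\<lambda>t. f t / e + g t / e) \<le> ennreal K" by (intro K) auto
    then have "Nm (\<lambda>t. f t / e + g t / e) \<le> ennreal C" using C(2) by (rule order_trans)
    then have "ennreal e * Nm (\<lambda>t. f t / e + g t / e) \<le> ennreal e * ennreal C"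
      by (rule mult_left_mono) simp
    also have "ennreal e * Nm (\<lambda>t. f t / e + g t / e) = Nm (\<lambda>t. e * (f t / e + g t / e))"
      using e by (subst Nm_cmult) auto
    also have "(\<lambda>t. e * (f t / e + g t / e)) = (\<lambda>t. f t + g t)" using e by (simp add: distrib_left)
    also have "ennreal e * ennreal C = ennreal d" using e C by (simp add: mult.commute flip: ennreal_mult)
    finally show "Nm (\<lambda>t. f t + g t) \<le> ennreal d" .
  qed
  have zero: "Nm f = 0 \<longleftrightarrow> (AE t in MI. f t = 0)" if f [measurable]: "f \<in> L0 I" for f
  proof
    assume "Nm f = 0"
    then show "AE t in MI. f t = 0" using L1[OF f] h0 by (intro AE_zero_of_integral[OF f h0(1)]) auto
  next
    assume z: "AE t in MI. f t = 0"
    have "Nm f \<le> Nm (\<lambda>t. 0 * f t)"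
    proof (rule Nm_mono)
      show "rear f t \<le> rear (\<lambda>t. 0 * f t) t" for t
        by (rule rear_mono) (use z in auto)
    qed measurable
    also have "\<dots> = 0" by (subst Nm_cmult) auto
    finally show "Nm f = 0" by simp
  qed
  have "quasi_norm_with C MI Mcl Nm"
    unfolding quasi_norm_with_def
    using lin tri zero by (auto simp: Mcl_iff Nm_cmult)
  then show "\<exists>C\<ge>1. quasi_norm_with C MI Mcl Nm" using C by blast
  show "complete_under Mcl Nm"
  proof (rule complete_underI[OF h0(1,2) L1 Nm_fatou])
    show "Mcl \<subseteq> L0 I" by (auto simp: Mcl_iff)
    fix f g assume f: "f \<in> Mcl" and g [measurable]: "g \<in> L0 I" and d: "Nm (\<lambda>t. f t - g t) < \<infinity>"
    have [measurable]: "f \<in> L0 I" using f by (simp add: Mcl_iff)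
    have "(\<lambda>t. f t - g t) \<in> Mcl" using d by (auto simp: Mcl_iff)
    then show "g \<in> Mcl" using linear_space_diff[OF lin f] by fastforce
  qed auto
qed

end

section \<open>A Radon--Nikodym theorem for signed set functions\<close>

text \<open>Domination by b gives continuity at the empty set, hence countable additivity of \<pi>,
  and absolute continuity; Radon-Nikodym then applies to a finite measure.\<close>

lemma additive_density:
  fixes \<pi> b :: "'a set \<Rightarrow> real"
  assumes sf: "sigma_finite_measure M"
    and add: "\<And>A B. A \<in> sets M \<Longrightarrow> B \<in> sets M \<Longrightarrow> A \<inter> B = {} \<Longrightarrow> \<pi> (A \<union> B) = \<pi> A + \<pi> B"
    and nonneg: "\<And>A. A \<in> sets M \<Longrightarrow> 0 \<le> \<pi> A" and bd: "\<And>A. A \<in> sets M \<Longrightarrow> \<pi> A \<le> b A"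
    and cont: "\<And>A. range A \<subseteq> sets M \<Longrightarrow> decseq A \<Longrightarrow> (\<Inter>i. A i) = {} \<Longrightarrow> (\<lambda>i. b (A i)) \<longlonglongrightarrow> 0"
    and null: "\<And>A. A \<in> null_sets M \<Longrightarrow> b A = 0"
  shows "\<exists>h. integrable M h \<and> (\<forall>A\<in>sets M. \<pi> A = (\<integral>x. h x * indicator A x \<partial>M))"
proof -
  interpret sigma_finite_measure M by fact
  define N where "N = measure_of (space M) (sets M) (\<lambda>A. ennreal (\<pi> A))"
  have \<pi>0: "\<pi> {} = 0" using add[of "{}" "{}"] by simp
  have pos: "positive (sets M) (\<lambda>A. ennreal (\<pi> A))" by (simp add: positive_def \<pi>0)
  have "countably_additive (sets M) (\<lambda>A. ennreal (\<pi> A))"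
  proof (rule sets.empty_continuous_imp_countably_additive[OF pos])
    show "additive (sets M) (\<lambda>A. ennreal (\<pi> A))"
      unfolding additive_def using add nonneg by (auto simp: ennreal_plus)
    fix A :: "nat \<Rightarrow> 'a set" assume A: "range A \<subseteq> sets M" "decseq A" "(\<Inter>i. A i) = {}"
    have "(\<lambda>i. \<pi> (A i)) \<longlonglongrightarrow> 0"
    proof (rule tendsto_sandwich[OF _ _ tendsto_const cont[OF A]])
      show "\<forall>\<^sub>F i in sequentially. 0 \<le> \<pi> (A i)" "\<forall>\<^sub>F i in sequentially. \<pi> (A i) \<le> b (A i)"
        using A(1) nonneg bd by (auto intro!: always_eventually)
    qed
    then show "(\<lambda>i. ennreal (\<pi> (A i))) \<longlonglongrightarrow> 0" using tendsto_ennrealI by fastforce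
  qed simp
  then have N: "emeasure N A = ennreal (\<pi> A)" if "A \<in> sets M" for A
    unfolding N_def using that pos by (intro emeasure_measure_of_sigma) (auto simp: sets.sigma_algebra_axioms)
  have sN: "sets N = sets M" by (simp add: N_def)
  have "absolutely_continuous M N"
    unfolding absolutely_continuous_def
  proof
    fix A assume A: "A \<in> null_sets M"
    then have "A \<in> sets M" by auto
    then have "\<pi> A = 0" using nonneg[of A] bd[of A] null[OF A] by simp
    then show "A \<in> null_sets N" using \<open>A \<in> sets M\<close> N[of A] sN by (intro null_setsI) auto
  qed
  then obtain k where k [measurable]: "k \<in> borel_measurable M" and kN: "density M k = N"
    using Radon_Nikodym[OF _ sN] by blast
  have ek: "(\<integral>\<^sup>+x. k x * indicator A x \<partial>M) = ennreal (\<pi> A)" if "A \<in> sets M" for A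
    using emeasure_density[OF k that] N[OF that] kN by simp
  have "(\<integral>\<^sup>+x. k x \<partial>M) = (\<integral>\<^sup>+x. k x * indicator (space M) x \<partial>M)" by (intro nn_integral_cong) auto
  then have kfin: "(\<integral>\<^sup>+x. k x \<partial>M) \<noteq> \<infinity>" using ek[of "space M"] by simp
  then have AEk: "AE x in M. k x \<noteq> \<infinity>" by (rule nn_integral_PInf_AE[OF k])
  define h where "h x = enn2real (k x)" for x
  have hm [measurable]: "h \<in> borel_measurable M" unfolding h_def by measurable
  have hk: "AE x in M. ennreal (h x) = k x" using AEk by eventually_elim (simp add: h_def less_top)
  have h0: "0 \<le> h x" for x by (simp add: h_def)
  have hA: "(\<integral>\<^sup>+x. ennreal (h x * indicator A x) \<partial>M) = ennreal (\<pi> A)" if "A \<in> sets M" for A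
  proof -
    have "(\<integral>\<^sup>+x. ennreal (h x * indicator A x) \<partial>M) = (\<integral>\<^sup>+x. k x * indicator A x \<partial>M)"
    proof (rule nn_integral_cong_AE)
      show "AE x in M. ennreal (h x * indicator A x) = k x * indicator A x"
        using hk by eventually_elim (auto simp: indicator_def)
    qed
    then show ?thesis using ek[OF that] by simp
  qed
  have "integrable M h"
  proof (rule integrableI_bounded[OF hm])
    have "(\<integral>\<^sup>+x. ennreal (norm (h x)) \<partial>M) = (\<integral>\<^sup>+x. k x \<partial>M)"
      using hk h0 by (intro nn_integral_cong_AE) (auto elim: eventually_mono)
    then show "(\<integral>\<^sup>+x. ennreal (norm (h x)) \<partial>M) < \<infinity>" using kfin by (simp add: less_top)
  qed
  moreover have "\<pi> A = (\<integral>x. h x * indicator A x \<partial>M)" if A: "A \<in> sets M" for A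
  proof -
    have "integrable M (\<lambda>x. h x * indicator A x)" using \<open>integrable M h\<close> A by (rule integrable_real_mult_indicator[rotated])
    then have "ennreal (\<pi> A) = ennreal (\<integral>x. h x * indicator A x \<partial>M)"
      unfolding hA[OF A, symmetric] using h0 by (intro nn_integral_eq_integral) auto
    then show ?thesis using nonneg[OF A] h0 by (subst (asm) ennreal_inj) (auto intro!: integral_nonneg_AE)
  qed
  ultimately show ?thesis by blast
qed

text \<open>Jordan decomposition: p E is the supremum of \<tau> over measurable subsets of E. Both p
  and p - \<tau> are additive and nonnegative, with bounds b and 2 b, so each has a density.\<close>

lemma signed_density:
  fixes \<tau> b :: "'a set \<Rightarrow> real"
  assumes sf: "sigma_finite_measure M"
    and add: "\<And>A B. A \<in> sets M \<Longrightarrow> B \<in> sets M \<Longrightarrow> A \<inter> B = {} \<Longrightarrow> \<tau> (A \<union> B) = \<tau> A + \<tau> B"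
    and bd: "\<And>A. A \<in> sets M \<Longrightarrow> \<bar>\<tau> A\<bar> \<le> b A"
    and mono: "\<And>A B. A \<in> sets M \<Longrightarrow> B \<in> sets M \<Longrightarrow> A \<subseteq> B \<Longrightarrow> b A \<le> b B"
    and cont: "\<And>A. range A \<subseteq> sets M \<Longrightarrow> decseq A \<Longrightarrow> (\<Inter>i. A i) = {} \<Longrightarrow> (\<lambda>i. b (A i)) \<longlonglongrightarrow> 0"
    and null: "\<And>A. A \<in> null_sets M \<Longrightarrow> b A = 0"
  shows "\<exists>h. integrable M h \<and> (\<forall>A\<in>sets M. \<tau> A = (\<integral>x. h x * indicator A x \<partial>M))"
proof -
  have \<tau>0: "\<tau> {} = 0" using add[of "{}" "{}"] by simp
  define S where "S E = \<tau> ` {A \<in> sets M. A \<subseteq> E}" for E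
  define p where "p E = Sup (S E)" for E
  have ne: "S E \<noteq> {}" for E by (auto simp: S_def)
  have Sb: "x \<le> b E" if "x \<in> S E" "E \<in> sets M" for x E
  proof -
    from that(1) obtain A where A: "x = \<tau> A" "A \<in> sets M" "A \<subseteq> E" by (auto simp: S_def)
    have "x \<le> \<bar>\<tau> A\<bar>" using A by simp
    also have "\<dots> \<le> b A" by (rule bd[OF A(2)])
    also have "\<dots> \<le> b E" by (rule mono[OF A(2) \<open>E \<in> sets M\<close> A(3)])
    finally show ?thesis .
  qed
  have bdd: "bdd_above (S E)" if "E \<in> sets M" for E using Sb that by (intro bdd_aboveI) blast
  have p_upper: "\<tau> A \<le> p E" if "A \<in> sets M" "A \<subseteq> E" "E \<in> sets M" for A E
    unfolding p_def using bdd[OF that(3)] that by (intro cSup_upper) (auto simp: S_def)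
  have p_le: "p E \<le> b E" if "E \<in> sets M" for E unfolding p_def using Sb that ne by (intro cSup_least) auto
  have p_nonneg: "0 \<le> p E" if "E \<in> sets M" for E using p_upper[of "{}" E] that \<tau>0 by simp
  have p_add: "p (E \<union> F) = p E + p F" if EF: "E \<in> sets M" "F \<in> sets M" "E \<inter> F = {}" for E F
  proof (rule antisym)
    show "p (E \<union> F) \<le> p E + p F"
      unfolding p_def[of "E \<union> F"]
    proof (rule cSup_least[OF ne])
      fix x assume "x \<in> S (E \<union> F)"
      then obtain A where A: "x = \<tau> A" "A \<in> sets M" "A \<subseteq> E \<union> F" by (auto simp: S_def)
      have "(A \<inter> E) \<union> (A \<inter> F) = A" using A by auto
      then have "\<tau> A = \<tau> (A \<inter> E) + \<tau> (A \<inter> F)" using add[of "A \<inter> E" "A \<inter> F"] A EF by auto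
      also have "\<dots> \<le> p E + p F" using A EF by (intro add_mono p_upper) auto
      finally show "x \<le> p E + p F" using A by simp
    qed
    have "p E \<le> p (E \<union> F) - p F"
      unfolding p_def[of E]
    proof (rule cSup_least[OF ne])
      fix x assume "x \<in> S E"
      then obtain A where A: "x = \<tau> A" "A \<in> sets M" "A \<subseteq> E" by (auto simp: S_def)
      have "p F \<le> p (E \<union> F) - \<tau> A"
        unfolding p_def[of F]
      proof (rule cSup_least[OF ne])
        fix y assume "y \<in> S F"
        then obtain B where B: "y = \<tau> B" "B \<in> sets M" "B \<subseteq> F" by (auto simp: S_def)
        have "\<tau> A + \<tau> B = \<tau> (A \<union> B)" using A B EF by (intro add[symmetric]) auto
        also have "\<dots> \<le> p (E \<union> F)" using A B EF by (intro p_upper) auto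
        finally show "y \<le> p (E \<union> F) - \<tau> A" using B by simp
      qed
      then show "x \<le> p (E \<union> F) - p F" using A by simp
    qed
    then show "p E + p F \<le> p (E \<union> F)" by simp
  qed
  have c2: "(\<lambda>i. 2 * b (A i)) \<longlonglongrightarrow> 0" if "range A \<subseteq> sets M" "decseq A" "(\<Inter>i. A i) = {}" for A
    using tendsto_mult_left[OF cont[OF that], of 2] by simp
  have "\<exists>h. integrable M h \<and> (\<forall>A\<in>sets M. p A = (\<integral>x. h x * indicator A x \<partial>M))"
    by (rule additive_density[OF sf, of p b]) (fact p_add p_nonneg p_le cont null)+
  then obtain h1 where h1: "integrable M h1" "\<And>A. A \<in> sets M \<Longrightarrow> p A = (\<integral>x. h1 x * indicator A x \<partial>M)"
    by blast
  have "\<exists>h. integrable M h \<and> (\<forall>A\<in>sets M. p A - \<tau> A = (\<integral>x. h x * indicator A x \<partial>M))"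
  proof (rule additive_density[OF sf, of _ "\<lambda>A. 2 * b A"])
    show "p A - \<tau> A \<le> 2 * b A" if "A \<in> sets M" for A using p_le[OF that] bd[OF that] by linarith
  qed (use p_add add p_upper c2 null in auto)
  then obtain h2 where h2: "integrable M h2" "\<And>A. A \<in> sets M \<Longrightarrow> p A - \<tau> A = (\<integral>x. h2 x * indicator A x \<partial>M)"
    by blast
  have "\<tau> A = (\<integral>x. (h1 x - h2 x) * indicator A x \<partial>M)" if A: "A \<in> sets M" for A
  proof -
    have "(\<integral>x. (h1 x - h2 x) * indicator A x \<partial>M) = (\<integral>x. h1 x * indicator A x - h2 x * indicator A x \<partial>M)"
      by (simp add: left_diff_distrib)
    also have "\<dots> = (\<integral>x. h1 x * indicator A x \<partial>M) - (\<integral>x. h2 x * indicator A x \<partial>M)"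
      using h1(1) h2(1) A by (intro Bochner_Integration.integral_diff integrable_real_mult_indicator)
    also have "\<dots> = \<tau> A" using h1(2)[OF A] h2(2)[OF A] by simp
    finally show ?thesis by simp
  qed
  then show ?thesis using h1(1) h2(1) by (intro exI[of _ "\<lambda>x. h1 x - h2 x"]) auto
qed

section \<open>Order continuity\<close>

context orlicz_lorentz begin

text \<open>If |g| exceeded y on a set of infinite measure, its rearrangement would be at least y
  throughout. Past t0 the weight is at most B = \<open>w t0\<close>, and \<phi> (y / s) s decreases
  in s, so the modular integrand would be at least B \<phi> (y / B) on a set of infinite
  measure.\<close>

lemma dist_f_finite:
  assumes g [measurable]: "g \<in> L0 I" and fin: "Mod g < top" and y: "0 < y"
  shows "dist_f g y < top"
proof (rule ccontr)
  assume "\<not> dist_f g y < top"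
  then have top: "dist_f g y = top" by (simp add: less_top[symmetric])
  then have len: "len = top" using dist_f_le_len[OF g, of y] by (simp add: top_unique)
  obtain t0 where t0: "t0 \<in> I" using I_nonempty by blast
  define B where "B = w t0"
  have B: "0 < B" using w_pos[OF t0] by (simp add: B_def)
  define A where "A = {t\<in>I. t0 \<le> t}"
  have Am [measurable]: "A \<in> sets MI"
  proof -
    have "A = I \<inter> {t0..}" by (auto simp: A_def)
    then show ?thesis by (auto simp: sets_MI_iff)
  qed
  have "top = emeasure MI I" using len emeasure_I by simp
  also have "\<dots> = emeasure MI ({t\<in>I. ennreal t < ennreal t0} \<union> A)"
    by (rule arg_cong[of _ _ "emeasure MI"]) (auto simp: A_def ennreal_less_I_iff)
  also have "\<dots> \<le> emeasure MI {t\<in>I. ennreal t < ennreal t0} + emeasure MI A"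
    by (intro emeasure_subadditive) auto
  finally have "emeasure MI A = top" by (auto simp: emeasure_initial top_unique min_def split: if_splits)
  have "0 < B * \<phi> (y / B)" using B y by (intro mult_pos_pos phi_pos) auto
  then have "ennreal (B * \<phi> (y / B)) \<noteq> 0" by (metis ennreal_eq_0_iff not_le)
  then have "top = ennreal (B * \<phi> (y / B)) * emeasure MI A"
    unfolding \<open>emeasure MI A = top\<close> by (simp only: ennreal_mult_top if_False split: if_split)
  also have "\<dots> = (\<integral>\<^sup>+t. ennreal (B * \<phi> (y / B)) * indicator A t \<partial>MI)"
    by (rule nn_integral_cmult_indicator[symmetric]) measurable
  also have "\<dots> \<le> Mod g" unfolding Mod_eq
  proof (intro nn_integral_mono)
    fix t show "ennreal (B * \<phi> (y / B)) * indicator A t \<le> Ph (rear g t) (w t)"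
    proof (cases "t \<in> A")
      case True
      then have t: "t \<in> I" "w t \<le> B" using w_antimono[OF t0] by (auto simp: A_def B_def)
      have wt: "0 < w t" using w_pos[OF t(1)] .
      have "B / w t * \<phi> (y / B) \<le> \<phi> (B / w t * (y / B))" using t wt B y by (intro phi_super_scale) auto
      then have "B * \<phi> (y / B) \<le> \<phi> (y / w t) * w t" using wt B by (simp add: field_simps)
      then have "ennreal (B * \<phi> (y / B)) \<le> Ph (ennreal y) (w t)" using y by (simp add: Ph_ennreal ennreal_leI)
      also have "\<dots> \<le> Ph (rear g t) (w t)"
        using rear_gt_iff[OF g, of y t] y top wt by (intro Ph_mono) (auto simp: less_imp_le)
      finally show ?thesis using True by simp
    qed simp
  qed
  finally show False using fin by simp
qed

section \<open>Consequences of the doubling condition\<close>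

lemma Delta2_iterate:
  assumes "Delta2 \<phi>"
  obtains K where "0 < K" "\<And>n u. 0 \<le> u \<Longrightarrow> \<phi> (2 ^ n * u) \<le> K ^ n * \<phi> u"
proof -
  obtain K where K: "0 < K" "\<And>u. 0 \<le> u \<Longrightarrow> \<phi> (2 * u) \<le> K * \<phi> u" using assms by (auto simp: Delta2_def)
  have "\<phi> (2 ^ n * u) \<le> K ^ n * \<phi> u" if "0 \<le> u" for n u
  proof (induction n)
    case (Suc n)
    have "\<phi> (2 ^ Suc n * u) \<le> K * \<phi> (2 ^ n * u)" using K(2)[of "2 ^ n * u"] that by (simp add: mult.assoc)
    also have "\<dots> \<le> K * (K ^ n * \<phi> u)" using Suc K by (intro mult_left_mono) auto
    finally show ?case by (simp add: mult.assoc)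
  qed simp
  then show ?thesis using that K(1) by blast
qed

lemma Delta2_scale:
  assumes "Delta2 \<phi>" "0 < d"
  obtains K where "0 < K" "\<And>u. 0 \<le> u \<Longrightarrow> \<phi> (d * u) \<le> K * \<phi> u"
proof -
  obtain K where K: "0 < K" "\<And>n u. 0 \<le> u \<Longrightarrow> \<phi> (2 ^ n * u) \<le> K ^ n * \<phi> u" using Delta2_iterate[OF assms(1)] by blast
  obtain n where n: "d < 2 ^ n" using real_arch_pow[of 2 d] by auto
  have "\<phi> (d * u) \<le> K ^ n * \<phi> u" if "0 \<le> u" for u
  proof -
    have "\<phi> (d * u) \<le> \<phi> (2 ^ n * u)" using n that assms(2) by (intro phi_mono mult_right_mono) auto
    then show ?thesis using K(2)[OF that, of n] by simp
  qed
  then show ?thesis using that[of "K ^ n"] K(1) by simp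
qed

lemma Delta2_Ph:
  assumes K: "0 < K" "\<And>u. 0 \<le> u \<Longrightarrow> \<phi> (d * u) \<le> K * \<phi> u" and d: "0 < d" and c: "0 < c"
  shows "Ph (ennreal d * x) c \<le> ennreal K * Ph x c"
proof (cases x)
  case (real r)
  have "\<phi> (d * (r / c)) * c \<le> K * \<phi> (r / c) * c" using K(2)[of "r / c"] real c by (intro mult_right_mono) auto
  then have "ennreal (\<phi> (d * r / c) * c) \<le> ennreal (K * (\<phi> (r / c) * c))" by (intro ennreal_leI) (simp add: mult.assoc)
  moreover have "ennreal d * x = ennreal (d * r)" using real d by (simp add: ennreal_mult)
  moreover have "ennreal K * Ph x c = ennreal (K * (\<phi> (r / c) * c))"
    using real K c phi_nonneg[of "r / c"] by (simp add: Ph_ennreal ennreal_mult)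
  ultimately show ?thesis using real d by (simp add: Ph_ennreal)
qed (use K in \<open>simp add: ennreal_mult_top\<close>)

text \<open>Membership in the class gives a finite modular at one scale; doubling transfers it to
  every scale.\<close>

lemma Delta2_Mod:
  assumes D: "Delta2 \<phi>" and f: "f \<in> Mcl"
  shows "Mod (\<lambda>t. c * f t) < top"
proof (cases "c = 0")
  case False
  have fm [measurable]: "f \<in> L0 I" using f by (simp add: Mcl_iff)
  obtain c0 where c0: "0 < c0" "Mod (\<lambda>t. c0 * f t) < \<infinity>" using f by (auto simp: M_class_def)
  define d where "d = \<bar>c\<bar> / c0"
  have d: "0 < d" using c0 False by (simp add: d_def)
  obtain K where K: "0 < K" "\<And>u. 0 \<le> u \<Longrightarrow> \<phi> (d * u) \<le> K * \<phi> u" using Delta2_scale[OF D d] by blast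
  have "rear (\<lambda>t. c * f t) t = ennreal d * rear (\<lambda>t. c0 * f t) t" for t
  proof -
    have "ennreal d * rear (\<lambda>t. c0 * f t) t = (ennreal d * ennreal c0) * rear f t"
      using c0 by (simp add: rear_cmult mult.assoc)
    also have "ennreal d * ennreal c0 = ennreal \<bar>c\<bar>" using c0 by (simp add: d_def flip: ennreal_mult)
    finally show ?thesis by (simp add: rear_cmult)
  qed
  then have "Mod (\<lambda>t. c * f t) \<le> (\<integral>\<^sup>+t. ennreal K * Ph (rear (\<lambda>t. c0 * f t) t) (w t) \<partial>MI)"
    unfolding Mod_eq using w_pos by (intro nn_integral_mono) (auto intro!: Delta2_Ph[OF K d])
  also have "\<dots> = ennreal K * Mod (\<lambda>t. c0 * f t)" unfolding Mod_eq by (rule nn_integral_cmult) measurable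
  also have "\<dots> < top" using c0(2) by (simp add: ennreal_mult_less_top)
  finally show ?thesis .
qed simp

text \<open>Dominated convergence twice. On the superlevel sets of f / e, which have finite measure,
  it drives the distribution functions and hence the rearrangements to 0; on the modular it uses the
  integrand of f / e as majorant. That the modular of f / e is finite for every e > 0 is the
  contribution of doubling.\<close>

lemma Nm_order_continuous:
  assumes D: "Delta2 \<phi>" and f: "f \<in> Mcl" and u [measurable]: "\<And>n. u n \<in> L0 I"
    and dom: "\<And>n t. t \<in> I \<Longrightarrow> \<bar>u n t\<bar> \<le> \<bar>f t\<bar>"
    and lim: "\<And>t. t \<in> I \<Longrightarrow> (\<lambda>n. u n t) \<longlonglongrightarrow> 0"
  shows "(\<lambda>n. Nm (u n)) \<longlonglongrightarrow> 0"
proof (rule order_tendstoI)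
  have fm [measurable]: "f \<in> L0 I" using f by (simp add: Mcl_iff)
  fix a :: ennreal assume "0 < a"
  then obtain x where x: "0 < x" "x < a" using dense by blast
  then obtain e where e: "x = ennreal e" "0 < e" by (cases x) auto
  let ?u = "\<lambda>n t. u n t / e" and ?f = "\<lambda>t. f t / e"
  have Mf: "Mod ?f < top" using Delta2_Mod[OF D f, of "1 / e"] by simp
  have rle: "rear (?u n) t \<le> rear ?f t" for n t
    by (rule rear_mono) (use dom e in \<open>auto simp: divide_right_mono\<close>)
  have small: "\<forall>\<^sub>F n in sequentially. rear (?u n) t \<le> ennreal y" if t: "t \<in> I" and y: "0 < y" for t y
  proof -
    have fin: "dist_f ?f y < top" using Mf y by (intro dist_f_finite) auto
    have m: "{t\<in>I. y < \<bar>?u n t\<bar>} \<in> sets MI" for n by (rule pred_abs_greater) measurable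
    have mf: "{t\<in>I. y < \<bar>?f t\<bar>} \<in> sets MI" by (rule pred_abs_greater) measurable
    have "(\<lambda>n. \<integral>\<^sup>+s. indicator {t\<in>I. y < \<bar>?u n t\<bar>} s \<partial>MI) \<longlonglongrightarrow> (\<integral>\<^sup>+s. 0 \<partial>MI)"
    proof (rule nn_integral_dominated_convergence[where w="indicator {t\<in>I. y < \<bar>?f t\<bar>}"])
      show "AE s in MI. indicator {t\<in>I. y < \<bar>?u n t\<bar>} s \<le> (indicator {t\<in>I. y < \<bar>?f t\<bar>} s :: ennreal)" for n
      proof (rule AE_I2)
        fix s assume "s \<in> space MI"
        then have "\<bar>?u n s\<bar> \<le> \<bar>?f s\<bar>" using dom e by (simp add: divide_right_mono)
        then show "indicator {t\<in>I. y < \<bar>?u n t\<bar>} s \<le> (indicator {t\<in>I. y < \<bar>?f t\<bar>} s :: ennreal)"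
          by (auto simp: indicator_def)
      qed
      show "(\<integral>\<^sup>+s. indicator {t\<in>I. y < \<bar>?f t\<bar>} s \<partial>MI) < \<infinity>" using fin mf by (simp add: dist_f_eq)
      show "AE s in MI. (\<lambda>n. indicator {t\<in>I. y < \<bar>?u n t\<bar>} s :: ennreal) \<longlonglongrightarrow> 0"
      proof (rule AE_I2)
        fix s assume "s \<in> space MI"
        then have "(\<lambda>n. \<bar>?u n s\<bar>) \<longlonglongrightarrow> \<bar>0 / e\<bar>" using lim e by (intro tendsto_intros) auto
        then have "\<forall>\<^sub>F n in sequentially. \<bar>?u n s\<bar> < y" using y by (intro order_tendstoD) auto
        then have "\<forall>\<^sub>F n in sequentially. (indicator {t\<in>I. y < \<bar>?u n t\<bar>} s :: ennreal) = 0"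
          by eventually_elim auto
        then show "(\<lambda>n. indicator {t\<in>I. y < \<bar>?u n t\<bar>} s :: ennreal) \<longlonglongrightarrow> 0" by (rule tendsto_eventually)
      qed
    qed (use m mf in auto)
    then have "(\<lambda>n. dist_f (?u n) y) \<longlonglongrightarrow> 0" using m by (simp add: dist_f_eq)
    moreover have "0 < ennreal t" using I_pos[OF t] by simp
    ultimately have "\<forall>\<^sub>F n in sequentially. dist_f (?u n) y < ennreal t" by (rule order_tendstoD)
    then show ?thesis
    proof eventually_elim
      case (elim n)
      then have "\<not> ennreal y < rear (?u n) t" using rear_gt_iff[of "?u n" y t] y by simp
      then show ?case by simp
    qed
  qed
  have "(\<lambda>n. \<integral>\<^sup>+t. Ph (rear (?u n) t) (w t) \<partial>MI) \<longlonglongrightarrow> (\<integral>\<^sup>+t. 0 \<partial>MI)"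
  proof (rule nn_integral_dominated_convergence[where w="\<lambda>t. Ph (rear ?f t) (w t)"])
    show "AE t in MI. Ph (rear (?u n) t) (w t) \<le> Ph (rear ?f t) (w t)" for n
      using rle w_pos by (intro AE_I2) (auto intro: Ph_mono)
    show "(\<integral>\<^sup>+t. Ph (rear ?f t) (w t) \<partial>MI) < \<infinity>" using Mf by (simp add: Mod_eq)
    show "AE t in MI. (\<lambda>n. Ph (rear (?u n) t) (w t)) \<longlonglongrightarrow> 0"
    proof (rule AE_I2, rule order_tendstoI)
      fix t and z :: ennreal assume t': "t \<in> space MI" and z: "0 < z"
      then have t: "t \<in> I" and wt: "0 < w t" using w_pos by auto
      have inv: "(\<lambda>n. inverse (real (Suc n))) \<longlonglongrightarrow> 0" by (rule LIMSEQ_inverse_real_of_nat)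
      have "(\<lambda>n. inverse (real (Suc n)) / w t) \<longlonglongrightarrow> 0 / w t" using wt by (intro tendsto_divide inv tendsto_const) auto
      then have "(\<lambda>n. \<phi> (inverse (real (Suc n)) / w t) * w t) \<longlonglongrightarrow> \<phi> (0 / w t) * w t"
        using wt by (intro tendsto_mult phi_tendsto tendsto_const) auto
      then have "(\<lambda>n. Ph (ennreal (inverse (real (Suc n)))) (w t)) \<longlonglongrightarrow> ennreal 0"
        by (simp add: Ph_ennreal tendsto_ennrealI del: of_nat_Suc ennreal_0)
      then have "\<forall>\<^sub>F n in sequentially. Ph (ennreal (inverse (real (Suc n)))) (w t) < z" using z by (intro order_tendstoD) auto
      then obtain k where k: "Ph (ennreal (inverse (real (Suc k)))) (w t) < z" by (auto simp: eventually_sequentially)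
      have "\<forall>\<^sub>F n in sequentially. rear (?u n) t \<le> ennreal (inverse (real (Suc k)))" by (rule small[OF t]) simp
      then show "\<forall>\<^sub>F n in sequentially. Ph (rear (?u n) t) (w t) < z"
        by eventually_elim (rule le_less_trans[OF Ph_mono[OF _ wt] k])
    qed simp
  qed measurable
  then have "(\<lambda>n. Mod (?u n)) \<longlonglongrightarrow> 0" by (simp add: Mod_eq)
  then have "\<forall>\<^sub>F n in sequentially. Mod (?u n) < 1" by (rule order_tendstoD) simp
  then show "\<forall>\<^sub>F n in sequentially. Nm (u n) < a"
  proof eventually_elim
    case (elim n)
    then have "Nm (u n) \<le> ennreal e" using Nm_le_iff[OF u e(2), of n] by (simp add: less_imp_le)
    then show ?case using x e by auto
  qed
qed simp

section \<open>Density of M\<close>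

lemma Delta2_Pint:
  assumes K: "0 < K" "\<And>u. 0 \<le> u \<Longrightarrow> \<phi> (d * u) \<le> K * \<phi> u" and d: "0 < d" and v: "0 \<le> v t"
  shows "Pint (\<lambda>t. d * f t) v t \<le> ennreal K * Pint f v t"
proof (cases "v t = 0")
  case True then show ?thesis using K d by (auto simp: Pint_def ennreal_mult_top)
next
  case False
  have "\<phi> (d * (\<bar>f t\<bar> / v t)) * v t \<le> K * \<phi> (\<bar>f t\<bar> / v t) * v t" using K(2)[of "\<bar>f t\<bar> / v t"] v by (intro mult_right_mono) auto
  then show ?thesis using False d K v phi_nonneg[of "\<bar>f t\<bar> / v t"]
    by (simp add: Pint_def abs_mult mult.assoc flip: ennreal_mult)
qed

text \<open>One v with finite integral for f / \<epsilon> serves at every scale \<delta> by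
  doubling, and dominated convergence with this fixed v makes the truncation errors f - g n small.
  The truncations are bounded with support in (0,b n), hence in M.\<close>

theorem M_dense:
  assumes D: "Delta2 \<phi>" and f: "f \<in> cM" and e: "0 < e"
  shows "\<exists>g\<in>Mcl. cMn (\<lambda>t. f t - g t) < e"
proof -
  have fm [measurable]: "f \<in> L0 I" and "cMn f < \<infinity>" using f by (auto simp: calM_space_def)
  then obtain \<epsilon> where \<epsilon>: "0 < \<epsilon>" "P_modular I \<phi> w (\<lambda>t. f t / \<epsilon>) \<le> 1"
    unfolding calM_norm_def Inf_less_iff by auto
  have "P_modular I \<phi> w (\<lambda>t. f t / \<epsilon>) < top" using \<epsilon>(2) by (rule le_less_trans) simp
  then obtain v where v [measurable]: "v \<in> L0 I" and vs: "submajorized I v w" and v0: "\<And>t. t \<in> I \<Longrightarrow> 0 \<le> v t"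
    and vP: "(\<integral>\<^sup>+t. Pint (\<lambda>t. f t / \<epsilon>) v t \<partial>MI) < top"
    unfolding P_modular_eq by (auto simp: INF_less_iff)
  obtain x where x: "0 < x" "x < e" using dense[OF e] by blast
  then obtain \<delta> where \<delta>: "x = ennreal \<delta>" "0 < \<delta>" by (cases x) auto
  define d where "d = \<epsilon> / \<delta>"
  have d: "0 < d" using \<epsilon> \<delta> by (simp add: d_def)
  obtain K where K: "0 < K" "\<And>u. 0 \<le> u \<Longrightarrow> \<phi> (d * u) \<le> K * \<phi> u" using Delta2_scale[OF D d] by blast
  have Pm: "Pint k v \<in> borel_measurable MI" if "k \<in> L0 I" for k using Pint_measurable[OF that v v0] .
  have F: "(\<lambda>t. d * (f t / \<epsilon>)) = (\<lambda>t. f t / \<delta>)" using \<epsilon> by (simp add: d_def)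
  have "(\<integral>\<^sup>+t. Pint (\<lambda>t. f t / \<delta>) v t \<partial>MI) \<le> (\<integral>\<^sup>+t. ennreal K * Pint (\<lambda>t. f t / \<epsilon>) v t \<partial>MI)"
    unfolding F[symmetric] using v0 by (intro nn_integral_mono Delta2_Pint[OF K d]) auto
  also have "\<dots> = ennreal K * (\<integral>\<^sup>+t. Pint (\<lambda>t. f t / \<epsilon>) v t \<partial>MI)" by (rule nn_integral_cmult[OF Pm]) measurable
  also have "\<dots> < top" using vP by (simp add: ennreal_mult_less_top)
  finally have fin: "(\<integral>\<^sup>+t. Pint (\<lambda>t. f t / \<delta>) v t \<partial>MI) < top" .
  obtain b :: "nat \<Rightarrow> real" where b: "incseq b" "\<And>n. b n \<in> I" "\<And>t. t \<in> I \<Longrightarrow> \<exists>n. t < b n"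
    by (rule I_exhaustion) blast
  define E where "E n = {t\<in>I. ennreal t < ennreal (b n)}" for n
  have Em [measurable]: "E n \<in> sets MI" for n unfolding E_def by (rule set_initial_MI)
  have Ee: "emeasure MI (E n) \<le> ennreal (b n)" for n unfolding E_def emeasure_initial by simp
  define g where "g n t = (if \<bar>f t\<bar> \<le> real n then f t * indicator (E n) t else 0)" for n t
  have gm [measurable]: "g n \<in> L0 I" for n unfolding g_def by measurable
  have gM: "g n \<in> Mcl" for n
  proof (rule Mod_finite_imp_Mcl[OF gm])
    show "Mod (g n) < \<infinity>"
      by (rule Mod_bounded_support[OF gm Em Ee b(2), of "real n"]) (auto simp: g_def indicator_def)
  qed
  have ev: "\<forall>\<^sub>F n in sequentially. f t - g n t = 0" if t: "t \<in> I" for t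
  proof -
    obtain n1 where n1: "t < b n1" using b(3)[OF t] by blast
    obtain n2 where n2: "\<bar>f t\<bar> \<le> real n2" using real_arch_simple by blast
    have "f t - g n t = 0" if "max n1 n2 \<le> n" for n
    proof -
      have "b n1 \<le> b n" using b(1) that by (auto dest: incseqD)
      then have "t \<in> E n" using n1 t by (simp add: E_def ennreal_less_I_iff)
      moreover have "\<bar>f t\<bar> \<le> real n" using n2 that by simp
      ultimately show ?thesis by (simp add: g_def)
    qed
    then show ?thesis by (auto simp: eventually_sequentially intro!: exI[of _ "max n1 n2"])
  qed
  have "(\<lambda>n. \<integral>\<^sup>+t. Pint (\<lambda>t. (f t - g n t) / \<delta>) v t \<partial>MI) \<longlonglongrightarrow> (\<integral>\<^sup>+t. 0 \<partial>MI)"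
  proof (rule nn_integral_dominated_convergence[where w="Pint (\<lambda>t. f t / \<delta>) v"])
    show "AE t in MI. Pint (\<lambda>t. (f t - g n t) / \<delta>) v t \<le> Pint (\<lambda>t. f t / \<delta>) v t" for n
    proof (rule AE_I2)
      fix t assume "t \<in> space MI"
      then have vt: "0 \<le> v t" using v0 by simp
      have le: "\<bar>f t - g n t\<bar> \<le> \<bar>f t\<bar>" by (auto simp: g_def indicator_def)
      show "Pint (\<lambda>t. (f t - g n t) / \<delta>) v t \<le> Pint (\<lambda>t. f t / \<delta>) v t"
      proof (cases "v t = 0")
        case False
        have "\<bar>(f t - g n t) / \<delta>\<bar> / v t \<le> \<bar>f t / \<delta>\<bar> / v t" using le \<delta> vt by (simp add: divide_right_mono)
        then show ?thesis using False vt
          by (auto simp: Pint_def simp del: abs_divide intro!: ennreal_leI mult_right_mono phi_mono)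
      qed (use le \<delta> in \<open>auto simp: Pint_def\<close>)
    qed
    show "(\<integral>\<^sup>+t. Pint (\<lambda>t. f t / \<delta>) v t \<partial>MI) < \<infinity>" using fin by simp
    show "AE t in MI. (\<lambda>n. Pint (\<lambda>t. (f t - g n t) / \<delta>) v t) \<longlonglongrightarrow> 0"
    proof (rule AE_I2)
      fix t assume "t \<in> space MI"
      then have "\<forall>\<^sub>F n in sequentially. Pint (\<lambda>t. (f t - g n t) / \<delta>) v t = 0"
        using ev[of t] by (auto elim: eventually_mono simp: Pint_def)
      then show "(\<lambda>n. Pint (\<lambda>t. (f t - g n t) / \<delta>) v t) \<longlonglongrightarrow> 0" by (rule tendsto_eventually)
    qed
  qed (auto intro!: Pm)
  then have "\<forall>\<^sub>F n in sequentially. (\<integral>\<^sup>+t. Pint (\<lambda>t. (f t - g n t) / \<delta>) v t \<partial>MI) < 1"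
    by (intro order_tendstoD) auto
  then obtain n where n: "(\<integral>\<^sup>+t. Pint (\<lambda>t. (f t - g n t) / \<delta>) v t \<partial>MI) < 1" by (auto simp: eventually_sequentially)
  have "P_modular I \<phi> w (\<lambda>t. (f t - g n t) / \<delta>) \<le> (\<integral>\<^sup>+t. Pint (\<lambda>t. (f t - g n t) / \<delta>) v t \<partial>MI)"
    unfolding P_modular_eq using v vs v0 by (intro INF_lower) auto
  also have "\<dots> \<le> 1" using n by simp
  finally have "cMn (\<lambda>t. f t - g n t) \<le> ennreal \<delta>"
    unfolding calM_norm_def using \<delta> by (intro Inf_lower) auto
  also have "\<dots> < e" using x \<delta> by simp
  finally show ?thesis using gM by blast
qed

end

section \<open>The dual space and the Banach envelope\<close>

context orlicz_lorentz begin

lemma Mcl_solid: "f \<in> Mcl \<Longrightarrow> k \<in> L0 I \<Longrightarrow> (\<And>t. t \<in> I \<Longrightarrow> \<bar>k t\<bar> \<le> \<bar>f t\<bar>) \<Longrightarrow> k \<in> Mcl \<and> Nm k \<le> Nm f"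
proof -
  assume f: "f \<in> Mcl" and k: "k \<in> L0 I" and le: "\<And>t. t \<in> I \<Longrightarrow> \<bar>k t\<bar> \<le> \<bar>f t\<bar>"
  have "Nm k \<le> Nm f" using f k le by (intro Nm_mono rear_mono) (auto simp: Mcl_iff)
  then show ?thesis using f k by (auto simp: Mcl_iff intro: le_less_trans)
qed

lemma dual_bound:
  assumes lin: "linear_space Mcl" and F: "F \<in> topological_dual Mcl Nm"
    and C: "functional_norm Mcl Nm F \<le> ennreal C" "0 \<le> C" and f: "f \<in> Mcl"
  shows "ennreal \<bar>F f\<bar> \<le> ennreal C * Nm f"
proof -
  have fm: "f \<in> L0 I" using f by (simp add: Mcl_iff)
  have Fc: "F (\<lambda>t. c * f t) = c * F f" for c using F f by (auto simp: topological_dual_def)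
  have bnd: "\<bar>F f\<bar> \<le> C * e" if e: "0 < e" "Nm f \<le> ennreal e" for e
  proof -
    have m: "(\<lambda>t. (1 / e) * f t) \<in> Mcl" using lin f unfolding linear_space_def by blast
    have "Nm (\<lambda>t. (1 / e) * f t) = ennreal \<bar>1 / e\<bar> * Nm f" by (rule Nm_cmult[OF fm])
    also have "\<dots> \<le> ennreal \<bar>1 / e\<bar> * ennreal e" using e by (intro mult_left_mono) auto
    also have "\<dots> = 1" using e by (simp flip: ennreal_mult)
    finally have "ennreal \<bar>F (\<lambda>t. (1 / e) * f t)\<bar> \<le> functional_norm Mcl Nm F"
      unfolding functional_norm_def using m by (intro SUP_upper) auto
    also have "\<dots> \<le> ennreal C" by (rule C)
    finally have "ennreal \<bar>(1 / e) * F f\<bar> \<le> ennreal C" unfolding Fc .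
    then have "\<bar>(1 / e) * F f\<bar> \<le> C" using C(2) by (subst (asm) ennreal_le_iff) auto
    then show ?thesis using e by (simp add: abs_mult field_simps)
  qed
  obtain r where r: "Nm f = ennreal r" "0 \<le> r" using f by (cases "Nm f") (auto simp: Mcl_iff)
  have "\<bar>F f\<bar> \<le> C * r"
  proof (rule field_le_epsilon)
    fix \<delta> :: real assume \<delta>: "0 < \<delta>"
    define e where "e = r + \<delta> / (C + 1)"
    have "\<bar>F f\<bar> \<le> C * e" using r \<delta> C(2) by (intro bnd) (auto simp: e_def add_nonneg_pos intro!: ennreal_leI)
    also have "\<dots> = C * r + \<delta> / (1 + C) * C" by (simp add: e_def algebra_simps)
    also have "\<dots> \<le> C * r + \<delta>" using \<delta> C(2) by (intro add_left_mono divide_one_plus_le) auto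
    finally show "\<bar>F f\<bar> \<le> C * r + \<delta>" .
  qed
  then show ?thesis using r C(2) by (simp add: ennreal_leI flip: ennreal_mult)
qed

text \<open>The set function sending A to F (g0 1_A) is controlled by C times the quasi-norm of g0
  1_A, which tends to 0 along sets decreasing to the empty set by order continuity. Working with the
  strictly positive g0 of M, not with indicators, keeps it defined on all measurable subsets of
  \<open>I\<close>. Its density h' gives h = h' / g0.\<close>

theorem dual_representation:
  assumes lin: "linear_space Mcl" and D: "Delta2 \<phi>" and F: "F \<in> topological_dual Mcl Nm"
    and C: "functional_norm Mcl Nm F \<le> ennreal C" "0 \<le> C"
  obtains h where "h \<in> L0 I" "Nd h \<le> ennreal C" "\<And>f. f \<in> Mcl \<Longrightarrow> F f = (\<integral>t. f t * h t \<partial>MI)"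
proof -
  note bnd = dual_bound[OF lin F C]
  have Fadd: "F (\<lambda>t. f t + g t) = F f + F g" if "f \<in> Mcl" "g \<in> Mcl" for f g
    using F that by (auto simp: topological_dual_def)
  have Fc: "F (\<lambda>t. c * f t) = c * F f" if "f \<in> Mcl" for c f
    using F that by (auto simp: topological_dual_def)
  have lin_add: "(\<lambda>t. f t + g t) \<in> Mcl" if "f \<in> Mcl" "g \<in> Mcl" for f g
  proof -
    have "\<forall>f\<in>Mcl. \<forall>g\<in>Mcl. (\<lambda>t. f t + g t) \<in> Mcl" using lin by (simp add: linear_space_def)
    then show ?thesis using that by auto
  qed
  have lin_c: "(\<lambda>t. c * f t) \<in> Mcl" if "f \<in> Mcl" for c f using lin that unfolding linear_space_def by blast
  have Fdiff: "F (\<lambda>t. f t - g t) = F f - F g" if "f \<in> Mcl" "g \<in> Mcl" for f g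
    using Fadd[OF that(1) lin_c[OF that(2), of "-1"]] Fc[OF that(2), of "-1"] by simp
  have Mm: "f \<in> L0 I" if "f \<in> Mcl" for f using that by (simp add: Mcl_iff)
  have Nm0: "Nm f = 0" if "f \<in> Mcl" "AE t in MI. f t = 0" for f
    using M_quasi_Banach[OF lin] that by (auto simp: quasi_Banach_def quasi_norm_with_def)
  \<comment> \<open>Functions are defined on the whole line, so it must be checked that F sees only
    their values on \<open>I\<close>.\<close>
  have Fcong: "F f = F g" if fg: "f \<in> Mcl" "g \<in> Mcl" "\<And>t. t \<in> I \<Longrightarrow> f t = g t" for f g
  proof -
    have d: "(\<lambda>t. f t - g t) \<in> Mcl" by (rule linear_space_diff[OF lin fg(1,2)])
    have "Nm (\<lambda>t. f t - g t) = 0" using fg(3) by (intro Nm0[OF d] AE_I2) auto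
    then have "ennreal \<bar>F (\<lambda>t. f t - g t)\<bar> \<le> 0" using bnd[OF d] by simp
    then show ?thesis using Fdiff[OF fg(1,2)] by simp
  qed
  obtain g0 where g0 [measurable]: "g0 \<in> L0 I" and g0p: "\<And>t. t \<in> I \<Longrightarrow> 0 < g0 t" and g01: "Mod g0 \<le> 1"
    by (rule ex_positive_class) blast
  have g0M: "g0 \<in> Mcl" using g0 g01 by (rule Mod_le_1_imp_Mcl)
  define k where "k A t = g0 t * indicator A t" for A t
  have km [measurable]: "k A \<in> L0 I" if "A \<in> sets MI" for A unfolding k_def using that by measurable
  have kM: "k A \<in> Mcl" if "A \<in> sets MI" for A
    using Mcl_solid[OF g0M km[OF that]] by (auto simp: k_def indicator_def)
  define \<tau> where "\<tau> A = F (k A)" for A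
  define b where "b A = C * enn2real (Nm (k A))" for A
  have kfin: "Nm (k A) < top" if "A \<in> sets MI" for A using kM[OF that] by (simp add: Mcl_iff)
  have "\<exists>h. integrable MI h \<and> (\<forall>A\<in>sets MI. \<tau> A = (\<integral>x. h x * indicator A x \<partial>MI))"
  proof (rule signed_density[OF sigma_finite_MI, of \<tau> b])
    fix A B :: "real set" assume A: "A \<in> sets MI"
    have "ennreal \<bar>\<tau> A\<bar> \<le> ennreal C * Nm (k A)" unfolding \<tau>_def by (rule bnd[OF kM[OF A]])
    also have "\<dots> = ennreal (b A)" using kfin[OF A] C(2) by (simp add: b_def ennreal_mult)
    finally show "\<bar>\<tau> A\<bar> \<le> b A" using C(2) by (subst (asm) ennreal_le_iff) (auto simp: b_def)
    assume B: "B \<in> sets MI"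
    show "\<tau> (A \<union> B) = \<tau> A + \<tau> B" if "A \<inter> B = {}"
    proof -
      have "k (A \<union> B) = (\<lambda>t. k A t + k B t)" using that by (auto simp: k_def indicator_def fun_eq_iff)
      then show ?thesis unfolding \<tau>_def using Fadd[OF kM[OF A] kM[OF B]] by simp
    qed
    show "b A \<le> b B" if "A \<subseteq> B"
    proof -
      have "\<bar>k A t\<bar> \<le> \<bar>k B t\<bar>" for t using that by (auto simp: k_def indicator_def)
      then have "Nm (k A) \<le> Nm (k B)" using Mcl_solid[OF kM[OF B] km[OF A]] by blast
      then show ?thesis unfolding b_def using kfin[OF B] C(2) by (intro mult_left_mono enn2real_mono) auto
    qed
  next
    fix A :: "nat \<Rightarrow> real set" assume A: "range A \<subseteq> sets MI" "decseq A" "(\<Inter>i. A i) = {}"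
    have "(\<lambda>i. Nm (k (A i))) \<longlonglongrightarrow> 0"
    proof (rule Nm_order_continuous[OF D g0M])
      show "k (A n) \<in> L0 I" for n using A(1) by (intro km) auto
      show "\<bar>k (A n) t\<bar> \<le> \<bar>g0 t\<bar>" for n t by (auto simp: k_def indicator_def)
      show "(\<lambda>n. k (A n) t) \<longlonglongrightarrow> 0" for t
      proof -
        obtain n0 where "t \<notin> A n0" using A(3) by blast
        then have "t \<notin> A n" if "n0 \<le> n" for n using decseqD[OF A(2) that] by auto
        then have "\<forall>\<^sub>F n in sequentially. k (A n) t = 0"
          by (auto simp: eventually_sequentially k_def intro!: exI[of _ n0])
        then show ?thesis by (rule tendsto_eventually)
      qed
    qed
    then have "(\<lambda>i. enn2real (Nm (k (A i)))) \<longlonglongrightarrow> 0" by (intro tendsto_enn2real) auto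
    then have "(\<lambda>i. C * enn2real (Nm (k (A i)))) \<longlonglongrightarrow> C * 0" by (intro tendsto_mult tendsto_const)
    then show "(\<lambda>i. b (A i)) \<longlonglongrightarrow> 0" by (simp add: b_def)
  next
    fix A assume A: "A \<in> null_sets MI"
    have "AE t in MI. k A t = 0" using AE_not_in[OF A] by eventually_elim (simp add: k_def)
    then have "Nm (k A) = 0" using A by (intro Nm0 kM) auto
    then show "b A = 0" by (simp add: b_def)
  qed
  then obtain h' where h'i: "integrable MI h'" and h'\<tau>: "\<And>A. A \<in> sets MI \<Longrightarrow> \<tau> A = (\<integral>x. h' x * indicator A x \<partial>MI)"
    by blast
  have h'm [measurable]: "h' \<in> L0 I" using h'i by simp
  have simple: "(\<lambda>t. g0 t * s t) \<in> Mcl \<and> integrable MI (\<lambda>t. s t * h' t) \<and> F (\<lambda>t. g0 t * s t) = (\<integral>t. s t * h' t \<partial>MI)"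
    if s [measurable]: "s \<in> L0 I" and fin: "finite (s ` I)" for s
  proof -
    define A where "A y = {t\<in>I. s t = y}" for y
    have Am: "A y \<in> sets MI" for y
    proof -
      have "{t\<in>space MI. s t = y} \<in> sets MI" by measurable
      then show ?thesis by (simp add: A_def)
    qed
    have sum: "(\<lambda>t. \<Sum>y\<in>V. y * k (A y) t) \<in> Mcl \<and> F (\<lambda>t. \<Sum>y\<in>V. y * k (A y) t) = (\<Sum>y\<in>V. y * \<tau> (A y))"
      if "finite V" for V
      using that
    proof (induction V rule: finite_induct)
      case empty
      have "(\<lambda>t. 0) \<in> Mcl" using lin by (simp add: linear_space_def)
      then show ?case using Fc[of "\<lambda>t. 0" 0] by simp
    next
      case (insert y V)
      have "(\<lambda>t. y * k (A y) t) \<in> Mcl" by (intro lin_c kM Am)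
      then show ?case using insert lin_add[of "\<lambda>t. y * k (A y) t"] Fadd[of "\<lambda>t. y * k (A y) t"] Fc[OF kM[OF Am], of y y]
        by (simp add: \<tau>_def)
    qed
    have rep: "(\<Sum>y\<in>s ` I. y * (x * indicator (A y) t)) = x * s t" if t: "t \<in> I" for x t
    proof -
      have "(\<Sum>y\<in>s ` I. y * (x * indicator (A y) t)) = (\<Sum>y\<in>s ` I. if y = s t then x * s t else 0)"
        using t by (intro sum.cong) (auto simp: A_def indicator_def)
      also have "\<dots> = x * s t" using fin t by (simp add: sum.delta')
      finally show ?thesis .
    qed
    have mem: "(\<lambda>t. g0 t * s t) \<in> Mcl"
    proof (rule conjunct1[OF Mcl_solid[OF conjunct1[OF sum[OF fin]]]])
      show "\<bar>g0 t * s t\<bar> \<le> \<bar>\<Sum>y\<in>s ` I. y * k (A y) t\<bar>" if "t \<in> I" for t using rep[OF that, of "g0 t"] by (simp add: k_def)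
    qed measurable
    have "F (\<lambda>t. g0 t * s t) = F (\<lambda>t. \<Sum>y\<in>s ` I. y * k (A y) t)"
      using rep sum[OF fin] mem by (intro Fcong) (auto simp: k_def)
    also have "\<dots> = (\<Sum>y\<in>s ` I. y * (\<integral>t. h' t * indicator (A y) t \<partial>MI))"
      using sum[OF fin] h'\<tau>[OF Am] by simp
    also have "\<dots> = (\<integral>t. (\<Sum>y\<in>s ` I. y * (h' t * indicator (A y) t)) \<partial>MI)"
      using h'i Am by (subst Bochner_Integration.integral_sum) (auto intro!: integrable_real_mult_indicator)
    also have "\<dots> = (\<integral>t. s t * h' t \<partial>MI)"
      using rep by (intro Bochner_Integration.integral_cong) (auto simp: mult.commute)
    finally have eq: "F (\<lambda>t. g0 t * s t) = (\<integral>t. s t * h' t \<partial>MI)" .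
    have "integrable MI (\<lambda>t. \<Sum>y\<in>s ` I. y * (h' t * indicator (A y) t))"
      by (intro Bochner_Integration.integrable_sum integrable_mult_right
            integrable_real_mult_indicator[OF Am h'i])
    then have "integrable MI (\<lambda>t. s t * h' t)"
      by (rule Bochner_Integration.integrable_cong[THEN iffD1, rotated 2]) (use rep in \<open>auto simp: mult.commute\<close>)
    then show ?thesis using mem eq by simp
  qed
  define h where "h t = h' t / g0 t" for t
  have hm [measurable]: "h \<in> L0 I" unfolding h_def by measurable
  have approx: "\<exists>s. (\<forall>n. s n \<in> L0 I \<and> finite (s n ` I)) \<and> (\<forall>n t. 0 \<le> s n t) \<and>
      (\<forall>t\<in>I. \<forall>n. g0 t * s n t \<le> \<bar>f t\<bar>) \<and> (\<forall>t\<in>I. (\<lambda>n. g0 t * s n t) \<longlonglongrightarrow> \<bar>f t\<bar>)" if "f \<in> Mcl" for f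
  proof -
    have [measurable]: "f \<in> L0 I" by (rule Mm[OF that])
    obtain s :: "nat \<Rightarrow> real \<Rightarrow> real" where s: "incseq s" "\<And>i. simple_function MI (s i)" "\<And>x. bdd_above (range (\<lambda>i. s i x))"
      "\<And>i x. 0 \<le> s i x" "(\<lambda>t. \<bar>f t / g0 t\<bar>) = (SUP i. s i)"
      using borel_measurable_implies_simple_function_sequence_real[of "\<lambda>t. \<bar>f t / g0 t\<bar>" MI] by auto
    have s_inc: "incseq (\<lambda>i. s i t)" for t using s(1) by (auto simp: incseq_def le_fun_def)
    have s_lim: "(\<lambda>i. s i t) \<longlonglongrightarrow> \<bar>f t / g0 t\<bar>" for t
      using LIMSEQ_incseq_SUP[OF s(3) s_inc, of t] fun_cong[OF s(5), of t] by (simp add: image_comp)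
    have fg: "g0 t * \<bar>f t / g0 t\<bar> = \<bar>f t\<bar>" if "t \<in> I" for t using g0p[OF that] by simp
    show ?thesis
    proof (intro exI[of _ s] conjI allI ballI s(4))
      show "s n \<in> L0 I" for n using s(2) by (rule borel_measurable_simple_function)
      show "finite (s n ` I)" for n using s(2)[of n] by (simp add: simple_function_def)
      fix t assume t: "t \<in> I"
      show "g0 t * s n t \<le> \<bar>f t\<bar>" for n
        unfolding fg[OF t, symmetric] by (rule mult_left_mono[OF incseq_le[OF s_inc s_lim] less_imp_le[OF g0p[OF t]]])
      show "(\<lambda>n. g0 t * s n t) \<longlonglongrightarrow> \<bar>f t\<bar>"
        unfolding fg[OF t, symmetric] by (intro tendsto_mult tendsto_const s_lim)
    qed
  qed
  have part1: "(\<integral>\<^sup>+t. ennreal \<bar>f t * h t\<bar> \<partial>MI) \<le> ennreal C * Nm f" if f: "f \<in> Mcl" for f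
  proof -
    have [measurable]: "f \<in> L0 I" by (rule Mm[OF f])
    obtain s where s: "\<And>n. s n \<in> L0 I" "\<And>n. finite (s n ` I)" "\<And>n t. 0 \<le> s n t"
      "\<And>t n. t \<in> I \<Longrightarrow> g0 t * s n t \<le> \<bar>f t\<bar>" "\<And>t. t \<in> I \<Longrightarrow> (\<lambda>n. g0 t * s n t) \<longlonglongrightarrow> \<bar>f t\<bar>"
      using approx[OF f] by blast
    note [measurable] = s(1)
    have le: "(\<integral>\<^sup>+t. ennreal (s n t * \<bar>h' t\<bar>) \<partial>MI) \<le> ennreal C * Nm f" for n
    proof -
      \<comment> \<open>The sign of h' turns the representation for simple functions into a bound
        for the integral of s n |h'|.\<close>
      define r where "r t = s n t * sgn (h' t)" for t
      have rm [measurable]: "r \<in> L0 I" unfolding r_def by measurable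
      have "r ` I \<subseteq> (\<lambda>(x, y). x * y) ` (s n ` I \<times> {-1, 0, 1})"
        by (auto simp: r_def sgn_if image_iff)
      then have "finite (r ` I)" by (rule finite_subset) (intro finite_imageI finite_cartesian_product s(2), simp)
      note r = simple[OF rm this]
      have rh: "r t * h' t = s n t * \<bar>h' t\<bar>" for t by (simp add: r_def abs_sgn mult.assoc mult.commute[of "sgn (h' t)"])
      have "(\<integral>\<^sup>+t. ennreal (s n t * \<bar>h' t\<bar>) \<partial>MI) = ennreal (\<integral>t. s n t * \<bar>h' t\<bar> \<partial>MI)"
        using r s(3) by (intro nn_integral_eq_integral) (auto simp: rh)
      also have "\<dots> = ennreal (F (\<lambda>t. g0 t * r t))" using r by (simp add: rh)
      also have "\<dots> \<le> ennreal \<bar>F (\<lambda>t. g0 t * r t)\<bar>" by (intro ennreal_leI) simp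
      also have "\<dots> \<le> ennreal C * Nm (\<lambda>t. g0 t * r t)" using r by (intro bnd) simp
      also have "\<dots> \<le> ennreal C * Nm f"
      proof (intro mult_left_mono conjunct2[OF Mcl_solid[OF f]])
        fix t assume t: "t \<in> I"
        have "\<bar>g0 t * r t\<bar> \<le> g0 t * s n t"
          using g0p[OF t] s(3)[of n t] by (auto simp: r_def abs_mult sgn_if)
        then show "\<bar>g0 t * r t\<bar> \<le> \<bar>f t\<bar>" using s(4)[OF t, of n] by simp
      qed auto
      finally show ?thesis .
    qed
    have "(\<integral>\<^sup>+t. ennreal \<bar>f t * h t\<bar> \<partial>MI) \<le> (\<integral>\<^sup>+t. liminf (\<lambda>n. ennreal (s n t * \<bar>h' t\<bar>)) \<partial>MI)"
    proof (intro nn_integral_mono)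
      fix t assume "t \<in> space MI"
      then have t: "t \<in> I" by simp
      have "(\<lambda>n. g0 t * s n t * \<bar>h t\<bar>) \<longlonglongrightarrow> \<bar>f t\<bar> * \<bar>h t\<bar>" by (intro tendsto_mult tendsto_const s(5) t)
      moreover have "g0 t * s n t * \<bar>h t\<bar> = s n t * \<bar>h' t\<bar>" for n using g0p[OF t] by (simp add: h_def)
      ultimately have "(\<lambda>n. ennreal (s n t * \<bar>h' t\<bar>)) \<longlonglongrightarrow> ennreal \<bar>f t * h t\<bar>"
        by (intro tendsto_ennrealI) (simp add: abs_mult)
      then show "ennreal \<bar>f t * h t\<bar> \<le> liminf (\<lambda>n. ennreal (s n t * \<bar>h' t\<bar>))"
        using lim_imp_Liminf[OF sequentially_bot] by fastforce
    qed
    also have "\<dots> \<le> liminf (\<lambda>n. \<integral>\<^sup>+t. ennreal (s n t * \<bar>h' t\<bar>) \<partial>MI)" by (rule nn_integral_liminf) measurable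
    also have "\<dots> \<le> ennreal C * Nm f" using le by (intro Liminf_le) auto
    finally show ?thesis .
  qed
  have part2: "F f = (\<integral>t. f t * h t \<partial>MI)" if f: "f \<in> Mcl" for f
  proof -
    have [measurable]: "f \<in> L0 I" by (rule Mm[OF f])
    obtain s where s: "\<And>n. s n \<in> L0 I" "\<And>n. finite (s n ` I)" "\<And>n t. 0 \<le> s n t"
      "\<And>t n. t \<in> I \<Longrightarrow> g0 t * s n t \<le> \<bar>f t\<bar>" "\<And>t. t \<in> I \<Longrightarrow> (\<lambda>n. g0 t * s n t) \<longlonglongrightarrow> \<bar>f t\<bar>"
      using approx[OF f] by blast
    note [measurable] = s(1)
    \<comment> \<open>Here the sign is that of f: g0 r n converges to f itself, dominated by |f|, so
      order continuity gives the limit of the functional and dominated convergence that of the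
      integrals.\<close>
    define r where "r n t = s n t * sgn (f t)" for n t
    have rm [measurable]: "r n \<in> L0 I" for n unfolding r_def by measurable
    have rfin: "finite (r n ` I)" for n
    proof -
      have "r n ` I \<subseteq> (\<lambda>(x, y). x * y) ` (s n ` I \<times> {-1, 0, 1})"
        by (auto simp: r_def sgn_if image_iff)
      then show ?thesis by (rule finite_subset) (intro finite_imageI finite_cartesian_product s(2), simp)
    qed
    note r = simple[OF rm rfin]
    have r_lim: "(\<lambda>n. g0 t * r n t) \<longlonglongrightarrow> f t" if t: "t \<in> I" for t
    proof -
      have "(\<lambda>n. g0 t * s n t * sgn (f t)) \<longlonglongrightarrow> \<bar>f t\<bar> * sgn (f t)" by (intro tendsto_mult tendsto_const s(5) t)
      then show ?thesis by (simp add: r_def mult.assoc abs_mult_sgn)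
    qed
    have r_le: "\<bar>g0 t * r n t\<bar> \<le> \<bar>f t\<bar> \<and> \<bar>f t - g0 t * r n t\<bar> \<le> \<bar>f t\<bar>" if t: "t \<in> I" for n t
    proof -
      have "0 \<le> g0 t * s n t" "g0 t * s n t \<le> \<bar>f t\<bar>" using s(3,4) t g0p[OF t] by auto
      then show ?thesis by (cases "f t" "0::real" rule: linorder_cases) (auto simp: r_def)
    qed
    have dM: "(\<lambda>t. f t - g0 t * r n t) \<in> Mcl" for n using r[of n] by (intro linear_space_diff[OF lin f]) simp
    have "(\<lambda>n. Nm (\<lambda>t. f t - g0 t * r n t)) \<longlonglongrightarrow> 0"
    proof (rule Nm_order_continuous[OF D f])
      show "(\<lambda>n. f t - g0 t * r n t) \<longlonglongrightarrow> 0" if "t \<in> I" for t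
        using tendsto_diff[OF tendsto_const r_lim[OF that], of "f t"] by simp
    qed (use r_le in auto)
    then have l0: "(\<lambda>n. ennreal C * Nm (\<lambda>t. f t - g0 t * r n t)) \<longlonglongrightarrow> ennreal C * 0"
      by (intro ennreal_tendsto_cmult) auto
    have "(\<lambda>n. ennreal \<bar>F f - F (\<lambda>t. g0 t * r n t)\<bar>) \<longlonglongrightarrow> 0"
    proof (rule tendsto_sandwich[OF _ _ tendsto_const])
      show "\<forall>\<^sub>F n in sequentially. ennreal \<bar>F f - F (\<lambda>t. g0 t * r n t)\<bar> \<le> ennreal C * Nm (\<lambda>t. f t - g0 t * r n t)"
        using bnd[OF dM] Fdiff[OF f] r by (intro always_eventually) auto
      show "(\<lambda>n. ennreal C * Nm (\<lambda>t. f t - g0 t * r n t)) \<longlonglongrightarrow> 0" using l0 by simp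
    qed simp
    then have "(\<lambda>n. \<bar>F f - F (\<lambda>t. g0 t * r n t)\<bar>) \<longlonglongrightarrow> 0"
      using tendsto_enn2real[of "\<lambda>n. ennreal \<bar>F f - F (\<lambda>t. g0 t * r n t)\<bar>" 0] by simp
    then have "(\<lambda>n. F f - F (\<lambda>t. g0 t * r n t)) \<longlonglongrightarrow> 0" by (rule tendsto_rabs_zero_cancel)
    then have "(\<lambda>n. F f - (F f - F (\<lambda>t. g0 t * r n t))) \<longlonglongrightarrow> F f - 0" by (intro tendsto_diff tendsto_const)
    then have lim1: "(\<lambda>n. \<integral>t. r n t * h' t \<partial>MI) \<longlonglongrightarrow> F f" using r by simp
    have fh: "integrable MI (\<lambda>t. f t * h t)"
    proof (rule integrableI_bounded)
      have "(\<integral>\<^sup>+t. ennreal \<bar>f t * h t\<bar> \<partial>MI) < top"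
        using part1[OF f] f by (auto simp: Mcl_iff ennreal_mult_less_top intro: le_less_trans)
      then show "(\<integral>\<^sup>+t. ennreal (norm (f t * h t)) \<partial>MI) < \<infinity>" by simp
    qed measurable
    have "(\<lambda>n. \<integral>t. r n t * h' t \<partial>MI) \<longlonglongrightarrow> (\<integral>t. f t * h t \<partial>MI)"
    proof (rule integral_dominated_convergence[where w="\<lambda>t. \<bar>f t * h t\<bar>"])
      have rr: "r n t * h' t = (g0 t * r n t) * h t" if "t \<in> I" for n t using g0p[OF that] by (simp add: h_def)
      show "AE t in MI. (\<lambda>n. r n t * h' t) \<longlonglongrightarrow> f t * h t"
      proof (rule AE_I2)
        fix t assume "t \<in> space MI"
        then have t: "t \<in> I" by simp
        show "(\<lambda>n. r n t * h' t) \<longlonglongrightarrow> f t * h t"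
          unfolding rr[OF t] by (intro tendsto_mult tendsto_const r_lim t)
      qed
      show "AE t in MI. norm (r n t * h' t) \<le> \<bar>f t * h t\<bar>" for n
        using r_le by (intro AE_I2) (auto simp: rr abs_mult intro!: mult_right_mono)
      show "integrable MI (\<lambda>t. \<bar>f t * h t\<bar>)" using fh by (rule integrable_abs)
    qed measurable
    then show ?thesis using lim1 by (rule LIMSEQ_unique[rotated])
  qed
  have "Nd h \<le> ennreal C"
  proof (rule Nd_least)
    fix g assume g: "g \<in> L0 I" and 1: "Mod g \<le> 1"
    have "(\<integral>\<^sup>+t. ennreal \<bar>h t * g t\<bar> \<partial>MI) \<le> ennreal C * Nm g"
      using part1[OF Mod_le_1_imp_Mcl[OF g 1]] by (simp add: mult.commute)
    also have "\<dots> \<le> ennreal C * 1" using Nm_le_1_iff[OF g] 1 by (intro mult_left_mono) auto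
    finally show "(\<integral>\<^sup>+t. ennreal \<bar>h t * g t\<bar> \<partial>MI) \<le> ennreal C" by simp
  qed
  then show ?thesis using that hm part2 by blast
qed

lemma integral_functional:
  assumes h [measurable]: "h \<in> L0 I" and 1: "Nd h \<le> 1"
  defines "F \<equiv> \<lambda>f. \<integral>t. f t * h t \<partial>MI"
  shows "F \<in> topological_dual Mcl Nm" "functional_norm Mcl Nm F \<le> 1"
    "\<And>f. f \<in> Mcl \<Longrightarrow> integrable MI (\<lambda>t. f t * h t)"
proof -
  have le: "(\<integral>\<^sup>+t. ennreal \<bar>f t * h t\<bar> \<partial>MI) \<le> Nm f" if "f \<in> Mcl" for f
    using Nd_le_Nm[OF h _ 1, of f] that by (simp add: Mcl_iff mult.commute)
  show int: "integrable MI (\<lambda>t. f t * h t)" if f: "f \<in> Mcl" for f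
  proof (rule integrableI_bounded)
    have [measurable]: "f \<in> L0 I" using f by (simp add: Mcl_iff)
    show "(\<lambda>t. f t * h t) \<in> L0 I" by measurable
    show "(\<integral>\<^sup>+t. ennreal (norm (f t * h t)) \<partial>MI) < \<infinity>" using le[OF f] f by (auto simp: Mcl_iff intro: le_less_trans)
  qed
  show n: "functional_norm Mcl Nm F \<le> 1"
    unfolding functional_norm_def
  proof (rule SUP_least)
    fix f assume f: "f \<in> {f \<in> Mcl. Nm f \<le> 1}"
    have "ennreal \<bar>F f\<bar> \<le> (\<integral>\<^sup>+t. ennreal (norm (f t * h t)) \<partial>MI)"
      unfolding F_def using integral_norm_bound_ennreal[OF int, of f] f by simp
    also have "\<dots> \<le> Nm f" using le f by simp
    also have "\<dots> \<le> 1" using f by simp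
    finally show "ennreal \<bar>F f\<bar> \<le> 1" .
  qed
  show "F \<in> topological_dual Mcl Nm"
    unfolding topological_dual_def
  proof (intro CollectI conjI ballI allI)
    fix f g assume "f \<in> Mcl" "g \<in> Mcl"
    then show "F (\<lambda>t. f t + g t) = F f + F g" unfolding F_def distrib_right
      by (intro Bochner_Integration.integral_add int)
  next
    fix c f assume "f \<in> Mcl"
    show "F (\<lambda>t. c * f t) = c * F f" unfolding F_def mult.assoc by (rule integral_mult_right_zero)
  qed (use n in \<open>auto intro: le_less_trans\<close>)
qed

text \<open>Functionals of norm at most 1 and elements h with \<open>Nd h\<close> <= 1 correspond
  under integration. The bidual norm integrates |f h| while a functional integrates f h; the sign of
  f h, absorbed into h, reconciles the two.\<close>

theorem envelope_norm_eq:
  assumes lin: "linear_space Mcl" and D: "Delta2 \<phi>" and f: "f \<in> Mcl"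
  shows "envelope_norm Mcl Nm f = cMn f"
proof -
  have fm [measurable]: "f \<in> L0 I" using f by (simp add: Mcl_iff)
  have "envelope_norm Mcl Nm f = Nb f"
  proof (rule antisym)
    show "envelope_norm Mcl Nm f \<le> Nb f"
      unfolding envelope_norm_def
    proof (rule SUP_least)
      fix F assume F: "F \<in> {F \<in> topological_dual Mcl Nm. functional_norm Mcl Nm F \<le> 1}"
      obtain h where h [measurable]: "h \<in> L0 I" and h1: "Nd h \<le> ennreal 1" and Fh: "\<And>f. f \<in> Mcl \<Longrightarrow> F f = (\<integral>t. f t * h t \<partial>MI)"
        using dual_representation[OF lin D, of F 1] F by auto
      have "ennreal \<bar>F f\<bar> \<le> (\<integral>\<^sup>+t. ennreal (norm (f t * h t)) \<partial>MI)"
        unfolding Fh[OF f] using integral_norm_bound_ennreal[OF integral_functional(3)[OF h _ f]] h1 by simp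
      also have "\<dots> \<le> Nb f" using h1 by (simp add: Nb_upper[OF h])
      finally show "ennreal \<bar>F f\<bar> \<le> Nb f" .
    qed
    show "Nb f \<le> envelope_norm Mcl Nm f"
    proof (rule Nb_least)
      fix h assume h [measurable]: "h \<in> L0 I" and 1: "Nd h \<le> 1"
      define k where "k t = h t * sgn (f t * h t)" for t
      have km [measurable]: "k \<in> L0 I" unfolding k_def by measurable
      have "Nd k \<le> Nd h" by (intro Nd_mono) (auto simp: k_def abs_mult sgn_if)
      then have k1: "Nd k \<le> 1" using 1 by simp
      have fk: "f t * k t = \<bar>f t * h t\<bar>" for t by (simp add: k_def abs_sgn mult.assoc)
      note I = integral_functional[OF km k1]
      have "(\<integral>\<^sup>+t. ennreal \<bar>f t * h t\<bar> \<partial>MI) = ennreal (\<integral>t. \<bar>f t * h t\<bar> \<partial>MI)"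
        using I(3)[OF f] by (intro nn_integral_eq_integral) (auto simp: fk)
      also have "\<dots> = ennreal \<bar>\<integral>t. f t * k t \<partial>MI\<bar>" by (simp add: fk)
      also have "\<dots> \<le> envelope_norm Mcl Nm f"
        unfolding envelope_norm_def using I(1,2) by (intro SUP_upper2[of "\<lambda>f. \<integral>t. f t * k t \<partial>MI"]) auto
      finally show "(\<integral>\<^sup>+t. ennreal \<bar>f t * h t\<bar> \<partial>MI) \<le> envelope_norm Mcl Nm f" .
    qed
  qed
  then show ?thesis by (simp add: calM_norm_eq)
qed

text \<open>The sign of f - g, weighted by the strictly positive h0, gives a functional whose values
  at f and g differ by the integral of |f - g| h0.\<close>

lemma dual_separates: "separates_points MI Mcl (topological_dual Mcl Nm)"
  unfolding separates_points_def
proof (intro ballI impI)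
  fix f g assume fg: "f \<in> Mcl" "g \<in> Mcl" and ne: "\<not> (AE t in MI. f t = g t)"
  have [measurable]: "f \<in> L0 I" "g \<in> L0 I" using fg by (auto simp: Mcl_iff)
  obtain h0 where h0 [measurable]: "h0 \<in> L0 I" and h0p: "\<And>t. t \<in> I \<Longrightarrow> 0 < h0 t" and h01: "Nd h0 \<le> 1"
    by (rule ex_positive_dual) blast
  define k where "k t = h0 t * sgn (f t - g t)" for t
  have km [measurable]: "k \<in> L0 I" unfolding k_def by measurable
  have "Nd k \<le> Nd h0" by (intro Nd_mono) (auto simp: k_def abs_mult sgn_if)
  then have k1: "Nd k \<le> 1" using h01 by simp
  note I = integral_functional[OF km k1]
  let ?F = "\<lambda>f. \<integral>t. f t * k t \<partial>MI"
  have dk: "f t * k t - g t * k t = \<bar>f t - g t\<bar> * h0 t" for t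
    by (simp add: k_def abs_sgn algebra_simps)
  have di: "integrable MI (\<lambda>t. \<bar>f t - g t\<bar> * h0 t)"
    unfolding dk[symmetric] by (intro Bochner_Integration.integrable_diff I(3) fg)
  have "?F f \<noteq> ?F g"
  proof
    assume "?F f = ?F g"
    then have "(\<integral>t. \<bar>f t - g t\<bar> * h0 t \<partial>MI) = 0"
      unfolding dk[symmetric] using I(3)[OF fg(1)] I(3)[OF fg(2)] by simp
    moreover have "AE t in MI. 0 \<le> \<bar>f t - g t\<bar> * h0 t" using h0p by (intro AE_I2) (auto simp: less_imp_le)
    ultimately have "AE t in MI. \<bar>f t - g t\<bar> * h0 t = 0" using integral_nonneg_eq_0_iff_AE[OF di] by simp
    then have "AE t in MI. f t = g t" using AE_space by eventually_elim (use h0p in fastforce)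
    then show False using ne by simp
  qed
  then show "\<exists>F\<in>topological_dual Mcl Nm. F f \<noteq> F g" by (rule bexI[of _ ?F, OF _ I(1)])
qed

theorem Banach_envelope:
  assumes lin: "linear_space Mcl" and D: "Delta2 \<phi>"
  shows "is_Banach_envelope MI Mcl Nm cM cMn"
  unfolding is_Banach_envelope_def is_completion_def
proof (intro conjI ballI allI impI)
  show "quasi_Banach MI Mcl Nm" by (rule M_quasi_Banach[OF lin])
  show "separates_points MI Mcl (topological_dual Mcl Nm)" by (rule dual_separates)
  show "Banach MI cM cMn" by (rule calM_Banach)
  show "Mcl \<subseteq> cM"
  proof
    fix f assume f: "f \<in> Mcl"
    then have fm: "f \<in> L0 I" by (simp add: Mcl_iff)
    have "Nb f \<le> Nm f" using Nd_le_Nm[OF _ fm] by (intro Nb_least) (simp add: mult.commute)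
    then show "f \<in> cM" using f by (auto simp: Mcl_iff cM_iff intro: le_less_trans)
  qed
  show "cMn f = envelope_norm Mcl Nm f" if "f \<in> Mcl" for f by (rule envelope_norm_eq[OF lin D that, symmetric])
  show "\<exists>g\<in>Mcl. cMn (\<lambda>t. f t - g t) < e" if "f \<in> cM" "0 < e" for f e by (rule M_dense[OF D that])
qed

end

theorem corollary4p13:
  fixes \<phi> w :: "real \<Rightarrow> real" and a :: ereal and I :: "real set"
  assumes "0 < a" and "I = einterval 0 a"
    and "N_function \<phi>"
    and "weight_function I w"
    and "\<forall>t\<in>I. 0 < w t"
    and "\<forall>t\<in>I. (\<integral>\<^sup>+ s\<in>{0<..<t}. ennreal (w s) \<partial>lebesgue) < \<infinity>"
  shows "calM_space I \<phi> w = koethe_dual I (koethe_dual I (M_class I \<phi> w)) \<and>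
         (\<forall>f \<in> calM_space I \<phi> w. calM_norm I \<phi> w f =
            koethe_norm I (koethe_dual I (M_class I \<phi> w))
              (koethe_norm I (M_class I \<phi> w) (M_norm I \<phi> w)) f) \<and>
         (linear_space (M_class I \<phi> w) \<and> Delta2 \<phi> \<longrightarrow>
            is_Banach_envelope (lebesgue_on I) (M_class I \<phi> w) (M_norm I \<phi> w)
              (calM_space I \<phi> w) (calM_norm I \<phi> w))"
proof -
  interpret orlicz_lorentz a I \<phi> w
    by unfold_locales (use assms in auto)
  show ?thesis
    using calM_space_eq calM_norm_eq Banach_envelope by (auto simp: calM_space_def)
qed

end
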